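(* There is a path connected subset $\mathcal{U} \subset \mathcal{X}$ of the space $\mathcal{X}$ of similarity classes of pup tents such that every member of $\mathcal{U}$ is a general position pup tent (no four of its eight vertices are coplanar), and $\Phi(\mathcal{U}) = \mathcal{I}$, where $\Phi:\mathcal{X}\to\mathcal{M}$ sends a pup tent to the point of the modular surface representing its underlying flat structure and $\mathcal{I}\subset\mathcal{M}$ is the interior of the bi-cusped fundamental domain.
   Context: A flat torus is a quotient $\mathbb{R}^2/\Lambda$ with $\Lambda$ a lattice of translations. A paper torus is a piecewise linear isometric embedding $\phi:T\to\mathbb{R}^3$ of a flat torus $T$; equivalently, an embedded topological torus in $\mathbb{R}^3$ made from finitely many triangles such that the cone angle (sum of the incident triangle angles) at each vertex is $2\pi$. Uniform triangulation: the triangulation $K$ of the torus with vertex set $\{0,\dots,7\}=\mathbb{Z}/8$ and the 16 triangles $\{a,a+1,a+3\}$ and $\{a,a+2,a+3\}$ (mod 8), $a\in\mathbb{Z}/8$. Every vertex has degree 6. Orient $K$ so that each $(a,a+2,a+3)$ is positively oriented (and hence each $(a,a+3,a+1)$ is positively oriented). Pup tent: an 8-vertex paper torus triangulated by $K$, with vertices $p_0,\dots,p_7\in\mathbb{R}^3$ (each triangle of $K$ is mapped affinely onto the triangle with the corresponding vertices; the resulting map is injective; all cone angles are $2\pi$), such that: (i) it is invariant under $\rho(u,v,w)=(-u,-v,w)$, with $p_{7-j}=\rho(p_j)$ for all $j$; (ii) exactly 6 of the 16 triangles lie in the boundary of the convex hull of the torus, namely $\{1,2,7\},\{1,2,4\},\{2,4,5\},\{2,3,5\},\{3,5,6\},\{0,5,6\}$.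 Pup tents are considered up to similarity of $\mathbb{R}^3$; $\mathcal{X}$ is the space of similarity classes of pup tents, topologized via the vertex tuples $(p_0,\dots,p_7)\in(\mathbb{R}^3)^8$ (quotient topology). $\mathbb{H}^2$ is the upper half plane and $\mathcal{M}=\mathbb{H}^2/SL_2(\mathbb{Z})$ (linear fractional action) is the modular surface, parametrizing flat tori: a flat torus $\mathbb{C}/\Lambda$ with $\Lambda=\mathbb{Z}L_1+\mathbb{Z}L_2$ and $\mathrm{Im}(L_2/L_1)>0$ corresponds to the class of $L_2/L_1$. The map $\Phi:\mathcal{X}\to\mathcal{M}$ sends a pup tent to the point representing its intrinsic flat torus, oriented by the orientation of $K$ above. The bi-cusped fundamental domain $\mathcal{F}\subset\mathbb{H}^2$ is the geodesic triangle with interior vertex $\tfrac12+\tfrac{\sqrt3}{2}i$ and cusps $0,\infty$, i.e. $\mathcal{F}=\{x+iy: y>0,\ x\ge 0,\ 1-2x\ge 0,\ -2x+x^2+y^2\ge 0\}$. $\mathcal{I}$ is its interior, which maps injectively into $\mathcal{M}$ and is regarded as a subset of $\mathcal{M}$. *)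

theory Defs
  imports "HOL-Analysis.Analysis" "HOL-Library.Numeral_Type"
begin

text \<open>Vertices are elements of the ring type \<^typ>\<open>8\<close>, that is, of Z/8 with arithmetic modulo 8.
  A vertex tuple is a point of \<^typ>\<open>real^3^8\<close>, with the Euclidean topology.\<close>

section \<open>The uniform triangulation\<close>

definition uniform_triangulation :: "8 set set" where
  "uniform_triangulation = (\<Union>a. {{a, a + 1, a + 3}, {a, a + 2, a + 3}})"

text \<open>The positively oriented vertex triples, in all three cyclic orders.\<close>

definition positive_triples :: "(8 \<times> 8 \<times> 8) set" where
  "positive_triples =
     (\<Union>a. {(a, a + 2, a + 3), (a + 2, a + 3, a), (a + 3, a, a + 2),
           (a, a + 3, a + 1), (a + 3, a + 1, a), (a + 1, a, a + 3)})"

lemma uniform_triangulation_positive_triples: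
  "uniform_triangulation = (\<lambda>(a, b, c). {a, b, c}) ` positive_triples"
  unfolding uniform_triangulation_def positive_triples_def
  by (simp add: image_Union image_UN insert_commute)

text \<open>Geometric realization in barycentric coordinates.\<close>

definition closed_simplex :: "8 set \<Rightarrow> (real^8) set" where
  "closed_simplex T = {t. (\<forall>i. 0 \<le> t $ i) \<and> (\<Sum>i\<in>UNIV. t $ i) = 1 \<and> (\<forall>i. i \<notin> T \<longrightarrow> t $ i = 0)}"

definition realization :: "(real^8) set" where
  "realization = (\<Union>T\<in>uniform_triangulation. closed_simplex T)"

definition pl_map :: "real^3^8 \<Rightarrow> real^8 \<Rightarrow> real^3" where
  "pl_map p t = (\<Sum>i\<in>UNIV. t $ i *\<^sub>R p $ i)"

section \<open>Pup tents\<close>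

definition angle_at :: "real^3 \<Rightarrow> real^3 \<Rightarrow> real^3 \<Rightarrow> real" where
  "angle_at v x y = arccos (((x - v) \<bullet> (y - v)) / (norm (x - v) * norm (y - v)))"

text \<open>Each triangle at \<open>v\<close> occurs exactly once among the positive triples starting with \<open>v\<close>.\<close>

definition cone_angle :: "real^3^8 \<Rightarrow> 8 \<Rightarrow> real" where
  "cone_angle p v = (\<Sum>(x, y) \<in> {(x, y). (v, x, y) \<in> positive_triples}. angle_at (p $ v) (p $ x) (p $ y))"

definition paper_torus :: "real^3^8 \<Rightarrow> bool" where
  "paper_torus p \<longleftrightarrow> inj_on (pl_map p) realization \<and> (\<forall>v. cone_angle p v = 2 * pi)"

definition torus :: "real^3^8 \<Rightarrow> (real^3) set" where
  "torus p = pl_map p ` realization"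

definition hull_triangles :: "real^3^8 \<Rightarrow> 8 set set" where
  "hull_triangles p =
     {T \<in> uniform_triangulation. pl_map p ` closed_simplex T \<subseteq> frontier (convex hull (torus p))}"

definition \<rho> :: "real^3 \<Rightarrow> real^3" where
  "\<rho> x = vector [- (x $ 1), - (x $ 2), x $ 3]"

text \<open>The vertex condition implies invariance of the torus under \<open>\<rho>\<close>, since \<open>j \<mapsto> 7 - j\<close> is an
  automorphism of the triangulation.\<close>

definition pup_tent :: "real^3^8 \<Rightarrow> bool" where
  "pup_tent p \<longleftrightarrow> paper_torus p \<and>
     (\<forall>j. p $ (7 - j) = \<rho> (p $ j)) \<and>
     hull_triangles p = {{1,2,7}, {1,2,4}, {2,4,5}, {2,3,5}, {3,5,6}, {0,5,6}}"

definition general_position :: "real^3^8 \<Rightarrow> bool" where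
  "general_position p \<longleftrightarrow> (\<forall>S. card S = 4 \<longrightarrow> \<not> coplanar ((\<lambda>i. p $ i) ` S))"

section \<open>The space of similarity classes\<close>

definition similarity :: "(real^3 \<Rightarrow> real^3) \<Rightarrow> bool" where
  "similarity f \<longleftrightarrow> (\<exists>c>0. \<forall>x y. dist (f x) (f y) = c * dist x y)"

definition similar :: "((real^3^8) \<times> (real^3^8)) set" where
  "similar = {(p, q). pup_tent p \<and> pup_tent q \<and> (\<exists>f. similarity f \<and> (\<forall>j. q $ j = f (p $ j)))}"

lemma similarity_inverse:
  assumes "similarity f"
  obtains g where "similarity g" "\<And>x. g (f x) = x"
proof -
  obtain c where c: "c > 0" and f: "\<And>x y. dist (f x) (f y) = c * dist x y"
    using assms unfolding similarity_def by blast
  define h where "h x = (1 / c) *\<^sub>R (f x - f 0)" for x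
  have "dist (h x) (h y) = dist x y" for x y
  proof -
    have "h x - h y = (1 / c) *\<^sub>R (f x - f y)"
      by (simp add: h_def scaleR_diff_right)
    then have "dist (h x) (h y) = (1 / c) * dist (f x) (f y)"
      using c by (simp add: dist_norm)
    then show ?thesis using f c by simp
  qed
  then have "orthogonal_transformation h"
    by (simp add: orthogonal_transformation_isometry h_def)
  then have "surj h" by (rule orthogonal_transformation_surj)
  have fh: "f x = f 0 + c *\<^sub>R h x" for x
    using c by (simp add: h_def)
  have "surj f"
  proof (rule surjI)
    fix y
    show "f (inv h ((1 / c) *\<^sub>R (y - f 0))) = y"
      using c by (subst fh) (simp add: surj_f_inv_f[OF \<open>surj h\<close>])
  qed
  have "inj f" using f c by (metis dist_eq_0_iff injI mult_eq_0_iff less_irrefl)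
  have "dist (inv f x) (inv f y) = (1 / c) * dist x y" for x y
    using f[of "inv f x" "inv f y"] c by (simp add: surj_f_inv_f[OF \<open>surj f\<close>])
  then have "similarity (inv f)" unfolding similarity_def using c
    by (intro exI[of _ "1 / c"]) simp
  then show ?thesis using that \<open>inj f\<close> by simp
qed

lemma equiv_similar: "equiv {p. pup_tent p} similar"
proof (rule equivI)
  show "similar \<subseteq> {p. pup_tent p} \<times> {p. pup_tent p}"
    by (auto simp: similar_def)
  have "similarity id" unfolding similarity_def by (intro exI[of _ 1]) simp
  then show "refl_on {p. pup_tent p} similar"
    by (auto simp: refl_on_def similar_def intro!: exI[of _ id])
  show "sym similar"
    unfolding sym_def similar_def by clarsimp (metis similarity_inverse)
  have "similarity (g \<circ> f)" if "similarity f" "similarity g" for f g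
  proof -
    obtain a b where "a > 0" "\<forall>x y. dist (f x) (f y) = a * dist x y"
      "b > 0" "\<forall>x y. dist (g x) (g y) = b * dist x y"
      using \<open>similarity f\<close> \<open>similarity g\<close> unfolding similarity_def by blast
    then show ?thesis
      unfolding similarity_def by (intro exI[of _ "b * a"]) simp
  qed
  then show "trans similar"
    unfolding trans_def similar_def by clarsimp (metis comp_apply)
qed

definition pup_classes :: "(real^3^8) set set" where
  "pup_classes = {p. pup_tent p} // similar"

definition quotient_topology :: "'a topology \<Rightarrow> ('a \<Rightarrow> 'b) \<Rightarrow> 'b topology" where
  "quotient_topology X f =
     topology (\<lambda>U. U \<subseteq> f ` topspace X \<and> openin X {x \<in> topspace X. f x \<in> U})"

lemma openin_quotient_topology:
  "openin (quotient_topology X f) U \<longleftrightarrow> U \<subseteq> f ` topspace X \<and> openin X {x \<in> topspace X. f x \<in> U}"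
proof -
  have "istopology (\<lambda>U. U \<subseteq> f ` topspace X \<and> openin X {x \<in> topspace X. f x \<in> U})"
    unfolding istopology_def
  proof (intro conjI allI impI)
    fix S T
    assume "S \<subseteq> f ` topspace X \<and> openin X {x \<in> topspace X. f x \<in> S}"
      and "T \<subseteq> f ` topspace X \<and> openin X {x \<in> topspace X. f x \<in> T}"
    moreover have "{x \<in> topspace X. f x \<in> S \<inter> T} =
        {x \<in> topspace X. f x \<in> S} \<inter> {x \<in> topspace X. f x \<in> T}" by auto
    ultimately show "S \<inter> T \<subseteq> f ` topspace X" "openin X {x \<in> topspace X. f x \<in> S \<inter> T}"
      by auto
  next
    fix \<K>
    assume *: "\<forall>K\<in>\<K>. K \<subseteq> f ` topspace X \<and> openin X {x \<in> topspace X. f x \<in> K}"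
    then show "\<Union>\<K> \<subseteq> f ` topspace X" by blast
    have "{x \<in> topspace X. f x \<in> \<Union>\<K>} = (\<Union>K\<in>\<K>. {x \<in> topspace X. f x \<in> K})" by auto
    then show "openin X {x \<in> topspace X. f x \<in> \<Union>\<K>}" using * by auto
  qed
  then show ?thesis by (simp add: quotient_topology_def topology_inverse')
qed

lemma topspace_quotient_topology: "topspace (quotient_topology X f) = f ` topspace X"
proof -
  have "{x \<in> topspace X. f x \<in> f ` topspace X} = topspace X" by auto
  then have "openin (quotient_topology X f) (f ` topspace X)"
    by (simp add: openin_quotient_topology)
  then show ?thesis
    by (meson openin_quotient_topology openin_subset openin_topspace subset_antisym)
qed

lemma quotient_map_quotient_topology: "quotient_map X (quotient_topology X f) f"
  by (auto simp: quotient_map_def topspace_quotient_topology openin_quotient_topology)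

definition pup_topology :: "(real^3^8) set topology" where
  "pup_topology = quotient_topology (top_of_set {p. pup_tent p}) (\<lambda>p. similar `` {p})"

lemma topspace_pup_topology: "topspace pup_topology = pup_classes"
  by (auto simp: pup_topology_def topspace_quotient_topology pup_classes_def quotient_def)

section \<open>Flat tori and the modular surface\<close>

definition period_lattice :: "complex \<Rightarrow> complex \<Rightarrow> complex set" where
  "period_lattice L1 L2 = {of_int m * L1 + of_int n * L2 | m n. True}"

definition lattice_cong :: "complex set \<Rightarrow> (complex \<times> complex) set" where
  "lattice_cong \<Lambda> = {(z, w). z - w \<in> \<Lambda>}"

definition flat_torus :: "complex set \<Rightarrow> complex set set" where
  "flat_torus \<Lambda> = UNIV // lattice_cong \<Lambda>"

text \<open>An orientation preserving isometry from the intrinsic metric of the paper torus (each triangle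
  of the realization carrying the metric of its image under \<open>pl_map p\<close>) onto \<open>\<complex>/\<Lambda>\<close>: a bijection
  which on each triangle lifts to an isometric affine map into the plane that takes a positive triple
  to a counterclockwise one. Such a bijection is continuous, hence a homeomorphism, since it is so
  on each of the finitely many compact triangles.\<close>

definition flat_isometry :: "real^3^8 \<Rightarrow> complex set \<Rightarrow> (real^8 \<Rightarrow> complex set) \<Rightarrow> bool" where
  "flat_isometry p \<Lambda> f \<longleftrightarrow>
     bij_betw f realization (flat_torus \<Lambda>) \<and>
     (\<forall>(a, b, c) \<in> positive_triples. \<exists>A B C.
        dist A B = dist (p $ a) (p $ b) \<and>
        dist B C = dist (p $ b) (p $ c) \<and>
        dist C A = dist (p $ c) (p $ a) \<and>
        0 < Im ((C - A) / (B - A)) \<and>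
        (\<forall>t \<in> closed_simplex {a, b, c}.
           f t = lattice_cong \<Lambda> `` {t $ a *\<^sub>R A + t $ b *\<^sub>R B + t $ c *\<^sub>R C}))"

definition modular_orbit :: "complex \<Rightarrow> complex set" where
  "modular_orbit \<tau> = {(of_int a * \<tau> + of_int b) / (of_int c * \<tau> + of_int d) | a b c d :: int.
     a * d - b * c = 1}"

definition modular_surface :: "complex set set" where
  "modular_surface = modular_orbit ` {\<tau>. 0 < Im \<tau>}"

definition flat_structure :: "real^3^8 \<Rightarrow> complex set" where
  "flat_structure p = (THE m. m \<in> modular_surface \<and>
     (\<exists>L1 L2. 0 < Im (L2 / L1) \<and> (\<exists>f. flat_isometry p (period_lattice L1 L2) f) \<and>
        m = modular_orbit (L2 / L1)))"

text \<open>\<^const>\<open>flat_structure\<close> is constant on similarity classes.\<close>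

definition \<Phi> :: "(real^3^8) set \<Rightarrow> complex set" where
  "\<Phi> c = the_elem (flat_structure ` c)"

definition bicusped_domain :: "complex set" where
  "bicusped_domain = {z. 0 < Im z \<and> 0 \<le> Re z \<and> 0 \<le> 1 - 2 * Re z \<and>
     0 \<le> - 2 * Re z + (Re z)\<^sup>2 + (Im z)\<^sup>2}"

definition bicusped_interior :: "complex set set" where
  "bicusped_interior = modular_orbit ` interior bicusped_domain"

end

theory Submission imports Defs begin

text \<open>Every flat torus with period \<open>\<tau>\<close> in the interior of the bi-cusped domain is reached by perturbing a
  degenerate tent in which vertices 1 and 2 (hence 5 and 6) coincide and which is known in closed
  form. Splitting the double vertices by a small \<open>\<epsilon>\<close>, the edge length equations of the flat torus reduce
  to three equations \<open>Q = 0\<close> in three unknowns, with \<open>Q\<close> strictly differentiable up to \<open>\<epsilon> = 0\<close> and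
  invertible in the unknowns there. So near the limits the zero set is a graph over an open set of
  parameters \<open>(\<tau>, \<epsilon>)\<close> by invariance of domain, and its part with small \<open>\<epsilon> > 0\<close> is path connected. The orientations of all
  quadruples of vertices are determined by their leading terms in \<open>\<epsilon>\<close>; they give embeddedness, general
  position and the convex hull. The edge vectors of the flat torus develop to an injective piecewise linear
  map of the plane, which gives the cone angles and the flat structure.\<close>

section \<open>Strict derivatives and local homeomorphisms\<close>

text \<open>In the limit four triangles shrink to segments and many quadruples become coplanar, so
  embeddedness, general position and the hull cannot be obtained by openness at the limit itself.
  Every quantity is therefore divided by its power of \<open>\<epsilon>\<close>: the length equation
  of the edge from 1 to 2 by \<open>\<epsilon>^2\<close>, that of the edge from 2 to 5 by
  \<open>\<epsilon>\<close>, the determinants by up to \<open>\<epsilon>^3\<close>. Only strict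
  inequalities at \<open>\<epsilon> = 0\<close> are then left. Vertices 1 and 2 separate
  horizontally to order \<open>\<epsilon>\<close>, but in height only to order
  \<open>\<epsilon>^2\<close>; to that order \<open>p 0\<close> also leaves the vertical plane
  through \<open>p 1\<close> and \<open>p 6\<close>. Strict differentiability at a single point
  yields injectivity on a ball and is inherited through arithmetic and roots, so the derivative of
  the long formulas is never expanded. Only the triviality of its kernel in the unknowns is shown,
  along lines with \<open>\<epsilon> = 0\<close>, where everything is explicit. The inequalities
  required of the limit come down to \<open>0 < X\<close>, \<open>X < 1/2\<close> and
  \<open>2 * X < X^2 + Y^2\<close>, the three sides of the domain.\<close>

definition has_strict_derivative ::
    "('a::real_normed_vector \<Rightarrow> 'b::real_normed_vector) \<Rightarrow> ('a \<Rightarrow> 'b) \<Rightarrow> 'a \<Rightarrow> bool" where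
  "has_strict_derivative f f' x \<longleftrightarrow> bounded_linear f' \<and>
     (\<forall>e>0. \<exists>d>0. \<forall>y\<in>ball x d. \<forall>z\<in>ball x d. norm (f y - f z - f' (y - z)) \<le> e * norm (y - z))"

definition strictly_differentiable ::
    "('a::real_normed_vector \<Rightarrow> 'b::real_normed_vector) \<Rightarrow> 'a \<Rightarrow> bool" where
  "strictly_differentiable f x \<longleftrightarrow> (\<exists>f'. has_strict_derivative f f' x)"

lemma has_strict_derivativeE:
  assumes "has_strict_derivative f f' x" "e > 0"
  obtains d where "d > 0" "\<forall>y\<in>ball x d. \<forall>z\<in>ball x d.
    norm (f y - f z - f' (y - z)) \<le> e * norm (y - z)"
  using assms unfolding has_strict_derivative_def by blast

lemma has_strict_derivative_bounded_linear:
  "bounded_linear f \<Longrightarrow> has_strict_derivative f f x"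
  by (auto simp: has_strict_derivative_def linear_simps intro: exI[of _ 1])

lemma has_strict_derivative_const: "has_strict_derivative (\<lambda>_. c) (\<lambda>_. 0) x"
  by (auto simp: has_strict_derivative_def bounded_linear_zero intro: exI[of _ 1])

lemma has_strict_derivative_add:
  assumes "has_strict_derivative f f' x" "has_strict_derivative g g' x"
  shows "has_strict_derivative (\<lambda>y. f y + g y) (\<lambda>y. f' y + g' y) x"
  unfolding has_strict_derivative_def
proof (intro conjI allI impI)
  show "bounded_linear (\<lambda>y. f' y + g' y)"
    using assms by (auto simp: has_strict_derivative_def intro: bounded_linear_add)
  fix e :: real assume "e > 0"
  then have "e / 2 > 0" by simp
  obtain d1 where d1: "d1 > 0" "\<forall>y\<in>ball x d1. \<forall>z\<in>ball x d1.
      norm (f y - f z - f' (y - z)) \<le> e / 2 * norm (y - z)"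
    by (rule has_strict_derivativeE[OF assms(1) \<open>e / 2 > 0\<close>])
  obtain d2 where d2: "d2 > 0" "\<forall>y\<in>ball x d2. \<forall>z\<in>ball x d2.
      norm (g y - g z - g' (y - z)) \<le> e / 2 * norm (y - z)"
    by (rule has_strict_derivativeE[OF assms(2) \<open>e / 2 > 0\<close>])
  have "norm (f y + g y - (f z + g z) - (f' (y - z) + g' (y - z))) \<le> e * norm (y - z)"
    if "y \<in> ball x (min d1 d2)" "z \<in> ball x (min d1 d2)" for y z
  proof -
    have "f y + g y - (f z + g z) - (f' (y - z) + g' (y - z))
        = (f y - f z - f' (y - z)) + (g y - g z - g' (y - z))" by simp
    then have "norm (f y + g y - (f z + g z) - (f' (y - z) + g' (y - z)))
        \<le> norm (f y - f z - f' (y - z)) + norm (g y - g z - g' (y - z))"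
      by (metis norm_triangle_ineq)
    also have "\<dots> \<le> e / 2 * norm (y - z) + e / 2 * norm (y - z)"
      using that by (intro add_mono d1(2)[rule_format] d2(2)[rule_format]) auto
    finally show ?thesis by simp
  qed
  then show "\<exists>d>0. \<forall>y\<in>ball x d. \<forall>z\<in>ball x d.
      norm (f y + g y - (f z + g z) - (f' (y - z) + g' (y - z))) \<le> e * norm (y - z)"
    using d1(1) d2(1) by (intro exI[of _ "min d1 d2"]) auto
qed

lemma has_strict_derivative_lipschitz:
  assumes "has_strict_derivative f f' x"
  obtains d B where "d > 0" "B > 0"
    "\<forall>y\<in>ball x d. \<forall>z\<in>ball x d. norm (f y - f z) \<le> B * norm (y - z)"
proof -
  obtain d where d: "d > 0" "\<forall>y\<in>ball x d. \<forall>z\<in>ball x d.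
      norm (f y - f z - f' (y - z)) \<le> 1 * norm (y - z)"
    by (rule has_strict_derivativeE[OF assms zero_less_one])
  obtain K where K: "K > 0" "\<And>v. norm (f' v) \<le> norm v * K"
    using assms bounded_linear.pos_bounded unfolding has_strict_derivative_def by blast
  have "norm (f y - f z) \<le> (1 + K) * norm (y - z)" if "y \<in> ball x d" "z \<in> ball x d" for y z
  proof -
    have "norm (f y - f z) \<le> norm (f y - f z - f' (y - z)) + norm (f' (y - z))"
      by (metis diff_add_cancel norm_triangle_ineq)
    also have "\<dots> \<le> 1 * norm (y - z) + norm (y - z) * K"
      using K(2) by (intro add_mono d(2)[rule_format] that)
    finally show ?thesis by (simp add: algebra_simps)
  qed
  then show ?thesis using d(1) K(1) by (intro that[of d "1 + K"]) auto
qed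

text \<open>The outer function enters through a factored difference quotient \<open>\<psi>\<close>
  that is continuous at one diagonal point. Squares, inverses and roots have it in closed form, so
  the mean value theorem is avoided; the derivative of \<open>\<phi>\<close> at \<open>f x\<close>
  is \<open>\<psi> (f x) (f x)\<close>.\<close>

lemma has_strict_derivative_compose_real:
  fixes f :: "'a::real_normed_vector \<Rightarrow> real" and \<phi> :: "real \<Rightarrow> real"
  assumes f: "has_strict_derivative f f' x"
    and \<phi>: "\<And>u v. u \<in> S \<Longrightarrow> v \<in> S \<Longrightarrow> \<phi> u - \<phi> v = \<psi> u v * (u - v)"
    and "open S" "f x \<in> S"
    and \<psi>: "isCont (\<lambda>(u, v). \<psi> u v) (f x, f x)"
  shows "has_strict_derivative (\<lambda>y. \<phi> (f y)) (\<lambda>v. \<psi> (f x) (f x) * f' v) x"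
  unfolding has_strict_derivative_def
proof (intro conjI allI impI)
  show "bounded_linear (\<lambda>v. \<psi> (f x) (f x) * f' v)"
    using f by (auto simp: has_strict_derivative_def intro: bounded_linear_const_mult)
  fix e :: real assume e: "e > 0"
  define c where "c = \<psi> (f x) (f x)"
  obtain d1 B where B: "d1 > 0" "B > 0"
    "\<forall>y\<in>ball x d1. \<forall>z\<in>ball x d1. norm (f y - f z) \<le> B * norm (y - z)"
    by (rule has_strict_derivative_lipschitz[OF f])
  define e1 where "e1 = e / (2 * (\<bar>c\<bar> + 1))"
  have e1: "e1 > 0" "\<bar>c\<bar> * e1 \<le> e / 2"
    using e by (auto simp: e1_def field_simps)
  obtain d2 where d2: "d2 > 0" "\<forall>y\<in>ball x d2. \<forall>z\<in>ball x d2.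
      norm (f y - f z - f' (y - z)) \<le> e1 * norm (y - z)"
    by (rule has_strict_derivativeE[OF f e1(1)])
  have "e / (2 * B) > 0" using e B by simp
  then obtain r where r: "r > 0"
    "\<And>p. dist p (f x, f x) < r \<Longrightarrow> \<bar>(case p of (u, v) \<Rightarrow> \<psi> u v) - c\<bar> < e / (2 * B)"
    using \<psi> unfolding continuous_at_eps_delta dist_real_def c_def by fastforce
  obtain r' where r': "r' > 0" "ball (f x) r' \<subseteq> S"
    using \<open>open S\<close> \<open>f x \<in> S\<close> openE by blast
  \<comment> \<open>\<open>d1\<close> makes \<open>f\<close> Lipschitz with constant
    \<open>B\<close> and \<open>d2\<close> controls its linear error. The other two radii, divided
    by that constant, keep the values of \<open>f\<close> where \<open>\<psi>\<close> is nearly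
    constant and inside \<open>S\<close>.\<close>
  define d where "d = Min {d1, d2, r / (2 * B), r' / B}"
  have dpos: "d > 0" using B d2 r r' by (simp add: d_def)
  have "norm (\<phi> (f y) - \<phi> (f z) - \<psi> (f x) (f x) * f' (y - z)) \<le> e * norm (y - z)"
    if yz: "y \<in> ball x d" "z \<in> ball x d" for y z
  proof -
    have dle: "d \<le> d1" "d \<le> d2" "d \<le> r / (2 * B)" "d \<le> r' / B" by (auto simp: d_def)
    have close: "dist (f w) (f x) < r / 2 \<and> dist (f w) (f x) < r'" if "w \<in> ball x d" for w
    proof -
      have "dist (f w) (f x) \<le> B * norm (w - x)"
        using B(3)[rule_format, of w x] that dle B(1) by (auto simp: dist_norm)
      also have "\<dots> < B * d" using that B(2) by (simp add: dist_norm norm_minus_commute)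
      finally have "dist (f w) (f x) < B * d" .
      moreover have "B * d \<le> r / 2" "B * d \<le> r'"
        using dle B(2) by (auto simp: field_simps)
      ultimately show ?thesis by linarith
    qed
    have "f y \<in> S" "f z \<in> S"
      using close[OF yz(1)] close[OF yz(2)] r' by (auto simp: dist_commute subset_iff)
    then have 1: "\<phi> (f y) - \<phi> (f z) = \<psi> (f y) (f z) * (f y - f z)" by (rule \<phi>)
    have "dist (f y, f z) (f x, f x) \<le> dist (f y) (f x) + dist (f z) (f x)"
      by (simp add: dist_Pair_Pair sqrt_sum_squares_le_sum)
    also have "\<dots> < r" using close[OF yz(1)] close[OF yz(2)] by simp
    finally have 2: "\<bar>\<psi> (f y) (f z) - c\<bar> < e / (2 * B)" using r(2) by fastforce
    have 3: "norm (f y - f z) \<le> B * norm (y - z)" "norm (f y - f z - f' (y - z)) \<le> e1 * norm (y - z)"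
      using B(3) d2(2) yz dle by auto
    have "\<phi> (f y) - \<phi> (f z) - \<psi> (f x) (f x) * f' (y - z)
        = (\<psi> (f y) (f z) - c) * (f y - f z) + c * (f y - f z - f' (y - z))"
      by (simp add: 1 c_def algebra_simps)
    then have "norm (\<phi> (f y) - \<phi> (f z) - \<psi> (f x) (f x) * f' (y - z))
        \<le> \<bar>\<psi> (f y) (f z) - c\<bar> * norm (f y - f z) + \<bar>c\<bar> * norm (f y - f z - f' (y - z))"
      by (metis norm_triangle_ineq norm_mult real_norm_def)
    also have "\<dots> \<le> e / (2 * B) * (B * norm (y - z)) + \<bar>c\<bar> * (e1 * norm (y - z))"
      using 2 3 by (intro add_mono mult_mono) auto
    also have "\<dots> \<le> e / 2 * norm (y - z) + e / 2 * norm (y - z)"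
      using B(2) mult_right_mono[OF e1(2), of "norm (y - z)"] by (simp add: algebra_simps)
    finally show ?thesis by simp
  qed
  then show "\<exists>d>0. \<forall>y\<in>ball x d. \<forall>z\<in>ball x d.
      norm (\<phi> (f y) - \<phi> (f z) - \<psi> (f x) (f x) * f' (y - z)) \<le> e * norm (y - z)"
    using dpos by blast
qed

lemma has_strict_derivative_Pair:
  assumes "has_strict_derivative f f' x" "has_strict_derivative g g' x"
  shows "has_strict_derivative (\<lambda>y. (f y, g y)) (\<lambda>y. (f' y, g' y)) x"
  unfolding has_strict_derivative_def
proof (intro conjI allI impI)
  show "bounded_linear (\<lambda>y. (f' y, g' y))"
    using assms by (auto simp: has_strict_derivative_def intro: bounded_linear_Pair)
  fix e :: real assume "e > 0"
  then have "e / 2 > 0" by simp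
  obtain d1 where d1: "d1 > 0" "\<forall>y\<in>ball x d1. \<forall>z\<in>ball x d1.
      norm (f y - f z - f' (y - z)) \<le> e / 2 * norm (y - z)"
    by (rule has_strict_derivativeE[OF assms(1) \<open>e / 2 > 0\<close>])
  obtain d2 where d2: "d2 > 0" "\<forall>y\<in>ball x d2. \<forall>z\<in>ball x d2.
      norm (g y - g z - g' (y - z)) \<le> e / 2 * norm (y - z)"
    by (rule has_strict_derivativeE[OF assms(2) \<open>e / 2 > 0\<close>])
  have "norm ((f y, g y) - (f z, g z) - (f' (y - z), g' (y - z))) \<le> e * norm (y - z)"
    if "y \<in> ball x (min d1 d2)" "z \<in> ball x (min d1 d2)" for y z
  proof -
    have "norm ((f y, g y) - (f z, g z) - (f' (y - z), g' (y - z)))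
        \<le> norm (f y - f z - f' (y - z)) + norm (g y - g z - g' (y - z))"
      by (simp add: norm_Pair sqrt_sum_squares_le_sum)
    also have "\<dots> \<le> e / 2 * norm (y - z) + e / 2 * norm (y - z)"
      using that by (intro add_mono d1(2)[rule_format] d2(2)[rule_format]) auto
    finally show ?thesis by simp
  qed
  then show "\<exists>d>0. \<forall>y\<in>ball x d. \<forall>z\<in>ball x d.
      norm ((f y, g y) - (f z, g z) - (f' (y - z), g' (y - z))) \<le> e * norm (y - z)"
    using d1(1) d2(1) by (intro exI[of _ "min d1 d2"]) auto
qed

lemma has_strict_derivative_imp_has_derivative:
  assumes "has_strict_derivative f f' x"
  shows "(f has_derivative f') (at x)"
  unfolding has_derivative_at_alt
proof (intro conjI allI impI)
  show "bounded_linear f'" using assms by (simp add: has_strict_derivative_def)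
  fix e :: real assume "e > 0"
  then obtain d where "d > 0" "\<forall>y\<in>ball x d. \<forall>z\<in>ball x d. norm (f y - f z - f' (y - z)) \<le> e * norm (y - z)"
    using assms unfolding has_strict_derivative_def by blast
  then show "\<exists>d>0. \<forall>y. norm (y - x) < d \<longrightarrow> norm (f y - f x - f' (y - x)) \<le> e * norm (y - x)"
    by (intro exI[of _ d]) (auto simp: dist_norm norm_minus_commute)
qed

lemma strictly_differentiable_const [intro!]: "strictly_differentiable (\<lambda>_. c) x"
  using has_strict_derivative_const by (auto simp: strictly_differentiable_def)

lemma strictly_differentiable_bounded_linear: "bounded_linear f \<Longrightarrow> strictly_differentiable f x"
  using has_strict_derivative_bounded_linear by (auto simp: strictly_differentiable_def)

lemma strictly_differentiable_add [intro!]: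
  "strictly_differentiable f x \<Longrightarrow> strictly_differentiable g x \<Longrightarrow>
    strictly_differentiable (\<lambda>y. f y + g y) x"
  using has_strict_derivative_add unfolding strictly_differentiable_def by blast

lemma strictly_differentiable_Pair [intro!]:
  "strictly_differentiable f x \<Longrightarrow> strictly_differentiable g x \<Longrightarrow>
    strictly_differentiable (\<lambda>y. (f y, g y)) x"
  using has_strict_derivative_Pair unfolding strictly_differentiable_def by blast

context
  fixes f :: "'a::real_normed_vector \<Rightarrow> real" and x :: 'a
  assumes f: "strictly_differentiable f x"
begin

lemma strictly_differentiable_compose_real:
  fixes \<phi> :: "real \<Rightarrow> real"
  assumes "\<And>u v. u \<in> S \<Longrightarrow> v \<in> S \<Longrightarrow> \<phi> u - \<phi> v = \<psi> u v * (u - v)"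
    and "open S" "f x \<in> S" "isCont (\<lambda>(u, v). \<psi> u v) (f x, f x)"
  shows "strictly_differentiable (\<lambda>y. \<phi> (f y)) x"
  using f has_strict_derivative_compose_real[where S = S and \<phi> = \<phi> and \<psi> = \<psi>] assms
  unfolding strictly_differentiable_def by metis

lemma strictly_differentiable_cmult: "strictly_differentiable (\<lambda>y. c * f y) x"
  by (rule strictly_differentiable_compose_real[where S = UNIV and \<psi> = "\<lambda>_ _. c"])
    (auto simp: algebra_simps case_prod_unfold)

lemma strictly_differentiable_minus [intro!]: "strictly_differentiable (\<lambda>y. - f y) x"
  using strictly_differentiable_cmult[of "-1"] by simp

lemma strictly_differentiable_square: "strictly_differentiable (\<lambda>y. (f y)\<^sup>2) x"
  by (rule strictly_differentiable_compose_real[where S = UNIV and \<psi> = "\<lambda>u v. u + v"])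
    (auto simp: algebra_simps power2_eq_square case_prod_unfold intro!: continuous_intros)

lemma strictly_differentiable_inverse [intro!]:
  assumes "f x \<noteq> 0"
  shows "strictly_differentiable (\<lambda>y. inverse (f y)) x"
  by (rule strictly_differentiable_compose_real[where S = "- {0}" and \<psi> = "\<lambda>u v. - inverse (u * v)"])
    (use assms in \<open>auto simp: field_simps case_prod_unfold open_Compl intro!: continuous_intros\<close>)

lemma strictly_differentiable_sqrt [intro!]:
  assumes "f x > 0"
  shows "strictly_differentiable (\<lambda>y. sqrt (f y)) x"
proof (rule strictly_differentiable_compose_real[where S = "{0<..}" and \<psi> = "\<lambda>u v. inverse (sqrt u + sqrt v)"])
  fix u v :: real assume "u \<in> {0<..}" "v \<in> {0<..}"
  then have pos: "sqrt u > 0" "sqrt v > 0" and "sqrt u * sqrt u = u" "sqrt v * sqrt v = v" by auto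
  then have "u - v = (sqrt u + sqrt v) * (sqrt u - sqrt v)"
    by (simp add: algebra_simps)
  moreover have "sqrt u + sqrt v \<noteq> 0" using add_pos_pos[OF pos] by linarith
  ultimately show "sqrt u - sqrt v = inverse (sqrt u + sqrt v) * (u - v)" by simp
qed (use assms in \<open>auto simp: case_prod_unfold intro!: continuous_intros\<close>)

end

lemma strictly_differentiable_diff [intro!]:
  fixes f g :: "'a::real_normed_vector \<Rightarrow> real"
  assumes "strictly_differentiable f x" "strictly_differentiable g x"
  shows "strictly_differentiable (\<lambda>y. f y - g y) x"
  using strictly_differentiable_add[OF assms(1) strictly_differentiable_minus[OF assms(2)]] by simp

text \<open>Products reduce to squares by polarization.\<close>

lemma strictly_differentiable_mult [intro!]:
  fixes f g :: "'a::real_normed_vector \<Rightarrow> real"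
  assumes "strictly_differentiable f x" "strictly_differentiable g x"
  shows "strictly_differentiable (\<lambda>y. f y * g y) x"
proof -
  have "(\<lambda>y. f y * g y) = (\<lambda>y. (1/4) * ((f y + g y)\<^sup>2 - (f y - g y)\<^sup>2))"
    by (auto simp: power2_eq_square algebra_simps)
  moreover have "strictly_differentiable (\<lambda>y. (1/4) * ((f y + g y)\<^sup>2 - (f y - g y)\<^sup>2)) x"
    using assms by (intro strictly_differentiable_cmult strictly_differentiable_diff
        strictly_differentiable_square strictly_differentiable_add)
  ultimately show ?thesis by simp
qed

lemma strictly_differentiable_divide [intro!]:
  fixes f g :: "'a::real_normed_vector \<Rightarrow> real"
  assumes "strictly_differentiable f x" "strictly_differentiable g x" "g x \<noteq> 0"
  shows "strictly_differentiable (\<lambda>y. f y / g y) x"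
  unfolding divide_inverse
  by (intro strictly_differentiable_mult strictly_differentiable_inverse assms)

lemma strictly_differentiable_power [intro!]:
  fixes f :: "'a::real_normed_vector \<Rightarrow> real"
  assumes "strictly_differentiable f x"
  shows "strictly_differentiable (\<lambda>y. f y ^ n) x"
  by (induction n) (use assms in auto)

lemma strictly_differentiable_isCont:
  assumes "strictly_differentiable f x" shows "isCont f x"
  using assms has_strict_derivative_imp_has_derivative has_derivative_continuous
  unfolding strictly_differentiable_def by blast

text \<open>Comparing two arbitrary points near \<open>x\<close> gives a Lipschitz bound on a whole
  ball, hence continuity also at the neighbours of \<open>x\<close>, where nothing was
  assumed.\<close>

lemma strictly_differentiable_continuous_on_ball:
  assumes "strictly_differentiable f x"
  obtains r where "r > 0" "continuous_on (ball x r) f"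
proof -
  obtain f' where "has_strict_derivative f f' x"
    using assms by (auto simp: strictly_differentiable_def)
  then obtain d B where d: "d > 0" "B > 0"
    "\<forall>y\<in>ball x d. \<forall>z\<in>ball x d. norm (f y - f z) \<le> B * norm (y - z)"
    by (rule has_strict_derivative_lipschitz)
  then have "B-lipschitz_on (ball x d) f"
    by (auto simp: lipschitz_on_def dist_norm)
  then show ?thesis using that d(1) lipschitz_on_continuous_on by blast
qed

text \<open>An injective linear map expands lengths by at least some \<open>m > 0\<close>. With
  linear error \<open>m / 2\<close>, two points with equal images are at distance zero.\<close>

lemma has_strict_derivative_inj_on_ball:
  fixes f :: "'a::euclidean_space \<Rightarrow> 'b::euclidean_space"
  assumes f: "has_strict_derivative f f' x" and ker: "\<And>v. f' v = 0 \<Longrightarrow> v = 0"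
  obtains r where "r > 0" "inj_on f (ball x r)"
proof -
  have lin: "linear f'" using f by (simp add: has_strict_derivative_def bounded_linear.linear)
  have "inj f'" using ker lin by (simp add: linear_injective_0)
  then obtain m where m: "m > 0" "\<And>v. norm (f' v) \<ge> m * norm v"
    using linear_inj_bounded_below_pos[OF lin] by blast
  obtain d where d: "d > 0" "\<forall>y\<in>ball x d. \<forall>z\<in>ball x d.
      norm (f y - f z - f' (y - z)) \<le> m / 2 * norm (y - z)"
    by (rule has_strict_derivativeE[OF f half_gt_zero[OF m(1)]])
  have "inj_on f (ball x d)"
  proof (rule inj_onI)
    fix y z assume yz: "y \<in> ball x d" "z \<in> ball x d" "f y = f z"
    have "m * norm (y - z) \<le> norm (f' (y - z))" by (rule m(2))
    also have "\<dots> \<le> m / 2 * norm (y - z)" using d(2)[rule_format, OF yz(1,2)] yz(3) by simp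
    finally show "y = z" using m(1) by (simp add: field_simps)
  qed
  then show ?thesis using that d(1) by blast
qed

text \<open>Over each base point the zero set of \<open>Q\<close> is a graph over the parameters, by invariance of
  domain; pieces over neighbouring base points overlap because the graphs are unique.\<close>

lemma path_connected_zero_set:
  fixes Q :: "'u::euclidean_space \<times> ('t::euclidean_space \<times> real) \<Rightarrow> 'u"
    and u0 :: "'t \<Rightarrow> 'u"
  assumes I: "connected I"
    and u0: "continuous_on I u0" and Q0: "\<And>t. t \<in> I \<Longrightarrow> Q (u0 t, t, 0) = 0"
    and loc: "\<And>t. t \<in> I \<Longrightarrow> \<exists>r>0. inj_on (\<lambda>x. (Q x, snd x)) (ball (u0 t, t, 0) r) \<and>
        continuous_on (ball (u0 t, t, 0) r) Q \<and> continuous_on (ball (u0 t, t, 0) r) P \<and>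
        (\<forall>x\<in>ball (u0 t, t, 0) r. snd (snd x) > 0 \<longrightarrow> Q x = 0 \<longrightarrow> G x)"
  obtains S where "path_connected (P ` S)" "\<And>x. x \<in> S \<Longrightarrow> Q x = 0 \<and> snd (snd x) > 0 \<and> G x"
    "I \<subseteq> (\<lambda>x. fst (snd x)) ` S"
proof -
  \<comment> \<open>Adjoining the parameters makes source and target equidimensional, so that
    invariance of domain turns local injectivity into openness.\<close>
  define \<Psi> where "\<Psi> = (\<lambda>x. (Q x, snd x))"
  define x0 where "x0 t = (u0 t, t, 0::real)" for t
  have "\<exists>r. \<forall>t\<in>I. r t > 0 \<and> inj_on \<Psi> (ball (x0 t) (r t)) \<and> continuous_on (ball (x0 t) (r t)) Q \<and>
      continuous_on (ball (x0 t) (r t)) P \<and>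
      (\<forall>x\<in>ball (x0 t) (r t). snd (snd x) > 0 \<longrightarrow> Q x = 0 \<longrightarrow> G x)"
    by (rule bchoice) (use loc in \<open>auto simp: \<Psi>_def x0_def\<close>)
  then obtain r where r: "\<And>t. t \<in> I \<Longrightarrow> r t > 0" "\<And>t. t \<in> I \<Longrightarrow> inj_on \<Psi> (ball (x0 t) (r t))"
    "\<And>t. t \<in> I \<Longrightarrow> continuous_on (ball (x0 t) (r t)) Q" "\<And>t. t \<in> I \<Longrightarrow> continuous_on (ball (x0 t) (r t)) P"
    "\<And>t x. t \<in> I \<Longrightarrow> x \<in> ball (x0 t) (r t) \<Longrightarrow> snd (snd x) > 0 \<Longrightarrow> Q x = 0 \<Longrightarrow> G x"
    by blast
  define B where "B t = ball (x0 t) (r t)" for t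
  have cont: "continuous_on (B t) \<Psi>" if "t \<in> I" for t
    unfolding \<Psi>_def B_def by (intro continuous_intros r(3)[OF that])
  have inj: "inj_on \<Psi> (B t)" if "t \<in> I" for t using r(2)[OF that] by (simp add: B_def)
  have op: "open (\<Psi> ` B t)" if "t \<in> I" for t
    using cont[OF that] inj[OF that] by (intro invariance_of_domain) (auto simp: B_def)
  have x0B: "x0 t \<in> B t" if "t \<in> I" for t using r(1)[OF that] by (simp add: B_def)
  have \<Psi>x0: "\<Psi> (x0 t) = (0, t, 0)" if "t \<in> I" for t
    using Q0[OF that] by (simp add: \<Psi>_def x0_def)
  have "\<exists>d>0. ball (0, t, 0) d \<subseteq> \<Psi> ` B t" if t: "t \<in> I" for t
  proof -
    have "(0, t, 0) \<in> \<Psi> ` B t" using \<Psi>x0[OF t] x0B[OF t] by (metis imageI)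
    with op[OF t] show ?thesis by (meson open_contains_ball)
  qed
  then have "\<exists>\<rho>. \<forall>t\<in>I. \<rho> t > 0 \<and> ball (0, t, 0) (\<rho> t) \<subseteq> \<Psi> ` B t"
    by (intro bchoice) auto
  then obtain \<rho> where \<rho>: "\<And>t. t \<in> I \<Longrightarrow> \<rho> t > 0" "\<And>t. t \<in> I \<Longrightarrow> ball (0, t, 0) (\<rho> t) \<subseteq> \<Psi> ` B t"
    by blast
  define g where "g t = inv_into (B t) \<Psi>" for t
  have g: "continuous_on (\<Psi> ` B t) (g t)" if "t \<in> I" for t
    unfolding g_def using inj[OF that] cont[OF that]
    by (intro continuous_on_inverse_open) (auto simp: B_def inv_into_f_f)
  have gin: "g t y \<in> B t" "\<Psi> (g t y) = y" if "y \<in> \<Psi> ` B t" for t y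
    unfolding g_def using that by (auto intro: inv_into_into f_inv_into_f)
  have guniq: "g t (\<Psi> x) = x" if "t \<in> I" "x \<in> B t" for t x
    unfolding g_def using inj that by (simp add: inv_into_f_f)
  \<comment> \<open>The slice \<open>Q = 0\<close>, \<open>\<epsilon> > 0\<close> of a ball in the
    target is convex, so its image under the local inverse is path connected. This replaces any
    direct argument about the zero set in the source.\<close>
  define V where "V t = ball (0, t, 0) (\<rho> t) \<inter> {y. fst y = (0::'u) \<and> snd (snd y) > (0::real)}" for t
  have "convex {y. fst y = (0::'u) \<and> snd (snd (y::'u \<times> 't \<times> real)) > 0}"
    unfolding convex_def
  proof (clarsimp)
    fix b ba u v :: real
    assume "0 < b" "0 < ba" "0 \<le> u" "0 \<le> v" "u + v = 1"
    then show "0 < u * b + v * ba"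
      by (cases "u = 0") (auto intro: add_pos_nonneg)
  qed
  then have Vconv: "convex (V t)" for t
    unfolding V_def by (intro convex_Int convex_ball)
  have Vsub: "V t \<subseteq> \<Psi> ` B t" if "t \<in> I" for t using \<rho>(2)[OF that] by (auto simp: V_def)
  define S where "S t = g t ` V t" for t
  have Sprop: "Q x = 0 \<and> snd (snd x) > 0 \<and> x \<in> B t" if tx: "t \<in> I" "x \<in> S t" for t x
  proof -
    obtain y where y: "y \<in> V t" "x = g t y" using tx(2) unfolding S_def by blast
    then have "\<Psi> x = y" "x \<in> B t" using gin[OF subsetD[OF Vsub[OF tx(1)] y(1)]] by auto
    then show ?thesis using y(1) by (auto simp: \<Psi>_def V_def)
  qed
  have PS: "path_connected (P ` S t)" if "t \<in> I" for t
  proof -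
    have "path_connected (S t)" unfolding S_def
      using Vconv g[OF that] Vsub[OF that]
      by (intro path_connected_continuous_image convex_imp_path_connected) (auto intro: continuous_on_subset)
    moreover have "continuous_on (S t) P"
      using r(4)[OF that] Sprop[OF that] by (auto intro: continuous_on_subset simp: B_def)
    ultimately show ?thesis by (rule path_connected_continuous_image[rotated])
  qed
  \<comment> \<open>Over \<open>(t', e)\<close> with \<open>e\<close> tending to 0 the inverse
    \<open>g t'\<close> tends to \<open>x0 t'\<close>, hence enters \<open>B t\<close>; injectivity
    of \<open>\<Psi>\<close> on \<open>B t\<close> then identifies its value with that of
    \<open>g t\<close>.\<close>
  have overlap: "S t \<inter> S t' \<noteq> {}" if "t \<in> I" "t' \<in> I" "x0 t' \<in> B t" "dist t' t < \<rho> t" for t t'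
  proof -
    have "((\<lambda>e. (0::'u, t', e::real)) \<longlongrightarrow> (0, t', 0)) (at_right 0)"
      by (intro tendsto_intros)
    moreover have "isCont (g t') (0, t', 0)"
      using g[OF that(2)] op[OF that(2)] \<rho>(1)[OF that(2)] \<rho>(2)[OF that(2)]
      by (meson centre_in_ball continuous_on_eq_continuous_at subsetD)
    ultimately have "((\<lambda>e. g t' (0, t', e)) \<longlongrightarrow> g t' (0, t', 0)) (at_right 0)"
      by (rule isCont_tendsto_compose[rotated])
    moreover have "g t' (0, t', 0) = x0 t'"
      using guniq[OF that(2) x0B[OF that(2)]] by (simp add: \<Psi>x0[OF that(2)])
    ultimately have "eventually (\<lambda>e. g t' (0, t', e) \<in> B t) (at_right 0)"
      using that(3) by (intro topological_tendstoD) (auto simp: B_def)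
    moreover have "eventually (\<lambda>e::real. 0 < e \<and> e < \<rho> t') (at_right 0)"
      using \<rho>(1)[OF that(2)] eventually_at_right_less eventually_at_right_field
      by (metis (mono_tags, lifting))
    moreover have "eventually (\<lambda>e::real. dist (0::'u, t', e) (0, t, 0) < \<rho> t) (at_right 0)"
    proof (rule order_tendstoD)
      show "((\<lambda>e. dist (0::'u, t', e::real) (0, t, 0)) \<longlongrightarrow> dist (0::'u, t', 0::real) (0, t, 0)) (at_right 0)"
        by (intro tendsto_intros)
      show "dist (0::'u, t', 0::real) (0, t, 0) < \<rho> t"
        using that(4) by (simp add: dist_Pair_Pair)
    qed
    ultimately have "eventually (\<lambda>e. g t' (0, t', e) \<in> B t \<and> (0 < e \<and> e < \<rho> t') \<and>
        dist (0::'u, t', e) (0, t, 0) < \<rho> t) (at_right 0)"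
      by eventually_elim auto
    then obtain e where e: "g t' (0, t', e) \<in> B t" "0 < e" "e < \<rho> t'"
        "dist (0::'u, t', e) (0, t, 0) < \<rho> t"
      using eventually_happens[of _ "at_right (0::real)"] trivial_limit_at_right_real by blast
    have V': "(0, t', e) \<in> V t'" using e by (simp add: V_def dist_Pair_Pair)
    have V: "(0, t', e) \<in> V t" using e by (simp add: V_def dist_commute)
    have "\<Psi> (g t' (0, t', e)) = (0, t', e)" by (rule gin(2)[OF subsetD[OF Vsub[OF that(2)] V']])
    then have "g t' (0, t', e) = g t (0, t', e)"
      using guniq[OF that(1) e(1)] by simp
    then show ?thesis using V V' by (auto simp: S_def)
  qed
  define U where "U = (\<Union>t\<in>I. S t)"
  \<comment> \<open>Being joined inside the union is an equivalence relation whose classes are open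
    by \<open>overlap\<close>; on the connected set \<open>I\<close> there is only one
    class.\<close>
  define R where "R = (\<lambda>t t'. \<forall>x\<in>P ` S t. \<forall>y\<in>P ` S t'. path_component (P ` U) x y)"
  have Sne: "S t \<noteq> {}" if "t \<in> I" for t
    using overlap[OF that that x0B[OF that]] \<rho>(1)[OF that] by auto
  have comp: "path_component (P ` U) x y" if "t \<in> I" "x \<in> P ` S t" "y \<in> P ` S t" for t x y
  proof -
    have "P ` S t \<subseteq> P ` U" using that(1) by (auto simp: U_def)
    then show ?thesis
      using PS[OF that(1)] that(2,3) path_component_of_subset
      unfolding path_connected_component by blast
  qed
  have "R a b" if "a \<in> I" "b \<in> I" for a b
  proof (rule connected_equivalence_relation[OF I that])
    show "R y x" if "R x y" for x y
      using that path_component_sym unfolding R_def by blast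
    show "R x z" if R: "R x y" "R y z" "y \<in> I" for x y z
    proof -
      obtain w where "w \<in> P ` S y" using Sne[OF R(3)] by auto
      then show ?thesis using R(1,2) path_component_trans unfolding R_def by blast
    qed
    fix t assume t: "t \<in> I"
    have "continuous_on I (\<lambda>t'. x0 t')" unfolding x0_def by (intro continuous_intros u0)
    then have "openin (top_of_set I) (I \<inter> x0 -` B t)"
      using continuous_openin_preimage_gen[of I x0 "B t"] by (simp add: B_def)
    moreover have "openin (top_of_set I) (I \<inter> ball t (\<rho> t))" by (simp add: openin_open_Int)
    ultimately have "openin (top_of_set I) ((I \<inter> x0 -` B t) \<inter> (I \<inter> ball t (\<rho> t)))" by blast
    moreover have "R t t'" if t': "t' \<in> (I \<inter> x0 -` B t) \<inter> (I \<inter> ball t (\<rho> t))" for t'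
    proof -
      have "t' \<in> I" using t' by auto
      obtain w where w: "w \<in> S t" "w \<in> S t'"
        using overlap[OF t, of t'] t' by (auto simp: dist_commute)
      show ?thesis unfolding R_def
        using comp[OF t _ imageI[OF w(1)]] comp[OF \<open>t' \<in> I\<close> imageI[OF w(2)]] path_component_trans by blast
    qed
    ultimately show "\<exists>T. openin (top_of_set I) T \<and> t \<in> T \<and> (\<forall>x\<in>T. R t x)"
      using t x0B[OF t] \<rho>(1)[OF t] by (intro exI[of _ "(I \<inter> x0 -` B t) \<inter> (I \<inter> ball t (\<rho> t))"]) auto
  qed
  then have "path_connected (P ` U)"
    unfolding path_connected_component R_def U_def by blast
  moreover have "Q x = 0 \<and> snd (snd x) > 0 \<and> G x" if xU: "x \<in> U" for x
  proof -
    obtain t where t: "t \<in> I" "x \<in> S t" using xU unfolding U_def by blast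
    show ?thesis using Sprop[OF t] r(5)[OF t(1)] by (auto simp: B_def)
  qed
  moreover have "t \<in> (\<lambda>x. fst (snd x)) ` U" if t: "t \<in> I" for t
  proof -
    have V: "(0, t, \<rho> t / 2) \<in> V t" using \<rho>(1)[OF t] by (simp add: V_def dist_Pair_Pair)
    have "\<Psi> (g t (0, t, \<rho> t / 2)) = (0, t, \<rho> t / 2)" by (rule gin(2)[OF subsetD[OF Vsub[OF t] V]])
    then have "fst (snd (g t (0, t, \<rho> t / 2))) = t" by (auto simp: \<Psi>_def)
    moreover have "g t (0, t, \<rho> t / 2) \<in> U" using V t by (auto simp: U_def S_def)
    ultimately show ?thesis by force
  qed
  ultimately show ?thesis using that by blast
qed

section \<open>Embeddedness from the chirotope\<close>

lemma UNIV_8: "(UNIV :: 8 set) = {0, 1, 2, 3, 4, 5, 6, 7}"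
  by (rule sym, rule card_subset_eq) (simp_all add: card_insert_if)

lemma all_8: "(\<forall>v::8. R v) \<longleftrightarrow> R 0 \<and> R 1 \<and> R 2 \<and> R 3 \<and> R 4 \<and> R 5 \<and> R 6 \<and> R 7"
proof -
  have "(\<forall>v::8. R v) \<longleftrightarrow> (\<forall>v\<in>{0,1,2,3,4,5,6,7::8}. R v)" by (subst UNIV_8[symmetric]) simp
  then show ?thesis by simp
qed

text \<open>Six times the signed volume of a tetrahedron. As a function of the last point it is
  affine, and its sign tells the side of the plane through the first three.\<close>

definition vol :: "real^3 \<Rightarrow> real^3 \<Rightarrow> real^3 \<Rightarrow> real^3 \<Rightarrow> real" where
  "vol a b c d = cross3 (b - a) (c - a) \<bullet> (d - a)"

lemma vol_expand:
  "vol a b c d =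
     ((b$2 - a$2) * (c$3 - a$3) - (b$3 - a$3) * (c$2 - a$2)) * (d$1 - a$1) +
     ((b$3 - a$3) * (c$1 - a$1) - (b$1 - a$1) * (c$3 - a$3)) * (d$2 - a$2) +
     ((b$1 - a$1) * (c$2 - a$2) - (b$2 - a$2) * (c$1 - a$1)) * (d$3 - a$3)"
  by (simp add: vol_def cross3_def inner_vec_def sum_3)

lemma vol_swap:
  "vol a b d c = - vol a b c d" "vol a c b d = - vol a b c d" "vol b a c d = - vol a b c d"
  by (simp_all add: vol_expand) algebra+

lemma vol_degenerate: "vol a b c a = 0" "vol a b c b = 0" "vol a b c c = 0"
  by (simp_all add: vol_expand algebra_simps)

lemma vol_convex_combination:
  fixes p :: "real^3^'n"
  assumes "(\<Sum>i\<in>UNIV. t $ i) = (1::real)"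
  shows "vol a b c (\<Sum>i\<in>UNIV. t $ i *\<^sub>R p $ i) = (\<Sum>i\<in>UNIV. t $ i * vol a b c (p $ i))"
proof -
  have "(\<Sum>i\<in>UNIV. t $ i *\<^sub>R p $ i) - a = (\<Sum>i\<in>UNIV. t $ i *\<^sub>R (p $ i - a))"
    using assms by (simp add: scaleR_diff_right sum_subtractf flip: scaleR_left.sum)
  then show ?thesis by (simp add: vol_def inner_sum_right)
qed

lemma vol_coplanar:
  assumes "coplanar {a, b, c, d}" shows "vol a b c d = 0"
proof -
  obtain u v w where "{a, b, c, d} \<subseteq> affine hull {u, v, w}"
    using assms by (auto simp: coplanar_def)
  moreover have "\<exists>r s. x = u + r *\<^sub>R (v - u) + s *\<^sub>R (w - u)" if "x \<in> affine hull {u, v, w}" for x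
  proof -
    from that obtain l r s where "l + r + s = 1" "x = l *\<^sub>R u + r *\<^sub>R v + s *\<^sub>R w"
      by (auto simp: affine_hull_3)
    moreover from this have "l = 1 - r - s" by simp
    ultimately show ?thesis by (intro exI[of _ r] exI[of _ s]) (simp add: algebra_simps)
  qed
  moreover have "cross3 (\<alpha> *\<^sub>R v' + \<beta> *\<^sub>R w') (\<gamma> *\<^sub>R v' + \<delta> *\<^sub>R w') \<bullet> (\<epsilon> *\<^sub>R v' + \<zeta> *\<^sub>R w') = 0"
    for \<alpha> \<beta> \<gamma> \<delta> \<epsilon> \<zeta> and v' w' :: "real^3"
    by (simp add: cross3_def inner_vec_def sum_3 algebra_simps)
  moreover have "(u + r *\<^sub>R v' + s *\<^sub>R w') - (u + r' *\<^sub>R v' + s' *\<^sub>R w') = (r - r') *\<^sub>R v' + (s - s') *\<^sub>R w'"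
    for r s r' s' and v' w' :: "real^3" by (simp add: algebra_simps)
  moreover obtain r1 s1 r2 s2 r3 s3 r4 s4 where
    "a = u + r1 *\<^sub>R (v - u) + s1 *\<^sub>R (w - u)" "b = u + r2 *\<^sub>R (v - u) + s2 *\<^sub>R (w - u)"
    "c = u + r3 *\<^sub>R (v - u) + s3 *\<^sub>R (w - u)" "d = u + r4 *\<^sub>R (v - u) + s4 *\<^sub>R (w - u)"
    using calculation(1,2) by (metis insert_subset)
  ultimately show ?thesis by (simp add: vol_def)
qed

context
  fixes p :: "real^3^8" and T T' :: "8 set" and i j k :: 8
  assumes T: "\<And>m. m \<in> T \<Longrightarrow> vol (p$i) (p$j) (p$k) (p$m) \<ge> 0"
    and T': "\<And>m. m \<in> T' \<Longrightarrow> vol (p$i) (p$j) (p$k) (p$m) \<le> 0"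
    and off: "\<And>m. m \<notin> {i, j, k} \<Longrightarrow> vol (p$i) (p$j) (p$k) (p$m) \<noteq> 0"
begin

text \<open>A common image point has all its weight on the separating plane through \<open>p i, p j, p k\<close>.\<close>

lemma separated_simplices:
  assumes ne: "i \<noteq> j" "j \<noteq> k" "i \<noteq> k"
    and t: "t \<in> closed_simplex T" and t': "t' \<in> closed_simplex T'" and eq: "pl_map p t = pl_map p t'"
  shows "t = t'"
proof -
  let ?f = "\<lambda>m. vol (p$i) (p$j) (p$k) (p$m)"
  have t1: "\<And>m. t $ m \<ge> 0" "(\<Sum>m\<in>UNIV. t $ m) = 1" "\<And>m. m \<notin> T \<Longrightarrow> t $ m = 0"
    and t2: "\<And>m. t' $ m \<ge> 0" "(\<Sum>m\<in>UNIV. t' $ m) = 1" "\<And>m. m \<notin> T' \<Longrightarrow> t' $ m = 0"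
    using t t' by (auto simp: closed_simplex_def)
  have "vol (p$i) (p$j) (p$k) (pl_map p t) = (\<Sum>m\<in>UNIV. t $ m * ?f m)"
    "vol (p$i) (p$j) (p$k) (pl_map p t') = (\<Sum>m\<in>UNIV. t' $ m * ?f m)"
    unfolding pl_map_def using t1(2) t2(2) by (simp_all add: vol_convex_combination)
  then have sums: "(\<Sum>m\<in>UNIV. t $ m * ?f m) = (\<Sum>m\<in>UNIV. t' $ m * ?f m)" using eq by simp
  have nn: "t $ m * ?f m \<ge> 0" for m by (cases "m \<in> T") (use t1 T in auto)
  have np: "t' $ m * ?f m \<le> 0" for m
    by (cases "m \<in> T'") (use t2 T' in \<open>auto simp: mult_nonneg_nonpos\<close>)
  have "(\<Sum>m\<in>UNIV. t $ m * ?f m) \<ge> 0" "(\<Sum>m\<in>UNIV. t' $ m * ?f m) \<le> 0"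
    using nn np by (auto intro: sum_nonneg sum_nonpos)
  then have z: "(\<Sum>m\<in>UNIV. t $ m * ?f m) = 0" "(\<Sum>m\<in>UNIV. - (t' $ m * ?f m)) = 0"
    using sums by (auto simp: sum_negf)
  have 1: "t $ m * ?f m = 0" for m
    using z(1) sum_nonneg_eq_0_iff[of UNIV "\<lambda>m. t $ m * ?f m"] nn by auto
  have 2: "t' $ m * ?f m = 0" for m
    using z(2) sum_nonneg_eq_0_iff[of UNIV "\<lambda>m. - (t' $ m * ?f m)"] np by auto
  \<comment> \<open>The difference of the two weight vectors is supported on \<open>i, j, k\<close>
    and is an affine dependence of these three points. A vertex off their plane shows that they are
    not collinear, so the dependence is trivial. Common faces may thus lie in the separating
    plane.\<close>
  define c where "c m = t $ m - t' $ m" for m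
  have c0: "c m = 0" if "m \<notin> {i, j, k}" for m using 1[of m] 2[of m] off[OF that] by (simp add: c_def)
  have sub: "(\<Sum>m\<in>UNIV. g m) = g i + g j + g k" if "\<And>m. m \<notin> {i, j, k} \<Longrightarrow> g m = 0"
    for g :: "8 \<Rightarrow> 'b::comm_monoid_add"
  proof -
    have "(\<Sum>m\<in>UNIV. g m) = (\<Sum>m\<in>{i, j, k}. g m)" by (rule sum.mono_neutral_right) (use that in auto)
    then show ?thesis using ne by (simp add: add.assoc)
  qed
  have "(\<Sum>m\<in>UNIV. c m) = 0" using t1(2) t2(2) by (simp add: c_def sum_subtractf)
  then have ci: "c i = - c j - c k" using sub[of c] c0 by auto
  have "(\<Sum>m\<in>UNIV. c m *\<^sub>R p $ m) = 0"
    using eq by (simp add: c_def pl_map_def scaleR_diff_left sum_subtractf)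
  moreover have "(\<Sum>m\<in>UNIV. c m *\<^sub>R p $ m) = c i *\<^sub>R p $ i + c j *\<^sub>R p $ j + c k *\<^sub>R p $ k"
    by (rule sub) (use c0 in auto)
  ultimately have lin: "c j *\<^sub>R (p$j - p$i) + c k *\<^sub>R (p$k - p$i) = 0"
    unfolding ci by (simp add: algebra_simps)
  have "card {i, j, k} < card (UNIV :: 8 set)" using card_insert_le_m1[of 3 "{j,k}" i] by (simp add: card_insert_if)
  then obtain m where "m \<notin> {i, j, k}" by (metis less_irrefl UNIV_eq_I)
  then have n0: "cross3 (p$j - p$i) (p$k - p$i) \<noteq> 0" using off[of m] by (auto simp: vol_def)
  have "cross3 (c j *\<^sub>R (p$j - p$i) + c k *\<^sub>R (p$k - p$i)) (p$k - p$i) = c j *\<^sub>R cross3 (p$j - p$i) (p$k - p$i)"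
    "cross3 (p$j - p$i) (c j *\<^sub>R (p$j - p$i) + c k *\<^sub>R (p$k - p$i)) = c k *\<^sub>R cross3 (p$j - p$i) (p$k - p$i)"
    by (simp_all add: cross_add_left cross_add_right cross_mult_left cross_mult_right)
  then have "c j = 0" "c k = 0" unfolding lin using n0 by (auto simp: cross_zero_left)
  then have "c m = 0" for m using c0[of m] ci by (cases "m \<in> {i,j,k}") auto
  then show ?thesis by (simp add: c_def vec_eq_iff)
qed

end

text \<open>The negatively oriented quadruples \<open>i < j < k < l\<close> of a pup tent close to the collapsed ones;
  all other quadruples are positively oriented.\<close>

definition negative_quadruples :: "(nat \<times> nat \<times> nat \<times> nat) list" where
  "negative_quadruples = [(0, 1, 2, 7), (0, 1, 3, 7), (0, 1, 4, 5), (0, 1, 4, 6), (0, 1, 5, 6), (0, 2, 3, 7), (0, 2, 4, 5), (0, 2, 4, 6), (0, 2, 5, 6), (0, 3, 4, 5), (0, 3, 4, 6), (0, 3, 5, 6), (0, 4, 5, 6), (0, 4, 5, 7), (0, 4, 6, 7), (0, 5, 6, 7), (1, 2, 3, 7), (1, 2, 4, 5), (1, 2, 4, 6), (1, 2, 4, 7), (1, 2, 5, 6), (1, 2, 5, 7), (1, 2, 6, 7), (1, 3, 4, 6), (1, 3, 4, 7), (1, 3, 5, 6), (1, 3, 5, 7), (1, 3, 6, 7), (2, 3, 4, 7), (2, 3, 5, 6), (2, 3, 5, 7), (2, 3, 6, 7)]"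

definition orientation :: "nat \<Rightarrow> nat \<Rightarrow> nat \<Rightarrow> nat \<Rightarrow> int" where
  "orientation i j k l = (if (i, j, k, l) \<in> set negative_quadruples then - 1 else 1)"

definition pup_chirotope :: "(nat \<Rightarrow> real^3) \<Rightarrow> bool" where
  "pup_chirotope P \<longleftrightarrow> (\<forall>i j k l. i < j \<longrightarrow> j < k \<longrightarrow> k < l \<longrightarrow> l < 8 \<longrightarrow>
     sgn (vol (P i) (P j) (P k) (P l)) = of_int (orientation i j k l))"

text \<open>The side of the plane through \<open>i < j < k\<close> on which vertex \<open>m\<close>
  lies. The signs are the parities of moving \<open>m\<close> to its sorted place; the vertices
  spanning the plane get 0.\<close>

definition side :: "nat \<times> nat \<times> nat \<Rightarrow> nat \<Rightarrow> int" where
  "side = (\<lambda>(i, j, k) m. if m = i \<or> m = j \<or> m = k then 0 else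
     if k < m then orientation i j k m else if j < m then - orientation i j m k else
     if i < m then orientation i m j k else - orientation m i j k)"

lemma side_eq:
  assumes "pup_chirotope P" "i < j" "j < k" "k < 8" "m < 8"
  shows "sgn (vol (P i) (P j) (P k) (P m)) = of_int (side (i, j, k) m)"
proof -
  consider "m = i \<or> m = j \<or> m = k" | "k < m" | "j < m" "m < k" | "i < m" "m < j" | "m < i"
    using assms by linarith
  then show ?thesis
  proof cases
    case 1 then show ?thesis by (auto simp: side_def vol_degenerate)
  next
    case 2 then show ?thesis using assms by (simp add: side_def pup_chirotope_def)
  next
    case 3
    then have "sgn (vol (P i) (P j) (P m) (P k)) = of_int (orientation i j m k)"
      using assms by (simp add: pup_chirotope_def)
    then show ?thesis using 3 assms by (simp add: side_def vol_swap(1)[of "P i" "P j" "P k"] sgn_minus)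
  next
    case 4
    then have "sgn (vol (P i) (P m) (P j) (P k)) = of_int (orientation i m j k)"
      using assms by (simp add: pup_chirotope_def)
    moreover have "vol (P i) (P j) (P k) (P m) = vol (P i) (P m) (P j) (P k)"
      by (metis vol_swap(1,2) minus_minus)
    ultimately show ?thesis using 4 assms by (simp add: side_def)
  next
    case 5
    then have "sgn (vol (P m) (P i) (P j) (P k)) = of_int (orientation m i j k)"
      using assms by (simp add: pup_chirotope_def)
    moreover have "vol (P i) (P j) (P k) (P m) = - vol (P m) (P i) (P j) (P k)"
      by (metis vol_swap minus_minus)
    ultimately show ?thesis using 5 assms by (simp add: side_def sgn_minus)
  qed
qed

definition triangle_list :: "(nat \<times> nat \<times> nat) list" where
  "triangle_list = [(0, 2, 7), (1, 2, 7), (1, 6, 7), (0, 1, 6), (0, 5, 6), (0, 5, 7), (4, 5, 7), (4, 6, 7), (3, 4, 6), (3, 5, 6), (2, 3, 5), (2, 4, 5), (1, 2, 4), (1, 3, 4), (0, 1, 3), (0, 2, 3)]"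

text \<open>A certificate aligned with \<open>triangle_list\<close>: row \<open>n\<close> holds one
  plane, spanned by three vertices, for each triangle after the \<open>n\<close>-th, in the same
  order.\<close>

definition plane_list :: "(nat \<times> nat \<times> nat) list list" where
  "plane_list = [
    [(0, 2, 7), (0, 1, 7), (0, 1, 2), (0, 1, 2), (0, 1, 7), (0, 1, 7), (0, 1, 7), (0, 1, 2), (0, 1, 2), (0, 1, 2), (0, 1, 2), (0, 1, 2), (0, 1, 2), (0, 1, 2), (0, 1, 2)],
    [(0, 1, 7), (0, 1, 2), (0, 1, 2), (0, 1, 7), (0, 1, 7), (0, 1, 7), (0, 1, 2), (0, 1, 2), (0, 1, 2), (0, 1, 2), (0, 1, 2), (0, 1, 2), (0, 1, 2), (0, 1, 2)],
    [(0, 1, 6), (0, 4, 6), (0, 5, 7), (0, 5, 7), (0, 6, 7), (1, 3, 6), (1, 3, 6), (1, 3, 4), (1, 2, 5), (1, 2, 4), (1, 3, 4), (0, 1, 6), (0, 1, 6)],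
    [(0, 1, 6), (0, 1, 5), (0, 1, 5), (0, 1, 6), (1, 3, 6), (1, 3, 6), (1, 3, 4), (1, 2, 5), (1, 2, 4), (1, 3, 4), (0, 1, 3), (0, 1, 3)],
    [(0, 1, 5), (0, 1, 5), (0, 4, 6), (0, 4, 6), (0, 5, 6), (0, 3, 5), (0, 2, 5), (0, 2, 4), (0, 3, 4), (0, 1, 3), (0, 1, 3)],
    [(0, 5, 7), (4, 5, 7), (4, 5, 6), (0, 1, 5), (0, 1, 5), (1, 2, 5), (1, 2, 4), (3, 4, 5), (0, 1, 5), (0, 1, 5)],
    [(4, 5, 7), (4, 5, 6), (0, 1, 5), (0, 1, 5), (1, 4, 5), (1, 2, 4), (3, 4, 5), (0, 1, 5), (0, 1, 5)],
    [(1, 4, 6), (1, 4, 6), (1, 3, 4), (1, 3, 4), (1, 2, 4), (1, 3, 4), (0, 1, 6), (0, 1, 6)],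
    [(2, 3, 6), (1, 3, 4), (1, 3, 4), (0, 2, 4), (0, 3, 4), (0, 1, 3), (0, 1, 3)],
    [(0, 3, 5), (0, 2, 5), (0, 2, 4), (0, 3, 4), (0, 1, 3), (0, 1, 3)],
    [(0, 2, 5), (0, 2, 4), (1, 3, 4), (1, 2, 3), (0, 2, 3)],
    [(0, 2, 4), (1, 3, 4), (1, 2, 3), (0, 2, 3)],
    [(1, 2, 4), (1, 2, 3), (0, 2, 3)],
    [(0, 1, 3), (0, 1, 3)],
    [(0, 1, 3)],
    []]"

fun separates :: "nat \<times> nat \<times> nat \<Rightarrow> nat \<times> nat \<times> nat \<Rightarrow> nat \<times> nat \<times> nat \<Rightarrow> bool" where
  "separates (i, j, k) (a, b, c) (d, e, f) \<longleftrightarrow> i < j \<and> j < k \<and> k < 8 \<and>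
     side (i, j, k) a \<ge> 0 \<and> side (i, j, k) b \<ge> 0 \<and> side (i, j, k) c \<ge> 0 \<and>
     side (i, j, k) d \<le> 0 \<and> side (i, j, k) e \<le> 0 \<and> side (i, j, k) f \<le> 0"

fun all_separated :: "(nat \<times> nat \<times> nat) list \<Rightarrow> (nat \<times> nat \<times> nat) list list \<Rightarrow> bool" where
  "all_separated (T # Ts) (zs # zss) \<longleftrightarrow>
     list_all2 (\<lambda>T' z. separates z T T' \<or> separates z T' T) Ts zs \<and> all_separated Ts zss"
| "all_separated [] zss \<longleftrightarrow> True"
| "all_separated Ts [] \<longleftrightarrow> False"

lemma all_separatedD:
  assumes "all_separated Ts zss" "T \<in> set Ts" "T' \<in> set Ts" "T \<noteq> T'"
  shows "\<exists>z. separates z T T' \<or> separates z T' T"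
  using assms
proof (induction Ts zss rule: all_separated.induct)
  case (1 U Ts zs zss)
  have *: "\<exists>z. separates z U V \<or> separates z V U" if V: "V \<in> set Ts" for V
  proof -
    obtain n where "n < length Ts" "V = Ts ! n" using V by (metis in_set_conv_nth)
    then have "separates (zs ! n) U V \<or> separates (zs ! n) V U"
      using 1(2) by (simp add: list_all2_conv_all_nth)
    then show ?thesis by blast
  qed
  show ?case using 1 *[of T] *[of T'] by auto
qed auto

text \<open>A finite check of all 120 pairs of triangles. It depends on the chirotope alone, hence
  serves every tent of the family at once.\<close>

lemma triangles_separated: "all_separated triangle_list plane_list"
  by code_simp

definition vertex_set :: "nat \<times> nat \<times> nat \<Rightarrow> 8 set" where
  "vertex_set = (\<lambda>(i, j, k). {of_nat i, of_nat j, of_nat k})"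

lemma numeral_8_wrap: "(8::8) = 0" "(9::8) = 1" "(10::8) = 2"
  by simp_all

lemma uniform_triangulation_list: "uniform_triangulation = vertex_set ` set triangle_list"
proof -
  have "{5, 6, 0} = {0, 5, 6 :: 8}" "{5, 7, 0} = {0, 5, 7 :: 8}" "{6, 7, 1} = {1, 6, 7 :: 8}"
    "{6, 0, 1} = {0, 1, 6 :: 8}" "{7, 0, 2} = {0, 2, 7 :: 8}" "{7, 1, 2} = {1, 2, 7 :: 8}"
    by blast+
  then show ?thesis
    unfolding uniform_triangulation_def UNIV_8 triangle_list_def vertex_set_def
    by (simp add: numeral_8_wrap)
qed

lemma ex_of_nat_8: "\<exists>n<8. m = (of_nat n :: 8)"
proof -
  have "\<forall>m::8. \<exists>n<8. m = of_nat n"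
    unfolding all_8 by (intro conjI, rule exI[of _ 0], simp, rule exI[of _ 1], simp, rule exI[of _ 2], simp, rule exI[of _ 3], simp, rule exI[of _ 4], simp, rule exI[of _ 5], simp, rule exI[of _ 6], simp, rule exI[of _ 7], simp)
  then show ?thesis by blast
qed

lemma triangle_list_sorted: "(i, j, k) \<in> set triangle_list \<Longrightarrow> i < j \<and> j < k \<and> k < 8"
  unfolding triangle_list_def by auto

definition hull_list :: "(nat \<times> nat \<times> nat) list" where
  "hull_list = [(1, 2, 7), (1, 2, 4), (2, 4, 5), (2, 3, 5), (3, 5, 6), (0, 5, 6)]"

lemma hull_list_sides:
  "list_all (\<lambda>z. list_all (\<lambda>m. side z m \<ge> 0) [0..<8] \<or> list_all (\<lambda>m. side z m \<le> 0) [0..<8]) hull_list"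
  by code_simp

text \<open>A triangle with vertices strictly on both sides of its plane cannot lie in the boundary
  of the hull; this holds for the ten remaining triangles.\<close>

lemma non_hull_sides:
  "list_all (\<lambda>z. z \<in> set hull_list \<or>
     (list_ex (\<lambda>m. side z m > 0) [0..<8] \<and> list_ex (\<lambda>m. side z m < 0) [0..<8])) triangle_list"
  by code_simp

lemma hull_subset: "set hull_list \<subseteq> set triangle_list"
  unfolding hull_list_def triangle_list_def by auto

text \<open>The case distinction admits hulls without interior, so that full dimension need not be
  established before the lemma is applied.\<close>

lemma supporting_plane_of_point:
  fixes H :: "(real^3) set"
  assumes "convex H" "x \<in> H" "x \<notin> interior H"
  obtains a where "a \<noteq> 0" "\<And>y. y \<in> H \<Longrightarrow> a \<bullet> x \<le> a \<bullet> y"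
proof (cases "interior H = {}")
  case True
  then obtain a b where "a \<noteq> 0" "H \<subseteq> {x. a \<bullet> x = b}"
    using empty_interior_subset_hyperplane[OF \<open>convex H\<close>] by metis
  then show ?thesis using that[of a] \<open>x \<in> H\<close> by (auto simp: subset_iff)
next
  case False
  then have "x \<notin> rel_interior H" using assms(3) interior_rel_interior_gen rel_interior_nonempty_interior by metis
  then show ?thesis using that supporting_hyperplane_rel_boundary[OF assms(1,2)] by metis
qed

lemma of_nat_neq: "i < j \<Longrightarrow> j < 8 \<Longrightarrow> of_nat i \<noteq> (of_nat j :: 8)"
proof -
  have "inj_on (of_nat :: nat \<Rightarrow> 8) {..<8}"
  proof (rule eq_card_imp_inj_on)
    have "(of_nat :: nat \<Rightarrow> 8) ` {..<8} = UNIV" using ex_of_nat_8 by auto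
    then show "card ((of_nat :: nat \<Rightarrow> 8) ` {..<8}) = card {..<8::nat}" by simp
  qed simp
  then show "i < j \<Longrightarrow> j < 8 \<Longrightarrow> of_nat i \<noteq> (of_nat j :: 8)" by (auto simp: inj_on_def)
qed

text \<open>Embeddedness, general position and the hull triangles are consequences of the
  orientations of quadruples. The metric of the tent does not enter here.\<close>

locale pup_configuration =
  fixes p :: "real^3^8"
  assumes chi: "pup_chirotope (\<lambda>n. p $ of_nat n)"
begin

abbreviation P :: "nat \<Rightarrow> real^3" where "P n \<equiv> p $ of_nat n"

lemma sgn_vol: "i < j \<Longrightarrow> j < k \<Longrightarrow> k < 8 \<Longrightarrow> m < 8 \<Longrightarrow> sgn (vol (P i) (P j) (P k) (P m)) = of_int (side (i, j, k) m)"
  using side_eq[OF chi] by simp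

lemma vol_off:
  assumes "i < j" "j < k" "k < 8" "m \<notin> {of_nat i, of_nat j, of_nat k}"
  shows "vol (P i) (P j) (P k) (p $ m) \<noteq> 0"
proof -
  obtain n where n: "n < 8" "m = of_nat n" using ex_of_nat_8 by blast
  then have "side (i, j, k) n \<noteq> 0" using assms(4) by (auto simp: side_def orientation_def)
  then show ?thesis using sgn_vol[OF assms(1-3) n(1)] n(2) by (metis of_int_eq_0_iff sgn_0)
qed

lemma separated:
  assumes "separates z T T'" "t \<in> closed_simplex (vertex_set T)" "t' \<in> closed_simplex (vertex_set T')"
    "set [fst T, fst (snd T), snd (snd T), fst T', fst (snd T'), snd (snd T')] \<subseteq> {..<8}"
    "pl_map p t = pl_map p t'"
  shows "t = t'"
proof -
  obtain i j k a b c d e f where z: "z = (i, j, k)" "T = (a, b, c)" "T' = (d, e, f)"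
    by (metis prod_cases3)
  have s: "i < j" "j < k" "k < 8" using assms(1) z by auto
  have nn: "vol (P i) (P j) (P k) (P m) \<ge> 0" if "side (i, j, k) m \<ge> 0" "m < 8" for m
    using sgn_vol[OF s that(2)] that(1) by (metis of_int_0_le_iff sgn_zero_iff zero_le_sgn_iff)
  have np: "vol (P i) (P j) (P k) (P m) \<le> 0" if "side (i, j, k) m \<le> 0" "m < 8" for m
    using sgn_vol[OF s that(2)] that(1) by (metis of_int_le_0_iff sgn_le_0_iff)
  show ?thesis
  proof (rule separated_simplices[where p = p and i = "of_nat i" and j = "of_nat j" and k = "of_nat k"])
    show "vol (P i) (P j) (P k) (p $ m) \<ge> 0" if "m \<in> vertex_set T" for m
      using that assms(1,4) nn by (auto simp: z vertex_set_def)
    show "vol (P i) (P j) (P k) (p $ m) \<le> 0" if "m \<in> vertex_set T'" for m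
      using that assms(1,4) np by (auto simp: z vertex_set_def)
    show "vol (P i) (P j) (P k) (p $ m) \<noteq> 0" if "m \<notin> {of_nat i, of_nat j, of_nat k}" for m
      using vol_off[OF s that] .
    show "of_nat i \<noteq> (of_nat j :: 8)" "of_nat j \<noteq> (of_nat k :: 8)" "of_nat i \<noteq> (of_nat k :: 8)"
      using s of_nat_neq by auto
  qed (use assms in auto)
qed

lemma inj_on_realization: "inj_on (pl_map p) realization"
proof (rule inj_onI)
  fix t t' assume "t \<in> realization" "t' \<in> realization" and eq: "pl_map p t = pl_map p t'"
  then obtain T T' where T: "T \<in> set triangle_list" "t \<in> closed_simplex (vertex_set T)"
    and T': "T' \<in> set triangle_list" "t' \<in> closed_simplex (vertex_set T')"
    by (auto simp: realization_def uniform_triangulation_list)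
  have b: "set [fst T, fst (snd T), snd (snd T), fst T', fst (snd T'), snd (snd T')] \<subseteq> {..<8}"
    "set [fst T', fst (snd T'), snd (snd T'), fst T, fst (snd T), snd (snd T)] \<subseteq> {..<8}"
    using triangle_list_sorted[of "fst T" "fst (snd T)" "snd (snd T)"]
      triangle_list_sorted[of "fst T'" "fst (snd T')" "snd (snd T')"] T(1) T'(1) by auto
  show "t = t'"
  proof (cases "T = T'")
    case False
    then obtain z where "separates z T T' \<or> separates z T' T"
      using all_separatedD[OF triangles_separated T(1) T'(1)] by blast
    then show ?thesis using separated[OF _ T(2) T'(2) b(1) eq] separated[OF _ T'(2) T(2) b(2) eq[symmetric]] by blast
  next
    case True
    obtain i j k where z: "T = (i, j, k)" by (metis prod_cases3)
    \<comment> \<open>Within one triangle its own plane separates it weakly from itself, all six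
      sides being 0.\<close>
    then have "separates T T T'" using triangle_list_sorted T(1) True by (auto simp: side_def)
    then show ?thesis using separated[OF _ T(2) T'(2) b(1) eq] by blast
  qed
qed

text \<open>The four vertices are sorted because the chirotope speaks of increasing indices; its
  values are never 0.\<close>

lemma general_position: "general_position p"
  unfolding general_position_def
proof (intro allI impI)
  fix S :: "8 set" assume "card S = 4"
  let ?N = "{n. n < 8 \<and> of_nat n \<in> S}"
  have inj: "inj_on (of_nat :: nat \<Rightarrow> 8) ?N" using of_nat_neq by (auto simp: inj_on_def) (metis linorder_neqE_nat)
  have "S = of_nat ` ?N" by (auto simp: image_iff) (metis ex_of_nat_8)
  then have "card ?N = 4" "finite ?N" using card_image[OF inj] \<open>card S = 4\<close> by auto
  define xs where "xs = sorted_list_of_set ?N"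
  have xs: "sorted_wrt (<) xs" "set xs = ?N" "length xs = 4"
    using \<open>card ?N = 4\<close> \<open>finite ?N\<close> by (simp_all add: xs_def strict_sorted_list_of_set)
  obtain i j k l where "xs = [i, j, k, l]"
    using xs(3) by (auto simp: length_Suc_conv numeral_eq_Suc)
  then have ord: "i < j" "j < k" "k < l" and N: "?N = {i, j, k, l}" using xs by auto
  have "l < 8" using N by auto
  have "sgn (vol (P i) (P j) (P k) (P l)) \<noteq> 0"
    using chi ord \<open>l < 8\<close> by (auto simp: pup_chirotope_def orientation_def)
  then have "\<not> coplanar {P i, P j, P k, P l}" using vol_coplanar by (metis sgn_0)
  moreover have "(\<lambda>i. p $ i) ` S = {P i, P j, P k, P l}"
    by (subst \<open>S = of_nat ` ?N\<close>) (simp add: N)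
  ultimately show "\<not> coplanar ((\<lambda>i. p $ i) ` S)" by simp
qed

lemma vertex_in_torus: "T \<in> set triangle_list \<Longrightarrow> m \<in> vertex_set T \<Longrightarrow> p $ m \<in> torus p"
proof -
  assume T: "T \<in> set triangle_list" "m \<in> vertex_set T"
  have "axis m 1 \<in> closed_simplex (vertex_set T)"
    using T(2) by (auto simp: closed_simplex_def axis_def)
  moreover have "pl_map p (axis m 1) = p $ m"
    by (simp add: pl_map_def axis_def if_distrib[where f = "\<lambda>x. x *\<^sub>R _"] cong: if_cong)
  ultimately show ?thesis
    unfolding torus_def realization_def uniform_triangulation_list using T(1) by (metis UN_I imageI)
qed

lemma all_vertices_in_torus: "p $ m \<in> torus p"
proof -
  have "\<exists>T\<in>set triangle_list. m \<in> vertex_set T"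
  proof -
    have "\<forall>m. \<exists>T\<in>set triangle_list. m \<in> vertex_set T"
      unfolding all_8 triangle_list_def vertex_set_def by simp
    then show ?thesis by blast
  qed
  then show ?thesis using vertex_in_torus by blast
qed

lemma torus_halfspace:
  assumes "\<And>m. c * vol (P i) (P j) (P k) (p $ m) \<ge> 0"
  shows "convex hull (torus p) \<subseteq> {x. c * vol (P i) (P j) (P k) x \<ge> 0}"
proof (rule hull_minimal)
  show "torus p \<subseteq> {x. c * vol (P i) (P j) (P k) x \<ge> 0}"
  proof
    fix x assume "x \<in> torus p"
    then obtain t where t: "\<And>i. 0 \<le> t $ i" "(\<Sum>i\<in>UNIV. t $ i) = 1" "x = pl_map p t"
      by (auto simp: torus_def realization_def closed_simplex_def)
    have "c * vol (P i) (P j) (P k) x = (\<Sum>m\<in>UNIV. t $ m * (c * vol (P i) (P j) (P k) (p $ m)))"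
      unfolding t(3) pl_map_def vol_convex_combination[OF t(2)] by (simp add: sum_distrib_left algebra_simps)
    also have "\<dots> \<ge> 0" using t(1) assms by (intro sum_nonneg) simp
    finally show "x \<in> {x. c * vol (P i) (P j) (P k) x \<ge> 0}" by simp
  qed
  have "{x. c * vol (P i) (P j) (P k) x \<ge> 0} =
      {x. (c *\<^sub>R cross3 (P j - P i) (P k - P i)) \<bullet> x \<ge> (c *\<^sub>R cross3 (P j - P i) (P k - P i)) \<bullet> P i}"
    by (auto simp: vol_def inner_diff_right algebra_simps)
  then show "convex {x. c * vol (P i) (P j) (P k) x \<ge> 0}" by (simp only: convex_halfspace_ge)
qed

lemma normal_nonzero:
  assumes "i < j" "j < k" "k < 8"
  shows "cross3 (P j - P i) (P k - P i) \<noteq> 0"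
proof -
  have "card {of_nat i, of_nat j, of_nat k :: 8} \<le> 3" by (simp add: card_insert_if)
  moreover have "card (UNIV :: 8 set) = 8" by simp
  ultimately have "{of_nat i, of_nat j, of_nat k} \<noteq> (UNIV :: 8 set)" by (metis numeral_le_iff semiring_norm(69,72,73))
  then obtain m where m: "m \<notin> {of_nat i, of_nat j, of_nat k :: 8}" by blast
  show ?thesis using vol_off[OF assms m] by (auto simp: vol_def)
qed

text \<open>All vertices lie weakly on one side of the plane of the triangle. So the hull lies in a
  closed half space whose boundary contains the triangle.\<close>

lemma hull_triangle:
  assumes "T \<in> set hull_list"
  shows "pl_map p ` closed_simplex (vertex_set T) \<subseteq> frontier (convex hull (torus p))"
proof -
  obtain i j k where z: "T = (i, j, k)" by (metis prod_cases3)
  have T: "T \<in> set triangle_list" using assms hull_subset by blast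
  then have s: "i < j" "j < k" "k < 8" using triangle_list_sorted z by auto
  have "(\<forall>m<8. side T m \<ge> 0) \<or> (\<forall>m<8. side T m \<le> 0)"
    using hull_list_sides assms by (auto simp: list_all_iff)
  then have "\<exists>c\<in>{1,-1}. \<forall>m<8. c * vol (P i) (P j) (P k) (P m) \<ge> 0"
  proof
    assume "\<forall>m<8. side T m \<ge> 0"
    then have "\<forall>m<8. sgn (vol (P i) (P j) (P k) (P m)) \<ge> 0" using sgn_vol[OF s] z by simp
    then show ?thesis by (intro bexI[of _ 1]) auto
  next
    assume "\<forall>m<8. side T m \<le> 0"
    then have "\<forall>m<8. sgn (vol (P i) (P j) (P k) (P m)) \<le> 0" using sgn_vol[OF s] z by simp
    then show ?thesis by (intro bexI[of _ "-1"]) auto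
  qed
  then obtain c where "c \<in> {1, - 1}" and c8: "\<forall>m<8. c * vol (P i) (P j) (P k) (P m) \<ge> 0" by blast
  then have c: "c \<noteq> 0" by auto
  have H: "convex hull (torus p) \<subseteq> {x. c * vol (P i) (P j) (P k) x \<ge> 0}"
  proof (rule torus_halfspace)
    fix m :: 8
    obtain n where "n < 8" "m = of_nat n" using ex_of_nat_8 by blast
    then show "c * vol (P i) (P j) (P k) (p $ m) \<ge> 0" using c8 by simp
  qed
  let ?n = "c *\<^sub>R cross3 (P j - P i) (P k - P i)"
  have hs: "{x. c * vol (P i) (P j) (P k) x \<ge> 0} = {x. ?n \<bullet> x \<ge> ?n \<bullet> P i}"
    by (auto simp: vol_def inner_diff_right algebra_simps)
  have n0: "?n \<noteq> 0" using c normal_nonzero[OF s] by simp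
  show ?thesis
  proof
    fix x assume "x \<in> pl_map p ` closed_simplex (vertex_set T)"
    then obtain t where t: "t \<in> closed_simplex (vertex_set T)" "x = pl_map p t" by blast
    have xt: "x \<in> torus p"
      unfolding torus_def realization_def uniform_triangulation_list using T t by blast
    have "vol (P i) (P j) (P k) x = (\<Sum>m\<in>UNIV. t $ m * vol (P i) (P j) (P k) (p $ m))"
      unfolding t(2) pl_map_def using t(1) by (intro vol_convex_combination) (simp add: closed_simplex_def)
    also have "\<dots> = 0"
    proof (intro sum.neutral ballI)
      fix m show "t $ m * vol (P i) (P j) (P k) (p $ m) = 0"
      proof (cases "m \<in> {of_nat i, of_nat j, of_nat k}")
        case True then show ?thesis by (auto simp: vol_degenerate)
      next
        case False then show ?thesis using t(1) by (simp add: closed_simplex_def z vertex_set_def)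
      qed
    qed
    finally have x0: "?n \<bullet> x = ?n \<bullet> P i" by (simp add: vol_def inner_diff_right)
    have "x \<notin> interior (convex hull (torus p))"
    proof
      assume "x \<in> interior (convex hull (torus p))"
      then have "x \<in> interior {x. ?n \<bullet> x \<ge> ?n \<bullet> P i}" using interior_mono[OF H] hs by auto
      then have "x \<in> {x. ?n \<bullet> x > ?n \<bullet> P i}" by (simp only: interior_halfspace_ge[OF n0])
      then show False using x0 by auto
    qed
    then show "x \<in> frontier (convex hull (torus p))"
      using xt by (auto simp: frontier_def hull_inc intro: subsetD[OF closure_subset])
  qed
qed

text \<open>A supporting plane at the barycentre must contain the three corners, hence is the plane
  of the triangle. But vertices lie strictly on both sides of that plane.\<close>

lemma non_hull_triangle:
  assumes "T \<in> set triangle_list" "T \<notin> set hull_list"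
  shows "\<not> pl_map p ` closed_simplex (vertex_set T) \<subseteq> frontier (convex hull (torus p))"
proof
  assume sub: "pl_map p ` closed_simplex (vertex_set T) \<subseteq> frontier (convex hull (torus p))"
  obtain i j k where z: "T = (i, j, k)" by (metis prod_cases3)
  have s: "i < j" "j < k" "k < 8" using triangle_list_sorted assms(1) z by auto
  obtain m m' where m: "m < 8" "side T m > 0" "m' < 8" "side T m' < 0"
    using non_hull_sides assms by (fastforce simp: list_all_iff list_ex_iff)
  have vm: "vol (P i) (P j) (P k) (P m) > 0" "vol (P i) (P j) (P k) (P m') < 0"
    using sgn_vol[OF s m(1)] sgn_vol[OF s m(3)] m(2,4) unfolding z
    by (metis of_int_0_less_iff sgn_greater) (metis of_int_less_0_iff sgn_less sgn_vol[OF s m(3)] m(4) z)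
  have ne: "of_nat i \<noteq> (of_nat j :: 8)" "of_nat j \<noteq> (of_nat k :: 8)" "of_nat i \<noteq> (of_nat k :: 8)"
    using s of_nat_neq by auto
  define t :: "real^8" where "t = (\<chi> l. if l \<in> {of_nat i, of_nat j, of_nat k} then 1/3 else 0)"
  have sum3: "(\<Sum>l\<in>UNIV. t $ l *\<^sub>R g l) = (1/3) *\<^sub>R (g (of_nat i) + g (of_nat j) + g (of_nat k))"
    for g :: "8 \<Rightarrow> 'b::real_vector"
  proof -
    have "(\<Sum>l\<in>UNIV. t $ l *\<^sub>R g l) = (\<Sum>l\<in>{of_nat i, of_nat j, of_nat k}. t $ l *\<^sub>R g l)"
      by (rule sum.mono_neutral_right) (auto simp: t_def)
    then show ?thesis using ne by (simp add: t_def scaleR_add_right)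
  qed
  have "t \<in> closed_simplex (vertex_set T)"
    using sum3[of "\<lambda>_. 1::real"] by (auto simp: closed_simplex_def z vertex_set_def t_def)
  moreover define x where "x = pl_map p t"
  ultimately have x: "x \<in> frontier (convex hull (torus p))" "x \<in> torus p"
    using sub assms(1) by (auto simp: torus_def realization_def uniform_triangulation_list)
  obtain a where a: "a \<noteq> 0" "\<And>y. y \<in> convex hull (torus p) \<Longrightarrow> a \<bullet> x \<le> a \<bullet> y"
    using supporting_plane_of_point[of "convex hull (torus p)" x] x by (auto simp: frontier_def hull_inc convex_convex_hull)
  have ap: "a \<bullet> x \<le> a \<bullet> p $ l" for l using a(2) all_vertices_in_torus hull_inc by metis
  \<comment> \<open>The minimum of the functional over the hull is the average of its three corner
    values, so each corner attains it.\<close>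
  have "a \<bullet> x = (a \<bullet> P i + a \<bullet> P j + a \<bullet> P k) / 3"
    by (simp add: x_def pl_map_def sum3 inner_add_right)
  then have "3 * (a \<bullet> x) = a \<bullet> P i + a \<bullet> P j + a \<bullet> P k" by simp
  moreover note ap[of "of_nat i"] ap[of "of_nat j"] ap[of "of_nat k"]
  ultimately have eqs: "a \<bullet> P i = a \<bullet> x" "a \<bullet> P j = a \<bullet> x" "a \<bullet> P k = a \<bullet> x"
    by (smt (verit))+
  let ?u = "P j - P i" and ?v = "P k - P i"
  let ?n = "cross3 ?u ?v"
  have "a \<bullet> ?u = 0" "a \<bullet> ?v = 0" using eqs by (simp_all add: inner_diff_right)
  \<comment> \<open>\<open>a\<close> is orthogonal to both edge vectors, hence parallel to their
    cross product \<open>?n\<close>; the triple product expansion extracts the factor.\<close>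
  then have "cross3 a ?n = 0" by (simp add: Lagrange)
  moreover have "cross3 ?n (cross3 a ?n) = (?n \<bullet> ?n) *\<^sub>R a - (?n \<bullet> a) *\<^sub>R ?n" by (rule Lagrange)
  ultimately have par: "(?n \<bullet> ?n) *\<^sub>R a = (a \<bullet> ?n) *\<^sub>R ?n"
    by (simp add: inner_commute)
  have n: "?n \<bullet> ?n > 0" using normal_nonzero[OF s] by simp
  have key: "(?n \<bullet> ?n) * (a \<bullet> (P l - P i)) = (a \<bullet> ?n) * vol (P i) (P j) (P k) (P l)" for l
    using arg_cong[OF par, of "\<lambda>w. w \<bullet> (P l - P i)"] by (simp add: vol_def)
  have "a \<bullet> ?n \<noteq> 0" using par n a(1) by auto
  moreover have "(a \<bullet> ?n) * vol (P i) (P j) (P k) (P l) \<ge> 0" for l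
    unfolding key[symmetric] using n ap[of "of_nat l"] eqs by (simp add: inner_diff_right)
  moreover from this[of m] this[of m'] have "a \<bullet> ?n = 0"
    using vm by (simp add: zero_le_mult_iff)
  ultimately show False by blast
qed

lemma hull_triangles:
  "hull_triangles p = {{1,2,7}, {1,2,4}, {2,4,5}, {2,3,5}, {3,5,6}, {0,5,6}}"
proof -
  have "hull_triangles p = vertex_set ` set hull_list"
  proof
    show "hull_triangles p \<subseteq> vertex_set ` set hull_list"
      unfolding hull_triangles_def uniform_triangulation_list using non_hull_triangle by blast
    show "vertex_set ` set hull_list \<subseteq> hull_triangles p"
    proof (rule image_subsetI)
      fix T assume T: "T \<in> set hull_list"
      then have "vertex_set T \<in> vertex_set ` set triangle_list" using hull_subset by blast
      then show "vertex_set T \<in> hull_triangles p"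
        unfolding hull_triangles_def uniform_triangulation_list using hull_triangle[OF T] by blast
    qed
  qed
  also have "\<dots> = {{1,2,7}, {1,2,4}, {2,4,5}, {2,3,5}, {3,5,6}, {0,5,6}}"
    by (simp add: hull_list_def vertex_set_def)
  finally show ?thesis .
qed

end

section \<open>Piecewise linear maps of the plane\<close>

text \<open>The unit squares of the plane are cut along their diagonals of slope 1;
  \<open>plane_interp V\<close> is linear on each of the triangles and equals \<open>V i j\<close> at \<open>(i, j)\<close>.\<close>

definition cell_interp :: "(int \<Rightarrow> int \<Rightarrow> 'a::real_vector) \<Rightarrow> int \<Rightarrow> int \<Rightarrow> real \<Rightarrow> real \<Rightarrow> 'a" where
  "cell_interp V i j x y = (let \<xi> = x - i; \<eta> = y - j in
     (1 - max \<xi> \<eta>) *\<^sub>R V i j + max 0 (\<eta> - \<xi>) *\<^sub>R V i (j + 1) + max 0 (\<xi> - \<eta>) *\<^sub>R V (i + 1) j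
       + min \<xi> \<eta> *\<^sub>R V (i + 1) (j + 1))"

definition plane_interp :: "(int \<Rightarrow> int \<Rightarrow> 'a::real_vector) \<Rightarrow> real \<Rightarrow> real \<Rightarrow> 'a" where
  "plane_interp V x y = cell_interp V \<lfloor>x\<rfloor> \<lfloor>y\<rfloor> x y"

lemma cell_interp_upper:
  "x - of_int i \<le> y - of_int j \<Longrightarrow> cell_interp V i j x y =
     V i j + (y - of_int j) *\<^sub>R (V i (j + 1) - V i j) + (x - of_int i) *\<^sub>R (V (i + 1) (j + 1) - V i (j + 1))"
  by (simp add: cell_interp_def Let_def max_absorb1 max_absorb2 min_absorb1 algebra_simps)

lemma cell_interp_lower:
  "y - of_int j \<le> x - of_int i \<Longrightarrow> cell_interp V i j x y =
     V i j + (x - of_int i) *\<^sub>R (V (i + 1) j - V i j) + (y - of_int j) *\<^sub>R (V (i + 1) (j + 1) - V (i + 1) j)"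
  by (simp add: cell_interp_def Let_def max_absorb1 max_absorb2 min_absorb2 algebra_simps)

text \<open>The floor assigns the right and upper sides of a cell to its neighbours. The formulas of
  adjacent cells agree on the common side because both interpolate the same two corner
  values.\<close>

lemma plane_interp_closed_cell:
  assumes "of_int i \<le> x" "x \<le> of_int i + 1" "of_int j \<le> y" "y \<le> of_int j + 1"
  shows "plane_interp V x y = cell_interp V i j x y"
proof -
  consider "\<lfloor>x\<rfloor> = i" "\<lfloor>y\<rfloor> = j" | "x = of_int (i + 1)" "\<lfloor>y\<rfloor> = j" | "\<lfloor>x\<rfloor> = i" "y = of_int (j + 1)"
    | "x = of_int (i + 1)" "y = of_int (j + 1)"
    using assms by (auto simp: floor_eq_iff) linarith
  then show ?thesis
  proof cases
    case 1 then show ?thesis by (simp add: plane_interp_def)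
  next
    case 2
    then have "of_int j \<le> y" "y < of_int j + 1" by linarith+
    then have le: "x - of_int (i + 1) \<le> y - of_int j" "y - of_int j \<le> x - of_int i" using 2(1) by simp_all
    have "\<lfloor>x\<rfloor> = i + 1" using 2(1) by simp
    then show ?thesis
      unfolding plane_interp_def 2(2) cell_interp_lower[OF le(2)] by (simp add: cell_interp_upper[OF le(1)]) (simp add: 2(1))
  next
    case 3
    then have "of_int i \<le> x" "x < of_int i + 1" by linarith+
    then have le: "y - of_int (j + 1) \<le> x - of_int i" "x - of_int i \<le> y - of_int j" using 3(2) by simp_all
    have "\<lfloor>y\<rfloor> = j + 1" using 3(2) by simp
    then show ?thesis
      unfolding plane_interp_def 3(1) cell_interp_upper[OF le(2)] by (simp add: cell_interp_lower[OF le(1)]) (simp add: 3(2))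
  next
    case 4 then show ?thesis
      by (simp add: plane_interp_def cell_interp_lower)
  qed
qed

lemma plane_interp_shift:
  assumes "\<And>i j. V (i + a) (j + b) = V i j + c"
  shows "plane_interp V (x + of_int a) (y + of_int b) = plane_interp V x y + c"
proof -
  let ?i = "\<lfloor>x\<rfloor>" and ?j = "\<lfloor>y\<rfloor>"
  have s: "V (?i + a + 1) (?j + b) = V (?i + 1) ?j + c" "V (?i + a) (?j + b + 1) = V ?i (?j + 1) + c"
    "V (?i + a + 1) (?j + b + 1) = V (?i + 1) (?j + 1) + c"
    using assms[of "?i + 1" ?j] assms[of ?i "?j + 1"] assms[of "?i + 1" "?j + 1"] by (simp_all add: add_ac)
  have fl: "\<lfloor>x + of_int a\<rfloor> = ?i + a" "\<lfloor>y + of_int b\<rfloor> = ?j + b"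
    "x + of_int a - of_int (?i + a) = x - of_int ?i" "y + of_int b - of_int (?j + b) = y - of_int ?j"
    by simp_all
  show ?thesis
  proof (cases "x - of_int ?i \<le> y - of_int ?j")
    case True
    show ?thesis
      unfolding plane_interp_def fl(1,2) cell_interp_upper[OF True] cell_interp_upper[OF True[folded fl(3,4)]] fl(3,4) s assms
      by simp
  next
    case False
    then have le: "y - of_int ?j \<le> x - of_int ?i" by simp
    show ?thesis
      unfolding plane_interp_def fl(1,2) cell_interp_lower[OF le] cell_interp_lower[OF le[folded fl(3,4)]] fl(3,4) s assms
      by simp
  qed
qed

text \<open>Continuity on each closed cell suffices, since finitely many cells cover a bounded
  box.\<close>

lemma continuous_on_plane_interp:
  fixes V :: "int \<Rightarrow> int \<Rightarrow> 'a::real_normed_vector"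
  shows "continuous_on UNIV (\<lambda>w. plane_interp V (fst w) (snd w))"
proof -
  define C where "C k = {of_int (fst k)..of_int (fst k) + 1::real} \<times> {of_int (snd k)..of_int (snd k) + 1::real}"
    for k :: "int \<times> int"
  have cell: "continuous_on (C k) (\<lambda>w. plane_interp V (fst w) (snd w))" for k
  proof -
    have "continuous_on (C k) (\<lambda>w. cell_interp V (fst k) (snd k) (fst w) (snd w))"
      unfolding cell_interp_def Let_def by (intro continuous_intros)
    then show ?thesis
      by (rule continuous_on_eq) (auto simp: C_def plane_interp_closed_cell)
  qed
  have "isCont (\<lambda>w. plane_interp V (fst w) (snd w)) w0" for w0
  proof -
    obtain N :: nat where N: "\<bar>fst w0\<bar> < N" "\<bar>snd w0\<bar> < N"
      by (metis abs_ge_zero max_less_iff_conj reals_Archimedean2)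
    define I where "I = {- int N..int N} \<times> {- int N..int N}"
    have "continuous_on (\<Union>k\<in>I. C k) (\<lambda>w. plane_interp V (fst w) (snd w))"
      by (rule continuous_on_closed_Union) (use cell in \<open>auto simp: I_def C_def intro!: closed_Times\<close>)
    moreover have "({- real N<..<real N} \<times> {- real N<..<real N}) \<subseteq> (\<Union>k\<in>I. C k)"
    proof
      fix w assume "w \<in> {- real N<..<real N} \<times> {- real N<..<real N}"
      then have w: "- real N < fst w" "fst w < real N" "- real N < snd w" "snd w < real N" by auto
      have "w \<in> C (\<lfloor>fst w\<rfloor>, \<lfloor>snd w\<rfloor>)"
        by (cases w) (auto simp: C_def intro: less_imp_le real_of_int_floor_add_one_gt)
      moreover have "(\<lfloor>fst w\<rfloor>, \<lfloor>snd w\<rfloor>) \<in> I"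
        using w by (auto simp: I_def le_floor_iff floor_le_iff)
      ultimately show "w \<in> (\<Union>k\<in>I. C k)" by blast
    qed
    ultimately have "continuous_on ({- real N<..<real N} \<times> {- real N<..<real N}) (\<lambda>w. plane_interp V (fst w) (snd w))"
      by (rule continuous_on_subset)
    moreover have "w0 \<in> {- real N<..<real N} \<times> {- real N<..<real N}"
      using N by (cases w0) auto
    ultimately show ?thesis
      using continuous_on_eq_continuous_at[OF open_Times[OF open_greaterThanLessThan open_greaterThanLessThan]] by blast
  qed
  then show ?thesis by (simp add: continuous_at_imp_continuous_on)
qed

text \<open>A maximum over \<open>{a..b}\<close> cannot sit to the left of \<open>b\<close>. Only
  growth to the right of each point is assumed, which is what a piecewise linear function offers at
  its break points.\<close>

lemma strict_mono_if_locally_increasing: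
  fixes g :: "real \<Rightarrow> real"
  assumes g: "continuous_on UNIV g" and loc: "\<And>s. \<exists>d>0. \<forall>h. 0 < h \<longrightarrow> h < d \<longrightarrow> g s < g (s + h)"
    and "a < b"
  shows "g a < g b"
proof -
  have "\<exists>m\<in>{a..b}. \<forall>x\<in>{a..b}. g x \<le> g m"
    by (rule continuous_attains_sup) (use g \<open>a < b\<close> in \<open>auto intro: continuous_on_subset\<close>)
  then obtain m where m: "m \<in> {a..b}" "\<And>x. x \<in> {a..b} \<Longrightarrow> g x \<le> g m" by blast
  have nomax: "\<exists>x\<in>{a..b}. g s < g x" if s: "s \<in> {a..b}" "s < b" for s
  proof -
    obtain d where d: "d > 0" "\<And>h. 0 < h \<Longrightarrow> h < d \<Longrightarrow> g s < g (s + h)" using loc by blast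
    have "g s < g (s + min (d / 2) (b - s))" using d(1) s by (intro d(2)) auto
    moreover have "s + min (d / 2) (b - s) \<in> {a..b}" using d(1) s by auto
    ultimately show ?thesis by blast
  qed
  have "m = b" using nomax[of m] m by (metis atLeastAtMost_iff linorder_not_less order_le_less)
  moreover obtain x where "x \<in> {a..b}" "g a < g x" using nomax[of a] \<open>a < b\<close> by auto
  ultimately show ?thesis using m(2) by fastforce
qed

context
  fixes V :: "int \<Rightarrow> int \<Rightarrow> 'a::real_inner" and n :: 'a
begin

text \<open>A short move in an edge direction stays in one triangle, where the map is affine with
  the increment along a parallel edge as its slope. Which edge it is depends on the position
  relative to the diagonal of the cell.\<close>

lemma plane_interp_increments:
  fixes x y :: real
  shows "\<exists>d>0. \<exists>a b. \<forall>h. 0 < h \<longrightarrow> h < d \<longrightarrow> plane_interp V (x + h) y = plane_interp V x y + h *\<^sub>R (V (a + 1) b - V a b)"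
    and "\<exists>d>0. \<exists>a b. \<forall>h. 0 < h \<longrightarrow> h < d \<longrightarrow> plane_interp V x (y + h) = plane_interp V x y + h *\<^sub>R (V a (b + 1) - V a b)"
    and "\<exists>d>0. \<exists>a b. \<forall>h. 0 < h \<longrightarrow> h < d \<longrightarrow>
      plane_interp V (x + h) (y + h) = plane_interp V x y + h *\<^sub>R (V (a + 1) (b + 1) - V a b)"
proof -
  let ?i = "\<lfloor>x\<rfloor>" and ?j = "\<lfloor>y\<rfloor>"
  let ?\<xi> = "x - of_int ?i" and ?\<eta> = "y - of_int ?j"
  have fl: "0 \<le> ?\<xi>" "?\<xi> < 1" "0 \<le> ?\<eta>" "?\<eta> < 1" by linarith+
  have cell: "plane_interp V x' y' = cell_interp V ?i ?j x' y'"
    if "of_int ?i \<le> x'" "x' \<le> of_int ?i + 1" "of_int ?j \<le> y'" "y' \<le> of_int ?j + 1" for x' y'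
    using that by (rule plane_interp_closed_cell)
  have base: "plane_interp V x y = cell_interp V ?i ?j x y" using fl by (intro cell) auto
  show "\<exists>d>0. \<exists>a b. \<forall>h. 0 < h \<longrightarrow> h < d \<longrightarrow> plane_interp V (x + h) y = plane_interp V x y + h *\<^sub>R (V (a + 1) b - V a b)"
  proof (cases "?\<xi> < ?\<eta>")
    case True
    have "plane_interp V (x + h) y = plane_interp V x y + h *\<^sub>R (V (?i + 1) (?j + 1) - V ?i (?j + 1))" if h: "0 < h" "h < ?\<eta> - ?\<xi>" for h
    proof -
      have c: "plane_interp V (x + h) y = cell_interp V ?i ?j (x + h) y"
        by (rule cell) (use h fl True in linarith)+
      have le: "x + h - of_int ?i \<le> y - of_int ?j" "x - of_int ?i \<le> y - of_int ?j" using h True by linarith+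
      show ?thesis unfolding base c cell_interp_upper[OF le(1)] cell_interp_upper[OF le(2)] by (simp add: algebra_simps)
    qed
    then show ?thesis using True by (intro exI[of _ "?\<eta> - ?\<xi>"] conjI exI[of _ ?i] exI[of _ "?j + 1"]) auto
  next
    case False
    have "plane_interp V (x + h) y = plane_interp V x y + h *\<^sub>R (V (?i + 1) ?j - V ?i ?j)" if h: "0 < h" "h < 1 - ?\<xi>" for h
    proof -
      have c: "plane_interp V (x + h) y = cell_interp V ?i ?j (x + h) y"
        by (rule cell) (use h fl False in linarith)+
      have le: "y - of_int ?j \<le> x + h - of_int ?i" "y - of_int ?j \<le> x - of_int ?i" using h False by linarith+
      show ?thesis unfolding base c cell_interp_lower[OF le(1)] cell_interp_lower[OF le(2)] by (simp add: algebra_simps)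
    qed
    then show ?thesis using fl by (intro exI[of _ "1 - ?\<xi>"] conjI exI[of _ ?i] exI[of _ ?j]) auto
  qed
  show "\<exists>d>0. \<exists>a b. \<forall>h. 0 < h \<longrightarrow> h < d \<longrightarrow> plane_interp V x (y + h) = plane_interp V x y + h *\<^sub>R (V a (b + 1) - V a b)"
  proof (cases "?\<eta> < ?\<xi>")
    case True
    have "plane_interp V x (y + h) = plane_interp V x y + h *\<^sub>R (V (?i + 1) (?j + 1) - V (?i + 1) ?j)" if h: "0 < h" "h < ?\<xi> - ?\<eta>" for h
    proof -
      have c: "plane_interp V x (y + h) = cell_interp V ?i ?j x (y + h)"
        by (rule cell) (use h fl True in linarith)+
      have le: "y + h - of_int ?j \<le> x - of_int ?i" "y - of_int ?j \<le> x - of_int ?i" using h True by linarith+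
      show ?thesis unfolding base c cell_interp_lower[OF le(1)] cell_interp_lower[OF le(2)] by (simp add: algebra_simps)
    qed
    then show ?thesis using True by (intro exI[of _ "?\<xi> - ?\<eta>"] conjI exI[of _ "?i + 1"] exI[of _ ?j]) auto
  next
    case False
    have "plane_interp V x (y + h) = plane_interp V x y + h *\<^sub>R (V ?i (?j + 1) - V ?i ?j)" if h: "0 < h" "h < 1 - ?\<eta>" for h
    proof -
      have c: "plane_interp V x (y + h) = cell_interp V ?i ?j x (y + h)"
        by (rule cell) (use h fl False in linarith)+
      have le: "x - of_int ?i \<le> y + h - of_int ?j" "x - of_int ?i \<le> y - of_int ?j" using h False by linarith+
      show ?thesis unfolding base c cell_interp_upper[OF le(1)] cell_interp_upper[OF le(2)] by (simp add: algebra_simps)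
    qed
    then show ?thesis using fl by (intro exI[of _ "1 - ?\<eta>"] conjI exI[of _ ?i] exI[of _ ?j]) auto
  qed
  have "plane_interp V (x + h) (y + h) = plane_interp V x y + h *\<^sub>R (V (?i + 1) (?j + 1) - V ?i ?j)"
    if h: "0 < h" "h < min (1 - ?\<eta>) (1 - ?\<xi>)" for h
  proof -
    have c: "plane_interp V (x + h) (y + h) = cell_interp V ?i ?j (x + h) (y + h)"
      by (rule cell) (use h fl in linarith)+
    show ?thesis
    proof (cases "?\<xi> \<le> ?\<eta>")
      case True
      then have le: "x + h - of_int ?i \<le> y + h - of_int ?j" by linarith
      show ?thesis unfolding base c cell_interp_upper[OF le] cell_interp_upper[OF True] by (simp add: algebra_simps)
    next
      case False
      then have le: "y + h - of_int ?j \<le> x + h - of_int ?i" "y - of_int ?j \<le> x - of_int ?i" by linarith+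
      show ?thesis unfolding base c cell_interp_lower[OF le(1)] cell_interp_lower[OF le(2)] by (simp add: algebra_simps)
    qed
  qed
  then show "\<exists>d>0. \<exists>a b. \<forall>h. 0 < h \<longrightarrow> h < d \<longrightarrow>
      plane_interp V (x + h) (y + h) = plane_interp V x y + h *\<^sub>R (V (a + 1) (b + 1) - V a b)"
    using fl by (intro exI[of _ "min (1 - ?\<eta>) (1 - ?\<xi>)"] conjI exI[of _ ?i] exI[of _ ?j]) auto
qed

lemma inner_plane_interp_line:
  fixes u v x y r r' :: real
  assumes inc: "\<And>x y. \<exists>d>0. \<forall>h. 0 < h \<longrightarrow> h < d \<longrightarrow>
      n \<bullet> plane_interp V x y < n \<bullet> plane_interp V (x + h * u) (y + h * v)" and "r \<ge> 0"
  shows "n \<bullet> plane_interp V x y \<le> n \<bullet> plane_interp V (x + r * u) (y + r * v)"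
    and "r > 0 \<Longrightarrow> n \<bullet> plane_interp V x y < n \<bullet> plane_interp V (x + r * u) (y + r * v)"
proof -
  let ?g = "\<lambda>s. n \<bullet> plane_interp V (x + s * u) (y + s * v)"
  have c: "continuous_on UNIV ?g"
  proof (intro continuous_intros)
    have "continuous_on UNIV (\<lambda>s. plane_interp V (fst (x + s * u, y + s * v)) (snd (x + s * u, y + s * v)))"
      by (rule continuous_on_compose2[OF continuous_on_plane_interp]) (auto intro!: continuous_intros)
    then show "continuous_on UNIV (\<lambda>s. plane_interp V (x + s * u) (y + s * v))" by simp
  qed
  have l: "\<exists>d>0. \<forall>h. 0 < h \<longrightarrow> h < d \<longrightarrow> ?g s < ?g (s + h)" for s
    using inc[of "x + s * u" "y + s * v"] by (simp add: algebra_simps)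
  show 1: "r > 0 \<Longrightarrow> n \<bullet> plane_interp V x y < n \<bullet> plane_interp V (x + r * u) (y + r * v)"
    using strict_mono_if_locally_increasing[OF c l, of 0 r] by simp
  show "n \<bullet> plane_interp V x y \<le> n \<bullet> plane_interp V (x + r * u) (y + r * v)"
    using 1 \<open>r \<ge> 0\<close> by (cases "r = 0") auto
qed

lemma inner_increment:
  assumes "\<exists>d>0. \<exists>a b. \<forall>h. 0 < h \<longrightarrow> h < d \<longrightarrow> G h = G0 + h *\<^sub>R E a b" "\<And>a b. n \<bullet> E a b > 0"
  shows "\<exists>d>0. \<forall>h::real. 0 < h \<longrightarrow> h < d \<longrightarrow> n \<bullet> G0 < n \<bullet> G h"
proof -
  obtain d a b where "d > 0" "\<And>h. 0 < h \<Longrightarrow> h < d \<Longrightarrow> G h = G0 + h *\<^sub>R E a b" using assms(1) by blast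
  then show ?thesis using assms(2)[of a b] by (intro exI[of _ d]) (auto simp: inner_add_right)
qed

lemma inner_plane_interp_right:
  assumes "\<And>i j. n \<bullet> (V (i + 1) j - V i j) > 0" and "r \<ge> 0"
  shows "n \<bullet> plane_interp V x y \<le> n \<bullet> plane_interp V (x + r) y"
    and "r > 0 \<Longrightarrow> n \<bullet> plane_interp V x y < n \<bullet> plane_interp V (x + r) y"
  using inner_plane_interp_line[of 1 0 r x y]
    inner_increment[OF plane_interp_increments(1) assms(1)] assms(2) by simp_all

lemma inner_plane_interp_up:
  assumes "\<And>i j. n \<bullet> (V i (j + 1) - V i j) > 0" and "r \<ge> 0"
  shows "n \<bullet> plane_interp V x y \<le> n \<bullet> plane_interp V x (y + r)"
    and "r > 0 \<Longrightarrow> n \<bullet> plane_interp V x y < n \<bullet> plane_interp V x (y + r)"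
  using inner_plane_interp_line[of 0 1 r x y]
    inner_increment[OF plane_interp_increments(2) assms(1)] assms(2) by simp_all

lemma inner_plane_interp_diagonal:
  assumes "\<And>i j. n \<bullet> (V (i + 1) (j + 1) - V i j) > 0" and "r \<ge> 0"
  shows "n \<bullet> plane_interp V x y \<le> n \<bullet> plane_interp V (x + r) (y + r)"
    and "r > 0 \<Longrightarrow> n \<bullet> plane_interp V x y < n \<bullet> plane_interp V (x + r) (y + r)"
  using inner_plane_interp_line[of 1 1 r x y]
    inner_increment[OF plane_interp_increments(3) assms(1)] assms(2) by simp_all

end

text \<open>Each of the three functionals increases along the edges bounding one of the three double
  sectors of directions.\<close>

lemma plane_interp_inj:
  fixes V :: "int \<Rightarrow> int \<Rightarrow> 'a::real_inner"
  assumes n1: "\<And>i j. n1 \<bullet> (V i (j + 1) - V i j) > 0" "\<And>i j. n1 \<bullet> (V (i + 1) (j + 1) - V i j) > 0"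
    and n2: "\<And>i j. n2 \<bullet> (V (i + 1) (j + 1) - V i j) > 0" "\<And>i j. n2 \<bullet> (V (i + 1) j - V i j) > 0"
    and n3: "\<And>i j. n3 \<bullet> (V (i + 1) j - V i j) > 0" "\<And>i j. n3 \<bullet> (V i (j + 1) - V i j) < 0"
    and eq: "plane_interp V x y = plane_interp V x' y'"
  shows "x = x' \<and> y = y'"
proof -
  have neg: "(- n3) \<bullet> (V i (j + 1) - V i j) > 0" for i j using n3(2)[of i j] by simp
  have main: "x = x' \<and> y = y'"
    if eq: "plane_interp V x y = plane_interp V x' y'" and le: "x \<le> x'" for x y x' y'
  proof (rule ccontr)
    assume ne: "\<not> (x = x' \<and> y = y')"
    \<comment> \<open>The way from the left point to the right one is broken into two segments in
      edge directions: right and down, diagonal and right, or diagonal and up. One functional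
      increases along both segments in each case.\<close>
    consider "y' < y" | "0 \<le> y' - y" "y' - y \<le> x' - x" | "x' - x < y' - y" by linarith
    then show False
    proof cases
      case 1
      have "n3 \<bullet> plane_interp V x y \<le> n3 \<bullet> plane_interp V x' y"
        using inner_plane_interp_right(1)[where n = n3 and V = V, OF n3(1), of "x' - x" x y] le by simp
      moreover have "(- n3) \<bullet> plane_interp V x' y' < (- n3) \<bullet> plane_interp V x' y"
        using inner_plane_interp_up(2)[where n = "- n3" and V = V, OF neg, of "y - y'" x' y'] 1 by simp
      ultimately show False using eq by simp
    next
      case 2
      have "n2 \<bullet> plane_interp V x y \<le> n2 \<bullet> plane_interp V (x + (y' - y)) y'"
        "y < y' \<Longrightarrow> n2 \<bullet> plane_interp V x y < n2 \<bullet> plane_interp V (x + (y' - y)) y'"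
        using inner_plane_interp_diagonal[where n = n2 and V = V, OF n2(1), of "y' - y" x y] 2 by simp_all
      moreover have "n2 \<bullet> plane_interp V (x + (y' - y)) y' \<le> n2 \<bullet> plane_interp V x' y'"
        "x + (y' - y) < x' \<Longrightarrow> n2 \<bullet> plane_interp V (x + (y' - y)) y' < n2 \<bullet> plane_interp V x' y'"
        using inner_plane_interp_right[where n = n2 and V = V, OF n2(2), of "x' - x - (y' - y)" "x + (y' - y)" y'] 2 by simp_all
      moreover have "y < y' \<or> x + (y' - y) < x'" using ne 2 by linarith
      ultimately show False using eq by auto
    next
      case 3
      have "n1 \<bullet> plane_interp V x y \<le> n1 \<bullet> plane_interp V x' (y + (x' - x))"
        using inner_plane_interp_diagonal(1)[where n = n1 and V = V, OF n1(2), of "x' - x" x y] le by simp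
      moreover have "n1 \<bullet> plane_interp V x' (y + (x' - x)) < n1 \<bullet> plane_interp V x' y'"
        using inner_plane_interp_up(2)[where n = n1 and V = V, OF n1(1), of "y' - y - (x' - x)" x' "y + (x' - x)"] 3 by simp
      ultimately show False using eq by simp
    qed
  qed
  show ?thesis using main[of x y x' y'] main[of x' y' x y] eq by (cases "x \<le> x'") auto
qed

text \<open>By Brouwer's fixed point theorem.\<close>

lemma surj_near_linear:
  fixes F :: "'a::euclidean_space \<Rightarrow> 'a"
  assumes F: "continuous_on UNIV F" and lin: "linear A" "inj A" and bd: "\<And>w. norm (F w - A w) \<le> K"
  shows "\<exists>w. F w = z"
proof -
  have bij: "bij A" using lin linear_injective_imp_surjective bij_def by blast
  define B where "B = inv A"
  have B: "linear B" "\<And>w. B (A w) = w" "\<And>w. A (B w) = w"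
    using lin bij by (auto simp: B_def inj_linear_imp_inv_linear bij_is_inj bij_is_surj surj_f_inv_f)
  obtain M where M: "M > 0" "\<And>w. norm (B w) \<le> norm w * M"
    using B(1) linear_conv_bounded_linear bounded_linear.pos_bounded by blast
  define R where "R = (\<bar>K\<bar> + 1) * M"
  have R: "R > 0" using M by (simp add: R_def)
  \<comment> \<open>\<open>B\<close> after \<open>F\<close> moves every point by at most
    \<open>R\<close>, so its image of the ball of radius \<open>R\<close> about \<open>B z\<close>
    covers the centre.\<close>
  have near: "norm (w - B (F w)) \<le> R" for w
  proof -
    have "w - B (F w) = - B (F w - A w)" using B by (simp add: linear_diff)
    then have "norm (w - B (F w)) \<le> norm (F w - A w) * M" using M(2) by (metis norm_minus_cancel)
    also have "\<dots> \<le> R" unfolding R_def using bd[of w] M(1) by (intro mult_right_mono) auto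
    finally show ?thesis .
  qed
  have "\<exists>w\<in>cball (B z) R. B (F w) = B z"
  proof (rule brouwer_surjective_cball[where S = "{B z}"])
    show "continuous_on (cball (B z) R) (\<lambda>w. B (F w))"
      using continuous_on_compose2[OF linear_continuous_on[of B UNIV] continuous_on_subset[OF F]] B(1)
      by (auto simp: linear_conv_bounded_linear)
  qed (use R near in \<open>auto simp: dist_norm norm_minus_commute\<close>)
  then show ?thesis by (metis B(3))
qed

section \<open>Flat structures\<close>

lemma sgn_mult_cnj: "z \<noteq> 0 \<Longrightarrow> sgn (z::complex) * cnj (sgn z) = 1"
  using complex_norm_square[of "sgn z"] by (simp add: norm_sgn)

text \<open>The angle from \<open>a\<close> to \<open>b\<close> when \<open>b\<close> is to the left of \<open>a\<close>.\<close>

definition plane_angle :: "complex \<Rightarrow> complex \<Rightarrow> real" where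
  "plane_angle a b = arccos ((a \<bullet> b) / (norm a * norm b))"

text \<open>The cosine agrees by definition; positivity of the imaginary part selects the positive
  root for the sine of an arccosine.\<close>

lemma plane_angle:
  assumes "Im (b * cnj a) > 0"
  shows "cis (plane_angle a b) = sgn b * cnj (sgn a)" "0 < plane_angle a b" "plane_angle a b < pi"
proof -
  have nz: "a \<noteq> 0" "b \<noteq> 0" using assms by auto
  define c where "c = (a \<bullet> b) / (norm a * norm b)"
  have w: "sgn b * cnj (sgn a) = (b * cnj a) / of_real (norm a * norm b)"
    by (simp add: sgn_eq)
  have Re: "Re (sgn b * cnj (sgn a)) = c" unfolding w
    by (simp add: c_def Re_divide_of_real inner_complex_def algebra_simps)
  have Im: "Im (sgn b * cnj (sgn a)) > 0" unfolding w
    using assms nz by (simp add: Im_divide_of_real)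
  have "norm (sgn b * cnj (sgn a)) = 1" using nz by (simp add: norm_mult norm_sgn)
  then have one: "c\<^sup>2 + (Im (sgn b * cnj (sgn a)))\<^sup>2 = 1"
    using Re cmod_power2[of "sgn b * cnj (sgn a)"] by simp
  then have "c\<^sup>2 < 1" using Im by (smt (verit) zero_less_power)
  then have "\<bar>c\<bar> < 1" by (simp add: abs_square_less_1)
  then have c: "- 1 < c" "c < 1" by linarith+
  show "0 < plane_angle a b" "plane_angle a b < pi"
    unfolding plane_angle_def c_def[symmetric] using arccos_lt_bounded[OF c] by auto
  have "sin (plane_angle a b) = sqrt (1 - c\<^sup>2)"
    unfolding plane_angle_def c_def[symmetric] using c by (simp add: sin_arccos)
  also have "1 - c\<^sup>2 = (Im (sgn b * cnj (sgn a)))\<^sup>2" using one by linarith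
  also have "sqrt \<dots> = Im (sgn b * cnj (sgn a))" using Im by (simp only: real_sqrt_abs abs_of_pos)
  finally have "sin (plane_angle a b) = Im (sgn b * cnj (sgn a))" .
  moreover have "cos (plane_angle a b) = c" unfolding plane_angle_def c_def[symmetric] using c by simp
  ultimately show "cis (plane_angle a b) = sgn b * cnj (sgn a)"
    using Re by (simp add: complex_eq_iff)
qed

text \<open>The product of the three quotients of directions is -1, so the sum is an odd multiple of
  \<open>pi\<close>; it lies strictly between 0 and \<open>3 * pi\<close>.\<close>

lemma plane_triangle_angles:
  assumes "Im (b * cnj a) > 0"
  shows "plane_angle a b + plane_angle (b - a) (- a) + plane_angle (- b) (a - b) = pi"
proof -
  have pos: "Im ((- a) * cnj (b - a)) > 0" "Im ((a - b) * cnj (- b)) > 0"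
    using assms by (simp_all add: algebra_simps)
  have nz: "a \<noteq> 0" "b \<noteq> 0" "b - a \<noteq> 0" using assms by (auto simp: algebra_simps)
  let ?S = "plane_angle a b + plane_angle (b - a) (- a) + plane_angle (- b) (a - b)"
  have "cis ?S = (sgn b * cnj (sgn a)) * (sgn (- a) * cnj (sgn (b - a))) * (sgn (a - b) * cnj (sgn (- b)))"
    by (simp add: cis_mult[symmetric] plane_angle(1)[OF assms] plane_angle(1)[OF pos(1)] plane_angle(1)[OF pos(2)])
  also have "sgn (a - b) = - sgn (b - a)" by (metis minus_diff_eq sgn_minus)
  also have "(sgn b * cnj (sgn a)) * (sgn (- a) * cnj (sgn (b - a))) * (- sgn (b - a) * cnj (sgn (- b)))
      = - ((sgn a * cnj (sgn a)) * (sgn b * cnj (sgn b)) * (sgn (b - a) * cnj (sgn (b - a))))"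
    by (simp add: sgn_minus)
  also have "\<dots> = - 1" using sgn_mult_cnj nz by simp
  finally have "cis ?S = - 1" .
  then have "cos ?S = - 1" by (metis cis.sel(1) one_complex.sel(1) uminus_complex.sel(1))
  then obtain k :: int where k: "?S = 2 * of_int k * pi + pi" by (auto simp: cos_eq_minus1 algebra_simps)
  have "0 < ?S" "?S < 3 * pi"
    using plane_angle(2,3)[OF assms] plane_angle(2,3)[OF pos(1)] plane_angle(2,3)[OF pos(2)] by linarith+
  then have "- 1 * pi < (2 * of_int k) * pi" "(2 * of_int k) * pi < 2 * pi" using k by linarith+
  then have "- 1 < 2 * real_of_int k" "2 * real_of_int k < 2" by (simp_all only: mult_less_cancel_right_pos[OF pi_gt_zero])
  then have "k = 0" by linarith
  then show ?thesis using k by simp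
qed

text \<open>The law of cosines: three side lengths determine the inner product at a corner.\<close>

lemma angle_at_eq_plane_angle:
  assumes "dist V X = norm a" "dist V Y = norm b" "dist X Y = norm (b - a)"
  shows "angle_at V X Y = plane_angle a b"
proof -
  have "(dist X Y)\<^sup>2 = (norm ((Y - V) - (X - V)))\<^sup>2" by (simp add: dist_norm norm_minus_commute)
  also have "\<dots> = (norm (Y - V))\<^sup>2 + (norm (X - V))\<^sup>2 - 2 * ((X - V) \<bullet> (Y - V))"
    by (simp add: power2_norm_eq_inner inner_diff inner_commute)
  finally have "2 * ((X - V) \<bullet> (Y - V)) = (norm b)\<^sup>2 + (norm a)\<^sup>2 - (norm (b - a))\<^sup>2"
    using assms by (simp add: dist_norm norm_minus_commute)
  also have "\<dots> = 2 * (a \<bullet> b)" by (simp add: power2_norm_eq_inner inner_diff inner_commute)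
  finally have "(X - V) \<bullet> (Y - V) = a \<bullet> b" by simp
  moreover have "norm (X - V) = norm a" "norm (Y - V) = norm b"
    using assms by (simp_all add: dist_norm norm_minus_commute)
  ultimately show ?thesis by (simp add: angle_at_def plane_angle_def)
qed

text \<open>\<open>e1 v\<close>, \<open>e2 v\<close>, \<open>e3 v\<close> are the edge vectors from \<open>v\<close> to \<open>v + 1\<close>, \<open>v + 2\<close>, \<open>v + 3\<close> in a
  developed image of the intrinsic metric; the functionals certify that the developing map is
  injective.\<close>

locale flat_data =
  fixes p :: "real^3^8" and e1 e2 e3 :: "8 \<Rightarrow> complex" and n1 n2 n3 :: complex
  assumes e3_upper: "\<And>v. e3 v = e2 v + e1 (v + 2)" and e3_lower: "\<And>v. e3 v = e1 v + e2 (v + 1)"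
    and dist1: "\<And>v. dist (p $ v) (p $ (v + 1)) = norm (e1 v)"
    and dist2: "\<And>v. dist (p $ v) (p $ (v + 2)) = norm (e2 v)"
    and dist3: "\<And>v. dist (p $ v) (p $ (v + 3)) = norm (e3 v)"
    and upper: "\<And>v. Im (e3 v * cnj (e2 v)) > 0" and lower: "\<And>v. Im (e1 v * cnj (e3 v)) > 0"
    and n1: "\<And>v. n1 \<bullet> e2 v > 0" "\<And>v. n1 \<bullet> e3 v > 0"
    and n2: "\<And>v. n2 \<bullet> e3 v > 0" "\<And>v. n2 \<bullet> e1 v > 0"
    and n3: "\<And>v. n3 \<bullet> e1 v > 0" "\<And>v. n3 \<bullet> e2 v < 0"
    and periods: "Im ((\<Sum>v\<in>UNIV. e1 v) * cnj (e2 0 - e1 0 - e1 1)) > 0"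
begin

text \<open>The link of \<open>v\<close> is the hexagon
  \<open>v + 2, v + 3, v + 1, v - 2, v - 3, v - 1\<close>. The edge vector from \<open>v\<close> to
  \<open>v - k\<close> is minus the one that starts at \<open>v - k\<close>.\<close>

lemma cone_angle_sum:
  "cone_angle p v = plane_angle (e2 v) (e3 v) + plane_angle (e3 v) (e1 v)
     + plane_angle (e1 v) (- e2 (v - 2)) + plane_angle (- e2 (v - 2)) (- e3 (v - 3))
     + plane_angle (- e3 (v - 3)) (- e1 (v - 1)) + plane_angle (- e1 (v - 1)) (e2 v)"
  and star_pos: "Im (e3 v * cnj (e2 v)) > 0" "Im (e1 v * cnj (e3 v)) > 0"
    "Im (- e2 (v - 2) * cnj (e1 v)) > 0" "Im (- e3 (v - 3) * cnj (- e2 (v - 2))) > 0"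
    "Im (- e1 (v - 1) * cnj (- e3 (v - 3))) > 0" "Im (e2 v * cnj (- e1 (v - 1))) > 0"
proof -
  have S: "{(x, y). (v, x, y) \<in> positive_triples} =
      {(v + 2, v + 3), (v + 3, v + 1), (v + 1, v - 2), (v - 2, v - 3), (v - 3, v - 1), (v - 1, v + 2)}"
    (is "?L = ?R")
  proof
    have T: "(a, a + 2, a + 3) \<in> positive_triples" "(a + 2, a + 3, a) \<in> positive_triples"
      "(a + 3, a, a + 2) \<in> positive_triples" "(a, a + 3, a + 1) \<in> positive_triples"
      "(a + 3, a + 1, a) \<in> positive_triples" "(a + 1, a, a + 3) \<in> positive_triples" for a
      unfolding positive_triples_def by blast+
    show "?R \<subseteq> ?L"
      using T(1)[of v] T(4)[of v] T(2)[of "v - 2"] T(5)[of "v - 3"] T(3)[of "v - 3"] T(6)[of "v - 1"]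
      by (simp add: add.commute)
    show "?L \<subseteq> ?R"
    proof
      fix xy assume "xy \<in> ?L"
      then obtain x y where xy: "xy = (x, y)" "(v, x, y) \<in> positive_triples" by blast
      then obtain a where "(v, x, y) = (a, a + 2, a + 3) \<or> (v, x, y) = (a + 2, a + 3, a) \<or>
          (v, x, y) = (a + 3, a, a + 2) \<or> (v, x, y) = (a, a + 3, a + 1) \<or>
          (v, x, y) = (a + 3, a + 1, a) \<or> (v, x, y) = (a + 1, a, a + 3)"
        unfolding positive_triples_def by blast
      then show "xy \<in> ?R" unfolding xy(1) by (elim disjE) (simp_all add: add.assoc)
    qed
  qed
  have sh: "v - 2 + 2 = v" "v - 3 + 3 = v" "v - 1 + 1 = v" "v - 3 + 1 = v - 2" "v - 3 + 2 = v - 1"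
    "v - 1 + 3 = v + 2" "v - 2 + 3 = v + 1" by simp_all
  have E: "e3 (v - 2) = e2 (v - 2) + e1 v" "e3 (v - 3) = e1 (v - 3) + e2 (v - 2)"
    "e3 (v - 3) = e2 (v - 3) + e1 (v - 1)" "e3 (v - 1) = e1 (v - 1) + e2 v"
    using e3_upper[of "v - 2"] e3_lower[of "v - 3"] e3_upper[of "v - 3"] e3_lower[of "v - 1"] by (simp_all add: sh)
  show pos: "Im (e3 v * cnj (e2 v)) > 0" "Im (e1 v * cnj (e3 v)) > 0"
    "Im (- e2 (v - 2) * cnj (e1 v)) > 0" "Im (- e3 (v - 3) * cnj (- e2 (v - 2))) > 0"
    "Im (- e1 (v - 1) * cnj (- e3 (v - 3))) > 0" "Im (e2 v * cnj (- e1 (v - 1))) > 0"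
  proof -
    \<comment> \<open>Each of the six triangles at \<open>v\<close> is an upper or lower triangle at
      \<open>v\<close>, \<open>v - 1\<close>, \<open>v - 2\<close> or \<open>v - 3\<close>.
      Subtracting one side from another leaves the signed area unchanged.\<close>
    have F: "e1 (v - 3) = e3 (v - 3) - e2 (v - 2)" "e2 (v - 3) = e3 (v - 3) - e1 (v - 1)"
      using E(2) by simp (use E(3) in simp)
    show "Im (e3 v * cnj (e2 v)) > 0" "Im (e1 v * cnj (e3 v)) > 0" using upper lower by blast+
    show "Im (- e2 (v - 2) * cnj (e1 v)) > 0" using upper[of "v - 2"] unfolding E(1) by (simp add: algebra_simps)
    show "Im (- e3 (v - 3) * cnj (- e2 (v - 2))) > 0" using lower[of "v - 3"] unfolding F(1) by (simp add: algebra_simps)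
    show "Im (- e1 (v - 1) * cnj (- e3 (v - 3))) > 0" using upper[of "v - 3"] unfolding F(2) by (simp add: algebra_simps)
    show "Im (e2 v * cnj (- e1 (v - 1))) > 0" using lower[of "v - 1"] unfolding E(4) by (simp add: algebra_simps)
  qed
  have D: "dist (p $ v) (p $ (v + 1)) = norm (e1 v)" "dist (p $ v) (p $ (v + 2)) = norm (e2 v)"
    "dist (p $ v) (p $ (v + 3)) = norm (e3 v)" "dist (p $ v) (p $ (v - 1)) = norm (- e1 (v - 1))"
    "dist (p $ v) (p $ (v - 2)) = norm (- e2 (v - 2))" "dist (p $ v) (p $ (v - 3)) = norm (- e3 (v - 3))"
    using dist1[of v] dist2[of v] dist3[of v] dist1[of "v - 1"] dist2[of "v - 2"] dist3[of "v - 3"]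
    by (simp_all add: dist_commute)
  have D': "dist (p $ (v + 2)) (p $ (v + 3)) = norm (e3 v - e2 v)"
    "dist (p $ (v + 3)) (p $ (v + 1)) = norm (e1 v - e3 v)"
    "dist (p $ (v + 1)) (p $ (v - 2)) = norm (- e2 (v - 2) - e1 v)"
    "dist (p $ (v - 2)) (p $ (v - 3)) = norm (- e3 (v - 3) - - e2 (v - 2))"
    "dist (p $ (v - 3)) (p $ (v - 1)) = norm (- e1 (v - 1) - - e3 (v - 3))"
    "dist (p $ (v - 1)) (p $ (v + 2)) = norm (e2 v - - e1 (v - 1))"
  proof -
    have "e3 v - e2 v = e1 (v + 2)" "e1 v - e3 v = - e2 (v + 1)"
      using e3_upper[of v] by simp (use e3_lower[of v] in simp)
    moreover have "- e2 (v - 2) - e1 v = - e3 (v - 2)" "- e3 (v - 3) - - e2 (v - 2) = - e1 (v - 3)"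
      "e2 v - - e1 (v - 1) = e3 (v - 1)" using E(1,2,4) by simp_all
    moreover have "- e1 (v - 1) - - e3 (v - 3) = e2 (v - 3)" using E(3) by simp
    moreover have "dist (p $ (v + 2)) (p $ (v + 3)) = norm (e1 (v + 2))"
      "dist (p $ (v + 1)) (p $ (v + 3)) = norm (e2 (v + 1))" using dist1[of "v + 2"] dist2[of "v + 1"]
      by (simp_all add: add.commute)
    moreover have "dist (p $ (v - 2)) (p $ (v + 1)) = norm (e3 (v - 2))"
      "dist (p $ (v - 3)) (p $ (v - 2)) = norm (e1 (v - 3))" "dist (p $ (v - 3)) (p $ (v - 1)) = norm (e2 (v - 3))"
      "dist (p $ (v - 1)) (p $ (v + 2)) = norm (e3 (v - 1))"
      using dist3[of "v - 2"] dist1[of "v - 3"] dist2[of "v - 3"] dist3[of "v - 1"] by (simp_all only: sh)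
    ultimately show "dist (p $ (v + 2)) (p $ (v + 3)) = norm (e3 v - e2 v)"
      "dist (p $ (v + 3)) (p $ (v + 1)) = norm (e1 v - e3 v)"
      "dist (p $ (v + 1)) (p $ (v - 2)) = norm (- e2 (v - 2) - e1 v)"
      "dist (p $ (v - 2)) (p $ (v - 3)) = norm (- e3 (v - 3) - - e2 (v - 2))"
      "dist (p $ (v - 3)) (p $ (v - 1)) = norm (- e1 (v - 1) - - e3 (v - 3))"
      "dist (p $ (v - 1)) (p $ (v + 2)) = norm (e2 v - - e1 (v - 1))"
      by (simp_all only: norm_minus_cancel dist_commute)
  qed
  have d1: "x + a = x + b \<longleftrightarrow> a = b" "x - a = x - b \<longleftrightarrow> a = b" for x a b :: 8 by simp_all
  have d2: "x + a = x - b \<longleftrightarrow> a + b = 0" for x a b :: 8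
  proof -
    have "x + a = x - b \<longleftrightarrow> x + a = x + (- b)" by simp
    also have "\<dots> \<longleftrightarrow> a = - b" by (rule add_left_cancel)
    also have "\<dots> \<longleftrightarrow> a + b = 0" by (rule eq_neg_iff_add_eq_0)
    finally show ?thesis .
  qed
  have d3: "x - b = x + a \<longleftrightarrow> a + b = 0" for x a b :: 8 using d2[of x a b] by (simp only: eq_commute[of "x - b"])
  \<comment> \<open>The six corners of the link are distinct in Z/8, so the sum over the set of
    pairs has six separate terms.\<close>
  have ne: "v + 2 \<noteq> v + 3" "v + 2 \<noteq> v + 1" "v + 2 \<noteq> v - 2" "v + 2 \<noteq> v - 3" "v + 2 \<noteq> v - 1"
    "v + 3 \<noteq> v + 1" "v + 3 \<noteq> v - 2" "v + 3 \<noteq> v - 3" "v + 3 \<noteq> v - 1"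
    "v + 1 \<noteq> v - 2" "v + 1 \<noteq> v - 3" "v + 1 \<noteq> v - 1" "v - 2 \<noteq> v - 3" "v - 2 \<noteq> v - 1" "v - 3 \<noteq> v - 1"
    by (simp_all only: d1 d2 d3) simp_all
  show "cone_angle p v = plane_angle (e2 v) (e3 v) + plane_angle (e3 v) (e1 v)
     + plane_angle (e1 v) (- e2 (v - 2)) + plane_angle (- e2 (v - 2)) (- e3 (v - 3))
     + plane_angle (- e3 (v - 3)) (- e1 (v - 1)) + plane_angle (- e1 (v - 1)) (e2 v)"
    unfolding cone_angle_def S
    using angle_at_eq_plane_angle[OF D(2) D(3) D'(1)] angle_at_eq_plane_angle[OF D(3) D(1) D'(2)]
      angle_at_eq_plane_angle[OF D(1) D(5) D'(3)] angle_at_eq_plane_angle[OF D(5) D(6) D'(4)]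
      angle_at_eq_plane_angle[OF D(6) D(4) D'(5)] angle_at_eq_plane_angle[OF D(4) D(2) D'(6)]
    by (simp add: ne ne[symmetric] del: add_right_cancel add_left_cancel)
qed

text \<open>Every cone angle is a positive multiple of \<open>2 * pi\<close>, and they add up to \<open>16 * pi\<close>.\<close>

lemma cone_angle: "cone_angle p v = 2 * pi"
proof -
  have ge: "cone_angle p v \<ge> 2 * pi" for v
  proof -
    note pos = star_pos[of v]
    have nz: "e1 v \<noteq> 0" "e2 v \<noteq> 0" "e3 v \<noteq> 0" "e2 (v - 2) \<noteq> 0" "e3 (v - 3) \<noteq> 0" "e1 (v - 1) \<noteq> 0"
      using pos by auto
    have "cis (cone_angle p v) = (sgn (e3 v) * cnj (sgn (e2 v))) * (sgn (e1 v) * cnj (sgn (e3 v)))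
        * (sgn (- e2 (v - 2)) * cnj (sgn (e1 v))) * (sgn (- e3 (v - 3)) * cnj (sgn (- e2 (v - 2))))
        * (sgn (- e1 (v - 1)) * cnj (sgn (- e3 (v - 3)))) * (sgn (e2 v) * cnj (sgn (- e1 (v - 1))))"
      unfolding cone_angle_sum by (simp add: cis_mult[symmetric] plane_angle(1)[OF pos(1)] plane_angle(1)[OF pos(2)]
        plane_angle(1)[OF pos(3)] plane_angle(1)[OF pos(4)] plane_angle(1)[OF pos(5)] plane_angle(1)[OF pos(6)]
        del: complex_cnj_minus minus_mult_minus mult_minus_left mult_minus_right)
    \<comment> \<open>Around the closed star each unit direction meets its own conjugate, so the
      product telescopes to 1.\<close>
    also have "\<dots> = (sgn (e3 v) * cnj (sgn (e3 v))) * (sgn (e1 v) * cnj (sgn (e1 v))) * (sgn (e2 v) * cnj (sgn (e2 v)))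
        * (sgn (- e2 (v - 2)) * cnj (sgn (- e2 (v - 2)))) * (sgn (- e3 (v - 3)) * cnj (sgn (- e3 (v - 3))))
        * (sgn (- e1 (v - 1)) * cnj (sgn (- e1 (v - 1))))" by (simp only: ac_simps)
    also have "\<dots> = 1" using nz sgn_mult_cnj[of "e1 v"] sgn_mult_cnj[of "e2 v"] sgn_mult_cnj[of "e3 v"]
        sgn_mult_cnj[of "- e2 (v - 2)"] sgn_mult_cnj[of "- e3 (v - 3)"] sgn_mult_cnj[of "- e1 (v - 1)"]
      by (simp del: complex_cnj_minus minus_mult_minus sgn_minus)
    finally have "cos (cone_angle p v) = 1" by (metis cis.sel(1) one_complex.sel(1))
    then obtain k :: int where k: "cone_angle p v = of_int k * 2 * pi" by (auto simp: cos_one_2pi_int)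
    have "cone_angle p v > 0" unfolding cone_angle_sum
      using plane_angle(2)[OF pos(1)] plane_angle(2)[OF pos(2)] plane_angle(2)[OF pos(3)]
        plane_angle(2)[OF pos(4)] plane_angle(2)[OF pos(5)] plane_angle(2)[OF pos(6)] by linarith
    then have "k > 0" using k by (simp add: zero_less_mult_iff)
    then have "1 * (2 * pi) \<le> of_int k * (2 * pi)" by (intro mult_right_mono) auto
    then show ?thesis using k by simp
  qed
  \<comment> \<open>Translating the summation index regroups the angles by triangles instead of
    vertices: 16 triangles contribute \<open>pi\<close> each, exactly \<open>2 * pi\<close> per
    vertex on average.\<close>
  have shift: "(\<Sum>v\<in>UNIV. g (v - c)) = (\<Sum>v\<in>UNIV. g v)" for g :: "8 \<Rightarrow> real" and c
    by (rule sum.reindex_bij_witness[of _ "\<lambda>v. v + c" "\<lambda>v. v - c"]) auto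
  let ?D = "\<lambda>v. plane_angle (e2 v) (e3 v) + plane_angle (e3 v - e2 v) (- e2 v) + plane_angle (- e3 v) (e2 v - e3 v)"
  let ?U = "\<lambda>v. plane_angle (e3 v) (e1 v) + plane_angle (e1 v - e3 v) (- e3 v) + plane_angle (- e1 v) (e3 v - e1 v)"
  have DU: "?D v = pi" "?U v = pi" for v
    using plane_triangle_angles[OF upper[of v]] plane_triangle_angles[OF lower[of v]] by simp_all
  have e: "e3 (v - 2) - e2 (v - 2) = e1 v" "e1 (v - 3) - e3 (v - 3) = - e2 (v - 2)"
    "e2 (v - 3) - e3 (v - 3) = - e1 (v - 1)" "e3 (v - 1) - e1 (v - 1) = e2 v" for v
    subgoal using e3_upper[of "v - 2"] by simp
    subgoal using e3_lower[of "v - 3"] by simp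
    subgoal using e3_upper[of "v - 3"] by simp
    subgoal using e3_lower[of "v - 1"] by simp
    done
  have "(\<Sum>v\<in>UNIV. cone_angle p v) = (\<Sum>v\<in>UNIV. ?D v + ?U v)"
    unfolding cone_angle_sum sum.distrib
    using shift[of "\<lambda>v. plane_angle (e3 v - e2 v) (- e2 v)" 2] shift[of "\<lambda>v. plane_angle (e1 v - e3 v) (- e3 v)" 3]
      shift[of "\<lambda>v. plane_angle (- e3 v) (e2 v - e3 v)" 3] shift[of "\<lambda>v. plane_angle (- e1 v) (e3 v - e1 v)" 1]
    unfolding e by simp
  then have total: "(\<Sum>v\<in>UNIV. cone_angle p v - 2 * pi) = 0" by (simp only: DU) (simp add: sum_subtractf)
  then have "\<forall>v\<in>UNIV. cone_angle p v - 2 * pi = 0"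
    using ge by (subst (asm) sum_nonneg_eq_0_iff) auto
  then show ?thesis by simp
qed

end

section \<open>Residues modulo 8, period lattices and modular orbits\<close>

lemma of_int_mod_8: "(of_int n :: 8) = of_nat (nat (n mod 8))"
proof -
  have "(of_int n :: 8) = of_int (8 * (n div 8) + n mod 8)" by simp
  also have "\<dots> = of_int 8 * of_int (n div 8) + of_int (n mod 8)" by (simp only: of_int_add of_int_mult)
  also have "(of_int 8 :: 8) = 0" by simp
  also have "(of_int (n mod 8) :: 8) = of_int (int (nat (n mod 8)))" by simp
  finally show ?thesis by (simp only: of_int_of_nat_eq mult_zero_left add_0)
qed

lemma of_int_eq_8: "(of_int m :: 8) = of_int n \<longleftrightarrow> m mod 8 = n mod 8"
proof
  assume "(of_int m :: 8) = of_int n"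
  then have "of_nat (nat (m mod 8)) = (of_nat (nat (n mod 8)) :: 8)" by (simp only: of_int_mod_8)
  moreover have "nat (m mod 8) < 8" "nat (n mod 8) < 8" by (simp_all add: nat_less_iff)
  ultimately have "nat (m mod 8) = nat (n mod 8)" using of_nat_neq by (metis linorder_neqE_nat)
  then show "m mod 8 = n mod 8" by simp
qed (simp only: of_int_mod_8)

lemma ex_of_int_8: "\<exists>n::int. m = (of_int n :: 8)"
  using ex_of_nat_8[of m] by (metis of_int_of_nat_eq)

text \<open>The error at a point is a convex combination of the errors at the three corners of its
  triangle.\<close>

lemma plane_interp_near_linear:
  fixes V :: "int \<Rightarrow> int \<Rightarrow> 'a::real_normed_vector"
  assumes "\<And>i j. norm (V i j - (of_int i *\<^sub>R a + of_int j *\<^sub>R b)) \<le> K"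
  shows "norm (plane_interp V x y - (x *\<^sub>R a + y *\<^sub>R b)) \<le> K"
proof -
  have conv: "norm (r *\<^sub>R u + s *\<^sub>R v + t *\<^sub>R w) \<le> K"
    if "r \<ge> 0" "s \<ge> 0" "t \<ge> 0" "r + s + t = 1" "norm u \<le> K" "norm v \<le> K" "norm w \<le> K" for r s t :: real and u v w :: 'a
  proof -
    have "norm (r *\<^sub>R u + s *\<^sub>R v + t *\<^sub>R w) \<le> r * norm u + s * norm v + t * norm w"
      using that by (intro norm_triangle_le add_mono) auto
    also have "\<dots> \<le> r * K + s * K + t * K" using that by (intro add_mono mult_left_mono) auto
    also have "\<dots> = K" using that(4) by (metis distrib_right mult_1)
    finally show ?thesis .
  qed
  let ?i = "\<lfloor>x\<rfloor>" and ?j = "\<lfloor>y\<rfloor>"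
  let ?\<xi> = "x - of_int ?i" and ?\<eta> = "y - of_int ?j"
  let ?d = "\<lambda>i j. V i j - (of_int i *\<^sub>R a + of_int j *\<^sub>R b)"
  have fl: "0 \<le> ?\<xi>" "?\<xi> \<le> 1" "0 \<le> ?\<eta>" "?\<eta> \<le> 1" by linarith+
  show ?thesis
  proof (cases "?\<xi> \<le> ?\<eta>")
    case True
    have "plane_interp V x y - (x *\<^sub>R a + y *\<^sub>R b) =
        (1 - ?\<eta>) *\<^sub>R ?d ?i ?j + (?\<eta> - ?\<xi>) *\<^sub>R ?d ?i (?j + 1) + ?\<xi> *\<^sub>R ?d (?i + 1) (?j + 1)"
      unfolding plane_interp_def cell_interp_upper[OF True] by (simp add: algebra_simps)
    then show ?thesis using fl True by (simp only:) (intro conv assms, auto)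
  next
    case False
    then have le: "?\<eta> \<le> ?\<xi>" by simp
    have "plane_interp V x y - (x *\<^sub>R a + y *\<^sub>R b) =
        (1 - ?\<xi>) *\<^sub>R ?d ?i ?j + (?\<xi> - ?\<eta>) *\<^sub>R ?d (?i + 1) ?j + ?\<eta> *\<^sub>R ?d (?i + 1) (?j + 1)"
      unfolding plane_interp_def cell_interp_lower[OF le] by (simp add: algebra_simps)
    then show ?thesis using fl le by (simp only:) (intro conv assms, auto)
  qed
qed

lemma closed_simplex_3:
  assumes "t \<in> closed_simplex {a, b, c}" "a \<noteq> b" "a \<noteq> c" "b \<noteq> c"
  shows "t $ a \<ge> 0" "t $ b \<ge> 0" "t $ c \<ge> 0" "t $ a + t $ b + t $ c = 1"
    "t = t $ a *\<^sub>R axis a 1 + t $ b *\<^sub>R axis b 1 + t $ c *\<^sub>R axis c 1"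
proof -
  have t: "\<And>i. 0 \<le> t $ i" "(\<Sum>i\<in>UNIV. t $ i) = 1" "\<And>i. i \<notin> {a, b, c} \<Longrightarrow> t $ i = 0"
    using assms(1) by (auto simp: closed_simplex_def)
  show "t $ a \<ge> 0" "t $ b \<ge> 0" "t $ c \<ge> 0" using t(1) by auto
  have "(\<Sum>i\<in>UNIV. t $ i) = (\<Sum>i\<in>{a, b, c}. t $ i)"
    by (rule sum.mono_neutral_right) (use t(3) in auto)
  then show "t $ a + t $ b + t $ c = 1" using t(2) assms(2-4) by simp
  show "t = t $ a *\<^sub>R axis a 1 + t $ b *\<^sub>R axis b 1 + t $ c *\<^sub>R axis c 1"
    using t(3) assms(2-4) by (auto simp: vec_eq_iff axis_def)
qed

lemma convex_axis_in_closed_simplex: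
  fixes a b c :: 8
  assumes "r \<ge> 0" "s \<ge> 0" "u \<ge> 0" "r + s + u = 1" "a \<noteq> b" "a \<noteq> c" "b \<noteq> c"
  shows "r *\<^sub>R axis a 1 + s *\<^sub>R axis b 1 + u *\<^sub>R axis c 1 \<in> closed_simplex {a, b, c}"
proof -
  let ?t = "r *\<^sub>R axis a 1 + s *\<^sub>R axis b 1 + u *\<^sub>R axis c 1 :: real^8"
  have "(\<Sum>i\<in>UNIV. ?t $ i) = (\<Sum>i\<in>{a, b, c}. ?t $ i)"
    by (rule sum.mono_neutral_right) (auto simp: axis_def)
  also have "\<dots> = 1" using assms by (simp add: axis_def)
  finally show ?thesis using assms by (auto simp: closed_simplex_def axis_def)
qed

lemma modular_orbit_subset:
  assumes "Im \<tau> > 0" "a * d - b * c = 1" "\<tau>' = (of_int a * \<tau> + of_int b) / (of_int c * \<tau> + of_int d)"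
  shows "modular_orbit \<tau>' \<subseteq> modular_orbit \<tau>"
proof
  have nz: "of_int m * \<tau> + of_int n \<noteq> 0" if "m \<noteq> 0 \<or> n \<noteq> 0" for m n :: int
    using that assms(1) by (auto simp: complex_eq_iff)
  have cd: "of_int c * \<tau> + of_int d \<noteq> 0" using assms(2) by (intro nz) auto
  fix z assume "z \<in> modular_orbit \<tau>'"
  then obtain a' b' c' d' where z: "a' * d' - b' * c' = 1"
    "z = (of_int a' * \<tau>' + of_int b') / (of_int c' * \<tau>' + of_int d')" by (auto simp: modular_orbit_def)
  have det: "(a' * a + b' * c) * (c' * b + d' * d) - (a' * b + b' * d) * (c' * a + d' * c) = 1"
  proof -
    have "(a' * a + b' * c) * (c' * b + d' * d) - (a' * b + b' * d) * (c' * a + d' * c)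
        = (a' * d' - b' * c') * (a * d - b * c)" by algebra
    then show ?thesis using assms(2) z(1) by simp
  qed
  have "z = (of_int (a' * a + b' * c) * \<tau> + of_int (a' * b + b' * d)) /
      (of_int (c' * a + d' * c) * \<tau> + of_int (c' * b + d' * d))"
  proof -
    have "of_int a' * \<tau>' + of_int b' =
        (of_int (a' * a + b' * c) * \<tau> + of_int (a' * b + b' * d)) / (of_int c * \<tau> + of_int d)"
      "of_int c' * \<tau>' + of_int d' =
        (of_int (c' * a + d' * c) * \<tau> + of_int (c' * b + d' * d)) / (of_int c * \<tau> + of_int d)"
      unfolding assms(3) using cd by (simp_all add: field_simps)
    then show ?thesis unfolding z(2) using cd by simp
  qed
  then show "z \<in> modular_orbit \<tau>" unfolding modular_orbit_def using det by blast
qed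

lemma modular_orbit_eq:
  assumes "Im \<tau> > 0" "Im \<tau>' > 0" "a * d - b * c = 1"
    and eq: "\<tau>' = (of_int a * \<tau> + of_int b) / (of_int c * \<tau> + of_int d)"
  shows "modular_orbit \<tau>' = modular_orbit \<tau>"
proof
  show "modular_orbit \<tau>' \<subseteq> modular_orbit \<tau>" using modular_orbit_subset assms by blast
  have "c \<noteq> 0 \<or> d \<noteq> 0" using assms(3) by auto
  then have cd: "of_int c * \<tau> + of_int d \<noteq> 0" using assms(1) by (auto simp: complex_eq_iff)
  have e: "\<tau>' * (of_int c * \<tau> + of_int d) = of_int a * \<tau> + of_int b" using eq cd by simp
  have "- c \<noteq> 0 \<or> a \<noteq> 0" using assms(3) by auto
  then have ca: "of_int (- c) * \<tau>' + of_int a \<noteq> 0" using assms(2) by (auto simp: complex_eq_iff)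
  have "\<tau> * (of_int (- c) * \<tau>' + of_int a) = of_int d * \<tau>' + of_int (- b)"
    using e by (simp add: algebra_simps)
  then have "\<tau> = (of_int d * \<tau>' + of_int (- b)) / (of_int (- c) * \<tau>' + of_int a)"
    using ca by (metis nonzero_mult_div_cancel_right)
  moreover have "d * a - (- b) * (- c) = 1" using assms(3) by (simp add: algebra_simps)
  ultimately show "modular_orbit \<tau> \<subseteq> modular_orbit \<tau>'" using modular_orbit_subset assms(2) by blast
qed

lemma period_latticeI: "x = of_int m * a + of_int n * b \<Longrightarrow> x \<in> period_lattice a b"
  unfolding period_lattice_def by blast

lemma period_latticeE:
  assumes "x \<in> period_lattice a b"
  obtains m n :: int where "x = of_int m * a + of_int n * b"
  using assms unfolding period_lattice_def by blast

lemma period_lattice_add: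
  assumes "x \<in> period_lattice a b" "y \<in> period_lattice a b"
  shows "x + y \<in> period_lattice a b"
proof -
  obtain m n m' n' :: int where "x = of_int m * a + of_int n * b" "y = of_int m' * a + of_int n' * b"
    using assms by (elim period_latticeE)
  then show ?thesis by (intro period_latticeI[of _ "m + m'" _ "n + n'"]) (simp add: algebra_simps)
qed

lemma period_lattice_minus:
  assumes "x \<in> period_lattice a b" shows "- x \<in> period_lattice a b"
proof -
  obtain m n :: int where "x = of_int m * a + of_int n * b" using assms by (elim period_latticeE)
  then show ?thesis by (intro period_latticeI[of _ "- m" _ "- n"]) simp
qed

lemma period_lattice_diff: "x \<in> period_lattice a b \<Longrightarrow> y \<in> period_lattice a b \<Longrightarrow> x - y \<in> period_lattice a b"
  using period_lattice_add[OF _ period_lattice_minus] by (metis add_uminus_conv_diff)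

lemma period_lattice_0: "0 \<in> period_lattice a b"
  by (rule period_latticeI[of _ 0 _ 0]) simp

lemma period_lattice_basis: "a \<in> period_lattice a b" "b \<in> period_lattice a b"
  by (rule period_latticeI[of _ 1 _ 0], simp) (rule period_latticeI[of _ 0 _ 1], simp)

lemma period_lattice_of_int:
  assumes "x \<in> period_lattice a b" shows "of_int k * x \<in> period_lattice a b"
proof -
  obtain m n :: int where "x = of_int m * a + of_int n * b" using assms by (elim period_latticeE)
  then show ?thesis by (intro period_latticeI[of _ "k * m" _ "k * n"]) (simp add: algebra_simps)
qed

lemma countable_period_lattice: "countable (period_lattice a b)"
proof -
  have "period_lattice a b = (\<lambda>(m, n). of_int m * a + of_int n * b) ` (UNIV :: (int \<times> int) set)"
    by (auto simp: period_lattice_def)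
  then show ?thesis by simp
qed

text \<open>Two bases of one lattice differ by mutually inverse integer matrices, of determinant 1
  or -1; equal orientation of the bases excludes -1.\<close>

lemma modular_orbit_period_lattice:
  assumes M: "Im (M2 / M1) > 0" and N: "Im (N2 / N1) > 0" and eq: "period_lattice M1 M2 = period_lattice N1 N2"
  shows "modular_orbit (M2 / M1) = modular_orbit (N2 / N1)"
proof -
  have nz: "M1 \<noteq> 0" "N1 \<noteq> 0" using M N by auto
  define \<tau> where "\<tau> = N2 / N1"
  define \<tau>' where "\<tau>' = M2 / M1"
  have im: "Im \<tau> > 0" "Im \<tau>' > 0" using M N by (simp_all add: \<tau>_def \<tau>'_def)
  obtain a b c d where M12: "M2 = of_int b * N1 + of_int a * N2" "M1 = of_int d * N1 + of_int c * N2"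
    using period_lattice_basis(1)[of M1 M2] period_lattice_basis(2)[of M2 M1] unfolding eq by (elim period_latticeE)
  obtain a' b' c' d' where N12: "N2 = of_int b' * M1 + of_int a' * M2" "N1 = of_int d' * M1 + of_int c' * M2"
    using period_lattice_basis(1)[of N1 N2] period_lattice_basis(2)[of N2 N1] unfolding eq[symmetric] by (elim period_latticeE)
  have T1: "M1 = N1 * (of_int c * \<tau> + of_int d)" "M2 = N1 * (of_int a * \<tau> + of_int b)"
    using M12 nz by (simp_all add: \<tau>_def algebra_simps)
  have T2: "N1 = M1 * (of_int c' * \<tau>' + of_int d')" "N2 = M1 * (of_int a' * \<tau>' + of_int b')"
    using N12 nz by (simp_all add: \<tau>'_def algebra_simps)
  \<comment> \<open>The transformation rule of the imaginary part under a real matrix, before its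
    determinant is known.\<close>
  have pos: "Im \<tau>' * (norm (of_int c * \<tau> + of_int d))\<^sup>2 = of_int (a * d - b * c) * Im \<tau>"
  proof -
    have "of_int c * \<tau> + of_int d \<noteq> 0" using T1(1) nz by auto
    then have "\<tau>' * (of_int c * \<tau> + of_int d) = of_int a * \<tau> + of_int b"
      unfolding \<tau>'_def using T1 nz by simp
    then have "\<tau>' * ((of_int c * \<tau> + of_int d) * cnj (of_int c * \<tau> + of_int d))
        = (of_int a * \<tau> + of_int b) * cnj (of_int c * \<tau> + of_int d)" by (simp only: mult.assoc[symmetric])
    then have "\<tau>' * of_real ((norm (of_int c * \<tau> + of_int d))\<^sup>2)
        = (of_int a * \<tau> + of_int b) * cnj (of_int c * \<tau> + of_int d)" by (simp only: complex_norm_square)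
    from arg_cong[OF this, of Im] show ?thesis by (simp add: algebra_simps)
  qed
  have "of_int (a * d - b * c) > (0::real)"
  proof -
    have "of_int c * \<tau> + of_int d \<noteq> 0" using T1(1) nz by auto
    then have "Im \<tau>' * (norm (of_int c * \<tau> + of_int d))\<^sup>2 > 0" using im by simp
    then show ?thesis using im(1) unfolding pos by (simp only: zero_less_mult_iff) linarith
  qed
  then have det0: "a * d - b * c > 0" by linarith
  have "M1 * ((of_int c' * \<tau>' + of_int d') * (of_int c * \<tau> + of_int d)) = M1"
    using T1(1) T2(1) by (simp add: algebra_simps)
  have "a * d - b * c = 1"
  proof -
    have i1: "N1 = of_int (d' * d + c' * b) * N1 + of_int (d' * c + c' * a) * N2"
      by (subst N12(2), subst M12(1), subst M12(2)) (simp add: algebra_simps)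
    have i2: "N2 = of_int (b' * d + a' * b) * N1 + of_int (b' * c + a' * a) * N2"
      by (subst N12(1), subst M12(1), subst M12(2)) (simp add: algebra_simps)
    \<comment> \<open>Linear independence over the integers turns the two base changes, composed,
      into the identity matrix, so the determinants have product 1.\<close>
    have indep: "m = 0 \<and> n = 0" if "of_int m * N1 + of_int n * N2 = 0" for m n :: int
    proof -
      have "of_int m + of_int n * \<tau> = 0" using that nz
        unfolding \<tau>_def by (simp add: field_simps)
      then have "Im (of_int m + of_int n * \<tau>) = 0" "Re (of_int m + of_int n * \<tau>) = 0" by simp_all
      then show ?thesis using im by auto
    qed
    have "d' * d + c' * b - 1 = 0 \<and> d' * c + c' * a = 0"
      by (rule indep) (use i1 in \<open>simp add: algebra_simps\<close>)
    moreover have "b' * d + a' * b = 0 \<and> b' * c + a' * a - 1 = 0"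
      by (rule indep) (use i2 in \<open>simp add: algebra_simps\<close>)
    moreover have "(a' * d' - b' * c') * (a * d - b * c) = (d' * d + c' * b) * (b' * c + a' * a) - (d' * c + c' * a) * (b' * d + a' * b)"
      if "True" for a b c d a' b' c' d' :: int by (simp add: algebra_simps)
    ultimately have "(a' * d' - b' * c') * (a * d - b * c) = 1" by simp
    then show ?thesis using det0 zmult_eq_1_iff[of "a' * d' - b' * c'" "a * d - b * c"] by linarith
  qed
  moreover have "\<tau>' = (of_int a * \<tau> + of_int b) / (of_int c * \<tau> + of_int d)"
    unfolding \<tau>'_def using T1 nz by simp
  ultimately show ?thesis using modular_orbit_eq[OF im] unfolding \<tau>_def \<tau>'_def by blast
qed

lemma lattice_class_eq_iff:
  "lattice_cong (period_lattice a b) `` {z} = lattice_cong (period_lattice a b) `` {w} \<longleftrightarrow> z - w \<in> period_lattice a b"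
proof
  assume "lattice_cong (period_lattice a b) `` {z} = lattice_cong (period_lattice a b) `` {w}"
  moreover have "w \<in> lattice_cong (period_lattice a b) `` {w}" by (simp add: lattice_cong_def period_lattice_0)
  ultimately show "z - w \<in> period_lattice a b" by (auto simp: lattice_cong_def)
next
  assume zw: "z - w \<in> period_lattice a b"
  have "z - u \<in> period_lattice a b \<longleftrightarrow> w - u \<in> period_lattice a b" for u
    using period_lattice_diff[OF _ zw, of "z - u"] period_lattice_add[OF zw, of "w - u"] by (auto simp: algebra_simps)
  then show "lattice_cong (period_lattice a b) `` {z} = lattice_cong (period_lattice a b) `` {w}"
    by (auto simp: lattice_cong_def)
qed

text \<open>A segment contained in a lattice, which is countable, is a point.\<close>

lemma segment_in_period_lattice:
  assumes "\<And>s::real. 0 \<le> s \<Longrightarrow> s \<le> 1 \<Longrightarrow> u + s *\<^sub>R w \<in> period_lattice a b"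
  shows "w = 0"
proof (rule ccontr)
  assume "w \<noteq> 0"
  have "(\<lambda>s::real. u + s *\<^sub>R w) ` {0..1} \<subseteq> period_lattice a b" using assms by auto
  then have "countable ((\<lambda>s::real. u + s *\<^sub>R w) ` {0..1})"
    using countable_period_lattice countable_subset by blast
  moreover have "inj_on (\<lambda>s::real. u + s *\<^sub>R w) {0..1}" using \<open>w \<noteq> 0\<close> by (auto simp: inj_on_def)
  ultimately have "countable {0..1::real}" by (rule countable_image_inj_on)
  then show False using uncountable_closed_interval[of 0 "1::real"] by simp
qed

text \<open>The ratio \<open>(C - A) / (B - A)\<close> is determined by its modulus, by its distance
  from 1 and by the sign of its imaginary part, all of which agree with those of
  \<open>c / b\<close>.\<close>

lemma congruent_triangles:
  assumes "dist A B = norm b" "dist B C = norm (c - b)" "dist C A = norm c"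
    and "Im ((C - A) / (B - A)) > 0" "Im (c * cnj b) > 0"
  obtains r :: complex where "norm r = 1" "B = A + r * b" "C = A + r * c"
proof -
  have nz: "b \<noteq> 0" "B - A \<noteq> 0" using assms(4,5) by auto
  define u where "u = (C - A) / (B - A)"
  define w where "w = c / b"
  have nu: "norm u = norm w" "norm (u - 1) = norm (w - 1)"
  proof -
    show "norm u = norm w" using assms(1,3) by (simp add: u_def w_def norm_divide dist_norm norm_minus_commute)
    have "u - 1 = (C - B) / (B - A)" "w - 1 = (c - b) / b"
      using nz by (simp_all add: u_def w_def diff_divide_distrib[symmetric] divide_eq_eq eq_divide_eq) (simp_all add: field_simps)
    then show "norm (u - 1) = norm (w - 1)"
      using assms(1,2) by (simp add: norm_divide dist_norm norm_minus_commute)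
  qed
  have "(norm (v - 1))\<^sup>2 = (norm v)\<^sup>2 - 2 * Re v + 1" for v :: complex
    unfolding cmod_power2 by (simp add: power2_eq_square algebra_simps)
  then have Re: "Re u = Re w" using nu by (metis add_right_cancel diff_left_imp_eq mult_cancel_left zero_neq_numeral)
  moreover have "(Im u)\<^sup>2 = (Im w)\<^sup>2" using nu(1) Re cmod_power2[of u] cmod_power2[of w] by simp
  moreover have "Im u > 0" using assms(4) by (simp add: u_def)
  moreover have "Im w > 0"
  proof -
    have "w = c * cnj b / of_real ((norm b)\<^sup>2)" unfolding w_def by (subst complex_div_cnj) simp
    then have "Im w = Im (c * cnj b) / (norm b)\<^sup>2" by (simp only: Im_divide_of_real)
    then show ?thesis using assms(5) nz(1) by (simp only:) (rule divide_pos_pos, auto)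
  qed
  ultimately have "u = w" by (simp add: complex_eq_iff power2_eq_iff_nonneg)
  then have "C - A = (B - A) / b * c" using nz by (simp add: u_def w_def field_simps)
  then have "C = A + (B - A) / b * c" by (simp add: algebra_simps)
  then show ?thesis
    using nz assms(1) by (intro that[of "(B - A) / b"]) (simp_all add: norm_divide dist_norm norm_minus_commute)
qed

text \<open>\<open>carrier_map\<close> wraps the plane around the triangulation; the vertex \<open>(i, j)\<close> has label \<open>i + 2 j\<close>.\<close>

definition carrier_map :: "real \<Rightarrow> real \<Rightarrow> real^8" where
  "carrier_map = plane_interp (\<lambda>i j. axis (of_int (i + 2 * j)) 1)"

lemma carrier_map_closed_cell:
  assumes "of_int i \<le> x" "x \<le> of_int i + 1" "of_int j \<le> y" "y \<le> of_int j + 1" and m: "m = of_int (i + 2 * j)"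
  shows "x - of_int i \<le> y - of_int j \<Longrightarrow> carrier_map x y = (1 - (y - of_int j)) *\<^sub>R axis m 1
      + ((y - of_int j) - (x - of_int i)) *\<^sub>R axis (m + 2) 1 + (x - of_int i) *\<^sub>R axis (m + 3) 1"
    and "y - of_int j \<le> x - of_int i \<Longrightarrow> carrier_map x y = (1 - (x - of_int i)) *\<^sub>R axis m 1
      + ((x - of_int i) - (y - of_int j)) *\<^sub>R axis (m + 1) 1 + (y - of_int j) *\<^sub>R axis (m + 3) 1"
proof -
  have l: "of_int (i + 2 * (j + 1)) = m + 2" "of_int (i + 1 + 2 * j) = m + 1" "of_int (i + 1 + 2 * (j + 1)) = m + 3"
    unfolding m by (simp_all add: add_ac)
  show "x - of_int i \<le> y - of_int j \<Longrightarrow> carrier_map x y = (1 - (y - of_int j)) *\<^sub>R axis m 1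
      + ((y - of_int j) - (x - of_int i)) *\<^sub>R axis (m + 2) 1 + (x - of_int i) *\<^sub>R axis (m + 3) 1"
    unfolding carrier_map_def plane_interp_closed_cell[OF assms(1-4)]
    by (simp only: cell_interp_upper l m[symmetric]) (simp add: algebra_simps)
  show "y - of_int j \<le> x - of_int i \<Longrightarrow> carrier_map x y = (1 - (x - of_int i)) *\<^sub>R axis m 1
      + ((x - of_int i) - (y - of_int j)) *\<^sub>R axis (m + 1) 1 + (y - of_int j) *\<^sub>R axis (m + 3) 1"
    unfolding carrier_map_def plane_interp_closed_cell[OF assms(1-4)]
    by (simp only: cell_interp_lower l m[symmetric]) (simp add: algebra_simps)
qed

lemma plane_point_cases:
  fixes x y :: real
  obtains (upper) i j :: int and m :: 8 where "of_int i \<le> x" "x \<le> of_int i + 1" "of_int j \<le> y" "y \<le> of_int j + 1"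
      "m = of_int (i + 2 * j)" "x - of_int i \<le> y - of_int j"
    | (lower) i j :: int and m :: 8 where "of_int i \<le> x" "x \<le> of_int i + 1" "of_int j \<le> y" "y \<le> of_int j + 1"
      "m = of_int (i + 2 * j)" "y - of_int j \<le> x - of_int i"
proof (cases "x - of_int \<lfloor>x\<rfloor> \<le> y - of_int \<lfloor>y\<rfloor>")
  case True
  show ?thesis by (rule upper[OF _ _ _ _ refl True]) linarith+
next
  case False
  show ?thesis by (rule lower[of "\<lfloor>x\<rfloor>" "\<lfloor>y\<rfloor>", OF _ _ _ _ refl]) (use False in linarith)+
qed

text \<open>A nonzero weight at \<open>l\<close> puts the point in the open star of a grid vertex
  with label \<open>l\<close>. The neighbours at offsets \<open>(1,0)\<close>, \<open>(0,1)\<close>,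
  \<open>(1,1)\<close> carry the labels \<open>l + 1\<close>, \<open>l + 2\<close>,
  \<open>l + 3\<close>, the opposite ones \<open>l + 7\<close>, \<open>l + 6\<close>,
  \<open>l + 5\<close>. So the weights determine the position relative to that vertex.\<close>

lemma carrier_map_recover:
  assumes "carrier_map x y $ l \<noteq> 0"
  shows "\<exists>i j. of_int (i + 2 * j) = l \<and>
      x = of_int i + (carrier_map x y $ (l + 1) + carrier_map x y $ (l + 3) - carrier_map x y $ (l + 7) - carrier_map x y $ (l + 5)) \<and>
      y = of_int j + (carrier_map x y $ (l + 2) + carrier_map x y $ (l + 3) - carrier_map x y $ (l + 6) - carrier_map x y $ (l + 5))"
proof (cases rule: plane_point_cases[of x y])
  case (upper i j m)
  note eq = carrier_map_closed_cell(1)[OF upper]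
  have "l = m \<or> l = m + 2 \<or> l = m + 3" using assms unfolding eq by (auto simp: axis_def split: if_splits)
  then show ?thesis
  proof (elim disjE)
    assume l: "l = m"
    show ?thesis unfolding l eq using upper(5)
      by (intro exI[of _ i] exI[of _ j]) (simp add: axis_def)
  next
    assume l: "l = m + 2"
    show ?thesis unfolding l eq using upper(5)
      by (intro exI[of _ i] exI[of _ "j + 1"]) (simp add: axis_def add.assoc)
  next
    assume l: "l = m + 3"
    show ?thesis unfolding l eq using upper(5)
      by (intro exI[of _ "i + 1"] exI[of _ "j + 1"]) (simp add: axis_def add.assoc)
  qed
next
  case (lower i j m)
  note eq = carrier_map_closed_cell(2)[OF lower]
  have "l = m \<or> l = m + 1 \<or> l = m + 3" using assms unfolding eq by (auto simp: axis_def split: if_splits)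
  then show ?thesis
  proof (elim disjE)
    assume l: "l = m"
    show ?thesis unfolding l eq using lower(5)
      by (intro exI[of _ i] exI[of _ j]) (simp add: axis_def)
  next
    assume l: "l = m + 1"
    show ?thesis unfolding l eq using lower(5)
      by (intro exI[of _ "i + 1"] exI[of _ j]) (simp add: axis_def add.assoc)
  next
    assume l: "l = m + 3"
    show ?thesis unfolding l eq using lower(5)
      by (intro exI[of _ "i + 1"] exI[of _ "j + 1"]) (simp add: axis_def add.assoc)
  qed
qed

text \<open>Three weights with sum 1 cannot all vanish. Relative to grid vertices with the label of
  a nonzero weight, both points have the same offset, and such vertices differ by a vector with
  \<open>a + 2 * b\<close> divisible by 8.\<close>

lemma carrier_map_eq_imp:
  assumes "carrier_map x y = carrier_map x' y'"
  shows "\<exists>a b c. x' = x + of_int a \<and> y' = y + of_int b \<and> a + 2 * b = 8 * c"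
proof -
  have "\<exists>l. carrier_map x y $ l \<noteq> 0"
  proof (cases rule: plane_point_cases[of x y])
    case (upper i j m)
    have "carrier_map x y $ m + carrier_map x y $ (m + 2) + carrier_map x y $ (m + 3) = 1"
      unfolding carrier_map_closed_cell(1)[OF upper] by (simp add: axis_def)
    then show ?thesis by (metis add_0 zero_neq_one)
  next
    case (lower i j m)
    have "carrier_map x y $ m + carrier_map x y $ (m + 1) + carrier_map x y $ (m + 3) = 1"
      unfolding carrier_map_closed_cell(2)[OF lower] by (simp add: axis_def)
    then show ?thesis by (metis add_0 zero_neq_one)
  qed
  then obtain l where l: "carrier_map x y $ l \<noteq> 0" by blast
  obtain i j where ij: "of_int (i + 2 * j) = l"
      "x = of_int i + (carrier_map x y $ (l + 1) + carrier_map x y $ (l + 3) - carrier_map x y $ (l + 7) - carrier_map x y $ (l + 5))"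
      "y = of_int j + (carrier_map x y $ (l + 2) + carrier_map x y $ (l + 3) - carrier_map x y $ (l + 6) - carrier_map x y $ (l + 5))"
    using carrier_map_recover[OF l] by blast
  obtain i' j' where ij': "of_int (i' + 2 * j') = l"
      "x' = of_int i' + (carrier_map x y $ (l + 1) + carrier_map x y $ (l + 3) - carrier_map x y $ (l + 7) - carrier_map x y $ (l + 5))"
      "y' = of_int j' + (carrier_map x y $ (l + 2) + carrier_map x y $ (l + 3) - carrier_map x y $ (l + 6) - carrier_map x y $ (l + 5))"
    using carrier_map_recover[of x' y' l] l unfolding assms[symmetric] by blast
  have "(i' + 2 * j') mod 8 = (i + 2 * j) mod 8" using ij(1) ij'(1) of_int_eq_8 by metis
  then have "8 dvd (i' + 2 * j') - (i + 2 * j)" by (simp only: mod_eq_dvd_iff)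
  then obtain c where "(i' + 2 * j') - (i + 2 * j) = 8 * c" by (elim dvdE)
  then have "(i' - i) + 2 * (j' - j) = 8 * c" by simp
  moreover have "x' = x + of_int (i' - i)" "y' = y + of_int (j' - j)" using ij(2,3) ij'(2,3) by simp_all
  ultimately show ?thesis by blast
qed

lemma carrier_map_shift:
  assumes "a + 2 * b = 8 * c"
  shows "carrier_map (x + of_int a) (y + of_int b) = carrier_map x y"
proof -
  have "of_int (i + a + 2 * (j + b)) = (of_int (i + 2 * j) :: 8)" for i j
  proof -
    have "i + a + 2 * (j + b) = i + 2 * j + 8 * c" using assms by simp
    then show ?thesis by (simp only: of_int_eq_8 mod_mult_self2)
  qed
  then have "plane_interp (\<lambda>i j. axis (of_int (i + 2 * j) :: 8) 1 :: real^8) (x + of_int a) (y + of_int b)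
      = plane_interp (\<lambda>i j. axis (of_int (i + 2 * j) :: 8) 1 :: real^8) x y + 0"
    by (intro plane_interp_shift) (simp only: add_0_right)
  then show ?thesis unfolding carrier_map_def by (simp only: add_0_right)
qed

lemma carrier_map_in_realization: "carrier_map x y \<in> realization"
proof (cases rule: plane_point_cases[of x y])
  case (upper i j m)
  have "carrier_map x y \<in> closed_simplex {m, m + 2, m + 3}"
    unfolding carrier_map_closed_cell(1)[OF upper]
    by (rule convex_axis_in_closed_simplex) (use upper in auto)
  then show ?thesis unfolding realization_def uniform_triangulation_def by blast
next
  case (lower i j m)
  have "carrier_map x y \<in> closed_simplex {m, m + 1, m + 3}"
    unfolding carrier_map_closed_cell(2)[OF lower]
    by (rule convex_axis_in_closed_simplex) (use lower in auto)
  then show ?thesis unfolding realization_def uniform_triangulation_def by blast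
qed

text \<open>The cell with lower left corner \<open>(n, 0)\<close> represents the triangles based at
  the label of \<open>n\<close>.\<close>

lemma carrier_map_upper:
  assumes "t \<in> closed_simplex {m, m + 2, m + 3}" "m = of_int n"
  shows "t = carrier_map (of_int n + t $ (m + 3)) (t $ (m + 2) + t $ (m + 3))"
proof -
  have s: "t $ m \<ge> 0" "t $ (m + 2) \<ge> 0" "t $ (m + 3) \<ge> 0" "t $ m + t $ (m + 2) + t $ (m + 3) = 1"
    "t = t $ m *\<^sub>R axis m 1 + t $ (m + 2) *\<^sub>R axis (m + 2) 1 + t $ (m + 3) *\<^sub>R axis (m + 3) 1"
    using closed_simplex_3[OF assms(1)] by simp_all
  have tm: "t $ m = 1 - (t $ (m + 2) + t $ (m + 3))" using s(4) by simp
  have "carrier_map (of_int n + t $ (m + 3)) (t $ (m + 2) + t $ (m + 3)) =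
     t $ m *\<^sub>R axis m 1 + t $ (m + 2) *\<^sub>R axis (m + 2) 1 + t $ (m + 3) *\<^sub>R axis (m + 3) 1"
    using s(1-4) assms(2) carrier_map_closed_cell(1)[of n "of_int n + t $ (m + 3)" 0 "t $ (m + 2) + t $ (m + 3)" m]
    by (simp add: tm)
  then show ?thesis using s(5) by simp
qed

lemma carrier_map_lower:
  assumes "t \<in> closed_simplex {m, m + 1, m + 3}" "m = of_int n"
  shows "t = carrier_map (of_int n + (t $ (m + 1) + t $ (m + 3))) (t $ (m + 3))"
proof -
  have s: "t $ m \<ge> 0" "t $ (m + 1) \<ge> 0" "t $ (m + 3) \<ge> 0" "t $ m + t $ (m + 1) + t $ (m + 3) = 1"
    "t = t $ m *\<^sub>R axis m 1 + t $ (m + 1) *\<^sub>R axis (m + 1) 1 + t $ (m + 3) *\<^sub>R axis (m + 3) 1"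
    using closed_simplex_3[OF assms(1)] by simp_all
  have tm: "t $ m = 1 - (t $ (m + 1) + t $ (m + 3))" using s(4) by simp
  have "carrier_map (of_int n + (t $ (m + 1) + t $ (m + 3))) (t $ (m + 3)) =
     t $ m *\<^sub>R axis m 1 + t $ (m + 1) *\<^sub>R axis (m + 1) 1 + t $ (m + 3) *\<^sub>R axis (m + 3) 1"
    using s(1-4) assms(2) carrier_map_closed_cell(2)[of n "of_int n + (t $ (m + 1) + t $ (m + 3))" 0 "t $ (m + 3)" m]
    by (simp add: tm)
  then show ?thesis using s(5) by simp
qed

lemma carrier_map_onto:
  assumes "t \<in> realization" obtains x y where "t = carrier_map x y"
proof -
  obtain m where "t \<in> closed_simplex {m, m + 1, m + 3} \<or> t \<in> closed_simplex {m, m + 2, m + 3}"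
    using assms unfolding realization_def uniform_triangulation_def by blast
  moreover obtain n where "m = of_int n" using ex_of_int_8 by blast
  ultimately show ?thesis using carrier_map_lower carrier_map_upper that by blast
qed

section \<open>The developing map, the flat isometry it induces, and uniqueness of the
  lattice\<close>

context flat_data
begin

text \<open>\<open>period1\<close> compares the edge from 0 to 2 with the path through 1, and
  \<open>period2\<close> is the loop through all eight vertices. In the grid they are the
  translations by \<open>(-2, 1)\<close> and \<open>(8, 0)\<close>, which generate those preserving
  the labels.\<close>

definition period1 :: complex where "period1 = e2 0 - e1 0 - e1 1"
definition period2 :: complex where "period2 = (\<Sum>v\<in>UNIV. e1 v)"

text \<open>The developed position of the grid vertex \<open>(n, 0)\<close>. Quotient and remainder
  extend the partial sums of \<open>e1\<close> to negative \<open>n\<close>.\<close>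

definition zeta :: "int \<Rightarrow> complex" where
  "zeta n = of_int (n div 8) * period2 + (\<Sum>k<nat (n mod 8). e1 (of_nat k))"

definition vert :: "int \<Rightarrow> int \<Rightarrow> complex" where
  "vert i j = zeta (i + 2 * j) + of_int j * period1"

definition developing :: "real \<Rightarrow> real \<Rightarrow> complex" where
  "developing = plane_interp vert"

lemma zeta_0: "zeta 0 = 0" by (simp add: zeta_def)

lemma zeta_step: "zeta (n + 1) = zeta n + e1 (of_int n)"
proof -
  have r: "0 \<le> n mod 8" "n mod 8 < 8" by simp_all
  have P: "period2 = (\<Sum>k<8. e1 (of_nat k))"
    unfolding period2_def UNIV_8 by (simp add: eval_nat_numeral lessThan_Suc add_ac)
  show ?thesis
  proof (cases "n mod 8 = 7")
    case True
    then have "(n + 1) mod 8 = 0" "(n + 1) div 8 = n div 8 + 1" by presburger+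
    moreover have "(of_int n :: 8) = 7" unfolding of_int_mod_8 True by simp
    ultimately show ?thesis using True by (simp add: zeta_def P eval_nat_numeral lessThan_Suc algebra_simps)
  next
    case False
    then have m: "(n + 1) mod 8 = n mod 8 + 1" "(n + 1) div 8 = n div 8" using r by presburger+
    have "nat (n mod 8 + 1) = Suc (nat (n mod 8))" using r by simp
    then show ?thesis by (simp add: zeta_def m of_int_mod_8[of n])
  qed
qed

lemma zeta_add_8: "zeta (n + 8 * c) = zeta n + of_int c * period2"
  by (simp add: zeta_def algebra_simps)

text \<open>The two triangles at \<open>v\<close> close up, so
  \<open>e2 v - e1 v - e1 (v + 1)\<close> does not change from \<open>v\<close> to
  \<open>v + 1\<close>.\<close>

lemma period1: "e2 v = e1 v + e1 (v + 1) + period1"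
proof -
  have step: "e2 (v + 1) - e1 (v + 1) - e1 (v + 1 + 1) = e2 v - e1 v - e1 (v + 1)" for v
  proof -
    have "e2 v + e1 (v + 2) = e1 v + e2 (v + 1)" using e3_upper[of v] e3_lower[of v] by simp
    then show ?thesis by (simp add: algebra_simps)
  qed
  have "e2 (of_nat n) - e1 (of_nat n) - e1 (of_nat n + 1) = period1" for n
  proof (induction n)
    case 0 then show ?case by (simp add: period1_def)
  next
    case (Suc n) then show ?case using step[of "of_nat n"] by (simp add: add.commute)
  qed
  moreover obtain n where "v = of_nat n" using ex_of_nat_8 by blast
  ultimately show ?thesis by (metis add.commute diff_add_cancel diff_diff_eq)
qed

lemma vert_right: "vert (i + 1) j - vert i j = e1 (of_int (i + 2 * j))"
proof -
  have "i + 1 + 2 * j = (i + 2 * j) + 1" by simp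
  then show ?thesis by (simp only: vert_def zeta_step) simp
qed

lemma vert_up: "vert i (j + 1) - vert i j = e2 (of_int (i + 2 * j))"
proof -
  have "i + 2 * (j + 1) = (i + 2 * j) + 1 + 1" by simp
  then have "vert i (j + 1) = zeta (i + 2 * j) + e1 (of_int (i + 2 * j)) + e1 (of_int (i + 2 * j + 1)) + of_int (j + 1) * period1"
    by (simp only: vert_def zeta_step)
  then show ?thesis using period1[of "of_int (i + 2 * j)"] by (simp add: vert_def algebra_simps)
qed

lemma vert_diagonal: "vert (i + 1) (j + 1) - vert i j = e3 (of_int (i + 2 * j))"
proof -
  have "of_int (i + 1 + 2 * j) = (of_int (i + 2 * j) + 1 :: 8)" by simp
  then have "vert (i + 1) (j + 1) - vert (i + 1) j = e2 (of_int (i + 2 * j) + 1)" using vert_up[of "i + 1" j] by (simp only:)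
  then show ?thesis using vert_right[of i j] e3_lower[of "of_int (i + 2 * j)"] by (simp add: algebra_simps)
qed

lemma developing_inj: "developing x y = developing x' y' \<Longrightarrow> x = x' \<and> y = y'"
  unfolding developing_def
  by (rule plane_interp_inj[where V = vert and ?n1.0 = n1 and ?n2.0 = n2 and ?n3.0 = n3])
    (simp_all only: vert_right vert_up vert_diagonal n1 n2 n3)

lemma developing_shift:
  assumes "a + 2 * b = 8 * c"
  shows "developing (x + of_int a) (y + of_int b) = developing x y + (of_int c * period2 + of_int b * period1)"
  unfolding developing_def
proof (rule plane_interp_shift)
  fix i j
  have "i + a + 2 * (j + b) = i + 2 * j + 8 * c" using assms by simp
  then show "vert (i + a) (j + b) = vert i j + (of_int c * period2 + of_int b * period1)"
    by (simp only: vert_def zeta_add_8) (simp add: algebra_simps)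
qed

lemma im_periods: "Im (period2 * cnj period1) > 0" "Im (period2 / period1) > 0" "period1 \<noteq> 0"
proof -
  show 1: "Im (period2 * cnj period1) > 0" using periods by (simp only: period1_def period2_def)
  then show 3: "period1 \<noteq> 0" by auto
  have "period2 / period1 = period2 * cnj period1 / of_real ((norm period1)\<^sup>2)" by (subst complex_div_cnj) simp
  then have "Im (period2 / period1) = Im (period2 * cnj period1) / (norm period1)\<^sup>2" by (simp only: Im_divide_of_real)
  then show "Im (period2 / period1) > 0" using 1 3 by (simp only:) (rule divide_pos_pos, auto)
qed

text \<open>The linear map with the same periods sends \<open>(1, 0)\<close> to
  \<open>period2 / 8\<close> and \<open>(0, 1)\<close> to \<open>period1 + period2 / 4\<close>. The
  developing map stays within \<open>K\<close> of it, since at the grid vertices the difference is a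
  partial sum of at most seven edges minus a fraction of \<open>period2\<close>.\<close>

lemma developing_surj: "\<exists>x y. developing x y = z"
proof -
  let ?P = "period2 / 8" and ?Q = "period1 + period2 / 4"
  define A where "A w = Re w *\<^sub>R ?P + Im w *\<^sub>R ?Q" for w
  define K where "K = (\<Sum>v\<in>UNIV. norm (e1 v)) + norm period2"
  have lin: "linear A" unfolding A_def by (rule linearI) (simp_all add: algebra_simps)
  have det: "Im (?P * cnj ?Q) > 0" using im_periods(1) by (simp add: algebra_simps)
  have "inj A"
  proof (rule linear_injective_0[OF lin, THEN iffD2], intro allI impI)
    fix w assume "A w = 0"
    then have "A w * cnj ?Q = 0" by simp
    then have "Re w *\<^sub>R (?P * cnj ?Q) + Im w *\<^sub>R (?Q * cnj ?Q) = 0"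
      unfolding A_def by (simp only: distrib_right mult_scaleR_left)
    then have "Im (Re w *\<^sub>R (?P * cnj ?Q) + Im w *\<^sub>R (?Q * cnj ?Q)) = 0" by simp
    moreover have "Im (x *\<^sub>R (P * cnj Q) + y *\<^sub>R (Q * cnj Q)) = x * Im (P * cnj Q)" for x y P Q
      by (simp add: algebra_simps)
    ultimately have "Re w * Im (?P * cnj ?Q) = 0" by (simp only:)
    then have "Re w = 0" using det by simp
    moreover have "?Q \<noteq> 0"
    proof
      assume "?Q = 0"
      show False using det unfolding \<open>?Q = 0\<close> by simp
    qed
    moreover have "Im w *\<^sub>R ?Q = 0" using \<open>A w = 0\<close> \<open>Re w = 0\<close> unfolding A_def by simp
    then have "Im w = 0 \<or> ?Q = 0" by (simp only: scaleR_eq_0_iff)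
    ultimately have "Re w = 0" "Im w = 0" by blast+
    then show "w = 0" by (simp add: complex_eq_iff)
  qed
  have near: "norm (vert i j - (of_int i *\<^sub>R ?P + of_int j *\<^sub>R ?Q)) \<le> K" for i j
  proof -
    define n where "n = i + 2 * j"
    define q where "q = n div 8"
    define r where "r = n mod 8"
    have n: "n = 8 * q + r" "0 \<le> r" "r < 8" by (simp_all add: q_def r_def)
    have "vert i j - (of_int i *\<^sub>R ?P + of_int j *\<^sub>R ?Q) = zeta n - (of_int n / 8) * period2"
      by (simp add: vert_def n_def scaleR_conv_of_real field_simps)
    also have "zeta n = of_int q * period2 + (\<Sum>k<nat r. e1 (of_nat k))" by (simp add: zeta_def q_def r_def)
    also have "of_int n / 8 = of_int q + of_int r / (8::complex)" using n(1) by simp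
    finally have "vert i j - (of_int i *\<^sub>R ?P + of_int j *\<^sub>R ?Q) = (\<Sum>k<nat r. e1 (of_nat k)) - (of_int r / 8) * period2"
      by (simp add: algebra_simps)
    moreover have "norm (\<Sum>k<nat r. e1 (of_nat k)) \<le> (\<Sum>v\<in>UNIV. norm (e1 v))"
    proof -
      have inj: "inj_on (of_nat :: nat \<Rightarrow> 8) {..<nat r}"
      proof (rule inj_onI)
        fix a b assume "a \<in> {..<nat r}" "b \<in> {..<nat r}" "of_nat a = (of_nat b :: 8)"
        then show "a = b" using of_nat_neq[of a b] of_nat_neq[of b a] n(3) by (metis lessThan_iff linorder_neqE_nat nat_less_iff n(2) less_trans of_nat_less_iff of_nat_numeral)
      qed
      have "norm (\<Sum>k<nat r. e1 (of_nat k)) \<le> (\<Sum>k<nat r. norm (e1 (of_nat k)))" by (rule norm_sum)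
      also have "\<dots> = (\<Sum>v\<in>of_nat ` {..<nat r}. norm (e1 v))" by (simp add: sum.reindex[OF inj])
      also have "\<dots> \<le> (\<Sum>v\<in>UNIV. norm (e1 v))" by (rule sum_mono2) auto
      finally show ?thesis .
    qed
    moreover have "norm ((of_int r / 8) * period2) \<le> norm period2"
    proof -
      have "norm (of_int r / 8 :: complex) \<le> 1" using n by (simp add: norm_divide)
      then have "norm (of_int r / 8 :: complex) * norm period2 \<le> 1 * norm period2" by (rule mult_right_mono) simp
      then show ?thesis unfolding norm_mult by simp
    qed
    ultimately show ?thesis unfolding K_def by (metis norm_triangle_ineq4 add_mono order_trans)
  qed
  have "\<exists>w. plane_interp vert (Re w) (Im w) = z"
  proof (rule surj_near_linear[where A = A and K = K])
    have "continuous_on UNIV (\<lambda>w. plane_interp vert (fst (Re w, Im w)) (snd (Re w, Im w)))"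
      by (rule continuous_on_compose2[OF continuous_on_plane_interp]) (auto intro!: continuous_intros)
    then show "continuous_on UNIV (\<lambda>w. plane_interp vert (Re w) (Im w))" by simp
    show "norm (plane_interp vert (Re w) (Im w) - A w) \<le> K" for w
      unfolding A_def by (rule plane_interp_near_linear) (rule near)
  qed fact+
  then show ?thesis unfolding developing_def by blast
qed

abbreviation periods_lattice :: "complex set" where "periods_lattice \<equiv> period_lattice period1 period2"

text \<open>Equivariance gives one direction. In the other, a lattice vector is realized by a grid
  translation, and injectivity of the developing map identifies the points.\<close>

lemma developing_class_iff:
  "carrier_map x y = carrier_map x' y' \<longleftrightarrow> developing x y - developing x' y' \<in> periods_lattice"
proof
  assume "carrier_map x y = carrier_map x' y'"
  then obtain a b c where "x = x' + of_int a" "y = y' + of_int b" "a + 2 * b = 8 * c"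
    using carrier_map_eq_imp[of x' y' x y] by auto
  then show "developing x y - developing x' y' \<in> periods_lattice"
    using developing_shift[of a b c x' y'] by (intro period_latticeI[of _ b _ c]) simp
next
  assume "developing x y - developing x' y' \<in> periods_lattice"
  then obtain b c :: int where bc: "developing x y - developing x' y' = of_int b * period1 + of_int c * period2"
    by (elim period_latticeE)
  have e: "(8 * c - 2 * b) + 2 * b = 8 * c" by simp
  have "developing x y = developing (x' + of_int (8 * c - 2 * b)) (y' + of_int b)"
    unfolding developing_shift[OF e] using bc by (simp add: algebra_simps)
  then have "x = x' + of_int (8 * c - 2 * b)" "y = y' + of_int b" using developing_inj by blast+
  then show "carrier_map x y = carrier_map x' y'" using carrier_map_shift[OF e] by simp
qed

text \<open>The developing map passed to the quotient. \<open>developing_class_iff\<close> makes it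
  independent of the chosen preimage and also injective.\<close>

definition flat_map :: "real^8 \<Rightarrow> complex set" where
  "flat_map t = (THE c. \<exists>x y. t = carrier_map x y \<and> c = lattice_cong periods_lattice `` {developing x y})"

lemma flat_map: "flat_map (carrier_map x y) = lattice_cong periods_lattice `` {developing x y}"
  unfolding flat_map_def
proof (rule the_equality)
  show "\<exists>x' y'. carrier_map x y = carrier_map x' y' \<and>
      lattice_cong periods_lattice `` {developing x y} = lattice_cong periods_lattice `` {developing x' y'}" by blast
  fix c assume "\<exists>x' y'. carrier_map x y = carrier_map x' y' \<and> c = lattice_cong periods_lattice `` {developing x' y'}"
  then show "c = lattice_cong periods_lattice `` {developing x y}"
    using developing_class_iff lattice_class_eq_iff by metis
qed

lemma bij_betw_flat_map: "bij_betw flat_map realization (flat_torus periods_lattice)"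
proof (rule bij_betw_imageI)
  show "inj_on flat_map realization"
  proof (rule inj_onI)
    fix t t' assume t: "t \<in> realization" "t' \<in> realization" and eq: "flat_map t = flat_map t'"
    obtain x y where xy: "t = carrier_map x y" using carrier_map_onto[OF t(1)] .
    obtain x' y' where xy': "t' = carrier_map x' y'" using carrier_map_onto[OF t(2)] .
    show "t = t'" using eq unfolding xy xy' flat_map lattice_class_eq_iff developing_class_iff .
  qed
  show "flat_map ` realization = flat_torus periods_lattice"
  proof
    show "flat_map ` realization \<subseteq> flat_torus periods_lattice"
    proof (rule image_subsetI)
      fix t assume "t \<in> realization"
      then obtain x y where "t = carrier_map x y" by (rule carrier_map_onto)
      then show "flat_map t \<in> flat_torus periods_lattice"
        by (simp add: flat_map flat_torus_def quotientI)
    qed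
    show "flat_torus periods_lattice \<subseteq> flat_map ` realization"
    proof
      fix c assume "c \<in> flat_torus periods_lattice"
      then obtain z where z: "c = lattice_cong periods_lattice `` {z}" by (auto simp: flat_torus_def elim: quotientE)
      obtain x y where "developing x y = z" using developing_surj by blast
      then have "c = flat_map (carrier_map x y)" by (simp add: flat_map z)
      then show "c \<in> flat_map ` realization" using carrier_map_in_realization by blast
    qed
  qed
qed

lemma developing_closed_cell:
  assumes "of_int i \<le> x" "x \<le> of_int i + 1" "of_int j \<le> y" "y \<le> of_int j + 1" and m: "m = of_int (i + 2 * j)"
  shows "x - of_int i \<le> y - of_int j \<Longrightarrow> developing x y = vert i j
      + ((y - of_int j) - (x - of_int i)) *\<^sub>R e2 m + (x - of_int i) *\<^sub>R e3 m"
    and "y - of_int j \<le> x - of_int i \<Longrightarrow> developing x y = vert i j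
      + ((x - of_int i) - (y - of_int j)) *\<^sub>R e1 m + (y - of_int j) *\<^sub>R e3 m"
proof -
  have d: "vert i (j + 1) = vert i j + e2 m" "vert (i + 1) j = vert i j + e1 m" "vert (i + 1) (j + 1) = vert i j + e3 m"
    using vert_up[of i j] vert_right[of i j] vert_diagonal[of i j] unfolding m by (simp_all add: algebra_simps)
  show "x - of_int i \<le> y - of_int j \<Longrightarrow> developing x y = vert i j
      + ((y - of_int j) - (x - of_int i)) *\<^sub>R e2 m + (x - of_int i) *\<^sub>R e3 m"
    unfolding developing_def plane_interp_closed_cell[OF assms(1-4)]
    by (simp only: cell_interp_upper d) (simp add: algebra_simps)
  show "y - of_int j \<le> x - of_int i \<Longrightarrow> developing x y = vert i j
      + ((x - of_int i) - (y - of_int j)) *\<^sub>R e1 m + (y - of_int j) *\<^sub>R e3 m"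
    unfolding developing_def plane_interp_closed_cell[OF assms(1-4)]
    by (simp only: cell_interp_lower d) (simp add: algebra_simps)
qed

lemma flat_map_upper:
  assumes t: "t \<in> closed_simplex {m, m + 2, m + 3}" and m: "m = of_int n"
  shows "flat_map t = lattice_cong periods_lattice `` {zeta n + t $ (m + 2) *\<^sub>R e2 m + t $ (m + 3) *\<^sub>R e3 m}"
proof -
  have s: "t $ m \<ge> 0" "t $ (m + 2) \<ge> 0" "t $ (m + 3) \<ge> 0" "t $ m + t $ (m + 2) + t $ (m + 3) = 1"
    using closed_simplex_3[OF t] by simp_all
  have "developing (of_int n + t $ (m + 3)) (t $ (m + 2) + t $ (m + 3)) = zeta n + t $ (m + 2) *\<^sub>R e2 m + t $ (m + 3) *\<^sub>R e3 m"
    using s m developing_closed_cell(1)[of n "of_int n + t $ (m + 3)" 0 "t $ (m + 2) + t $ (m + 3)" m]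
    by (simp add: vert_def)
  then show ?thesis using flat_map carrier_map_upper[OF t m] by metis
qed

lemma flat_map_lower:
  assumes t: "t \<in> closed_simplex {m, m + 1, m + 3}" and m: "m = of_int n"
  shows "flat_map t = lattice_cong periods_lattice `` {zeta n + t $ (m + 1) *\<^sub>R e1 m + t $ (m + 3) *\<^sub>R e3 m}"
proof -
  have s: "t $ m \<ge> 0" "t $ (m + 1) \<ge> 0" "t $ (m + 3) \<ge> 0" "t $ m + t $ (m + 1) + t $ (m + 3) = 1"
    using closed_simplex_3[OF t] by simp_all
  have "developing (of_int n + (t $ (m + 1) + t $ (m + 3))) (t $ (m + 3)) = zeta n + t $ (m + 1) *\<^sub>R e1 m + t $ (m + 3) *\<^sub>R e3 m"
    using s m developing_closed_cell(2)[of n "of_int n + (t $ (m + 1) + t $ (m + 3))" 0 "t $ (m + 3)" m]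
    by (simp add: vert_def)
  then show ?thesis using flat_map carrier_map_lower[OF t m] by metis
qed

lemma side_lengths:
  "dist (p $ (v + 2)) (p $ (v + 3)) = norm (e3 v - e2 v)" "dist (p $ (v + 3)) (p $ (v + 1)) = norm (e1 v - e3 v)"
proof -
  have s: "v + 2 + 1 = v + 3" "v + 1 + 2 = v + 3" by simp_all
  show "dist (p $ (v + 2)) (p $ (v + 3)) = norm (e3 v - e2 v)" using dist1[of "v + 2"] e3_upper[of v] unfolding s by simp
  have "e1 v - e3 v = - e2 (v + 1)" using e3_lower[of v] by simp
  then show "dist (p $ (v + 3)) (p $ (v + 1)) = norm (e1 v - e3 v)" using dist2[of "v + 1"] unfolding s by (simp add: dist_commute)
qed

lemma Im_quotient_pos_iff: "Im (c / b) > 0 \<longleftrightarrow> Im (c * cnj b) > 0" for b c :: complex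
proof (cases "b = 0")
  case False
  have "c / b = c * cnj b / of_real ((norm b)\<^sup>2)" by (subst complex_div_cnj) simp
  then have "Im (c / b) = Im (c * cnj b) / (norm b)\<^sup>2" by (simp only: Im_divide_of_real)
  then show ?thesis using False by (simp add: zero_less_divide_iff del: times_complex.sel)
qed simp

text \<open>The condition on a positive triple is invariant under cyclic rotation, so the two
  triples starting at each vertex suffice.\<close>

lemma flat_isometry_flat_map: "flat_isometry p periods_lattice flat_map"
proof -
  define G where "G = (\<lambda>(a, b, c). \<exists>A B C. dist A B = dist (p $ a) (p $ b) \<and> dist B C = dist (p $ b) (p $ c) \<and>
        dist C A = dist (p $ c) (p $ a) \<and> 0 < Im ((C - A) / (B - A)) \<and>
        (\<forall>t \<in> closed_simplex {a, b, c}.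
           flat_map t = lattice_cong periods_lattice `` {t $ a *\<^sub>R A + t $ b *\<^sub>R B + t $ c *\<^sub>R C}))"
  have cyc: "G (b, c, a)" if G: "G (a, b, c)" for a b c
  proof -
    obtain A B C where 1: "dist A B = dist (p $ a) (p $ b)" "dist B C = dist (p $ b) (p $ c)"
        "dist C A = dist (p $ c) (p $ a)" "0 < Im ((C - A) / (B - A))"
        "\<forall>t \<in> closed_simplex {a, b, c}.
           flat_map t = lattice_cong periods_lattice `` {t $ a *\<^sub>R A + t $ b *\<^sub>R B + t $ c *\<^sub>R C}"
      using G unfolding G_def prod.case by blast
    have "Im ((A - B) / (C - B)) > 0"
      using 1(4) unfolding Im_quotient_pos_iff by (simp add: algebra_simps)
    moreover have "{b, c, a} = {a, b, c}" by auto
    moreover have "t $ b *\<^sub>R B + t $ c *\<^sub>R C + t $ a *\<^sub>R A = t $ a *\<^sub>R A + t $ b *\<^sub>R B + t $ c *\<^sub>R C" for t :: "real^8"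
      by simp
    ultimately show ?thesis using 1 unfolding G_def
      by (simp only: prod.case) (rule exI[of _ B], rule exI[of _ C], rule exI[of _ A], simp add: add_ac)
  qed
  have U: "G (v, v + 2, v + 3)" for v
  proof -
    obtain n where n: "v = of_int n" using ex_of_int_8 by blast
    have "flat_map t = lattice_cong periods_lattice `` {t $ v *\<^sub>R zeta n + t $ (v + 2) *\<^sub>R (zeta n + e2 v) + t $ (v + 3) *\<^sub>R (zeta n + e3 v)}"
      if t: "t \<in> closed_simplex {v, v + 2, v + 3}" for t
    proof -
      have "t $ v + t $ (v + 2) + t $ (v + 3) = 1" using closed_simplex_3(4)[OF t] by simp
      then have "zeta n = t $ v *\<^sub>R zeta n + t $ (v + 2) *\<^sub>R zeta n + t $ (v + 3) *\<^sub>R zeta n" by (metis scaleR_add_left scaleR_one)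
      then have "t $ v *\<^sub>R zeta n + t $ (v + 2) *\<^sub>R (zeta n + e2 v) + t $ (v + 3) *\<^sub>R (zeta n + e3 v) = zeta n + t $ (v + 2) *\<^sub>R e2 v + t $ (v + 3) *\<^sub>R e3 v"
        by (simp add: algebra_simps)
      then show ?thesis using flat_map_upper[OF t n] by simp
    qed
    then show ?thesis unfolding G_def prod.case
      using upper[of v] dist2[of v] dist3[of v] side_lengths(1)[of v]
      by (intro exI[of _ "zeta n"] exI[of _ "zeta n + e2 v"] exI[of _ "zeta n + e3 v"])
        (auto simp: Im_quotient_pos_iff dist_norm norm_minus_commute simp del: times_complex.sel)
  qed
  have D: "G (v, v + 3, v + 1)" for v
  proof -
    obtain n where n: "v = of_int n" using ex_of_int_8 by blast
    have "flat_map t = lattice_cong periods_lattice `` {t $ v *\<^sub>R zeta n + t $ (v + 3) *\<^sub>R (zeta n + e3 v) + t $ (v + 1) *\<^sub>R (zeta n + e1 v)}"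
      if t0: "t \<in> closed_simplex {v, v + 3, v + 1}" for t
    proof -
      have t: "t \<in> closed_simplex {v, v + 1, v + 3}" using t0 by (simp add: insert_commute)
      have "t $ v + t $ (v + 3) + t $ (v + 1) = 1" using closed_simplex_3(4)[OF t] by simp
      then have "zeta n = t $ v *\<^sub>R zeta n + t $ (v + 3) *\<^sub>R zeta n + t $ (v + 1) *\<^sub>R zeta n" by (metis scaleR_add_left scaleR_one)
      then have "t $ v *\<^sub>R zeta n + t $ (v + 3) *\<^sub>R (zeta n + e3 v) + t $ (v + 1) *\<^sub>R (zeta n + e1 v) = zeta n + t $ (v + 1) *\<^sub>R e1 v + t $ (v + 3) *\<^sub>R e3 v"
        by (simp add: algebra_simps)
      then show ?thesis using flat_map_lower[OF t n] by simp
    qed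
    then show ?thesis unfolding G_def prod.case
      using lower[of v] dist1[of v] dist3[of v] side_lengths(2)[of v]
      by (intro exI[of _ "zeta n"] exI[of _ "zeta n + e3 v"] exI[of _ "zeta n + e1 v"])
        (auto simp: Im_quotient_pos_iff dist_norm norm_minus_commute simp del: times_complex.sel)
  qed
  have "\<forall>T\<in>positive_triples. G T"
    unfolding positive_triples_def using U D cyc[OF U] cyc[OF cyc[OF U]] cyc[OF D] cyc[OF cyc[OF D]] by blast
  then show ?thesis unfolding flat_isometry_def G_def using bij_betw_flat_map by blast
qed

text \<open>Adjacent triangles of another flat isometry are developed by the same rotation \<open>r\<close>.\<close>

lemma flat_isometry_lifts:
  assumes g: "flat_isometry p \<Lambda> g" and \<Lambda>: "\<Lambda> = period_lattice M1 M2"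
  obtains r \<alpha> where "norm r = 1"
    "\<And>v t. t \<in> closed_simplex {v, v + 2, v + 3} \<Longrightarrow> g t = lattice_cong \<Lambda> `` {\<alpha> v + r * (t $ (v + 2) *\<^sub>R e2 v + t $ (v + 3) *\<^sub>R e3 v)}"
    "\<And>v t. t \<in> closed_simplex {v, v + 1, v + 3} \<Longrightarrow> g t = lattice_cong \<Lambda> `` {\<alpha> v + r * (t $ (v + 1) *\<^sub>R e1 v + t $ (v + 3) *\<^sub>R e3 v)}"
    "\<And>v. \<alpha> (v + 1) - (\<alpha> v + r * e1 v) \<in> \<Lambda>" "\<And>v. \<alpha> (v + 2) - (\<alpha> v + r * e2 v) \<in> \<Lambda>"
proof -
  have lifts: "\<exists>A r. norm r = 1 \<and> (\<forall>t\<in>closed_simplex {a, b, c}. g t = lattice_cong \<Lambda> `` {A + r * (t $ b *\<^sub>R x + t $ c *\<^sub>R y)})"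
    if T: "(a, b, c) \<in> positive_triples" "a \<noteq> b" "a \<noteq> c" "b \<noteq> c" and d: "dist (p $ a) (p $ b) = norm x"
      "dist (p $ b) (p $ c) = norm (y - x)" "dist (p $ a) (p $ c) = norm y" "Im (y * cnj x) > 0" for a b c x y
  proof -
    obtain A B C where 1: "dist A B = dist (p $ a) (p $ b)" "dist B C = dist (p $ b) (p $ c)"
        "dist C A = dist (p $ c) (p $ a)" "0 < Im ((C - A) / (B - A))"
        "\<forall>t \<in> closed_simplex {a, b, c}. g t = lattice_cong \<Lambda> `` {t $ a *\<^sub>R A + t $ b *\<^sub>R B + t $ c *\<^sub>R C}"
      using g T(1) unfolding flat_isometry_def by fast
    obtain r where r: "norm r = 1" "B = A + r * x" "C = A + r * y"
      by (rule congruent_triangles[of A B x C y]) (use 1 d in \<open>simp_all add: dist_commute\<close>)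
    have "t $ a *\<^sub>R A + t $ b *\<^sub>R B + t $ c *\<^sub>R C = A + r * (t $ b *\<^sub>R x + t $ c *\<^sub>R y)"
      if t: "t \<in> closed_simplex {a, b, c}" for t
    proof -
      have "t $ a + t $ b + t $ c = 1" using closed_simplex_3(4)[OF t T(2-4)] .
      then have "A = t $ a *\<^sub>R A + t $ b *\<^sub>R A + t $ c *\<^sub>R A" by (metis scaleR_add_left scaleR_one)
      then show ?thesis unfolding r by (simp add: algebra_simps)
    qed
    then show ?thesis using r(1) 1(5) by (intro exI[of _ A] exI[of _ r]) simp
  qed
  have P: "(v, v + 2, v + 3) \<in> positive_triples" "(v, v + 3, v + 1) \<in> positive_triples" for v
    unfolding positive_triples_def by blast+
  have "\<exists>A r. norm r = 1 \<and> (\<forall>t\<in>closed_simplex {v, v + 2, v + 3}. g t = lattice_cong \<Lambda> `` {A + r * (t $ (v + 2) *\<^sub>R e2 v + t $ (v + 3) *\<^sub>R e3 v)})" for v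
    by (rule lifts[OF P(1)]) (use dist2[of v] dist3[of v] side_lengths(1)[of v] upper[of v] in \<open>simp_all del: times_complex.sel\<close>)
  then obtain \<alpha> r where \<alpha>: "\<And>v. norm (r v) = 1" "\<And>v t. t \<in> closed_simplex {v, v + 2, v + 3} \<Longrightarrow>
      g t = lattice_cong \<Lambda> `` {\<alpha> v + r v * (t $ (v + 2) *\<^sub>R e2 v + t $ (v + 3) *\<^sub>R e3 v)}" by metis
  have "\<exists>A r. norm r = 1 \<and> (\<forall>t\<in>closed_simplex {v, v + 3, v + 1}. g t = lattice_cong \<Lambda> `` {A + r * (t $ (v + 3) *\<^sub>R e3 v + t $ (v + 1) *\<^sub>R e1 v)})" for v
    by (rule lifts[OF P(2)]) (use dist1[of v] dist3[of v] side_lengths(2)[of v] lower[of v] in \<open>simp_all del: times_complex.sel\<close>)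
  then obtain \<beta> q where \<beta>: "\<And>v. norm (q v) = 1" "\<And>v t. t \<in> closed_simplex {v, v + 3, v + 1} \<Longrightarrow>
      g t = lattice_cong \<Lambda> `` {\<beta> v + q v * (t $ (v + 3) *\<^sub>R e3 v + t $ (v + 1) *\<^sub>R e1 v)}" by metis
  define seg :: "8 \<Rightarrow> 8 \<Rightarrow> real \<Rightarrow> real^8" where "seg a b s = (1 - s) *\<^sub>R axis a 1 + s *\<^sub>R axis b 1" for a b s
  have seg_in: "seg a b s \<in> closed_simplex {a, b, c}" if "0 \<le> s" "s \<le> 1" "a \<noteq> b" "a \<noteq> c" "b \<noteq> c" for a b c s
    using convex_axis_in_closed_simplex[of "1 - s" s 0 a b c] that by (simp add: seg_def)
  have seg_nth: "a \<noteq> b \<Longrightarrow> seg a b s $ a = 1 - s" "a \<noteq> b \<Longrightarrow> seg a b s $ b = s"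
    "c \<noteq> a \<Longrightarrow> c \<noteq> b \<Longrightarrow> seg a b s $ c = 0" for a b c s by (simp_all add: seg_def axis_def)
  \<comment> \<open>Two lifts of one edge differ by a lattice vector at each parameter. A whole
    segment of such differences must be constant, so the directions coincide.\<close>
  have agree: "u - u' \<in> \<Lambda> \<and> x = x'"
    if "\<And>s::real. 0 \<le> s \<Longrightarrow> s \<le> 1 \<Longrightarrow> lattice_cong \<Lambda> `` {u + s *\<^sub>R x} = lattice_cong \<Lambda> `` {u' + s *\<^sub>R x'}" for u u' x x'
  proof -
    have "(u - u') + s *\<^sub>R (x - x') \<in> \<Lambda>" if s: "0 \<le> s" "s \<le> 1" for s :: real
    proof -
      have "(u + s *\<^sub>R x) - (u' + s *\<^sub>R x') \<in> \<Lambda>"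
        using \<open>\<And>s::real. 0 \<le> s \<Longrightarrow> s \<le> 1 \<Longrightarrow> lattice_cong \<Lambda> `` {u + s *\<^sub>R x} = lattice_cong \<Lambda> `` {u' + s *\<^sub>R x'}\<close>[OF s]
        unfolding \<Lambda> lattice_class_eq_iff .
      then show ?thesis by (simp add: algebra_simps)
    qed
    then show ?thesis using segment_in_period_lattice[of "u - u'" "x - x'" M1 M2] unfolding \<Lambda>
      by (metis (no_types, lifting) add.right_neutral eq_iff_diff_eq_0 order_refl scaleR_zero_left zero_le_one)
  qed
  have nz: "e1 v \<noteq> 0" "e2 v \<noteq> 0" "e3 v \<noteq> 0" for v using upper[of v] lower[of v] by auto
  \<comment> \<open>The diagonal from \<open>v\<close> to \<open>v + 3\<close> is common to the
    upper and the lower triangle at \<open>v\<close>; it equates the two rotations and the two base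
    points modulo the lattice.\<close>
  have shared3: "\<alpha> v - \<beta> v \<in> \<Lambda> \<and> r v * e3 v = q v * e3 v" for v
  proof (rule agree)
    fix s :: real assume s: "0 \<le> s" "s \<le> 1"
    have 1: "seg v (v + 3) s \<in> closed_simplex {v, v + 2, v + 3}" "seg v (v + 3) s \<in> closed_simplex {v, v + 3, v + 1}"
      using seg_in[OF s, of v "v + 3" "v + 2"] seg_in[OF s, of v "v + 3" "v + 1"] by (simp_all add: insert_commute)
    show "lattice_cong \<Lambda> `` {\<alpha> v + s *\<^sub>R (r v * e3 v)} = lattice_cong \<Lambda> `` {\<beta> v + s *\<^sub>R (q v * e3 v)}"
      using \<alpha>(2)[OF 1(1)] \<beta>(2)[OF 1(2)] by (simp add: seg_nth)
  qed
  then have rq: "r v = q v" for v using nz(3)[of v] by (metis mult_right_cancel)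
  \<comment> \<open>The edge from \<open>v + 1\<close> to \<open>v + 3\<close> joins the lower
    triangle at \<open>v\<close> to the upper one at \<open>v + 1\<close>, which carries the
    rotation from \<open>v\<close> to \<open>v + 1\<close>.\<close>
  have shared1: "(\<beta> v + q v * e1 v) - \<alpha> (v + 1) \<in> \<Lambda> \<and> q v * e2 (v + 1) = r (v + 1) * e2 (v + 1)" for v
  proof (rule agree)
    fix s :: real assume s: "0 \<le> s" "s \<le> 1"
    have 1: "seg (v + 1) (v + 3) s \<in> closed_simplex {v, v + 3, v + 1}"
      using seg_in[OF s, of "v + 1" "v + 3" v] by (simp add: insert_commute)
    have 2: "seg (v + 1) (v + 3) s \<in> closed_simplex {v + 1, v + 1 + 2, v + 1 + 3}"
      using seg_in[OF s, of "v + 1" "v + 3" "v + 4"] by (simp add: add.assoc)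
    have "\<beta> v + q v * (s *\<^sub>R e3 v + (1 - s) *\<^sub>R e1 v) = \<beta> v + q v * e1 v + s *\<^sub>R (q v * e2 (v + 1))"
      using e3_lower[of v] by (simp add: algebra_simps)
    then show "lattice_cong \<Lambda> `` {\<beta> v + q v * e1 v + s *\<^sub>R (q v * e2 (v + 1))} = lattice_cong \<Lambda> `` {\<alpha> (v + 1) + s *\<^sub>R (r (v + 1) * e2 (v + 1))}"
      using \<alpha>(2)[OF 2] \<beta>(2)[OF 1] by (simp add: seg_nth add.assoc)
  qed
  then have "r (v + 1) = r v" for v using rq[of v] nz(2)[of "v + 1"] by (metis mult_right_cancel)
  then have "r (of_nat n) = r 0" for n by (induction n) (simp_all add: add.commute[of 1 "of_nat _ :: 8"])
  then have r0: "r v = r 0" for v using ex_of_nat_8[of v] by metis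
  have \<alpha>\<beta>: "\<alpha> v - \<beta> v \<in> \<Lambda>" for v using shared3 by blast
  have L1: "\<alpha> (v + 1) - (\<alpha> v + r 0 * e1 v) \<in> \<Lambda>" for v
  proof -
    have "(\<beta> v + r 0 * e1 v) - \<alpha> (v + 1) \<in> \<Lambda>" using shared1[of v] rq[of v] r0[of v] by simp
    then have "- ((\<alpha> v - \<beta> v) + ((\<beta> v + r 0 * e1 v) - \<alpha> (v + 1))) \<in> \<Lambda>"
      using \<alpha>\<beta>[of v] unfolding \<Lambda> by (intro period_lattice_minus period_lattice_add)
    then show ?thesis by (simp add: algebra_simps)
  qed
  have L2: "\<alpha> (v + 2) - (\<alpha> v + r 0 * e2 v) \<in> \<Lambda>" for v
  proof -
    have 1: "axis (v + 2) 1 \<in> closed_simplex {v, v + 2, v + 3}" "axis (v + 2) 1 \<in> closed_simplex {v + 2, v + 2 + 2, v + 2 + 3}"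
      by (auto simp: closed_simplex_def axis_def)
    have "lattice_cong \<Lambda> `` {\<alpha> (v + 2)} = lattice_cong \<Lambda> `` {\<alpha> v + r 0 * e2 v}"
      using \<alpha>(2)[OF 1(1)] \<alpha>(2)[OF 1(2)] r0[of v] r0[of "v + 2"] by (simp add: axis_def add.assoc)
    then show ?thesis unfolding \<Lambda> lattice_class_eq_iff .
  qed
  show ?thesis
  proof (rule that[of "r 0" \<alpha>])
    show "norm (r 0) = 1" by (rule \<alpha>(1))
    show "g t = lattice_cong \<Lambda> `` {\<alpha> v + r 0 * (t $ (v + 2) *\<^sub>R e2 v + t $ (v + 3) *\<^sub>R e3 v)}"
      if "t \<in> closed_simplex {v, v + 2, v + 3}" for v t using \<alpha>(2)[OF that] r0[of v] by simp
    show "g t = lattice_cong \<Lambda> `` {\<alpha> v + r 0 * (t $ (v + 1) *\<^sub>R e1 v + t $ (v + 3) *\<^sub>R e3 v)}"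
      if t: "t \<in> closed_simplex {v, v + 1, v + 3}" for v t
    proof -
      have "t \<in> closed_simplex {v, v + 3, v + 1}" using t by (simp add: insert_commute)
      then have "g t = lattice_cong \<Lambda> `` {\<beta> v + r 0 * (t $ (v + 1) *\<^sub>R e1 v + t $ (v + 3) *\<^sub>R e3 v)}"
        using \<beta>(2) rq[of v] r0[of v] by (simp add: add.commute)
      also have "\<dots> = lattice_cong \<Lambda> `` {\<alpha> v + r 0 * (t $ (v + 1) *\<^sub>R e1 v + t $ (v + 3) *\<^sub>R e3 v)}"
        unfolding \<Lambda> lattice_class_eq_iff using period_lattice_minus[OF \<alpha>\<beta>[of v, unfolded \<Lambda>]] by (simp add: algebra_simps)
      finally show ?thesis .
    qed
  qed (use L1 L2 in blast)+
qed

text \<open>Pulled back to the plane, any flat isometry is the developing map followed by one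
  rotation and a translation, modulo its own lattice. That lattice must therefore be the rotated
  one.\<close>

lemma flat_isometry_lattice:
  assumes g: "flat_isometry p (period_lattice M1 M2) g"
  obtains r where "norm r = 1" "period_lattice M1 M2 = period_lattice (r * period1) (r * period2)"
proof -
  define \<Lambda> where "\<Lambda> = period_lattice M1 M2"
  obtain r \<alpha> where r: "norm r = 1"
    and U: "\<And>v t. t \<in> closed_simplex {v, v + 2, v + 3} \<Longrightarrow> g t = lattice_cong \<Lambda> `` {\<alpha> v + r * (t $ (v + 2) *\<^sub>R e2 v + t $ (v + 3) *\<^sub>R e3 v)}"
    and D: "\<And>v t. t \<in> closed_simplex {v, v + 1, v + 3} \<Longrightarrow> g t = lattice_cong \<Lambda> `` {\<alpha> v + r * (t $ (v + 1) *\<^sub>R e1 v + t $ (v + 3) *\<^sub>R e3 v)}"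
    and L1: "\<And>v. \<alpha> (v + 1) - (\<alpha> v + r * e1 v) \<in> \<Lambda>" and L2: "\<And>v. \<alpha> (v + 2) - (\<alpha> v + r * e2 v) \<in> \<Lambda>"
    using flat_isometry_lifts[OF g[folded \<Lambda>_def] \<Lambda>_def] by blast
  note add = period_lattice_add[where a = M1 and b = M2, folded \<Lambda>_def]
    and neg = period_lattice_minus[where a = M1 and b = M2, folded \<Lambda>_def]
    and diff = period_lattice_diff[where a = M1 and b = M2, folded \<Lambda>_def]
    and mult = period_lattice_of_int[where a = M1 and b = M2, folded \<Lambda>_def]
    and class_iff = lattice_class_eq_iff[where a = M1 and b = M2, folded \<Lambda>_def]
  have r0: "r \<noteq> 0" using r by auto
  have Z: "\<alpha> (of_int n) - (\<alpha> 0 + r * zeta n) \<in> \<Lambda>" for n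
  proof (induction n rule: int_induct[where k = 0])
    case base show ?case using period_lattice_0 by (simp add: zeta_0 \<Lambda>_def)
  next
    case (step1 i)
    have "(\<alpha> (of_int i) - (\<alpha> 0 + r * zeta i)) + (\<alpha> (of_int i + 1) - (\<alpha> (of_int i) + r * e1 (of_int i))) \<in> \<Lambda>"
      using step1 L1 by (intro add)
    then show ?case unfolding zeta_step of_int_add of_int_1 by (simp add: algebra_simps)
  next
    case (step2 i)
    have z: "zeta i = zeta (i - 1) + e1 (of_int (i - 1))" using zeta_step[of "i - 1"] by simp
    have "(\<alpha> (of_int i) - (\<alpha> 0 + r * zeta i)) - (\<alpha> (of_int (i - 1) + 1) - (\<alpha> (of_int (i - 1)) + r * e1 (of_int (i - 1)))) \<in> \<Lambda>"
      using diff[OF step2(2) L1] .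
    then show ?case unfolding z by (simp add: algebra_simps)
  qed
  \<comment> \<open>Eight steps along \<open>e1\<close> return to label 0, so the accumulated
    displacement is a lattice vector.\<close>
  have P2: "r * period2 \<in> \<Lambda>"
  proof -
    have "zeta 8 = period2" using zeta_add_8[of 0 1] by (simp add: zeta_0)
    moreover have "(of_int 8 :: 8) = 0" by simp
    ultimately have "\<alpha> 0 - (\<alpha> 0 + r * period2) \<in> \<Lambda>" using Z[of 8] by metis
    then show ?thesis using neg by force
  qed
  \<comment> \<open>Going 0, 1, 2 and going from 0 to 2 directly end at the same vertex.\<close>
  have P1: "r * period1 \<in> \<Lambda>"
  proof -
    have "(\<alpha> (0 + 1) - (\<alpha> 0 + r * e1 0)) + (\<alpha> (1 + 1) - (\<alpha> 1 + r * e1 1)) - (\<alpha> (0 + 2) - (\<alpha> 0 + r * e2 0)) \<in> \<Lambda>"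
      by (intro add diff L1 L2)
    then show ?thesis by (simp add: period1_def algebra_simps)
  qed
  have G: "g (carrier_map x y) = lattice_cong \<Lambda> `` {\<alpha> 0 + r * developing x y}" for x y
  proof -
    have V: "\<alpha> (of_int (i + 2 * j)) - (\<alpha> 0 + r * vert i j) \<in> \<Lambda>" for i j
    proof -
      have "(\<alpha> (of_int (i + 2 * j)) - (\<alpha> 0 + r * zeta (i + 2 * j))) - of_int j * (r * period1) \<in> \<Lambda>"
        by (intro diff Z mult P1)
      then show ?thesis by (simp add: vert_def algebra_simps)
    qed
    show ?thesis
    proof (cases rule: plane_point_cases[of x y])
      case (upper i j m)
      have st: "carrier_map x y \<in> closed_simplex {m, m + 2, m + 3}"
        unfolding carrier_map_closed_cell(1)[OF upper]
        by (rule convex_axis_in_closed_simplex) (use upper in auto)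
      have cm: "carrier_map x y $ (m + 2) = (y - of_int j) - (x - of_int i)" "carrier_map x y $ (m + 3) = x - of_int i"
        unfolding carrier_map_closed_cell(1)[OF upper] by (simp_all add: axis_def)
      have "g (carrier_map x y) = lattice_cong \<Lambda> `` {\<alpha> m + r * (((y - of_int j) - (x - of_int i)) *\<^sub>R e2 m + (x - of_int i) *\<^sub>R e3 m)}"
        using U[OF st] by (simp only: cm)
      also have "lattice_cong \<Lambda> `` {\<alpha> m + r * (((y - of_int j) - (x - of_int i)) *\<^sub>R e2 m + (x - of_int i) *\<^sub>R e3 m)}
          = lattice_cong \<Lambda> `` {\<alpha> 0 + r * developing x y}"
        unfolding class_iff developing_closed_cell(1)[OF upper] using V[of i j] upper(5) by (simp add: algebra_simps)
      finally show ?thesis .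
    next
      case (lower i j m)
      have st: "carrier_map x y \<in> closed_simplex {m, m + 1, m + 3}"
        unfolding carrier_map_closed_cell(2)[OF lower]
        by (rule convex_axis_in_closed_simplex) (use lower in auto)
      have cm: "carrier_map x y $ (m + 1) = (x - of_int i) - (y - of_int j)" "carrier_map x y $ (m + 3) = y - of_int j"
        unfolding carrier_map_closed_cell(2)[OF lower] by (simp_all add: axis_def)
      have "g (carrier_map x y) = lattice_cong \<Lambda> `` {\<alpha> m + r * (((x - of_int i) - (y - of_int j)) *\<^sub>R e1 m + (y - of_int j) *\<^sub>R e3 m)}"
        using D[OF st] by (simp only: cm)
      also have "lattice_cong \<Lambda> `` {\<alpha> m + r * (((x - of_int i) - (y - of_int j)) *\<^sub>R e1 m + (y - of_int j) *\<^sub>R e3 m)}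
          = lattice_cong \<Lambda> `` {\<alpha> 0 + r * developing x y}"
        unfolding class_iff developing_closed_cell(2)[OF lower] using V[of i j] lower(5) by (simp add: algebra_simps)
      finally show ?thesis .
    qed
  qed
  have "\<Lambda> = period_lattice (r * period1) (r * period2)"
  proof
    show "period_lattice (r * period1) (r * period2) \<subseteq> \<Lambda>"
      by (rule subsetI, elim period_latticeE) (use P1 P2 in \<open>simp add: add mult\<close>)
    \<comment> \<open>Points developing to 0 and to \<open>z / r\<close> have the same image under
      \<open>g\<close>. Injectivity of \<open>g\<close> makes them one point of the realization, so
      \<open>z / r\<close> is a period of the developing map.\<close>
    show "\<Lambda> \<subseteq> period_lattice (r * period1) (r * period2)"
    proof
      fix z assume "z \<in> \<Lambda>"
      have inj: "inj_on g realization" using g unfolding flat_isometry_def bij_betw_def by (rule conjunct1[THEN conjunct1])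
      obtain x y where xy: "developing x y = 0" using developing_surj by blast
      obtain x' y' where xy': "developing x' y' = z / r" using developing_surj by blast
      have "g (carrier_map x' y') = g (carrier_map x y)"
        unfolding G class_iff xy xy' using r0 \<open>z \<in> \<Lambda>\<close> by simp
      then have "carrier_map x' y' = carrier_map x y"
        by (rule inj_onD[OF inj]) (rule carrier_map_in_realization)+
      then have "z / r \<in> periods_lattice" unfolding developing_class_iff xy xy' by simp
      then obtain m n :: int where "z / r = of_int m * period1 + of_int n * period2" by (elim period_latticeE)
      then show "z \<in> period_lattice (r * period1) (r * period2)"
        using r0 by (intro period_latticeI[of _ m _ n]) (simp add: field_simps)
    qed
  qed
  then show ?thesis using that[OF r] by (simp add: \<Lambda>_def)
qed

lemma flat_structure: "flat_structure p = modular_orbit (period2 / period1)"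
  unfolding flat_structure_def
proof (rule the_equality)
  show "modular_orbit (period2 / period1) \<in> modular_surface \<and>
     (\<exists>L1 L2. 0 < Im (L2 / L1) \<and> (\<exists>f. flat_isometry p (period_lattice L1 L2) f) \<and>
        modular_orbit (period2 / period1) = modular_orbit (L2 / L1))"
    using im_periods(2) flat_isometry_flat_map unfolding modular_surface_def by blast
  fix m assume "m \<in> modular_surface \<and> (\<exists>L1 L2. 0 < Im (L2 / L1) \<and>
     (\<exists>f. flat_isometry p (period_lattice L1 L2) f) \<and> m = modular_orbit (L2 / L1))"
  then obtain M1 M2 g where M: "0 < Im (M2 / M1)" "flat_isometry p (period_lattice M1 M2) g" "m = modular_orbit (M2 / M1)"
    by blast
  obtain r where r: "norm r = 1" "period_lattice M1 M2 = period_lattice (r * period1) (r * period2)"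
    using flat_isometry_lattice[OF M(2)] .
  have "r \<noteq> 0" using r(1) by auto
  then have q: "(r * period2) / (r * period1) = period2 / period1" by simp
  show "m = modular_orbit (period2 / period1)"
    using modular_orbit_period_lattice[OF M(1) _ r(2)] im_periods(2) unfolding q M(3) by blast
qed

end

section \<open>Orientation of the vertex quadruples\<close>

text \<open>Normalized by a rotation about the axis, which gives \<open>p 1\<close> second
  coordinate 0, and by a vertical translation, which puts \<open>p 3\<close> and \<open>p 4\<close>
  at height 0. The second coordinate of \<open>p 0\<close> keeps vertices 0, 1, 6, 7 from being
  coplanar.\<close>

definition tent :: "real \<Rightarrow> real \<Rightarrow> real \<Rightarrow> real \<Rightarrow> real \<Rightarrow> real \<Rightarrow> real \<Rightarrow> real \<Rightarrow> real^3^8" where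
  "tent a s r a' y v w e = (\<chi> j.
     if j = 0 then vector [a, e\<^sup>2, - s] else if j = 1 then vector [r, 0, - e\<^sup>2]
     else if j = 2 then vector [r + e * v, e * w, 2 * e\<^sup>2] else if j = 3 then vector [a', y, 0]
     else if j = 4 then vector [- a', - y, 0] else if j = 5 then vector [- (r + e * v), - (e * w), 2 * e\<^sup>2]
     else if j = 6 then vector [- r, 0, - e\<^sup>2] else vector [- a, - e\<^sup>2, - s])"

lemma tent_nth:
  "tent a s r a' y v w e $ 0 = vector [a, e\<^sup>2, - s]" "tent a s r a' y v w e $ 1 = vector [r, 0, - e\<^sup>2]"
  "tent a s r a' y v w e $ 2 = vector [r + e * v, e * w, 2 * e\<^sup>2]" "tent a s r a' y v w e $ 3 = vector [a', y, 0]"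
  "tent a s r a' y v w e $ 4 = vector [- a', - y, 0]" "tent a s r a' y v w e $ 5 = vector [- (r + e * v), - (e * w), 2 * e\<^sup>2]"
  "tent a s r a' y v w e $ 6 = vector [- r, 0, - e\<^sup>2]" "tent a s r a' y v w e $ 7 = vector [- a, - e\<^sup>2, - s]"
  by (simp_all add: tent_def)

text \<open>The orientation determinants of the quadruples, divided by their order of vanishing in \<open>e\<close>.\<close>

definition tent_signs :: "real \<Rightarrow> real \<Rightarrow> real \<Rightarrow> real \<Rightarrow> real \<Rightarrow> real \<Rightarrow> real \<Rightarrow> real \<Rightarrow> bool" where
  "tent_signs a s r a' y v w e \<longleftrightarrow>
    0 < s * y * v - s * a' * w + s * r * w - 3 * r * y * e + 3 * a * y * e - y * v * e ^ 2 + a' * w * e ^ 2 - a * w * e ^ 2 - 3 * a' * e ^ 3 + 3 * r * e ^ 3 + v * e ^ 4 \<and>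
    0 < - s * y * v + s * a' * w + s * r * w + 3 * r * y * e - 3 * a * y * e + y * v * e ^ 2 - a' * w * e ^ 2 - a * w * e ^ 2 + 3 * a' * e ^ 3 + 3 * r * e ^ 3 + v * e ^ 4 \<and>
    0 < 2 * s * r * w + 4 * r * w * e ^ 2 - 6 * a * w * e ^ 2 + 6 * r * e ^ 3 + 6 * v * e ^ 4 \<and>
    0 < 2 * s * r * w - 2 * r * w * e ^ 2 + 6 * r * e ^ 3 \<and>
    0 < - 2 * a * s * w + 2 * s * v * e ^ 2 + 2 * a * w * e ^ 2 - 6 * r * e ^ 3 - 2 * v * e ^ 4 \<and>
    0 < 2 * s * r * y - 2 * a * y * e ^ 2 + 2 * a' * e ^ 4 \<and>
    0 < 2 * s * r * y + s * y * v * e - s * a' * w * e + s * r * w * e + r * y * e ^ 2 - 3 * a * y * e ^ 2 - y * v * e ^ 3 + a' * w * e ^ 3 - a * w * e ^ 3 + 3 * a' * e ^ 4 - r * e ^ 4 + v * e ^ 5 \<and>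
    0 < 2 * s * r * y - 2 * r * y * e ^ 2 + 2 * r * e ^ 4 \<and>
    0 < - 2 * a * s * y + 2 * s * a' * e ^ 2 - 2 * s * r * e ^ 2 + 2 * a * y * e ^ 2 - 2 * a' * e ^ 4 \<and>
    0 < 2 * s * r * y + s * y * v * e - s * a' * w * e - s * r * w * e + r * y * e ^ 2 - 3 * a * y * e ^ 2 - y * v * e ^ 3 + a' * w * e ^ 3 + a * w * e ^ 3 + 3 * a' * e ^ 4 + r * e ^ 4 - v * e ^ 5 \<and>
    0 < 2 * s * r * y - 2 * r * y * e ^ 2 - 2 * r * e ^ 4 \<and>
    0 < - 2 * a * s * y + 2 * s * a' * e ^ 2 + 2 * s * r * e ^ 2 + 2 * a * y * e ^ 2 - 2 * a' * e ^ 4 \<and>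
    0 < 2 * s * r * w - 2 * r * w * e ^ 2 - 6 * r * e ^ 3 \<and>
    0 < - 2 * a * s * w + 4 * s * r * e + 2 * s * v * e ^ 2 + 2 * a * w * e ^ 2 + 2 * r * e ^ 3 - 2 * v * e ^ 4 \<and>
    0 < 4 * s * r - 4 * r * e ^ 2 \<and>
    0 < 2 * s * r * y + 2 * s * y * v * e - 2 * s * a' * w * e + 4 * a * y * e ^ 2 - 4 * a' * e ^ 4 \<and>
    0 < 2 * s * r * y + 2 * s * y * v * e - 2 * s * a' * w * e + 4 * r * y * e ^ 2 + 4 * y * v * e ^ 3 - 4 * a' * w * e ^ 3 + 4 * a * w * e ^ 3 - 4 * r * e ^ 4 - 4 * v * e ^ 5 \<and>
    0 < 2 * s * r * y + s * y * v * e - s * a' * w * e - s * r * w * e + r * y * e ^ 2 + 3 * a * y * e ^ 2 - y * v * e ^ 3 + a' * w * e ^ 3 - a * w * e ^ 3 - 3 * a' * e ^ 4 - r * e ^ 4 + v * e ^ 5 \<and>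
    0 < - 2 * a * s * y + 2 * a * s * w * e + 2 * s * a' * e ^ 2 - 2 * s * r * e ^ 2 - 4 * a * y * e ^ 2 - 2 * s * v * e ^ 3 + 4 * a' * e ^ 4 \<and>
    0 < 2 * s * r * y + 2 * s * y * v * e - 2 * s * a' * w * e + 4 * r * y * e ^ 2 + 4 * y * v * e ^ 3 - 4 * a' * w * e ^ 3 - 4 * a * w * e ^ 3 + 4 * r * e ^ 4 + 4 * v * e ^ 5 \<and>
    0 < 2 * s * r * y + s * y * v * e - s * a' * w * e + s * r * w * e + r * y * e ^ 2 + 3 * a * y * e ^ 2 - y * v * e ^ 3 + a' * w * e ^ 3 + a * w * e ^ 3 - 3 * a' * e ^ 4 + r * e ^ 4 - v * e ^ 5 \<and>
    0 < - 2 * a * s * y - 2 * a * s * w * e + 2 * s * a' * e ^ 2 + 2 * s * r * e ^ 2 - 4 * a * y * e ^ 2 + 2 * s * v * e ^ 3 + 4 * a' * e ^ 4 \<and>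
    0 < 2 * s * r * w + 4 * r * w * e ^ 2 + 6 * a * w * e ^ 2 - 6 * r * e ^ 3 - 6 * v * e ^ 4 \<and>
    0 < - 4 * a * s * w + 4 * s * r * e + 4 * s * v * e ^ 2 - 8 * a * w * e ^ 2 + 8 * r * e ^ 3 + 8 * v * e ^ 4 \<and>
    0 < 2 * s * r * y + 2 * s * y * v * e - 2 * s * a' * w * e - 4 * a * y * e ^ 2 + 4 * a' * e ^ 4 \<and>
    0 < 2 * s * r * y + 2 * a * y * e ^ 2 - 2 * a' * e ^ 4 \<and>
    0 < - 4 * a * s * y + 4 * s * a' * e ^ 2 \<and>
    0 < - s * y * v + s * a' * w + s * r * w + 3 * r * y * e + 3 * a * y * e + y * v * e ^ 2 - a' * w * e ^ 2 + a * w * e ^ 2 - 3 * a' * e ^ 3 - 3 * r * e ^ 3 - v * e ^ 4 \<and>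
    0 < s * y * v - s * a' * w + s * r * w - 3 * r * y * e - 3 * a * y * e - y * v * e ^ 2 + a' * w * e ^ 2 + a * w * e ^ 2 + 3 * a' * e ^ 3 - 3 * r * e ^ 3 - v * e ^ 4 \<and>
    0 < 6 * r * y + 2 * y * v * e - 2 * a' * w * e \<and>
    0 < 6 * r * y + 6 * y * v * e - 6 * a' * w * e + 4 * r * w * e \<and>
    0 < 6 * r * y - 2 * r * w * e \<and>
    0 < 6 * r * y + 6 * y * v * e - 6 * a' * w * e - 4 * r * w * e \<and>
    0 < 6 * r * y + 2 * r * w * e \<and>
    0 < 12 * r * w \<and>
    0 < 2 * r * y - 2 * y * v * e + 2 * a' * w * e \<and>
    0 < 4 * r * y \<and>
    0 < 8 * r * y + 8 * y * v * e - 8 * a' * w * e"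

text \<open>The half turn sends \<open>i < j < k < l\<close> to
  \<open>7 - l < 7 - k < 7 - j < 7 - i\<close>, an even reversal, and so preserves the determinant.
  Six quadruples are fixed by it, hence 38 polynomials serve all 70.\<close>

lemma tent_vol:
  fixes a s r a' y v w e
  defines "T \<equiv> tent a s r a' y v w e"
  shows
  "vol (T $ 0) (T $ 1) (T $ 2) (T $ 3) = (e ^ 1 * (s * y * v - s * a' * w + s * r * w - 3 * r * y * e + 3 * a * y * e - y * v * e ^ 2 + a' * w * e ^ 2 - a * w * e ^ 2 - 3 * a' * e ^ 3 + 3 * r * e ^ 3 + v * e ^ 4))"
  "vol (T $ 4) (T $ 5) (T $ 6) (T $ 7) = (e ^ 1 * (s * y * v - s * a' * w + s * r * w - 3 * r * y * e + 3 * a * y * e - y * v * e ^ 2 + a' * w * e ^ 2 - a * w * e ^ 2 - 3 * a' * e ^ 3 + 3 * r * e ^ 3 + v * e ^ 4))"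
  "vol (T $ 0) (T $ 1) (T $ 2) (T $ 4) = (e ^ 1 * (- s * y * v + s * a' * w + s * r * w + 3 * r * y * e - 3 * a * y * e + y * v * e ^ 2 - a' * w * e ^ 2 - a * w * e ^ 2 + 3 * a' * e ^ 3 + 3 * r * e ^ 3 + v * e ^ 4))"
  "vol (T $ 3) (T $ 5) (T $ 6) (T $ 7) = (e ^ 1 * (- s * y * v + s * a' * w + s * r * w + 3 * r * y * e - 3 * a * y * e + y * v * e ^ 2 - a' * w * e ^ 2 - a * w * e ^ 2 + 3 * a' * e ^ 3 + 3 * r * e ^ 3 + v * e ^ 4))"
  "vol (T $ 0) (T $ 1) (T $ 2) (T $ 5) = (e ^ 1 * (2 * s * r * w + 4 * r * w * e ^ 2 - 6 * a * w * e ^ 2 + 6 * r * e ^ 3 + 6 * v * e ^ 4))"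
  "vol (T $ 2) (T $ 5) (T $ 6) (T $ 7) = (e ^ 1 * (2 * s * r * w + 4 * r * w * e ^ 2 - 6 * a * w * e ^ 2 + 6 * r * e ^ 3 + 6 * v * e ^ 4))"
  "vol (T $ 0) (T $ 1) (T $ 2) (T $ 6) = (e ^ 1 * (2 * s * r * w - 2 * r * w * e ^ 2 + 6 * r * e ^ 3))"
  "vol (T $ 1) (T $ 5) (T $ 6) (T $ 7) = (e ^ 1 * (2 * s * r * w - 2 * r * w * e ^ 2 + 6 * r * e ^ 3))"
  "vol (T $ 0) (T $ 1) (T $ 2) (T $ 7) = - (e ^ 1 * (- 2 * a * s * w + 2 * s * v * e ^ 2 + 2 * a * w * e ^ 2 - 6 * r * e ^ 3 - 2 * v * e ^ 4))"
  "vol (T $ 0) (T $ 5) (T $ 6) (T $ 7) = - (e ^ 1 * (- 2 * a * s * w + 2 * s * v * e ^ 2 + 2 * a * w * e ^ 2 - 6 * r * e ^ 3 - 2 * v * e ^ 4))"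
  "vol (T $ 0) (T $ 1) (T $ 3) (T $ 4) = (e ^ 0 * (2 * s * r * y - 2 * a * y * e ^ 2 + 2 * a' * e ^ 4))"
  "vol (T $ 3) (T $ 4) (T $ 6) (T $ 7) = (e ^ 0 * (2 * s * r * y - 2 * a * y * e ^ 2 + 2 * a' * e ^ 4))"
  "vol (T $ 0) (T $ 1) (T $ 3) (T $ 5) = (e ^ 0 * (2 * s * r * y + s * y * v * e - s * a' * w * e + s * r * w * e + r * y * e ^ 2 - 3 * a * y * e ^ 2 - y * v * e ^ 3 + a' * w * e ^ 3 - a * w * e ^ 3 + 3 * a' * e ^ 4 - r * e ^ 4 + v * e ^ 5))"
  "vol (T $ 2) (T $ 4) (T $ 6) (T $ 7) = (e ^ 0 * (2 * s * r * y + s * y * v * e - s * a' * w * e + s * r * w * e + r * y * e ^ 2 - 3 * a * y * e ^ 2 - y * v * e ^ 3 + a' * w * e ^ 3 - a * w * e ^ 3 + 3 * a' * e ^ 4 - r * e ^ 4 + v * e ^ 5))"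
  "vol (T $ 0) (T $ 1) (T $ 3) (T $ 6) = (e ^ 0 * (2 * s * r * y - 2 * r * y * e ^ 2 + 2 * r * e ^ 4))"
  "vol (T $ 1) (T $ 4) (T $ 6) (T $ 7) = (e ^ 0 * (2 * s * r * y - 2 * r * y * e ^ 2 + 2 * r * e ^ 4))"
  "vol (T $ 0) (T $ 1) (T $ 3) (T $ 7) = - (e ^ 0 * (- 2 * a * s * y + 2 * s * a' * e ^ 2 - 2 * s * r * e ^ 2 + 2 * a * y * e ^ 2 - 2 * a' * e ^ 4))"
  "vol (T $ 0) (T $ 4) (T $ 6) (T $ 7) = - (e ^ 0 * (- 2 * a * s * y + 2 * s * a' * e ^ 2 - 2 * s * r * e ^ 2 + 2 * a * y * e ^ 2 - 2 * a' * e ^ 4))"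
  "vol (T $ 0) (T $ 1) (T $ 4) (T $ 5) = - (e ^ 0 * (2 * s * r * y + s * y * v * e - s * a' * w * e - s * r * w * e + r * y * e ^ 2 - 3 * a * y * e ^ 2 - y * v * e ^ 3 + a' * w * e ^ 3 + a * w * e ^ 3 + 3 * a' * e ^ 4 + r * e ^ 4 - v * e ^ 5))"
  "vol (T $ 2) (T $ 3) (T $ 6) (T $ 7) = - (e ^ 0 * (2 * s * r * y + s * y * v * e - s * a' * w * e - s * r * w * e + r * y * e ^ 2 - 3 * a * y * e ^ 2 - y * v * e ^ 3 + a' * w * e ^ 3 + a * w * e ^ 3 + 3 * a' * e ^ 4 + r * e ^ 4 - v * e ^ 5))"
  "vol (T $ 0) (T $ 1) (T $ 4) (T $ 6) = - (e ^ 0 * (2 * s * r * y - 2 * r * y * e ^ 2 - 2 * r * e ^ 4))"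
  "vol (T $ 1) (T $ 3) (T $ 6) (T $ 7) = - (e ^ 0 * (2 * s * r * y - 2 * r * y * e ^ 2 - 2 * r * e ^ 4))"
  "vol (T $ 0) (T $ 1) (T $ 4) (T $ 7) = (e ^ 0 * (- 2 * a * s * y + 2 * s * a' * e ^ 2 + 2 * s * r * e ^ 2 + 2 * a * y * e ^ 2 - 2 * a' * e ^ 4))"
  "vol (T $ 0) (T $ 3) (T $ 6) (T $ 7) = (e ^ 0 * (- 2 * a * s * y + 2 * s * a' * e ^ 2 + 2 * s * r * e ^ 2 + 2 * a * y * e ^ 2 - 2 * a' * e ^ 4))"
  "vol (T $ 0) (T $ 1) (T $ 5) (T $ 6) = - (e ^ 1 * (2 * s * r * w - 2 * r * w * e ^ 2 - 6 * r * e ^ 3))"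
  "vol (T $ 1) (T $ 2) (T $ 6) (T $ 7) = - (e ^ 1 * (2 * s * r * w - 2 * r * w * e ^ 2 - 6 * r * e ^ 3))"
  "vol (T $ 0) (T $ 1) (T $ 5) (T $ 7) = (e ^ 1 * (- 2 * a * s * w + 4 * s * r * e + 2 * s * v * e ^ 2 + 2 * a * w * e ^ 2 + 2 * r * e ^ 3 - 2 * v * e ^ 4))"
  "vol (T $ 0) (T $ 2) (T $ 6) (T $ 7) = (e ^ 1 * (- 2 * a * s * w + 4 * s * r * e + 2 * s * v * e ^ 2 + 2 * a * w * e ^ 2 + 2 * r * e ^ 3 - 2 * v * e ^ 4))"
  "vol (T $ 0) (T $ 1) (T $ 6) (T $ 7) = (e ^ 2 * (4 * s * r - 4 * r * e ^ 2))"
  "vol (T $ 0) (T $ 2) (T $ 3) (T $ 4) = (e ^ 0 * (2 * s * r * y + 2 * s * y * v * e - 2 * s * a' * w * e + 4 * a * y * e ^ 2 - 4 * a' * e ^ 4))"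
  "vol (T $ 3) (T $ 4) (T $ 5) (T $ 7) = (e ^ 0 * (2 * s * r * y + 2 * s * y * v * e - 2 * s * a' * w * e + 4 * a * y * e ^ 2 - 4 * a' * e ^ 4))"
  "vol (T $ 0) (T $ 2) (T $ 3) (T $ 5) = (e ^ 0 * (2 * s * r * y + 2 * s * y * v * e - 2 * s * a' * w * e + 4 * r * y * e ^ 2 + 4 * y * v * e ^ 3 - 4 * a' * w * e ^ 3 + 4 * a * w * e ^ 3 - 4 * r * e ^ 4 - 4 * v * e ^ 5))"
  "vol (T $ 2) (T $ 4) (T $ 5) (T $ 7) = (e ^ 0 * (2 * s * r * y + 2 * s * y * v * e - 2 * s * a' * w * e + 4 * r * y * e ^ 2 + 4 * y * v * e ^ 3 - 4 * a' * w * e ^ 3 + 4 * a * w * e ^ 3 - 4 * r * e ^ 4 - 4 * v * e ^ 5))"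
  "vol (T $ 0) (T $ 2) (T $ 3) (T $ 6) = (e ^ 0 * (2 * s * r * y + s * y * v * e - s * a' * w * e - s * r * w * e + r * y * e ^ 2 + 3 * a * y * e ^ 2 - y * v * e ^ 3 + a' * w * e ^ 3 - a * w * e ^ 3 - 3 * a' * e ^ 4 - r * e ^ 4 + v * e ^ 5))"
  "vol (T $ 1) (T $ 4) (T $ 5) (T $ 7) = (e ^ 0 * (2 * s * r * y + s * y * v * e - s * a' * w * e - s * r * w * e + r * y * e ^ 2 + 3 * a * y * e ^ 2 - y * v * e ^ 3 + a' * w * e ^ 3 - a * w * e ^ 3 - 3 * a' * e ^ 4 - r * e ^ 4 + v * e ^ 5))"
  "vol (T $ 0) (T $ 2) (T $ 3) (T $ 7) = - (e ^ 0 * (- 2 * a * s * y + 2 * a * s * w * e + 2 * s * a' * e ^ 2 - 2 * s * r * e ^ 2 - 4 * a * y * e ^ 2 - 2 * s * v * e ^ 3 + 4 * a' * e ^ 4))"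
  "vol (T $ 0) (T $ 4) (T $ 5) (T $ 7) = - (e ^ 0 * (- 2 * a * s * y + 2 * a * s * w * e + 2 * s * a' * e ^ 2 - 2 * s * r * e ^ 2 - 4 * a * y * e ^ 2 - 2 * s * v * e ^ 3 + 4 * a' * e ^ 4))"
  "vol (T $ 0) (T $ 2) (T $ 4) (T $ 5) = - (e ^ 0 * (2 * s * r * y + 2 * s * y * v * e - 2 * s * a' * w * e + 4 * r * y * e ^ 2 + 4 * y * v * e ^ 3 - 4 * a' * w * e ^ 3 - 4 * a * w * e ^ 3 + 4 * r * e ^ 4 + 4 * v * e ^ 5))"
  "vol (T $ 2) (T $ 3) (T $ 5) (T $ 7) = - (e ^ 0 * (2 * s * r * y + 2 * s * y * v * e - 2 * s * a' * w * e + 4 * r * y * e ^ 2 + 4 * y * v * e ^ 3 - 4 * a' * w * e ^ 3 - 4 * a * w * e ^ 3 + 4 * r * e ^ 4 + 4 * v * e ^ 5))"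
  "vol (T $ 0) (T $ 2) (T $ 4) (T $ 6) = - (e ^ 0 * (2 * s * r * y + s * y * v * e - s * a' * w * e + s * r * w * e + r * y * e ^ 2 + 3 * a * y * e ^ 2 - y * v * e ^ 3 + a' * w * e ^ 3 + a * w * e ^ 3 - 3 * a' * e ^ 4 + r * e ^ 4 - v * e ^ 5))"
  "vol (T $ 1) (T $ 3) (T $ 5) (T $ 7) = - (e ^ 0 * (2 * s * r * y + s * y * v * e - s * a' * w * e + s * r * w * e + r * y * e ^ 2 + 3 * a * y * e ^ 2 - y * v * e ^ 3 + a' * w * e ^ 3 + a * w * e ^ 3 - 3 * a' * e ^ 4 + r * e ^ 4 - v * e ^ 5))"
  "vol (T $ 0) (T $ 2) (T $ 4) (T $ 7) = (e ^ 0 * (- 2 * a * s * y - 2 * a * s * w * e + 2 * s * a' * e ^ 2 + 2 * s * r * e ^ 2 - 4 * a * y * e ^ 2 + 2 * s * v * e ^ 3 + 4 * a' * e ^ 4))"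
  "vol (T $ 0) (T $ 3) (T $ 5) (T $ 7) = (e ^ 0 * (- 2 * a * s * y - 2 * a * s * w * e + 2 * s * a' * e ^ 2 + 2 * s * r * e ^ 2 - 4 * a * y * e ^ 2 + 2 * s * v * e ^ 3 + 4 * a' * e ^ 4))"
  "vol (T $ 0) (T $ 2) (T $ 5) (T $ 6) = - (e ^ 1 * (2 * s * r * w + 4 * r * w * e ^ 2 + 6 * a * w * e ^ 2 - 6 * r * e ^ 3 - 6 * v * e ^ 4))"
  "vol (T $ 1) (T $ 2) (T $ 5) (T $ 7) = - (e ^ 1 * (2 * s * r * w + 4 * r * w * e ^ 2 + 6 * a * w * e ^ 2 - 6 * r * e ^ 3 - 6 * v * e ^ 4))"
  "vol (T $ 0) (T $ 2) (T $ 5) (T $ 7) = (e ^ 1 * (- 4 * a * s * w + 4 * s * r * e + 4 * s * v * e ^ 2 - 8 * a * w * e ^ 2 + 8 * r * e ^ 3 + 8 * v * e ^ 4))"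
  "vol (T $ 0) (T $ 3) (T $ 4) (T $ 5) = - (e ^ 0 * (2 * s * r * y + 2 * s * y * v * e - 2 * s * a' * w * e - 4 * a * y * e ^ 2 + 4 * a' * e ^ 4))"
  "vol (T $ 2) (T $ 3) (T $ 4) (T $ 7) = - (e ^ 0 * (2 * s * r * y + 2 * s * y * v * e - 2 * s * a' * w * e - 4 * a * y * e ^ 2 + 4 * a' * e ^ 4))"
  "vol (T $ 0) (T $ 3) (T $ 4) (T $ 6) = - (e ^ 0 * (2 * s * r * y + 2 * a * y * e ^ 2 - 2 * a' * e ^ 4))"
  "vol (T $ 1) (T $ 3) (T $ 4) (T $ 7) = - (e ^ 0 * (2 * s * r * y + 2 * a * y * e ^ 2 - 2 * a' * e ^ 4))"
  "vol (T $ 0) (T $ 3) (T $ 4) (T $ 7) = (e ^ 0 * (- 4 * a * s * y + 4 * s * a' * e ^ 2))"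
  "vol (T $ 0) (T $ 3) (T $ 5) (T $ 6) = - (e ^ 1 * (- s * y * v + s * a' * w + s * r * w + 3 * r * y * e + 3 * a * y * e + y * v * e ^ 2 - a' * w * e ^ 2 + a * w * e ^ 2 - 3 * a' * e ^ 3 - 3 * r * e ^ 3 - v * e ^ 4))"
  "vol (T $ 1) (T $ 2) (T $ 4) (T $ 7) = - (e ^ 1 * (- s * y * v + s * a' * w + s * r * w + 3 * r * y * e + 3 * a * y * e + y * v * e ^ 2 - a' * w * e ^ 2 + a * w * e ^ 2 - 3 * a' * e ^ 3 - 3 * r * e ^ 3 - v * e ^ 4))"
  "vol (T $ 0) (T $ 4) (T $ 5) (T $ 6) = - (e ^ 1 * (s * y * v - s * a' * w + s * r * w - 3 * r * y * e - 3 * a * y * e - y * v * e ^ 2 + a' * w * e ^ 2 + a * w * e ^ 2 + 3 * a' * e ^ 3 - 3 * r * e ^ 3 - v * e ^ 4))"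
  "vol (T $ 1) (T $ 2) (T $ 3) (T $ 7) = - (e ^ 1 * (s * y * v - s * a' * w + s * r * w - 3 * r * y * e - 3 * a * y * e - y * v * e ^ 2 + a' * w * e ^ 2 + a * w * e ^ 2 + 3 * a' * e ^ 3 - 3 * r * e ^ 3 - v * e ^ 4))"
  "vol (T $ 1) (T $ 2) (T $ 3) (T $ 4) = (e ^ 2 * (6 * r * y + 2 * y * v * e - 2 * a' * w * e))"
  "vol (T $ 3) (T $ 4) (T $ 5) (T $ 6) = (e ^ 2 * (6 * r * y + 2 * y * v * e - 2 * a' * w * e))"
  "vol (T $ 1) (T $ 2) (T $ 3) (T $ 5) = (e ^ 2 * (6 * r * y + 6 * y * v * e - 6 * a' * w * e + 4 * r * w * e))"
  "vol (T $ 2) (T $ 4) (T $ 5) (T $ 6) = (e ^ 2 * (6 * r * y + 6 * y * v * e - 6 * a' * w * e + 4 * r * w * e))"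
  "vol (T $ 1) (T $ 2) (T $ 3) (T $ 6) = (e ^ 2 * (6 * r * y - 2 * r * w * e))"
  "vol (T $ 1) (T $ 4) (T $ 5) (T $ 6) = (e ^ 2 * (6 * r * y - 2 * r * w * e))"
  "vol (T $ 1) (T $ 2) (T $ 4) (T $ 5) = - (e ^ 2 * (6 * r * y + 6 * y * v * e - 6 * a' * w * e - 4 * r * w * e))"
  "vol (T $ 2) (T $ 3) (T $ 5) (T $ 6) = - (e ^ 2 * (6 * r * y + 6 * y * v * e - 6 * a' * w * e - 4 * r * w * e))"
  "vol (T $ 1) (T $ 2) (T $ 4) (T $ 6) = - (e ^ 2 * (6 * r * y + 2 * r * w * e))"
  "vol (T $ 1) (T $ 3) (T $ 5) (T $ 6) = - (e ^ 2 * (6 * r * y + 2 * r * w * e))"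
  "vol (T $ 1) (T $ 2) (T $ 5) (T $ 6) = - (e ^ 3 * (12 * r * w))"
  "vol (T $ 1) (T $ 3) (T $ 4) (T $ 5) = (e ^ 2 * (2 * r * y - 2 * y * v * e + 2 * a' * w * e))"
  "vol (T $ 2) (T $ 3) (T $ 4) (T $ 6) = (e ^ 2 * (2 * r * y - 2 * y * v * e + 2 * a' * w * e))"
  "vol (T $ 1) (T $ 3) (T $ 4) (T $ 6) = - (e ^ 2 * (4 * r * y))"
  "vol (T $ 2) (T $ 3) (T $ 4) (T $ 5) = (e ^ 2 * (8 * r * y + 8 * y * v * e - 8 * a' * w * e))"
  unfolding T_def tent_nth vol_expand vector_3 by algebra+

definition positive_quadruples :: "(nat \<times> nat \<times> nat \<times> nat) list" where
  "positive_quadruples = [(0, 1, 2, 3), (0, 1, 2, 4), (0, 1, 2, 5), (0, 1, 2, 6), (0, 1, 3, 4), (0, 1, 3, 5), (0, 1, 3, 6), (0, 1, 4, 7), (0, 1, 5, 7), (0, 1, 6, 7), (0, 2, 3, 4), (0, 2, 3, 5), (0, 2, 3, 6), (0, 2, 4, 7), (0, 2, 5, 7), (0, 2, 6, 7), (0, 3, 4, 7), (0, 3, 5, 7), (0, 3, 6, 7), (1, 2, 3, 4), (1, 2, 3, 5), (1, 2, 3, 6), (1, 3, 4, 5), (1, 4, 5, 6), (1, 4, 5, 7), (1, 4, 6, 7), (1, 5, 6, 7), (2, 3, 4, 5), (2, 3, 4, 6), (2, 4, 5, 6), (2, 4, 5, 7), (2, 4, 6, 7), (2, 5, 6, 7),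 (3, 4, 5, 6), (3, 4, 5, 7), (3, 4, 6, 7), (3, 5, 6, 7), (4, 5, 6, 7)]"

lemma quadruple_cases:
  assumes "i < j" "j < k" "k < l" "l < 8"
  shows "(i, j, k, l) \<in> set negative_quadruples \<or> (i, j, k, l) \<in> set positive_quadruples \<and> (i, j, k, l) \<notin> set negative_quadruples"
proof -
  have "list_all (\<lambda>l. list_all (\<lambda>k. list_all (\<lambda>j. list_all (\<lambda>i. (i, j, k, l) \<in> set negative_quadruples \<or>
      (i, j, k, l) \<in> set positive_quadruples \<and> (i, j, k, l) \<notin> set negative_quadruples) [0..<j]) [0..<k]) [0..<l]) [0..<8]"
    by code_simp
  then show ?thesis using assms by (simp add: list_all_iff)
qed


lemma tent_chirotope:
  assumes S: "tent_signs a s r a' y v w e" and e: "e > 0"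
  shows "pup_chirotope (\<lambda>n. tent a s r a' y v w e $ of_nat n)"
proof -
  let ?T = "tent a s r a' y v w e"
  have p: "0 < e ^ n * h" if "0 < h" for n h using e that by simp
  note S' = S[unfolded tent_signs_def]
  have pos:
    "0 < vol (?T $ 0) (?T $ 1) (?T $ 2) (?T $ 3)"
    "0 < vol (?T $ 0) (?T $ 1) (?T $ 2) (?T $ 4)"
    "0 < vol (?T $ 0) (?T $ 1) (?T $ 2) (?T $ 5)"
    "0 < vol (?T $ 0) (?T $ 1) (?T $ 2) (?T $ 6)"
    "0 < vol (?T $ 0) (?T $ 1) (?T $ 3) (?T $ 4)"
    "0 < vol (?T $ 0) (?T $ 1) (?T $ 3) (?T $ 5)"
    "0 < vol (?T $ 0) (?T $ 1) (?T $ 3) (?T $ 6)"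
    "0 < vol (?T $ 0) (?T $ 1) (?T $ 4) (?T $ 7)"
    "0 < vol (?T $ 0) (?T $ 1) (?T $ 5) (?T $ 7)"
    "0 < vol (?T $ 0) (?T $ 1) (?T $ 6) (?T $ 7)"
    "0 < vol (?T $ 0) (?T $ 2) (?T $ 3) (?T $ 4)"
    "0 < vol (?T $ 0) (?T $ 2) (?T $ 3) (?T $ 5)"
    "0 < vol (?T $ 0) (?T $ 2) (?T $ 3) (?T $ 6)"
    "0 < vol (?T $ 0) (?T $ 2) (?T $ 4) (?T $ 7)"
    "0 < vol (?T $ 0) (?T $ 2) (?T $ 5) (?T $ 7)"
    "0 < vol (?T $ 0) (?T $ 2) (?T $ 6) (?T $ 7)"
    "0 < vol (?T $ 0) (?T $ 3) (?T $ 4) (?T $ 7)"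
    "0 < vol (?T $ 0) (?T $ 3) (?T $ 5) (?T $ 7)"
    "0 < vol (?T $ 0) (?T $ 3) (?T $ 6) (?T $ 7)"
    "0 < vol (?T $ 1) (?T $ 2) (?T $ 3) (?T $ 4)"
    "0 < vol (?T $ 1) (?T $ 2) (?T $ 3) (?T $ 5)"
    "0 < vol (?T $ 1) (?T $ 2) (?T $ 3) (?T $ 6)"
    "0 < vol (?T $ 1) (?T $ 3) (?T $ 4) (?T $ 5)"
    "0 < vol (?T $ 1) (?T $ 4) (?T $ 5) (?T $ 6)"
    "0 < vol (?T $ 1) (?T $ 4) (?T $ 5) (?T $ 7)"
    "0 < vol (?T $ 1) (?T $ 4) (?T $ 6) (?T $ 7)"
    "0 < vol (?T $ 1) (?T $ 5) (?T $ 6) (?T $ 7)"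
    "0 < vol (?T $ 2) (?T $ 3) (?T $ 4) (?T $ 5)"
    "0 < vol (?T $ 2) (?T $ 3) (?T $ 4) (?T $ 6)"
    "0 < vol (?T $ 2) (?T $ 4) (?T $ 5) (?T $ 6)"
    "0 < vol (?T $ 2) (?T $ 4) (?T $ 5) (?T $ 7)"
    "0 < vol (?T $ 2) (?T $ 4) (?T $ 6) (?T $ 7)"
    "0 < vol (?T $ 2) (?T $ 5) (?T $ 6) (?T $ 7)"
    "0 < vol (?T $ 3) (?T $ 4) (?T $ 5) (?T $ 6)"
    "0 < vol (?T $ 3) (?T $ 4) (?T $ 5) (?T $ 7)"
    "0 < vol (?T $ 3) (?T $ 4) (?T $ 6) (?T $ 7)"
    "0 < vol (?T $ 3) (?T $ 5) (?T $ 6) (?T $ 7)"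
    "0 < vol (?T $ 4) (?T $ 5) (?T $ 6) (?T $ 7)"
    unfolding tent_vol by (rule p, simp only: S')+
  have neg:
    "vol (?T $ 0) (?T $ 1) (?T $ 2) (?T $ 7) < 0"
    "vol (?T $ 0) (?T $ 1) (?T $ 3) (?T $ 7) < 0"
    "vol (?T $ 0) (?T $ 1) (?T $ 4) (?T $ 5) < 0"
    "vol (?T $ 0) (?T $ 1) (?T $ 4) (?T $ 6) < 0"
    "vol (?T $ 0) (?T $ 1) (?T $ 5) (?T $ 6) < 0"
    "vol (?T $ 0) (?T $ 2) (?T $ 3) (?T $ 7) < 0"
    "vol (?T $ 0) (?T $ 2) (?T $ 4) (?T $ 5) < 0"
    "vol (?T $ 0) (?T $ 2) (?T $ 4) (?T $ 6) < 0"
    "vol (?T $ 0) (?T $ 2) (?T $ 5) (?T $ 6) < 0"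
    "vol (?T $ 0) (?T $ 3) (?T $ 4) (?T $ 5) < 0"
    "vol (?T $ 0) (?T $ 3) (?T $ 4) (?T $ 6) < 0"
    "vol (?T $ 0) (?T $ 3) (?T $ 5) (?T $ 6) < 0"
    "vol (?T $ 0) (?T $ 4) (?T $ 5) (?T $ 6) < 0"
    "vol (?T $ 0) (?T $ 4) (?T $ 5) (?T $ 7) < 0"
    "vol (?T $ 0) (?T $ 4) (?T $ 6) (?T $ 7) < 0"
    "vol (?T $ 0) (?T $ 5) (?T $ 6) (?T $ 7) < 0"
    "vol (?T $ 1) (?T $ 2) (?T $ 3) (?T $ 7) < 0"
    "vol (?T $ 1) (?T $ 2) (?T $ 4) (?T $ 5) < 0"
    "vol (?T $ 1) (?T $ 2) (?T $ 4) (?T $ 6) < 0"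
    "vol (?T $ 1) (?T $ 2) (?T $ 4) (?T $ 7) < 0"
    "vol (?T $ 1) (?T $ 2) (?T $ 5) (?T $ 6) < 0"
    "vol (?T $ 1) (?T $ 2) (?T $ 5) (?T $ 7) < 0"
    "vol (?T $ 1) (?T $ 2) (?T $ 6) (?T $ 7) < 0"
    "vol (?T $ 1) (?T $ 3) (?T $ 4) (?T $ 6) < 0"
    "vol (?T $ 1) (?T $ 3) (?T $ 4) (?T $ 7) < 0"
    "vol (?T $ 1) (?T $ 3) (?T $ 5) (?T $ 6) < 0"
    "vol (?T $ 1) (?T $ 3) (?T $ 5) (?T $ 7) < 0"
    "vol (?T $ 1) (?T $ 3) (?T $ 6) (?T $ 7) < 0"
    "vol (?T $ 2) (?T $ 3) (?T $ 4) (?T $ 7) < 0"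
    "vol (?T $ 2) (?T $ 3) (?T $ 5) (?T $ 6) < 0"
    "vol (?T $ 2) (?T $ 3) (?T $ 5) (?T $ 7) < 0"
    "vol (?T $ 2) (?T $ 3) (?T $ 6) (?T $ 7) < 0"
    unfolding tent_vol neg_less_0_iff_less by (rule p, simp only: S')+
  have "\<forall>(i, j, k, l) \<in> set positive_quadruples. 0 < vol (?T $ of_nat i) (?T $ of_nat j) (?T $ of_nat k) (?T $ of_nat l)"
    unfolding positive_quadruples_def by (simp add: pos)
  moreover have "\<forall>(i, j, k, l) \<in> set negative_quadruples. vol (?T $ of_nat i) (?T $ of_nat j) (?T $ of_nat k) (?T $ of_nat l) < 0"
    unfolding negative_quadruples_def by (simp add: neg)
  ultimately have "sgn (vol (?T $ of_nat i) (?T $ of_nat j) (?T $ of_nat k) (?T $ of_nat l)) = of_int (orientation i j k l)"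
    if "i < j" "j < k" "k < l" "l < 8" for i j k l
    using quadruple_cases[OF that] unfolding orientation_def by (fastforce simp: sgn_if)
  then show ?thesis unfolding pup_chirotope_def by blast
qed

text \<open>At \<open>e = 0\<close> every polynomial reduces to a positive multiple of one of the
  nine products collected in \<open>c\<close>.\<close>

lemma eventually_tent_signs:
  assumes l: "(a \<longlongrightarrow> A) F" "(s \<longlongrightarrow> S) F" "(r \<longlongrightarrow> R) F" "(a' \<longlongrightarrow> A') F" "(y \<longlongrightarrow> Y) F" "(v \<longlongrightarrow> V) F"
      "(w \<longlongrightarrow> W) F" "(e \<longlongrightarrow> (0::real)) F"
    and pos: "A < 0" "S > 0" "R > 0" "Y > 0" "W > 0" "Y * V - A' * W + R * W > 0" "- (Y * V) + A' * W + R * W > 0"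
  shows "\<forall>\<^sub>F z in F. tent_signs (a z) (s z) (r z) (a' z) (y z) (v z) (w z) (e z)"
proof -
  have c: "0 < S * (R * Y)" "0 < S * (R * W)" "0 < R * Y" "0 < R * W" "0 < S * R" "0 < (- A) * (S * Y)" "0 < (- A) * (S * W)"
      "0 < S * (Y * V - A' * W + R * W)" "0 < S * (- (Y * V) + A' * W + R * W)"
    by (intro mult_pos_pos; use pos in simp)+
  show ?thesis unfolding tent_signs_def
    by (intro eventually_conj; (rule order_tendstoD(1), (rule l tendsto_const tendsto_add tendsto_diff tendsto_minus tendsto_mult tendsto_power)+, use c in \<open>simp add: algebra_simps\<close>))
qed

section \<open>The family of tents\<close>

text \<open>The flat torus with periods \<open>1\<close> and \<open>\<tau>\<close> is placed so that the half turn \<open>\<rho>\<close> is \<open>z \<mapsto> - z\<close>. The vertex \<open>p j\<close>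
  has horizontal norm \<open>|zj|\<close>, where \<open>zj\<close> is half the difference of the flat positions of \<open>p j\<close> and \<open>p (7 - j)\<close>,
  and \<open>p 0, \<dots>, p 3\<close> have heights \<open>-s, -\<epsilon>\<^sup>2, 2 \<epsilon>\<^sup>2, 0\<close>. The unknowns are \<open>b = Im z3\<close>, the shift \<open>\<epsilon> k\<close> of \<open>Re z1\<close>, and
  the direction \<open>-1 + i D\<close> of the short edge from \<open>p 1\<close> to \<open>p 2\<close>; all other formulas solve the length
  equations in turn, leaving the edges from \<open>p 0\<close> to \<open>p 3\<close>, from \<open>p 2\<close> to \<open>p 5\<close> and from \<open>p 1\<close> to \<open>p 2\<close> for \<open>Q\<close>.\<close>

type_synonym family_point = "(real \<times> real \<times> real) \<times> (complex \<times> real)"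

definition pb :: "family_point \<Rightarrow> real" where "pb = (\<lambda>x. fst (fst x))"
definition pk :: "family_point \<Rightarrow> real" where "pk = (\<lambda>x. fst (snd (fst x)))"
definition pD :: "family_point \<Rightarrow> real" where "pD = (\<lambda>x. snd (snd (fst x)))"
definition pX :: "family_point \<Rightarrow> real" where "pX = (\<lambda>x. Re (fst (snd x)))"
definition pY :: "family_point \<Rightarrow> real" where "pY = (\<lambda>x. Im (fst (snd x)))"
definition pe :: "family_point \<Rightarrow> real" where "pe = (\<lambda>x. snd (snd x))"

definition fam_re1 :: "family_point \<Rightarrow> real" where
  "fam_re1 = (\<lambda>x. pX x / 2 - 1/4 + pe x * pk x)"
text \<open>Height relation (see \<open>pair_lengths\<close>) of the edges from 3 to 1 and to 6,
  solved for the imaginary part of \<open>z1\<close>. In the same way \<open>fam_hs\<close>,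
  \<open>fam_re0\<close> and \<open>fam_re3\<close> solve those of the edges from 0 to 2 and 5, from
  1 to 0 and 7, and from 2 to 3 and 4.\<close>

definition fam_im1 :: "family_point \<Rightarrow> real" where
  "fam_im1 = (\<lambda>x. (((pX x)^2 + (pY x)^2) / 4 - pe x ^ 4 - pX x * fam_re1 x) / pY x)"
definition fam_hs :: "family_point \<Rightarrow> real" where
  "fam_hs = (\<lambda>x. sqrt (pX x / 2 - pe x ^ 4 + pe x * (- pX x + pY x * pD x)) - 2 * (pe x)^2)"
definition fam_re2 :: "family_point \<Rightarrow> real" where
  "fam_re2 = (\<lambda>x. fam_re1 x + (1 - pX x) / 2 - pe x)"
definition fam_im2 :: "family_point \<Rightarrow> real" where
  "fam_im2 = (\<lambda>x. fam_im1 x - pY x / 2 + pe x * pD x)"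
definition fam_re0 :: "family_point \<Rightarrow> real" where
  "fam_re0 = (\<lambda>x. (fam_hs x - (pe x)^2)^2 - 1/4)"
definition fam_r1 :: "family_point \<Rightarrow> real" where
  "fam_r1 = (\<lambda>x. sqrt ((fam_re1 x)^2 + (fam_im1 x)^2))"
text \<open>By Lagrange's identity the norm and inner product conditions on \<open>p 0\<close> fix
  the cross product of \<open>z1\<close> and \<open>z0 + 1/2\<close> up to sign. The positive root
  is chosen, and the equation is linear in the imaginary part of \<open>z0\<close>.\<close>

definition fam_im0 :: "family_point \<Rightarrow> real" where
  "fam_im0 = (\<lambda>x. (fam_im1 x * (fam_re0 x + 1/2) - fam_r1 x * sqrt ((fam_hs x - (pe x)^2)^2 + pe x ^ 4)) / fam_re1 x)"
definition fam_re3 :: "family_point \<Rightarrow> real" where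
  "fam_re3 = (\<lambda>x. 1/4 - 4 * pe x ^ 4)"
definition fam_a0 :: "family_point \<Rightarrow> real" where
  "fam_a0 = (\<lambda>x. (fam_re1 x * (fam_re0 x + 1/2) + fam_im1 x * fam_im0 x) / fam_r1 x)"
definition fam_a3 :: "family_point \<Rightarrow> real" where
  "fam_a3 = (\<lambda>x. (fam_re3 x * (fam_re1 x - pX x / 2) + pb x * (fam_im1 x - pY x / 2)) / fam_r1 x)"
definition fam_y3 :: "family_point \<Rightarrow> real" where
  "fam_y3 = (\<lambda>x. sqrt ((fam_re3 x)^2 + (pb x)^2 - (fam_a3 x)^2))"
text \<open>Right-hand side of the inner product relation for vertices 0 and 2 minus that for 0 and
  1, divided by \<open>\<epsilon>\<close>. \<open>fam_R3\<close> is the analogue with 3 in place of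
  0.\<close>

definition fam_R0 :: "family_point \<Rightarrow> real" where
  "fam_R0 = (\<lambda>x. (- pX x + pY x * pD x - pk x - 6 * pe x * fam_hs x - 4 * pe x ^ 3) / 2 - fam_re0 x + fam_im0 x * pD x)"
definition fam_R3 :: "family_point \<Rightarrow> real" where
  "fam_R3 = (\<lambda>x. - 2 * pe x ^ 3 - pk x / 2 - (fam_re3 x - 1/2) + pb x * pD x)"
definition fam_det :: "family_point \<Rightarrow> real" where
  "fam_det = (\<lambda>x. fam_a0 x * fam_y3 x - (pe x)^2 * fam_a3 x)"
text \<open>Cramer's rule for the linear system with rows \<open>(fam_a0, \<epsilon>^2)\<close> and
  \<open>(fam_a3, fam_y3)\<close>. Its solution, times \<open>\<epsilon>\<close>, is the horizontal
  displacement from \<open>p 1\<close> to \<open>p 2\<close>.\<close>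

definition fam_v1 :: "family_point \<Rightarrow> real" where
  "fam_v1 = (\<lambda>x. (fam_R0 x * fam_y3 x - (pe x)^2 * fam_R3 x) / fam_det x)"
definition fam_v2 :: "family_point \<Rightarrow> real" where
  "fam_v2 = (\<lambda>x. (fam_a0 x * fam_R3 x - fam_a3 x * fam_R0 x) / fam_det x)"
definition fam_Q1 :: "family_point \<Rightarrow> real" where
  "fam_Q1 = (\<lambda>x. fam_a0 x * fam_a3 x + (pe x)^2 * fam_y3 x - ((fam_re0 x)^2 + (fam_im0 x)^2 + (fam_re3 x)^2 + (pb x)^2 + (fam_hs x)^2 - ((fam_re3 x - fam_re0 x - 1/2 + pX x / 2)^2 + (pb x - fam_im0 x + pY x / 2)^2)) / 2)"
text \<open>The edge from 2 to 5 requires horizontal norm \<open>|z2|\<close> for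
  \<open>p 2\<close>. Since \<open>|z2|\<close> differs from \<open>|z1|\<close> to order
  \<open>\<epsilon>\<close>, the equation is divided by \<open>\<epsilon>\<close>, after
  \<open>v1^2 + v2^2\<close> has been eliminated by means of \<open>fam_Q3\<close>.\<close>

definition fam_Q2 :: "family_point \<Rightarrow> real" where
  "fam_Q2 = (\<lambda>x. 2 * fam_r1 x * fam_v1 x - (pk x + 10 * pe x ^ 3 + 2 * (- (fam_re1 x + (1 - pX x) / 2) + pD x * (fam_im1 x - pY x / 2))))"
text \<open>The length equation of the edge from 1 to 2, divided by \<open>\<epsilon>^2\<close>; the
  term with 9 comes from the height difference \<open>3 * \<epsilon>^2\<close>.\<close>

definition fam_Q3 :: "family_point \<Rightarrow> real" where
  "fam_Q3 = (\<lambda>x. 1 + (pD x)^2 - ((fam_v1 x)^2 + (fam_v2 x)^2) - 9 * (pe x)^2)"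


definition fam_Q :: "family_point \<Rightarrow> real \<times> real \<times> real" where
  "fam_Q = (\<lambda>x. (fam_Q1 x, fam_Q2 x, fam_Q3 x))"

definition fam_tent :: "family_point \<Rightarrow> real^3^8" where
  "fam_tent = (\<lambda>x. tent (fam_a0 x) (fam_hs x) (fam_r1 x) (fam_a3 x) (fam_y3 x) (fam_v1 x) (fam_v2 x) (pe x))"

text \<open>The denominators and radicands of the formulas above. The condition on
  \<open>fam_hs\<close> keeps the root in \<open>fam_im0\<close> differentiable at
  \<open>\<epsilon> = 0\<close>.\<close>

definition regular :: "family_point \<Rightarrow> bool" where
  "regular x \<longleftrightarrow> pY x \<noteq> 0 \<and> pX x / 2 - pe x ^ 4 + pe x * (- pX x + pY x * pD x) > 0 \<and> fam_re1 x \<noteq> 0 \<and>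
     fam_hs x - (pe x)^2 \<noteq> 0 \<and> (fam_re3 x)^2 + (pb x)^2 - (fam_a3 x)^2 > 0 \<and> fam_det x \<noteq> 0"

lemmas strict_intros = strictly_differentiable_const strictly_differentiable_add strictly_differentiable_diff
  strictly_differentiable_minus strictly_differentiable_mult strictly_differentiable_divide
  strictly_differentiable_power strictly_differentiable_sqrt

lemma regular_r1:
  assumes "regular x" shows "(fam_re1 x)^2 + (fam_im1 x)^2 > 0" "(fam_hs x - (pe x)^2)^2 + pe x ^ 4 > 0" "fam_r1 x > 0"
proof -
  show 1: "(fam_re1 x)^2 + (fam_im1 x)^2 > 0" using assms unfolding regular_def by (simp add: sum_power2_gt_zero_iff)
  show "(fam_hs x - (pe x)^2)^2 + pe x ^ 4 > 0"
    by (rule add_pos_nonneg) (use assms in \<open>simp_all add: regular_def\<close>)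
  show "fam_r1 x > 0" using 1 by (simp add: fam_r1_def)
qed

text \<open>Only \<open>regular\<close> is assumed, not the sign of \<open>pe x\<close>: the limit
  is an interior point of the domain of the formulas, and the family extends across it to negative
  \<open>\<epsilon>\<close>.\<close>

lemma regular_strictly_differentiable:
  assumes reg: "regular x"
  shows 
"strictly_differentiable pb x"
    "strictly_differentiable pk x"
    "strictly_differentiable pD x"
    "strictly_differentiable pX x"
    "strictly_differentiable pY x"
    "strictly_differentiable pe x"
    "strictly_differentiable fam_re1 x"
    "strictly_differentiable fam_im1 x"
    "strictly_differentiable fam_hs x"
    "strictly_differentiable fam_re2 x"
    "strictly_differentiable fam_im2 x"
    "strictly_differentiable fam_re0 x"
    "strictly_differentiable fam_r1 x"
    "strictly_differentiable fam_im0 x"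
    "strictly_differentiable fam_re3 x"
    "strictly_differentiable fam_a0 x"
    "strictly_differentiable fam_a3 x"
    "strictly_differentiable fam_y3 x"
    "strictly_differentiable fam_R0 x"
    "strictly_differentiable fam_R3 x"
    "strictly_differentiable fam_det x"
    "strictly_differentiable fam_v1 x"
    "strictly_differentiable fam_v2 x"
    "strictly_differentiable fam_Q1 x"
    "strictly_differentiable fam_Q2 x"
    "strictly_differentiable fam_Q3 x"
    "strictly_differentiable fam_Q x"
proof -
  have nz: "pY x \<noteq> 0" "pX x / 2 - pe x ^ 4 + pe x * (- pX x + pY x * pD x) > 0" "fam_re1 x \<noteq> 0"
     "(fam_re3 x)^2 + (pb x)^2 - (fam_a3 x)^2 > 0" "fam_det x \<noteq> 0" "fam_r1 x \<noteq> 0"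
    using reg regular_r1(3)[OF reg] unfolding regular_def by auto
  note nz = nz regular_r1(1,2)[OF reg]
  show p: "strictly_differentiable pb x" "strictly_differentiable pk x" "strictly_differentiable pD x"
    "strictly_differentiable pX x" "strictly_differentiable pY x" "strictly_differentiable pe x"
    unfolding pb_def pk_def pD_def pX_def pY_def pe_def
    by (auto intro!: strictly_differentiable_bounded_linear bounded_linear_intros bounded_linear_Re[THEN bounded_linear_compose] bounded_linear_Im[THEN bounded_linear_compose])
  show q_re1: "strictly_differentiable fam_re1 x" unfolding fam_re1_def by (intro strict_intros p nz; simp)
  show q_im1: "strictly_differentiable fam_im1 x" unfolding fam_im1_def by (intro strict_intros p nz q_re1; simp)
  show q_hs: "strictly_differentiable fam_hs x" unfolding fam_hs_def by (intro strict_intros p nz q_re1 q_im1; simp)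
  show q_re2: "strictly_differentiable fam_re2 x" unfolding fam_re2_def by (intro strict_intros p nz q_re1 q_im1 q_hs; simp)
  show q_im2: "strictly_differentiable fam_im2 x" unfolding fam_im2_def by (intro strict_intros p nz q_re1 q_im1 q_hs q_re2; simp)
  show q_re0: "strictly_differentiable fam_re0 x" unfolding fam_re0_def by (intro strict_intros p nz q_re1 q_im1 q_hs q_re2 q_im2; simp)
  show q_r1: "strictly_differentiable fam_r1 x" unfolding fam_r1_def by (intro strict_intros p nz q_re1 q_im1 q_hs q_re2 q_im2 q_re0; simp)
  show q_im0: "strictly_differentiable fam_im0 x" unfolding fam_im0_def by (intro strict_intros p nz q_re1 q_im1 q_hs q_re2 q_im2 q_re0 q_r1; simp)
  show q_re3: "strictly_differentiable fam_re3 x" unfolding fam_re3_def by (intro strict_intros p nz q_re1 q_im1 q_hs q_re2 q_im2 q_re0 q_r1 q_im0; simp)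
  show q_a0: "strictly_differentiable fam_a0 x" unfolding fam_a0_def by (intro strict_intros p nz q_re1 q_im1 q_hs q_re2 q_im2 q_re0 q_r1 q_im0 q_re3; simp)
  show q_a3: "strictly_differentiable fam_a3 x" unfolding fam_a3_def by (intro strict_intros p nz q_re1 q_im1 q_hs q_re2 q_im2 q_re0 q_r1 q_im0 q_re3 q_a0; simp)
  show q_y3: "strictly_differentiable fam_y3 x" unfolding fam_y3_def by (intro strict_intros p nz q_re1 q_im1 q_hs q_re2 q_im2 q_re0 q_r1 q_im0 q_re3 q_a0 q_a3; simp)
  show q_R0: "strictly_differentiable fam_R0 x" unfolding fam_R0_def by (intro strict_intros p nz q_re1 q_im1 q_hs q_re2 q_im2 q_re0 q_r1 q_im0 q_re3 q_a0 q_a3 q_y3; simp)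
  show q_R3: "strictly_differentiable fam_R3 x" unfolding fam_R3_def by (intro strict_intros p nz q_re1 q_im1 q_hs q_re2 q_im2 q_re0 q_r1 q_im0 q_re3 q_a0 q_a3 q_y3 q_R0; simp)
  show q_det: "strictly_differentiable fam_det x" unfolding fam_det_def by (intro strict_intros p nz q_re1 q_im1 q_hs q_re2 q_im2 q_re0 q_r1 q_im0 q_re3 q_a0 q_a3 q_y3 q_R0 q_R3; simp)
  show q_v1: "strictly_differentiable fam_v1 x" unfolding fam_v1_def by (intro strict_intros p nz q_re1 q_im1 q_hs q_re2 q_im2 q_re0 q_r1 q_im0 q_re3 q_a0 q_a3 q_y3 q_R0 q_R3 q_det; simp)
  show q_v2: "strictly_differentiable fam_v2 x" unfolding fam_v2_def by (intro strict_intros p nz q_re1 q_im1 q_hs q_re2 q_im2 q_re0 q_r1 q_im0 q_re3 q_a0 q_a3 q_y3 q_R0 q_R3 q_det q_v1; simp)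
  show q_Q1: "strictly_differentiable fam_Q1 x" unfolding fam_Q1_def by (intro strict_intros p nz q_re1 q_im1 q_hs q_re2 q_im2 q_re0 q_r1 q_im0 q_re3 q_a0 q_a3 q_y3 q_R0 q_R3 q_det q_v1 q_v2; simp)
  show q_Q2: "strictly_differentiable fam_Q2 x" unfolding fam_Q2_def by (intro strict_intros p nz q_re1 q_im1 q_hs q_re2 q_im2 q_re0 q_r1 q_im0 q_re3 q_a0 q_a3 q_y3 q_R0 q_R3 q_det q_v1 q_v2 q_Q1; simp)
  show q_Q3: "strictly_differentiable fam_Q3 x" unfolding fam_Q3_def by (intro strict_intros p nz q_re1 q_im1 q_hs q_re2 q_im2 q_re0 q_r1 q_im0 q_re3 q_a0 q_a3 q_y3 q_R0 q_R3 q_det q_v1 q_v2 q_Q1 q_Q2; simp)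
  show "strictly_differentiable fam_Q x" unfolding fam_Q_def by (intro strictly_differentiable_Pair q_Q1 q_Q2 q_Q3)
qed

section \<open>Weierstrass points and edge vectors of the flat torus\<close>

definition fam_z0 :: "family_point \<Rightarrow> complex" where "fam_z0 = (\<lambda>x. Complex (fam_re0 x) (fam_im0 x))"
definition fam_z1 :: "family_point \<Rightarrow> complex" where "fam_z1 = (\<lambda>x. Complex (fam_re1 x) (fam_im1 x))"
definition fam_z2 :: "family_point \<Rightarrow> complex" where "fam_z2 = (\<lambda>x. Complex (fam_re2 x) (fam_im2 x))"
definition fam_z3 :: "family_point \<Rightarrow> complex" where "fam_z3 = (\<lambda>x. Complex (fam_re3 x) (pb x))"
definition fam_d :: "family_point \<Rightarrow> complex" where "fam_d = (\<lambda>x. Complex (- 1) (pD x))"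

text \<open>The edge vectors of the flat torus in terms of its Weierstrass points \<open>z0, \<dots>, z3\<close>; the edges
  from \<open>1\<close> to \<open>2\<close> and from \<open>5\<close> to \<open>6\<close> are short.\<close>

definition edge1 :: "complex \<Rightarrow> complex \<Rightarrow> complex \<Rightarrow> complex \<Rightarrow> complex \<Rightarrow> complex \<Rightarrow> 8 \<Rightarrow> complex" where
  "edge1 z0 z1 z2 z3 t ed v = (if v = 0 \<or> v = 6 then z1 - z0 - 1/2 else if v = 1 \<or> v = 5 then ed
     else if v = 2 \<or> v = 4 then z3 - z2 - 1/2 else if v = 3 then - 2 * z3 else 2 * z0)"

definition edge2 :: "complex \<Rightarrow> complex \<Rightarrow> complex \<Rightarrow> complex \<Rightarrow> complex \<Rightarrow> 8 \<Rightarrow> complex" where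
  "edge2 z0 z1 z2 z3 t v = (if v = 0 \<or> v = 5 then z2 - z0 + t/2 else if v = 1 \<or> v = 4 then z3 - z1 + t/2
     else if v = 2 \<or> v = 3 then 1/2 - z2 - z3 else z0 + z1 + 1/2)"

definition edge3 :: "complex \<Rightarrow> complex \<Rightarrow> complex \<Rightarrow> complex \<Rightarrow> complex \<Rightarrow> 8 \<Rightarrow> complex" where
  "edge3 z0 z1 z2 z3 t v = (if v = 0 \<or> v = 4 then z3 - z0 - 1/2 + t/2 else if v = 1 \<or> v = 3 then t/2 - z3 - z1
     else if v = 2 then - 2 * z2 else if v = 5 \<or> v = 7 then z2 + z0 + t/2 else 2 * z1)"

text \<open>Open conditions that make the edge vectors an embedded star at each vertex when the short
  edge vector is a small positive multiple of \<open>d\<close>.\<close>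

definition flat_signs :: "complex \<Rightarrow> complex \<Rightarrow> complex \<Rightarrow> complex \<Rightarrow> complex \<Rightarrow> complex \<Rightarrow> complex \<Rightarrow> complex \<Rightarrow> bool" where
  "flat_signs z0 z1 z2 z3 t d n2 n3 \<longleftrightarrow>
    0 < Im ((z3 - z0 - 1/2 + t/2) * cnj (z2 - z0 + t/2)) \<and>
    0 < Im ((t/2 - z3 - z1) * cnj (z3 - z1 + t/2)) \<and>
    0 < Im ((- 2 * z2) * cnj (1/2 - z2 - z3)) \<and>
    0 < Im ((d) * cnj (1/2 - z2 - z3)) \<and>
    0 < Im ((z3 - z0 - 1/2 + t/2) * cnj (z3 - z1 + t/2)) \<and>
    0 < Im ((z2 + z0 + t/2) * cnj (z2 - z0 + t/2)) \<and>
    0 < Im ((2 * z1) * cnj (z0 + z1 + 1/2)) \<and>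
    0 < Im ((d) * cnj (z0 + z1 + 1/2)) \<and>
    0 < Im ((z1 - z0 - 1/2) * cnj (z3 - z0 - 1/2 + t/2)) \<and>
    0 < Im ((d) * cnj (t/2 - z3 - z1)) \<and>
    0 < Im ((z3 - z2 - 1/2) * cnj (- 2 * z2)) \<and>
    0 < Im ((- 2 * z3) * cnj (t/2 - z3 - z1)) \<and>
    0 < Im ((z3 - z2 - 1/2) * cnj (z3 - z0 - 1/2 + t/2)) \<and>
    0 < Im ((d) * cnj (z2 + z0 + t/2)) \<and>
    0 < Im ((z1 - z0 - 1/2) * cnj (2 * z1)) \<and>
    0 < Im ((2 * z0) * cnj (z2 + z0 + t/2)) \<and>
    0 < Im (z2 - z0 + t/2) \<and>
    0 < Im (z3 - z1 + t/2) \<and>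
    0 < Im (1/2 - z2 - z3) \<and>
    0 < Im (z0 + z1 + 1/2) \<and>
    0 < Im (z3 - z0 - 1/2 + t/2) \<and>
    0 < Im (t/2 - z3 - z1) \<and>
    0 < Im (- 2 * z2) \<and>
    0 < Im (z2 + z0 + t/2) \<and>
    0 < Im (2 * z1) \<and>
    0 < n2 \<bullet> (z3 - z0 - 1/2 + t/2) \<and>
    0 < n2 \<bullet> (t/2 - z3 - z1) \<and>
    0 < n2 \<bullet> (- 2 * z2) \<and>
    0 < n2 \<bullet> (z2 + z0 + t/2) \<and>
    0 < n2 \<bullet> (2 * z1) \<and>
    0 < n2 \<bullet> (z1 - z0 - 1/2) \<and>
    0 < n2 \<bullet> (z3 - z2 - 1/2) \<and>
    0 < n2 \<bullet> (- 2 * z3) \<and>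
    0 < n2 \<bullet> (2 * z0) \<and>
    0 < n2 \<bullet> (d) \<and>
    0 < n3 \<bullet> (z1 - z0 - 1/2) \<and>
    0 < n3 \<bullet> (z3 - z2 - 1/2) \<and>
    0 < n3 \<bullet> (- 2 * z3) \<and>
    0 < n3 \<bullet> (2 * z0) \<and>
    0 < n3 \<bullet> (d) \<and>
    0 < - (n3 \<bullet> (z2 - z0 + t/2)) \<and>
    0 < - (n3 \<bullet> (z3 - z1 + t/2)) \<and>
    0 < - (n3 \<bullet> (1/2 - z2 - z3)) \<and>
    0 < - (n3 \<bullet> (z0 + z1 + 1/2))"

lemma eventually_flat_signs:
  assumes l: "(z0 \<longlongrightarrow> Z0) F" "(z1 \<longlongrightarrow> Z1) F" "(z2 \<longlongrightarrow> Z2) F" "(z3 \<longlongrightarrow> Z3) F" "(t \<longlongrightarrow> T) F" "(d \<longlongrightarrow> D) F"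
    and S: "flat_signs Z0 Z1 Z2 Z3 T D n2 n3"
  shows "\<forall>\<^sub>F x in F. flat_signs (z0 x) (z1 x) (z2 x) (z3 x) (t x) (d x) n2 n3"
proof -
  note S' = S[unfolded flat_signs_def]
  have half: "((\<lambda>x. f x / 2) \<longlongrightarrow> l / 2) F" if "(f \<longlongrightarrow> l) F" for f :: "'a \<Rightarrow> complex" and l
    by (intro tendsto_divide that tendsto_const) simp
  show ?thesis unfolding flat_signs_def
    by (intro eventually_conj; (rule order_tendstoD(1), (rule l half tendsto_const tendsto_Im tendsto_cnj tendsto_inner tendsto_add tendsto_diff tendsto_minus tendsto_mult)+, simp only: S'))
qed

text \<open>All sixteen triangles close up as soon as one relation holds: the short edge leads from
  vertex 1 to vertex 2.\<close>

lemma edge_relations: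
  assumes z2: "z2 = z1 + (1 - t) / 2 + ed"
  shows "edge3 z0 z1 z2 z3 t v = edge2 z0 z1 z2 z3 t v + edge1 z0 z1 z2 z3 t ed (v + 2)"
    and "edge3 z0 z1 z2 z3 t v = edge1 z0 z1 z2 z3 t ed v + edge2 z0 z1 z2 z3 t (v + 1)"
proof -
  have "\<forall>v. edge3 z0 z1 z2 z3 t v = edge2 z0 z1 z2 z3 t v + edge1 z0 z1 z2 z3 t ed (v + 2)"
    unfolding all_8 z2 by (simp add: edge1_def edge2_def edge3_def numeral_8_wrap field_simps)
  then show "edge3 z0 z1 z2 z3 t v = edge2 z0 z1 z2 z3 t v + edge1 z0 z1 z2 z3 t ed (v + 2)" by blast
  have "\<forall>v. edge3 z0 z1 z2 z3 t v = edge1 z0 z1 z2 z3 t ed v + edge2 z0 z1 z2 z3 t (v + 1)"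
    unfolding all_8 z2 by (simp add: edge1_def edge2_def edge3_def numeral_8_wrap field_simps)
  then show "edge3 z0 z1 z2 z3 t v = edge1 z0 z1 z2 z3 t ed v + edge2 z0 z1 z2 z3 t (v + 1)" by blast
qed

lemma edge_signs:
  assumes S: "flat_signs z0 z1 z2 z3 t d n2 n3" and e: "e > 0" and z2: "z2 = z1 + (1 - t) / 2 + of_real e * d"
  defines "e1 \<equiv> edge1 z0 z1 z2 z3 t (of_real e * d)" and "e2 \<equiv> edge2 z0 z1 z2 z3 t" and "e3 \<equiv> edge3 z0 z1 z2 z3 t"
  shows "Im (e3 v * cnj (e2 v)) > 0" "Im (e1 v * cnj (e3 v)) > 0" "\<i> \<bullet> e2 v > 0" "\<i> \<bullet> e3 v > 0"
    "n2 \<bullet> e3 v > 0" "n2 \<bullet> e1 v > 0" "n3 \<bullet> e1 v > 0" "n3 \<bullet> e2 v < 0"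
proof -
  note S' = S[unfolded flat_signs_def]
  have short: "Im (of_real e * z) = e * Im z" "of_real e * z * w = of_real e * (z * w)"
     "n \<bullet> (of_real e * z) = e * (n \<bullet> z)" for z w n
    by (simp_all add: inner_complex_def algebra_simps)
  have e13: "e1 1 = of_real e * d" "e1 5 = of_real e * d" by (simp_all add: e1_def edge1_def)
  \<comment> \<open>In the triangles \<open>{3, 5, 6}\<close> and \<open>{7, 1, 2}\<close> the short
    edge is the difference of the two other vectors. Their areas are therefore \<open>e\<close>
    times a quantity that stays positive in the limit.\<close>
  have sub: "e3 3 = e2 3 + e1 5" "e3 7 = e2 7 + e1 1"
    using edge_relations(1)[OF z2, of z0 z3 3] edge_relations(1)[OF z2, of z0 z3 7]
    by (simp_all add: e1_def e2_def e3_def numeral_8_wrap)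
  have ex: "e1 0 = z1 - z0 - 1/2" "e1 2 = z3 - z2 - 1/2" "e1 3 = - 2 * z3" "e1 4 = z3 - z2 - 1/2" "e1 6 = z1 - z0 - 1/2" "e1 7 = 2 * z0"
    "e2 0 = z2 - z0 + t/2" "e2 1 = z3 - z1 + t/2" "e2 2 = 1/2 - z2 - z3" "e2 3 = 1/2 - z2 - z3" "e2 4 = z3 - z1 + t/2"
    "e2 5 = z2 - z0 + t/2" "e2 6 = z0 + z1 + 1/2" "e2 7 = z0 + z1 + 1/2"
    "e3 0 = z3 - z0 - 1/2 + t/2" "e3 1 = t/2 - z3 - z1" "e3 2 = - 2 * z2" "e3 3 = t/2 - z3 - z1" "e3 4 = z3 - z0 - 1/2 + t/2"
    "e3 5 = z2 + z0 + t/2" "e3 6 = 2 * z1" "e3 7 = z2 + z0 + t/2"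
    by (simp_all add: e1_def e2_def e3_def edge1_def edge2_def edge3_def)
  have Im_self: "Im (z * cnj z) = 0" for z by simp
  have p: "0 < e * h" if "0 < h" for h using e that by simp
  have U: "Im (e3 3 * cnj (e2 3)) > 0" "Im (e3 7 * cnj (e2 7)) > 0"
    unfolding sub distrib_right plus_complex.sel Im_self e13 short add_0 by (rule p, simp only: ex S')+
  have "\<forall>v. Im (e3 v * cnj (e2 v)) > 0" unfolding all_8 by (intro conjI U; simp only: ex S')
  then show "Im (e3 v * cnj (e2 v)) > 0" by blast
  have "\<forall>v. Im (e1 v * cnj (e3 v)) > 0" unfolding all_8 e13 short
    by (intro conjI p; simp only: ex S')
  then show "Im (e1 v * cnj (e3 v)) > 0" by blast
  have i: "\<i> \<bullet> z = Im z" for z by (simp add: inner_complex_def)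
  have "\<forall>v. \<i> \<bullet> e2 v > 0" "\<forall>v. \<i> \<bullet> e3 v > 0" "\<forall>v. n2 \<bullet> e3 v > 0" unfolding all_8 i by (intro conjI; simp only: ex S')+
  then show "\<i> \<bullet> e2 v > 0" "\<i> \<bullet> e3 v > 0" "n2 \<bullet> e3 v > 0" by blast+
  have "\<forall>v. n2 \<bullet> e1 v > 0" "\<forall>v. n3 \<bullet> e1 v > 0" unfolding all_8 e13 short by (intro conjI p; simp only: ex S')+
  then show "n2 \<bullet> e1 v > 0" "n3 \<bullet> e1 v > 0" by blast+
  have "\<forall>v. 0 < - (n3 \<bullet> e2 v)" unfolding all_8 by (intro conjI; simp only: ex S')
  then show "n3 \<bullet> e2 v < 0" by simp
qed

section \<open>The length equations\<close>

lemma dist_vector_eq_norm_iff: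
  "dist (vector [a, b, c] :: real^3) (vector [a', b', c']) = norm z \<longleftrightarrow>
     (a - a')^2 + (b - b')^2 + (c - c')^2 = (Re z)^2 + (Im z)^2"
  by (simp add: dist_vec_def L2_set_def sum_3 dist_real_def cmod_def)

lemma dist_vector_eq_norm_double_iff:
  "dist (vector [a, b, c] :: real^3) (vector [a', b', c']) = 2 * norm z \<longleftrightarrow>
     (a - a')^2 + (b - b')^2 + (c - c')^2 = (2 * Re z)^2 + (2 * Im z)^2"
  using dist_vector_eq_norm_iff[of a b c a' b' c' "2 * z"] by (simp add: norm_mult)

text \<open>A vertex joined to both \<open>p j\<close> and \<open>p (7 - j)\<close> gives two length
  equations with opposite signs. Given the norms, their difference is an inner product relation and
  their sum a relation for the height difference \<open>h\<close>; \<open>(c, d)\<close> is the half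
  period in the flat position.\<close>

lemma pair_lengths:
  fixes x y x' y' \<xi> \<eta> \<xi>' \<eta>' c d h :: real
  assumes "x^2 + y^2 = \<xi>^2 + \<eta>^2" "x'^2 + y'^2 = \<xi>'^2 + \<eta>'^2" "x * x' + y * y' = \<xi> * (\<xi>' + c) + \<eta> * (\<eta>' + d)"
    and "h^2 = c^2 + d^2 + 2 * (c * \<xi>' + d * \<eta>')"
  shows "(x - x')^2 + (y - y')^2 + h^2 = (\<xi> - \<xi>' - c)^2 + (\<eta> - \<eta>' - d)^2"
    and "(x + x')^2 + (y + y')^2 + h^2 = (\<xi> + \<xi>' + c)^2 + (\<eta> + \<eta>' + d)^2"
  using assms by (simp_all add: power2_eq_square algebra_simps)

lemma fam_equations:
  fixes x :: family_point
  defines "X \<equiv> pX x" and "Y \<equiv> pY x" and "e \<equiv> pe x" and "b \<equiv> pb x" and "k \<equiv> pk x" and "D \<equiv> pD x"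
  assumes reg: "regular x" and Q: "fam_Q x = 0"
  shows "fam_re1 x = X/2 - 1/4 + e * k" "fam_im1 x * Y = (X^2 + Y^2)/4 - e^4 - X * fam_re1 x"
    "(fam_hs x + 2 * e^2)^2 = X/2 - e^4 + e * (- X + Y * D)"
    "fam_re2 x = fam_re1 x + (1 - X)/2 - e" "fam_im2 x = fam_im1 x - Y/2 + e * D"
    "fam_re0 x = (fam_hs x - e^2)^2 - 1/4" "fam_re3 x = 1/4 - 4 * e^4"
    "fam_r1 x ^ 2 = (fam_re1 x)^2 + (fam_im1 x)^2"
    "fam_r1 x * fam_a0 x = fam_re1 x * (fam_re0 x + 1/2) + fam_im1 x * fam_im0 x"
    "(fam_a0 x)^2 + e^4 = (fam_re0 x)^2 + (fam_im0 x)^2"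
    "fam_r1 x * fam_a3 x = fam_re3 x * (fam_re1 x - X/2) + b * (fam_im1 x - Y/2)"
    "(fam_a3 x)^2 + (fam_y3 x)^2 = (fam_re3 x)^2 + b^2"
    "fam_a0 x * fam_v1 x + e^2 * fam_v2 x = (- X + Y * D - k - 6 * e * fam_hs x - 4 * e^3) / 2 - fam_re0 x + fam_im0 x * D"
    "fam_a3 x * fam_v1 x + fam_y3 x * fam_v2 x = - 2 * e^3 - k/2 - (fam_re3 x - 1/2) + b * D"
    "2 * (fam_a0 x * fam_a3 x + e^2 * fam_y3 x) = (fam_re0 x)^2 + (fam_im0 x)^2 + (fam_re3 x)^2 + b^2 + (fam_hs x)^2
        - ((fam_re3 x - fam_re0 x - 1/2 + X/2)^2 + (b - fam_im0 x + Y/2)^2)"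
    "2 * fam_r1 x * fam_v1 x = k + 10 * e^3 + 2 * (- (fam_re1 x + (1 - X)/2) + D * (fam_im1 x - Y/2))"
    "(fam_v1 x)^2 + (fam_v2 x)^2 = 1 + D^2 - 9 * e^2"
proof -
  have nz: "Y \<noteq> 0" "X/2 - e^4 + e * (- X + Y * D) > 0" "fam_re1 x \<noteq> 0" "(fam_re3 x)^2 + b^2 - (fam_a3 x)^2 > 0"
      "fam_det x \<noteq> 0" "fam_r1 x \<noteq> 0"
    using reg regular_r1(3)[OF reg] unfolding regular_def X_def Y_def e_def b_def D_def by auto
  show "fam_re1 x = X/2 - 1/4 + e * k" "fam_re2 x = fam_re1 x + (1 - X)/2 - e" "fam_im2 x = fam_im1 x - Y/2 + e * D"
    and re0: "fam_re0 x = (fam_hs x - e^2)^2 - 1/4" and "fam_re3 x = 1/4 - 4 * e^4"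
    by (simp_all add: fam_re1_def fam_re2_def fam_im2_def fam_re0_def fam_re3_def X_def Y_def e_def k_def D_def)
  show "fam_im1 x * Y = (X^2 + Y^2)/4 - e^4 - X * fam_re1 x" using nz(1) by (simp add: fam_im1_def X_def Y_def e_def)
  show "(fam_hs x + 2 * e^2)^2 = X/2 - e^4 + e * (- X + Y * D)"
    using nz(2) by (simp add: fam_hs_def X_def Y_def e_def D_def)
  show r: "fam_r1 x ^ 2 = (fam_re1 x)^2 + (fam_im1 x)^2" by (simp add: fam_r1_def)
  show a0: "fam_r1 x * fam_a0 x = fam_re1 x * (fam_re0 x + 1/2) + fam_im1 x * fam_im0 x" using nz(6) by (simp add: fam_a0_def)
  show "fam_r1 x * fam_a3 x = fam_re3 x * (fam_re1 x - X/2) + b * (fam_im1 x - Y/2)"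
    using nz(6) by (simp add: fam_a3_def X_def Y_def b_def)
  show "(fam_a3 x)^2 + (fam_y3 x)^2 = (fam_re3 x)^2 + b^2" using nz(4) by (simp add: fam_y3_def b_def)
  define w where "w = sqrt ((fam_hs x - e^2)^2 + e^4)"
  have w: "w^2 = (fam_hs x - e^2)^2 + e^4" unfolding w_def by (rule real_sqrt_pow2) simp
  have cr: "fam_re1 x * fam_im0 x = fam_im1 x * (fam_re0 x + 1/2) - fam_r1 x * w"
    using nz(3) by (simp add: fam_im0_def w_def e_def)
  \<comment> \<open>Lagrange's identity for \<open>z1\<close> and \<open>z0 + 1/2\<close>, whose
    inner and cross products are now known.\<close>
  have "(fam_r1 x * fam_a0 x)^2 + (fam_r1 x * w)^2 = ((fam_re1 x)^2 + (fam_im1 x)^2) * ((fam_re0 x + 1/2)^2 + (fam_im0 x)^2)"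
  proof -
    have "fam_r1 x * w = fam_im1 x * (fam_re0 x + 1/2) - fam_re1 x * fam_im0 x" using cr by simp
    then show ?thesis unfolding a0 by (simp only:) (simp add: power2_eq_square algebra_simps)
  qed
  then have "fam_r1 x ^ 2 * ((fam_a0 x)^2 + w^2) = fam_r1 x ^ 2 * ((fam_re0 x + 1/2)^2 + (fam_im0 x)^2)"
    unfolding r by (simp only: power_mult_distrib r) (simp add: algebra_simps)
  then have "(fam_a0 x)^2 + w^2 = (fam_re0 x + 1/2)^2 + (fam_im0 x)^2" using nz(6) by simp
  moreover have "w^2 = fam_re0 x + 1/4 + e^4" unfolding w using re0 by simp
  ultimately show "(fam_a0 x)^2 + e^4 = (fam_re0 x)^2 + (fam_im0 x)^2"
    by (simp only:) (simp add: power2_eq_square algebra_simps)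
  have v: "fam_v1 x * fam_det x = fam_R0 x * fam_y3 x - e^2 * fam_R3 x" "fam_v2 x * fam_det x = fam_a0 x * fam_R3 x - fam_a3 x * fam_R0 x"
    using nz(5) by (simp_all add: fam_v1_def fam_v2_def e_def)
  have dd: "fam_det x = fam_a0 x * fam_y3 x - e^2 * fam_a3 x" by (simp add: fam_det_def e_def)
  have "fam_det x * (fam_a0 x * fam_v1 x + e^2 * fam_v2 x) = fam_a0 x * (fam_v1 x * fam_det x) + e^2 * (fam_v2 x * fam_det x)"
    by (simp add: algebra_simps)
  also have "\<dots> = fam_det x * fam_R0 x" by (simp only: v) (simp add: dd algebra_simps)
  finally have "fam_a0 x * fam_v1 x + e^2 * fam_v2 x = fam_R0 x" using nz(5) by simp
  then show "fam_a0 x * fam_v1 x + e^2 * fam_v2 x = (- X + Y * D - k - 6 * e * fam_hs x - 4 * e^3) / 2 - fam_re0 x + fam_im0 x * D"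
    by (simp add: fam_R0_def X_def Y_def e_def k_def D_def)
  have "fam_det x * (fam_a3 x * fam_v1 x + fam_y3 x * fam_v2 x) = fam_a3 x * (fam_v1 x * fam_det x) + fam_y3 x * (fam_v2 x * fam_det x)"
    by (simp add: algebra_simps)
  also have "\<dots> = fam_det x * fam_R3 x" by (simp only: v) (simp add: dd algebra_simps)
  finally have "fam_a3 x * fam_v1 x + fam_y3 x * fam_v2 x = fam_R3 x" using nz(5) by simp
  then show "fam_a3 x * fam_v1 x + fam_y3 x * fam_v2 x = - 2 * e^3 - k/2 - (fam_re3 x - 1/2) + b * D"
    by (simp add: fam_R3_def e_def b_def k_def D_def)
  have "fam_Q1 x = 0" "fam_Q2 x = 0" "fam_Q3 x = 0" using Q by (simp_all add: fam_Q_def zero_prod_def)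
  then show "2 * (fam_a0 x * fam_a3 x + e^2 * fam_y3 x) = (fam_re0 x)^2 + (fam_im0 x)^2 + (fam_re3 x)^2 + b^2 + (fam_hs x)^2
        - ((fam_re3 x - fam_re0 x - 1/2 + X/2)^2 + (b - fam_im0 x + Y/2)^2)"
    "2 * fam_r1 x * fam_v1 x = k + 10 * e^3 + 2 * (- (fam_re1 x + (1 - X)/2) + D * (fam_im1 x - Y/2))"
    "(fam_v1 x)^2 + (fam_v2 x)^2 = 1 + D^2 - 9 * e^2"
    by (simp_all add: fam_Q1_def fam_Q2_def fam_Q3_def X_def Y_def e_def b_def k_def D_def)
qed

text \<open>Four applications of \<open>pair_lengths\<close> cover eight kinds of edges. The edges
  from 0 to 3 and from 1 to 2 are read off from \<open>q1\<close> and \<open>q3\<close>; the edge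
  from 2 to 5 is the norm of \<open>p 2\<close>, and the half turn supplies the rest.\<close>

lemma family_lengths:
  fixes X Y e k D z1r z1i z2r z2i z0r z0i z3r b s r a0 a3 y v w :: real
  assumes re1: "z1r = X/2 - 1/4 + e * k" and im1: "z1i * Y = (X^2 + Y^2)/4 - e^4 - X * z1r"
    and hs: "(s + 2 * e^2)^2 = X/2 - e^4 + e * (- X + Y * D)"
    and z2: "z2r = z1r + (1 - X)/2 - e" "z2i = z1i - Y/2 + e * D"
    and re0: "z0r = (s - e^2)^2 - 1/4" and re3: "z3r = 1/4 - 4 * e^4" and r: "r^2 = z1r^2 + z1i^2"
    and d01: "r * a0 = z1r * (z0r + 1/2) + z1i * z0i" and n0: "a0^2 + e^4 = z0r^2 + z0i^2"
    and d13: "r * a3 = z3r * (z1r - X/2) + b * (z1i - Y/2)" and n3: "a3^2 + y^2 = z3r^2 + b^2"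
    and v0: "a0 * v + e^2 * w = (- X + Y * D - k - 6 * e * s - 4 * e^3) / 2 - z0r + z0i * D"
    and v3: "a3 * v + y * w = - 2 * e^3 - k/2 - (z3r - 1/2) + b * D"
    and q1: "2 * (a0 * a3 + e^2 * y) = z0r^2 + z0i^2 + z3r^2 + b^2 + s^2 - ((z3r - z0r - 1/2 + X/2)^2 + (b - z0i + Y/2)^2)"
    and q2: "2 * r * v = k + 10 * e^3 + 2 * (- (z1r + (1 - X)/2) + D * (z1i - Y/2))"
    and q3: "v^2 + w^2 = 1 + D^2 - 9 * e^2"
  shows "(r + e * v)^2 + (e * w)^2 = z2r^2 + z2i^2"
    and "(r - a0)^2 + (0 - e^2)^2 + (s - e^2)^2 = (z1r - z0r - 1/2)^2 + (z1i - z0i - 0)^2"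
    and "(r + a0)^2 + (0 + e^2)^2 + (s - e^2)^2 = (z1r + z0r + 1/2)^2 + (z1i + z0i + 0)^2"
    and "(a3 - r)^2 + (y - 0)^2 + (e^2)^2 = (z3r - z1r + X/2)^2 + (b - z1i + Y/2)^2"
    and "(a3 + r)^2 + (y + 0)^2 + (e^2)^2 = (z3r + z1r - X/2)^2 + (b + z1i - Y/2)^2"
    and "(r + e * v - a3)^2 + (e * w - y)^2 + (2 * e^2)^2 = (z2r - z3r + 1/2)^2 + (z2i - b - 0)^2"
    and "(r + e * v + a3)^2 + (e * w + y)^2 + (2 * e^2)^2 = (z2r + z3r - 1/2)^2 + (z2i + b + 0)^2"
    and "(a0 - (r + e * v))^2 + (e^2 - e * w)^2 + (s + 2 * e^2)^2 = (z0r - z2r - X/2)^2 + (z0i - z2i - Y/2)^2"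
    and "(a0 + (r + e * v))^2 + (e^2 + e * w)^2 + (s + 2 * e^2)^2 = (z0r + z2r + X/2)^2 + (z0i + z2i + Y/2)^2"
    and "(a0 - a3)^2 + (e^2 - y)^2 + s^2 = (z3r - z0r - 1/2 + X/2)^2 + (b - z0i + Y/2)^2"
    and "(e * v)^2 + (e * w)^2 + (3 * e^2)^2 = e^2 + (e * D)^2"
proof -
  have e4: "(e^2)^2 = e^4" by (simp add: power_mult[symmetric])
  have n0': "a0^2 + (e^2)^2 = z0r^2 + z0i^2" using n0 e4 by simp
  have n1: "r^2 + 0^2 = z1r^2 + z1i^2" using r by simp
  show n2: "(r + e * v)^2 + (e * w)^2 = z2r^2 + z2i^2"
  proof -
    have "(r + e * v)^2 + (e * w)^2 = r^2 + e * (2 * r * v) + e^2 * (v^2 + w^2)"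
      by (simp add: power2_eq_square algebra_simps)
    also have "\<dots> = z1r^2 + z1i^2 + e * (k + 10 * e^3 + 2 * (- (z1r + (1 - X)/2) + D * (z1i - Y/2))) + e^2 * (1 + D^2 - 9 * e^2)"
      unfolding r q2 q3 ..
    also have "\<dots> = z2r^2 + z2i^2"
      using re1 im1 unfolding z2 by (simp add: power2_eq_square power3_eq_cube power4_eq_xxxx algebra_simps add_divide_distrib diff_divide_distrib)
    finally show ?thesis .
  qed
  have 10: "r * a0 + 0 * e^2 = z1r * (z0r + 1/2) + z1i * (z0i + 0)" using d01 by simp
  have h10: "(s - e^2)^2 = (1/2)^2 + 0^2 + 2 * (1/2 * z0r + 0 * z0i)"
  proof -
    have "(s - e^2)^2 = z0r + 1/4" using re0 by simp
    then show ?thesis by (simp add: power_divide)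
  qed
  show "(r - a0)^2 + (0 - e^2)^2 + (s - e^2)^2 = (z1r - z0r - 1/2)^2 + (z1i - z0i - 0)^2"
    "(r + a0)^2 + (0 + e^2)^2 + (s - e^2)^2 = (z1r + z0r + 1/2)^2 + (z1i + z0i + 0)^2"
    by (rule pair_lengths[OF n1 n0' 10 h10])+
  have 31: "a3 * r + y * 0 = z3r * (z1r + - (X/2)) + b * (z1i + - (Y/2))" using d13 by (simp add: mult.commute)
  have h31: "(e^2)^2 = (- (X/2))^2 + (- (Y/2))^2 + 2 * (- (X/2) * z1r + - (Y/2) * z1i)"
    using im1 e4 by (simp add: power2_eq_square algebra_simps)
  show "(a3 - r)^2 + (y - 0)^2 + (e^2)^2 = (z3r - z1r + X/2)^2 + (b - z1i + Y/2)^2"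
    "(a3 + r)^2 + (y + 0)^2 + (e^2)^2 = (z3r + z1r - X/2)^2 + (b + z1i - Y/2)^2"
    using pair_lengths[OF n3 n1 31 h31] by simp_all
  have 23: "(r + e * v) * a3 + (e * w) * y = z2r * (z3r + - (1/2)) + z2i * (b + 0)"
  proof -
    have "(r + e * v) * a3 + (e * w) * y = r * a3 + e * (a3 * v + y * w)" by (simp add: algebra_simps)
    also have "\<dots> = z2r * (z3r + - (1/2)) + z2i * (b + 0)"
      unfolding d13 v3 z2 re1 re3 by (simp add: power2_eq_square power3_eq_cube power4_eq_xxxx algebra_simps add_divide_distrib diff_divide_distrib)
    finally show ?thesis .
  qed
  have h23: "(2 * e^2)^2 = (- (1/2))^2 + 0^2 + 2 * (- (1/2) * z3r + 0 * b)"
  proof -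
    have "(2 * e^2)^2 = 1/4 - z3r" using re3 e4 by (simp add: power_mult_distrib)
    then show ?thesis by (simp add: power_divide)
  qed
  show "(r + e * v - a3)^2 + (e * w - y)^2 + (2 * e^2)^2 = (z2r - z3r + 1/2)^2 + (z2i - b - 0)^2"
    "(r + e * v + a3)^2 + (e * w + y)^2 + (2 * e^2)^2 = (z2r + z3r - 1/2)^2 + (z2i + b + 0)^2"
    using pair_lengths[OF n2 n3 23 h23] by simp_all
  have se: "(s - e^2)^2 = (s + 2 * e^2)^2 - 6 * s * e^2 - 3 * e^4" by (simp add: power2_eq_square power4_eq_xxxx algebra_simps)
  \<comment> \<open>Both \<open>z0r\<close> and \<open>z1r\<close> come from height relations and
    differ by a multiple of \<open>e\<close> (fact \<open>zz\<close>). This is what allowed the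
    relation between vertices 0 and 2 to be divided by \<open>e\<close>.\<close>
  have 02: "a0 * (r + e * v) + e^2 * (e * w) = z0r * (z2r + X/2) + z0i * (z2i + Y/2)"
  proof -
    have zz: "z0r = z1r + e * (- X + Y * D) - 4 * e^4 - 6 * s * e^2 - e * k" unfolding re0 se hs re1 by simp
    have "a0 * (r + e * v) + e^2 * (e * w) = r * a0 + e * (a0 * v + e^2 * w)" by (simp add: algebra_simps)
    also have "\<dots> = z0r * (z1r + 1/2) + z0i * z1i + (z1r - z0r)/2 + e * ((- X + Y * D - k - 6 * e * s - 4 * e^3) / 2 - z0r + z0i * D)"
      unfolding d01 v0 by (simp add: algebra_simps add_divide_distrib diff_divide_distrib)
    also have "(z1r - z0r)/2 = - (e * (- X + Y * D) - 4 * e^4 - 6 * s * e^2 - e * k)/2" using zz by simp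
    also have "z0r * (z1r + 1/2) + z0i * z1i + - (e * (- X + Y * D) - 4 * e^4 - 6 * s * e^2 - e * k)/2
        + e * ((- X + Y * D - k - 6 * e * s - 4 * e^3) / 2 - z0r + z0i * D) = z0r * (z2r + X/2) + z0i * (z2i + Y/2)"
      unfolding z2 by (simp add: power2_eq_square power3_eq_cube power4_eq_xxxx algebra_simps add_divide_distrib diff_divide_distrib)
    finally show ?thesis .
  qed
  have h02: "(s + 2 * e^2)^2 = (X/2)^2 + (Y/2)^2 + 2 * (X/2 * z2r + Y/2 * z2i)"
    using im1 unfolding hs z2 by (simp add: power2_eq_square algebra_simps add_divide_distrib diff_divide_distrib)
  show "(a0 - (r + e * v))^2 + (e^2 - e * w)^2 + (s + 2 * e^2)^2 = (z0r - z2r - X/2)^2 + (z0i - z2i - Y/2)^2"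
    "(a0 + (r + e * v))^2 + (e^2 + e * w)^2 + (s + 2 * e^2)^2 = (z0r + z2r + X/2)^2 + (z0i + z2i + Y/2)^2"
    by (rule pair_lengths[OF n0' n2 02 h02])+
  have "(a0 - a3)^2 + (e^2 - y)^2 + s^2 = (a0^2 + (e^2)^2) + (a3^2 + y^2) + s^2 - 2 * (a0 * a3 + e^2 * y)"
    by (simp add: power2_eq_square algebra_simps)
  then show "(a0 - a3)^2 + (e^2 - y)^2 + s^2 = (z3r - z0r - 1/2 + X/2)^2 + (b - z0i + Y/2)^2"
    unfolding n0' n3 q1 by simp
  have "(e * v)^2 + (e * w)^2 + (3 * e^2)^2 = e^2 * (v^2 + w^2) + 9 * e^4" by (simp add: power_mult_distrib e4 algebra_simps)
  then show "(e * v)^2 + (e * w)^2 + (3 * e^2)^2 = e^2 + (e * D)^2"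
    unfolding q3 by (simp add: power2_eq_square power4_eq_xxxx algebra_simps)
qed

text \<open>All vectors \<open>e2\<close> and \<open>e3\<close> point upwards, so
  \<open>\<i>\<close> serves as the first functional. The periods come out as 1 and
  \<open>\<tau> - 3\<close>, which span the same lattice as 1 and \<open>\<tau>\<close>.\<close>

lemma fam_flat_data:
  assumes reg: "regular x" and Q: "fam_Q x = 0" and e: "pe x > 0" and Y: "pY x > 0"
    and S: "flat_signs (fam_z0 x) (fam_z1 x) (fam_z2 x) (fam_z3 x) (fst (snd x)) (fam_d x) n2 n3"
  defines "e1 \<equiv> edge1 (fam_z0 x) (fam_z1 x) (fam_z2 x) (fam_z3 x) (fst (snd x)) (of_real (pe x) * fam_d x)"
    and "e2 \<equiv> edge2 (fam_z0 x) (fam_z1 x) (fam_z2 x) (fam_z3 x) (fst (snd x))"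
    and "e3 \<equiv> edge3 (fam_z0 x) (fam_z1 x) (fam_z2 x) (fam_z3 x) (fst (snd x))"
  shows "flat_data (fam_tent x) e1 e2 e3 \<i> n2 n3" "(\<Sum>v\<in>UNIV. e1 v) = fst (snd x) - 3" "e2 0 - e1 0 - e1 1 = 1"
proof -
  note eqs = fam_equations[OF reg Q]
  have tau: "fst (snd x) = Complex (pX x) (pY x)" by (simp add: pX_def pY_def)
  have z2: "fam_z2 x = fam_z1 x + (1 - fst (snd x)) / 2 + of_real (pe x) * fam_d x"
    unfolding tau by (simp add: fam_z2_def fam_z1_def fam_d_def complex_eq_iff eqs(4,5) field_simps)
  note rel = edge_relations[OF z2, of "fam_z0 x" "fam_z3 x", folded e1_def e2_def e3_def]
  note sg = edge_signs[OF S e z2, folded e1_def e2_def e3_def]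
  show per: "e2 0 - e1 0 - e1 1 = 1"
    unfolding e1_def e2_def by (simp add: edge1_def edge2_def z2 field_simps)
  show sum: "(\<Sum>v\<in>UNIV. e1 v) = fst (snd x) - 3"
    unfolding UNIV_8 e1_def by (simp add: edge1_def z2 field_simps)
  note L = family_lengths[OF eqs]
  note N = eqs(8,10,12)
  note E = edge1_def edge2_def edge3_def numeral_8_wrap tent_nth dist_vector_eq_norm_iff dist_vector_eq_norm_double_iff fam_z0_def fam_z1_def fam_z2_def fam_z3_def fam_d_def
  have "\<forall>v. dist (fam_tent x $ v) (fam_tent x $ (v + 1)) = norm (e1 v)"
    unfolding all_8 e1_def tau fam_tent_def
    by (intro conjI; simp add: E; (insert L N, simp add: power2_eq_square power4_eq_xxxx algebra_simps)?; linarith?)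
  moreover have "\<forall>v. dist (fam_tent x $ v) (fam_tent x $ (v + 2)) = norm (e2 v)"
    unfolding all_8 e2_def tau fam_tent_def
    by (intro conjI; simp add: E; (insert L N, simp add: power2_eq_square power4_eq_xxxx algebra_simps)?; linarith?)
  moreover have "\<forall>v. dist (fam_tent x $ v) (fam_tent x $ (v + 3)) = norm (e3 v)"
    unfolding all_8 e3_def tau fam_tent_def
    by (intro conjI; simp add: E; (insert L N, simp add: power2_eq_square power4_eq_xxxx algebra_simps)?; linarith?)
  ultimately show "flat_data (fam_tent x) e1 e2 e3 \<i> n2 n3"
    using rel sg Y by unfold_locales (auto simp: sum per pY_def)
qed

section \<open>The limit configurations\<close>

text \<open>The period is \<open>X + i Y\<close>, with \<open>\<nu>\<^sup>2 = 2 X\<close>. The Weierstrass points of the limit are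
  \<open>z0, z1 = -(1 - \<nu>\<^sup>2)/4 + i (\<nu> q \<mp> \<alpha>)/2\<close>, \<open>z2 = 1/4 - i T/2\<close> and \<open>z3 = 1/4 + i (\<beta> - T/2)\<close>, and the short
  edge has direction \<open>-1 + i D\<close>.\<close>

locale tent_period =
  fixes X Y T \<nu> r \<alpha> q :: real
  assumes X: "0 < X" "X < 1/2" and Y: "0 < Y" and XY: "2 * X < X\<^sup>2 + Y\<^sup>2"
    and T: "2 * Y * T = X\<^sup>2 + Y\<^sup>2 - X" and nu: "0 < \<nu>" "\<nu>\<^sup>2 = 2 * X" and r: "0 < r" "r\<^sup>2 = T\<^sup>2 + 1/4"
    and al: "(1 - \<nu>\<^sup>2) * \<alpha> = Y - T - \<nu> * r" and q: "q = r - \<nu> * \<alpha>"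
begin

section \<open>Inequalities between the limit parameters\<close>

lemma nu1: "1 - \<nu>\<^sup>2 > 0" "\<nu> < 1"
proof -
  show "1 - \<nu>\<^sup>2 > 0" using nu X by simp
  then show "\<nu> < 1" using nu(1) by (metis diff_gt_0_iff_gt power2_less_imp_less one_power2 zero_le_one)
qed

lemma T_pos: "T > 0"
proof -
  have "2 * Y * T > 0" unfolding T using XY X by simp
  then show ?thesis using Y by (simp add: zero_less_mult_iff)
qed

lemma YT: "(Y - T)\<^sup>2 = T\<^sup>2 + X - X\<^sup>2" "Y - T > 0"
proof -
  show "(Y - T)\<^sup>2 = T\<^sup>2 + X - X\<^sup>2" using T by (simp add: power2_eq_square algebra_simps)
  have "X\<^sup>2 < X" using X by (simp add: power2_eq_square)
  moreover have "2 * Y * (Y - T) = Y\<^sup>2 - X\<^sup>2 + X" using T by (simp add: power2_eq_square algebra_simps)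
  moreover have "0 < Y\<^sup>2" using Y by simp
  ultimately have "2 * Y * (Y - T) > 0" by linarith
  then show "Y - T > 0" using Y by (simp add: zero_less_mult_iff)
qed

text \<open>Squaring reduces the claim to \<open>2 * X * T^2 + X/2 < T^2 + X - X^2\<close>, which
  follows from \<open>X < 1/2\<close>.\<close>

lemma alpha_pos: "\<alpha> > 0"
proof -
  have "(\<nu> * r)\<^sup>2 = 2 * X * T\<^sup>2 + X/2" by (simp add: power_mult_distrib nu(2) r(2) algebra_simps)
  moreover have "2 * X * T\<^sup>2 < 1 * T\<^sup>2" by (rule mult_strict_right_mono) (use X T_pos in auto)
  moreover have "X\<^sup>2 < X/2" using X by (simp add: power2_eq_square)
  ultimately have "(\<nu> * r)\<^sup>2 < (Y - T)\<^sup>2" unfolding YT(1) by simp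
  then have "\<nu> * r < Y - T" using YT(2) by (simp add: power2_less_imp_less)
  then have "(1 - \<nu>\<^sup>2) * \<alpha> > 0" unfolding al by simp
  then show ?thesis using nu1(1) by (simp add: zero_less_mult_iff)
qed

lemma r_eq: "r = q + \<nu> * \<alpha>" using q by simp

text \<open>Together with \<open>r_eq\<close>: the symmetric matrix with diagonal 1 and off-diagonal
  entry \<open>\<nu>\<close> maps \<open>(q, \<alpha>)\<close> to \<open>(r, Y - T)\<close>. Its
  determinant \<open>1 - \<nu>^2\<close> recurs as the factor by which the inequalities below are
  multiplied.\<close>

lemma Y_eq: "Y = T + \<nu> * q + \<alpha>"
  using al unfolding q by (simp add: power2_eq_square algebra_simps)

lemma r_YT: "r\<^sup>2 - (Y - T)\<^sup>2 = (1 - \<nu>\<^sup>2)\<^sup>2 / 4"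
  unfolding r(2) YT(1) nu(2) by (simp add: power2_eq_square algebra_simps)

lemma q_sq: "q\<^sup>2 = \<alpha>\<^sup>2 + (1 - \<nu>\<^sup>2) / 4"
proof -
  define \<kappa> where "\<kappa> = 1 - \<nu>\<^sup>2"
  have w: "\<kappa> * \<alpha> = Y - T - \<nu> * r" using al by (simp add: \<kappa>_def)
  have "\<kappa> * (q\<^sup>2 - \<alpha>\<^sup>2) = \<kappa> * r\<^sup>2 - 2 * \<nu> * r * (\<kappa> * \<alpha>) - (\<kappa> * \<alpha>)\<^sup>2"
    unfolding q \<kappa>_def by (simp add: power2_eq_square algebra_simps)
  also have "\<dots> = r\<^sup>2 - (Y - T)\<^sup>2" unfolding w unfolding \<kappa>_def by (simp add: power2_eq_square algebra_simps)
  also have "\<dots> = \<kappa> * (\<kappa> / 4)" unfolding r_YT \<kappa>_def by (simp add: power2_eq_square)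
  finally have "q\<^sup>2 - \<alpha>\<^sup>2 = \<kappa> / 4" using nu1(1) unfolding \<kappa>_def by (simp only: mult_cancel_left) auto
  then show ?thesis unfolding \<kappa>_def by linarith
qed

lemma kappa_q: "(1 - \<nu>\<^sup>2) * q = r - \<nu> * (Y - T)"
proof -
  have "(1 - \<nu>\<^sup>2) * q = (1 - \<nu>\<^sup>2) * r - \<nu> * ((1 - \<nu>\<^sup>2) * \<alpha>)" unfolding q by (simp add: algebra_simps)
  then show ?thesis unfolding al by (simp add: power2_eq_square algebra_simps)
qed

lemma q_pos: "q > 0"
proof -
  have "(\<nu> * (Y - T))\<^sup>2 < r\<^sup>2"
  proof -
    have "\<nu>\<^sup>2 * (Y - T)\<^sup>2 < 1 * (Y - T)\<^sup>2" by (rule mult_strict_right_mono) (use nu1 YT(2) in auto)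
    then show ?thesis using r_YT nu1(1) by (simp add: power_mult_distrib) (smt (verit) zero_less_power)
  qed
  then have "\<nu> * (Y - T) < r" using r(1) by (simp add: power2_less_imp_less)
  then have "(1 - \<nu>\<^sup>2) * q > 0" unfolding kappa_q by simp
  then show ?thesis using nu1(1) by (simp add: zero_less_mult_iff)
qed

lemma q_gt: "\<alpha> < q" "\<nu> * \<alpha> < q"
proof -
  have "\<alpha>\<^sup>2 < q\<^sup>2" using q_sq nu1(1) by simp
  then show 1: "\<alpha> < q" using q_pos by (simp add: power2_less_imp_less)
  have "\<nu> * \<alpha> < 1 * \<alpha>" using nu1(2) alpha_pos by (intro mult_strict_right_mono)
  then show "\<nu> * \<alpha> < q" using 1 by simp
qed

text \<open>The triangle with corners 0, 1 and \<open>\<tau>\<close> has circumcentre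
  \<open>1/2 + \<i> T\<close> and circumradius \<open>r\<close>; the first identity is the square of
  "product of the sides = 4 * circumradius * area". The second part factors into the two conditions
  \<open>X < 1/2\<close> and \<open>2 * X < X^2 + Y^2\<close>.\<close>

lemma abs_period:
  "4 * r\<^sup>2 * Y\<^sup>2 = (X\<^sup>2 + Y\<^sup>2) * ((1 - X)\<^sup>2 + Y\<^sup>2)" "2 * X * ((1 - X)\<^sup>2 + Y\<^sup>2) < X\<^sup>2 + Y\<^sup>2"
proof -
  have "4 * r\<^sup>2 * Y\<^sup>2 = (2 * Y * T)\<^sup>2 + Y\<^sup>2" unfolding r(2) by (simp add: power2_eq_square algebra_simps)
  then show "4 * r\<^sup>2 * Y\<^sup>2 = (X\<^sup>2 + Y\<^sup>2) * ((1 - X)\<^sup>2 + Y\<^sup>2)"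
    unfolding T by (simp add: power2_eq_square algebra_simps)
  have "(X\<^sup>2 + Y\<^sup>2) - 2 * X * ((1 - X)\<^sup>2 + Y\<^sup>2) = (1 - 2 * X) * (X\<^sup>2 + Y\<^sup>2 - 2 * X)"
    by (simp add: power2_eq_square algebra_simps)
  also have "\<dots> > 0" using X XY by (intro mult_pos_pos) auto
  finally show "2 * X * ((1 - X)\<^sup>2 + Y\<^sup>2) < X\<^sup>2 + Y\<^sup>2" by simp
qed

text \<open>Multiplied by \<open>1 - \<nu>^2\<close>, the difference of the two sides is
  \<open>2 * r * (|\<tau>|^2 - 2 * \<nu> * r * Y)\<close>. Here \<open>2 * r * Y\<close> is
  \<open>|\<tau>|\<close> times \<open>|1 - \<tau>|\<close>, so \<open>abs_period\<close> decides
  the sign.\<close>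

lemma opening_angle: "\<nu> * \<alpha> < 4 * T * (r * \<alpha> + T * q)"
proof -
  let ?A = "X\<^sup>2 + Y\<^sup>2" and ?B = "(1 - X)\<^sup>2 + Y\<^sup>2"
  have A: "?A > 0" using X Y by (simp add: add_pos_pos)
  have "(2 * \<nu> * r * Y)\<^sup>2 = ?A * (2 * X * ?B)"
  proof -
    have "(2 * \<nu> * r * Y)\<^sup>2 = \<nu>\<^sup>2 * (4 * r\<^sup>2 * Y\<^sup>2)" by (simp add: power_mult_distrib)
    then show ?thesis unfolding abs_period(1) nu(2) by simp
  qed
  also have "\<dots> < ?A * ?A" using abs_period(2) A by (rule mult_strict_left_mono)
  finally have "(2 * \<nu> * r * Y)\<^sup>2 < ?A\<^sup>2" by (simp only: power2_eq_square)
  then have "2 * \<nu> * r * Y < ?A" using A by (simp add: power2_less_imp_less)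
  then have pos: "0 < 2 * r * (?A - 2 * \<nu> * r * Y)" using r(1) by simp
  have "(1 - \<nu>\<^sup>2) * (4 * T * (r * \<alpha> + T * q) - \<nu> * \<alpha>)
      = 4 * T * r * ((1 - \<nu>\<^sup>2) * \<alpha>) + 4 * T\<^sup>2 * ((1 - \<nu>\<^sup>2) * q) - \<nu> * ((1 - \<nu>\<^sup>2) * \<alpha>)"
    by (simp add: power2_eq_square algebra_simps)
  also have "\<dots> = 4 * T * r * Y + \<nu>\<^sup>2 * r - \<nu> * (4 * T * r\<^sup>2 + (4 * T\<^sup>2 + 1) * (Y - T))"
    unfolding al kappa_q by (simp add: power2_eq_square algebra_simps)
  also have "4 * T\<^sup>2 + 1 = 4 * r\<^sup>2" using r(2) by simp
  also have "4 * T * r * Y + \<nu>\<^sup>2 * r - \<nu> * (4 * T * r\<^sup>2 + 4 * r\<^sup>2 * (Y - T)) = 2 * r * ((2 * Y * T + X) - 2 * \<nu> * r * Y)"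
    unfolding nu(2) by (simp add: power2_eq_square algebra_simps)
  also have "\<dots> > 0" using pos unfolding T by simp
  finally show ?thesis using nu1(1) by (simp add: zero_less_mult_iff)
qed

text \<open>Multiplied by \<open>1 - \<nu>^2\<close>, the expression is half the square of
  \<open>|\<tau>| - \<nu> * |1 - \<tau>|\<close>, which is nonzero by
  \<open>abs_period\<close>.\<close>

lemma descent: "0 < (1 - \<nu>\<^sup>2) * \<alpha>\<^sup>2 + \<alpha> * T - \<nu> * q * T"
proof -
  let ?A = "X\<^sup>2 + Y\<^sup>2" and ?B = "(1 - X)\<^sup>2 + Y\<^sup>2"
  have "(4 * \<nu> * r * Y)\<^sup>2 = 4 * (?A * (2 * X * ?B))"
  proof -
    have "(4 * \<nu> * r * Y)\<^sup>2 = 4 * \<nu>\<^sup>2 * (4 * r\<^sup>2 * Y\<^sup>2)" by (simp add: power_mult_distrib)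
    then show ?thesis unfolding abs_period(1) nu(2) by simp
  qed
  moreover have "(?A - 2 * X * ?B)\<^sup>2 > 0" using abs_period(2) by simp
  moreover have "(a - b)\<^sup>2 = (a + b)\<^sup>2 - 4 * (a * b)" for a b :: real by (simp add: power2_eq_square algebra_simps)
  ultimately have "(4 * \<nu> * r * Y)\<^sup>2 < (?A + 2 * X * ?B)\<^sup>2" by simp
  moreover have "?A + 2 * X * ?B \<ge> 0" using X by simp
  ultimately have lt: "4 * \<nu> * r * Y < ?A + 2 * X * ?B" by (rule power2_less_imp_less)
  have "(1 - \<nu>\<^sup>2) * ((1 - \<nu>\<^sup>2) * \<alpha>\<^sup>2 + \<alpha> * T - \<nu> * q * T)
      = ((1 - \<nu>\<^sup>2) * \<alpha>)\<^sup>2 + ((1 - \<nu>\<^sup>2) * \<alpha>) * T - \<nu> * T * ((1 - \<nu>\<^sup>2) * q)"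
    by (simp add: power2_eq_square algebra_simps)
  also have "\<dots> = (Y - T)\<^sup>2 - 2 * \<nu> * r * (Y - T) + \<nu>\<^sup>2 * r\<^sup>2 + (Y - T) * T - \<nu> * r * T - \<nu> * T * r + \<nu>\<^sup>2 * T * (Y - T)"
    unfolding al kappa_q by (simp add: power2_eq_square algebra_simps)
  also have "\<dots> = (X - X\<^sup>2 + X/2 + (1/2 + X) * (2 * Y * T)) - 2 * \<nu> * r * Y"
    unfolding YT(1) nu(2) r(2) by (simp add: power2_eq_square algebra_simps)
  also have "\<dots> = (?A + 2 * X * ?B - 4 * \<nu> * r * Y) / 2"
    unfolding T by (simp add: power2_eq_square field_simps)
  also have "\<dots> > 0" using lt by simp
  finally show ?thesis using nu1(1) by (simp add: zero_less_mult_iff)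
qed

lemma PQ_pos: "r * \<alpha> + T * q > 0" "T * \<alpha> + r * q > 0"
  using r(1) alpha_pos T_pos q_pos by (simp_all add: add_pos_pos)

end

text \<open>\<open>\<beta>\<close> is the zero of \<open>fam_Q1\<close> in the limit, shifted by
  \<open>T / 2\<close>, and \<open>D\<close> the slope of the short edge for which the other two
  equations hold with \<open>pk = 0\<close>. Both factors on the left are positive by
  \<open>PQ_pos\<close>.\<close>

locale tent_limit = tent_period +
  fixes \<beta> D :: real
  assumes be: "\<beta> * (4 * (r * \<alpha> + T * q)) = \<nu> * \<alpha>" and D: "D * (2 * (T * \<alpha> + r * q)) = \<nu> * r - \<alpha>"
begin

lemma beta_bounds: "0 < \<beta>" "\<beta> < T"
proof -
  have "\<beta> * (4 * (r * \<alpha> + T * q)) > 0" unfolding be using nu(1) alpha_pos by simp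
  then show "0 < \<beta>" using PQ_pos(1) by (simp add: zero_less_mult_iff)
  have "\<beta> * (4 * (r * \<alpha> + T * q)) < T * (4 * (r * \<alpha> + T * q))" unfolding be using opening_angle by (simp add: algebra_simps)
  then show "\<beta> < T" using PQ_pos(1) by (simp add: mult_less_cancel_right)
qed

text \<open>Clearing the positive denominators reduces the first bound to \<open>descent\<close>. In
  the second, \<open>q_sq\<close> turns the only negative term into a positive one.\<close>

lemma D_bounds: "D < 2 * \<beta>" "0 < 2 * q + \<nu> * D"
proof -
  let ?P = "r * \<alpha> + T * q" and ?R = "T * \<alpha> + r * q"
  have "\<nu> * \<alpha> * ?R - (\<nu> * r - \<alpha>) * ?P = r * ((1 - \<nu>\<^sup>2) * \<alpha>\<^sup>2 + \<alpha> * T - \<nu> * q * T)"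
    unfolding r_eq by (simp add: power2_eq_square algebra_simps)
  also have "\<dots> > 0" using descent r(1) by simp
  finally have "(\<nu> * r - \<alpha>) * ?P < \<nu> * \<alpha> * ?R" by simp
  then have "D * (2 * ?R) * ?P < \<beta> * (4 * ?P) * ?R" unfolding D be .
  then have "D * (2 * ?R * ?P) < (2 * \<beta>) * (2 * ?R * ?P)" by (simp add: algebra_simps)
  moreover have "2 * ?R * ?P > 0" using PQ_pos by simp
  ultimately show "D < 2 * \<beta>" by (simp only: mult_less_cancel_right)
  have "\<nu> * (\<nu> * r - \<alpha>) + 4 * q * ?R = \<nu>\<^sup>2 * q + 4 * q * T * \<alpha> + 4 * q * q\<^sup>2 + (4 * \<nu> * \<alpha> * q\<^sup>2 - \<nu> * (1 - \<nu>\<^sup>2) * \<alpha>)"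
    unfolding r_eq by (simp add: power2_eq_square algebra_simps)
  also have "4 * \<nu> * \<alpha> * q\<^sup>2 - \<nu> * (1 - \<nu>\<^sup>2) * \<alpha> = 4 * \<nu> * \<alpha> * \<alpha>\<^sup>2"
    unfolding q_sq by (simp add: power2_eq_square field_simps)
  also have "\<nu>\<^sup>2 * q + 4 * q * T * \<alpha> + 4 * q * q\<^sup>2 + 4 * \<nu> * \<alpha> * \<alpha>\<^sup>2 > 0"
    using q_pos T_pos alpha_pos nu(1) by (intro add_pos_pos mult_pos_pos) auto
  finally have "0 < \<nu> * (D * (2 * ?R)) + 4 * q * ?R" unfolding D .
  then have "0 < (2 * q + \<nu> * D) * (2 * ?R)" by (simp add: algebra_simps)
  then show "0 < 2 * q + \<nu> * D" using PQ_pos(2) by (simp add: zero_less_mult_iff)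
qed

text \<open>This makes the second functional of \<open>flat_signs_limit\<close> positive on the edge
  from 3 to 4, before its small tilt.\<close>

lemma half_plane: "2 * \<nu> * \<beta> < q + \<nu> * T"
proof -
  let ?P = "r * \<alpha> + T * q"
  have "\<nu>\<^sup>2 * \<alpha> < 2 * ?P * (q + \<nu> * T)"
  \<comment> \<open>If \<open>q\<close> is large, \<open>opening_angle\<close> suffices. Otherwise
    \<open>r < 2 * q\<close> and \<open>q < \<nu> * T < T\<close> force \<open>T^2 > 1/12\<close>
    and \<open>r^2 > 1/3\<close>, and crude estimates do.\<close>
  proof (cases "\<nu> * T \<le> q")
    case True
    have m: "\<nu> * T + \<nu> * T \<le> q + \<nu> * T" using True by linarith
    have m': "0 \<le> 2 * ?P" by (rule mult_nonneg_nonneg[OF _ less_imp_le[OF PQ_pos(1)]]) simp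
    have "\<nu> * (\<nu> * \<alpha>) < \<nu> * (4 * T * ?P)" using opening_angle nu(1) by (rule mult_strict_left_mono)
    also have "\<dots> = 2 * ?P * (\<nu> * T + \<nu> * T)" by (simp add: algebra_simps)
    also have "\<dots> \<le> 2 * ?P * (q + \<nu> * T)" using m m' by (rule mult_left_mono)
    finally show ?thesis by (simp add: power2_eq_square)
  next
    case False
    have "\<nu> * \<alpha> < q" by (rule q_gt)
    then have rq: "r < 2 * q" unfolding r_eq by simp
    have "\<nu> * T < 1 * T" using nu1(2) T_pos by (intro mult_strict_right_mono)
    then have rT: "r < 2 * T" using rq False by simp
    then have "r\<^sup>2 < (2 * T)\<^sup>2" using r(1) by (intro power_strict_mono) auto
    then have T2: "T\<^sup>2 > 1/12" unfolding r(2) by (simp add: power_mult_distrib)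
    then have r2: "r\<^sup>2 > 1/3" unfolding r(2) by simp
    have "(1/6)\<^sup>2 < (r * T)\<^sup>2"
    proof -
      have "(1/3) * (1/12) < r\<^sup>2 * T\<^sup>2" by (rule mult_strict_mono) (use T2 r2 in auto)
      then show ?thesis unfolding power_mult_distrib by (simp add: power_divide)
    qed
    then have "1/6 < r * T" by (rule power2_less_imp_less) (use r(1) T_pos in simp)
    moreover have "(r + T) * (r + 2 * T) = r\<^sup>2 + 3 * (r * T) + 2 * T\<^sup>2" by (simp add: power2_eq_square algebra_simps)
    ultimately have big: "1 < (r + T) * (r + 2 * T)" using T2 r2 by simp
    have "\<nu> * r < 1 * r" using nu1(2) r(1) by (intro mult_strict_right_mono)
    then have qn: "\<nu> * (r + 2 * T) < 2 * (q + \<nu> * T)" using rq by (simp add: algebra_simps)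
    have "\<nu> * \<nu> < \<nu> * 1" using nu1(2) nu(1) by (intro mult_strict_left_mono)
    also have "\<dots> < \<nu> * ((r + T) * (r + 2 * T))" using big nu(1) by (intro mult_strict_left_mono)
    also have "\<dots> = (r + T) * (\<nu> * (r + 2 * T))" by simp
    also have "\<dots> < (r + T) * (2 * (q + \<nu> * T))" using qn r(1) T_pos by (intro mult_strict_left_mono) auto
    finally have "\<nu> * \<nu> * \<alpha> < (r + T) * (2 * (q + \<nu> * T)) * \<alpha>" using alpha_pos by (intro mult_strict_right_mono)
    also have "\<dots> = 2 * ((r + T) * \<alpha>) * (q + \<nu> * T)" by (simp add: algebra_simps)
    also have "\<dots> \<le> 2 * ?P * (q + \<nu> * T)"
    proof -
      have "T * \<alpha> \<le> T * q" using q_gt(1) T_pos by simp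
      then have "(r + T) * \<alpha> \<le> ?P" by (simp add: algebra_simps)
      moreover have "q + \<nu> * T \<ge> 0" using q_pos nu(1) T_pos by simp
      ultimately show ?thesis by (intro mult_right_mono) auto
    qed
    finally show ?thesis by (simp add: power2_eq_square)
  qed
  moreover have "\<nu>\<^sup>2 * \<alpha> = \<nu> * (\<nu> * \<alpha>)" by (simp add: power2_eq_square)
  ultimately have "\<nu> * (\<beta> * (4 * ?P)) < 2 * ?P * (q + \<nu> * T)" unfolding be by simp
  then have "(2 * \<nu> * \<beta>) * (2 * ?P) < (q + \<nu> * T) * (2 * ?P)" by (simp add: algebra_simps)
  then show ?thesis using PQ_pos(1) by (simp add: mult_less_cancel_right)
qed

end

section \<open>The family at \<open>\<epsilon> = 0\<close>\<close>

context tent_limit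
begin

lemma X_eq: "X = \<nu>\<^sup>2 / 2" using nu(2) by simp

context
  fixes x :: family_point
  assumes x: "pX x = X" "pY x = Y" "pe x = 0"
begin

text \<open>At \<open>pe x = 0\<close> the unknowns \<open>pk\<close> and \<open>pD\<close> drop out
  of all these quantities, and \<open>pb\<close> survives only in \<open>fam_a3\<close>.\<close>

lemma fam_limit:
  shows "fam_re1 x = - (1 - \<nu>\<^sup>2) / 4" "fam_im1 x = (\<nu> * q + \<alpha>) / 2" "fam_hs x = \<nu> / 2" "fam_r1 x = r / 2"
    "fam_re0 x = - (1 - \<nu>\<^sup>2) / 4" "fam_im0 x = (\<nu> * q - \<alpha>) / 2" "fam_re2 x = 1/4" "fam_im2 x = - T / 2"
    "fam_re3 x = 1/4" "fam_a0 x = - (q - \<nu> * \<alpha>) / 2" "fam_a3 x = - (1/16 + T * pb x / 2) * (2 / r)"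
proof -
  show re1: "fam_re1 x = - (1 - \<nu>\<^sup>2) / 4" by (simp add: fam_re1_def x X_eq)
  show im1: "fam_im1 x = (\<nu> * q + \<alpha>) / 2"
  proof -
    have "(X\<^sup>2 + Y\<^sup>2) / 4 - X * (X/2 - 1/4) = (\<nu> * q + \<alpha>) / 2 * Y"
    proof -
      have "\<nu> * q + \<alpha> = Y - T" using Y_eq by simp
      then have "(\<nu> * q + \<alpha>) / 2 * Y = (Y - T) / 2 * Y" by (simp only:)
      also have "\<dots> = (2 * Y\<^sup>2 - 2 * Y * T) / 4" by (simp add: power2_eq_square field_simps)
      finally have "(\<nu> * q + \<alpha>) / 2 * Y = (2 * Y\<^sup>2 - 2 * Y * T) / 4" .
      then show ?thesis unfolding T by (simp add: power2_eq_square field_simps)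
    qed
    then show ?thesis using Y by (simp add: fam_im1_def fam_re1_def x)
  qed
  have "X / 2 = (\<nu> / 2)\<^sup>2" by (simp add: X_eq power_divide)
  then show hs: "fam_hs x = \<nu> / 2" using nu(1) by (simp add: fam_hs_def x)
  show r1: "fam_r1 x = r / 2"
  proof -
    have "(fam_re1 x)\<^sup>2 + (fam_im1 x)\<^sup>2 = (r / 2)\<^sup>2"
    proof -
      have e: "\<nu> * q + \<alpha> = Y - T" using Y_eq by simp
      have n: "(2::real)\<^sup>2 = 4" "(4::real)\<^sup>2 = 16" by simp_all
      show ?thesis unfolding re1 im1 e power_divide power2_minus n using r_YT by linarith
    qed
    then have "fam_r1 x = sqrt ((r / 2)\<^sup>2)" by (simp only: fam_r1_def)
    then show ?thesis using r(1) by (simp only: real_sqrt_abs; simp?)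
  qed
  show re0: "fam_re0 x = - (1 - \<nu>\<^sup>2) / 4" by (simp add: fam_re0_def hs x power_divide field_simps)
  have k0: "1 - \<nu>\<^sup>2 \<noteq> 0" using nu1(1) by simp
  show im0: "fam_im0 x = (\<nu> * q - \<alpha>) / 2"
  proof -
    have "(\<nu> * q + \<alpha>) / 2 * (- (1 - \<nu>\<^sup>2) / 4 + 1/2) - r / 2 * (\<nu> / 2) = (\<nu> * q - \<alpha>) / 2 * (- (1 - \<nu>\<^sup>2) / 4)"
      unfolding r_eq by (simp add: power2_eq_square field_simps)
    then have n: "fam_im1 x * (fam_re0 x + 1/2) - fam_r1 x * (\<nu> / 2) = (\<nu> * q - \<alpha>) / 2 * fam_re1 x"
      unfolding im1 re0 r1 re1 .
    have "sqrt ((fam_hs x - (pe x)\<^sup>2)\<^sup>2 + pe x ^ 4) = \<nu> / 2" using nu(1) by (simp add: hs x)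
    then have "fam_im0 x = (fam_im1 x * (fam_re0 x + 1/2) - fam_r1 x * (\<nu> / 2)) / fam_re1 x" by (simp only: fam_im0_def)
    moreover have "fam_re1 x \<noteq> 0" using k0 by (simp add: re1)
    ultimately show ?thesis unfolding n by simp
  qed
  show "fam_re2 x = 1/4" by (simp add: fam_re2_def re1 x X_eq field_simps)
  have im2: "fam_im1 x - Y / 2 = - T / 2" unfolding im1 Y_eq by (simp add: field_simps)
  then show "fam_im2 x = - T / 2" by (simp add: fam_im2_def x)
  show re3: "fam_re3 x = 1/4" by (simp add: fam_re3_def x)
  show "fam_a0 x = - (q - \<nu> * \<alpha>) / 2"
  proof -
    have "fam_re1 x * (fam_re0 x + 1/2) + fam_im1 x * fam_im0 x
        = - (1 - \<nu>\<^sup>2) * (1 + \<nu>\<^sup>2) / 16 + (\<nu>\<^sup>2 * q\<^sup>2 - \<alpha>\<^sup>2) / 4"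
      unfolding re1 re0 im1 im0 by (simp add: power2_eq_square field_simps)
    also have "\<dots> = - (q\<^sup>2 - \<nu>\<^sup>2 * \<alpha>\<^sup>2) / 4" unfolding q_sq by (simp add: field_simps)
    also have "\<dots> = - (q - \<nu> * \<alpha>) / 2 * fam_r1 x" unfolding r1 r_eq by (simp add: power2_eq_square field_simps)
    finally have "fam_a0 x = - (q - \<nu> * \<alpha>) / 2 * fam_r1 x / fam_r1 x" by (simp only: fam_a0_def)
    moreover have "fam_r1 x \<noteq> 0" using r(1) by (simp add: r1)
    ultimately show ?thesis by simp
  qed
  have "fam_re3 x * (fam_re1 x - X / 2) = - (1/16)" unfolding re3 re1 X_eq by (simp add: field_simps)
  then have "fam_a3 x = (- (1/16) + pb x * (- T / 2)) / (r / 2)" by (simp only: fam_a3_def x r1 im2)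
  then show "fam_a3 x = - (1/16 + T * pb x / 2) * (2 / r)" using r(1) by (simp add: field_simps)
qed

text \<open>The first equation involves only \<open>pb\<close>, affinely and with nonzero slope.
  This decouples the first unknown from the other two.\<close>

lemma fam_Q1_limit: "fam_Q1 x = (r * \<alpha> + T * q) / r * (pb x - (\<beta> - T / 2))"
proof -
  have n: "1/4 - - (1 - \<nu>\<^sup>2) / 4 - 1/2 + X / 2 = 0" unfolding X_eq by (simp add: field_simps)
  have "fam_Q1 x = fam_a0 x * fam_a3 x - ((fam_re0 x)\<^sup>2 + (fam_im0 x)\<^sup>2 + 1/16 + (pb x)\<^sup>2 + (\<nu> / 2)\<^sup>2 - (pb x - fam_im0 x + Y / 2)\<^sup>2) / 2"
    by (simp only: fam_Q1_def fam_limit(3,5,9) x n) (simp add: power2_eq_square)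
  also have "pb x - fam_im0 x + Y / 2 = pb x + (T / 2 + \<alpha>)" unfolding fam_limit(6) Y_eq by (simp add: field_simps)
  finally have Q: "fam_Q1 x = fam_a0 x * fam_a3 x - ((fam_re0 x)\<^sup>2 + (fam_im0 x)\<^sup>2 + 1/16 + (\<nu> / 2)\<^sup>2
      - 2 * pb x * (T / 2 + \<alpha>) - (T / 2 + \<alpha>)\<^sup>2) / 2"
    by (simp add: power2_eq_square algebra_simps)
  have "r * fam_Q1 x = (q - \<nu> * \<alpha>) * (1/16 + T * pb x / 2) - r * (((1 - \<nu>\<^sup>2) / 4)\<^sup>2 + ((\<nu> * q - \<alpha>) / 2)\<^sup>2 + 1/16 + (\<nu> / 2)\<^sup>2
      - 2 * pb x * (T / 2 + \<alpha>) - (T / 2 + \<alpha>)\<^sup>2) / 2"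
    unfolding Q fam_limit(5,6,10,11) using r(1) by (simp add: field_simps) (rule power2_commute)
  \<comment> \<open>The last two summands vanish by \<open>r(2)\<close> and \<open>q_sq\<close>;
    writing them out makes the step an identity of polynomials once \<open>r\<close> is
    expanded.\<close>
  also have "\<dots> = (r * \<alpha> + T * q) * (pb x + T / 2) - \<nu> * \<alpha> / 4 + (r / 8 - q / 2) * (T\<^sup>2 - (r\<^sup>2 - 1/4))
      + (0 - 3 * \<nu> * \<alpha>/8 - 1 * \<nu> * \<nu> * \<nu> * \<alpha>/8 - 3 * q/8 - 1 * \<nu> * \<nu> * q/8) * (q\<^sup>2 - (\<alpha>\<^sup>2 + (1 - \<nu>\<^sup>2) / 4))"
    unfolding r_eq power2_eq_square by ((simp add: field_simps; fail) | algebra)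
  also have "\<dots> = (r * \<alpha> + T * q) * (pb x + T / 2) - \<nu> * \<alpha> / 4" using q_sq r(2) by simp
  also have "\<nu> * \<alpha> / 4 = (r * \<alpha> + T * q) * \<beta>" unfolding be[symmetric] by simp
  finally have "r * fam_Q1 x = (r * \<alpha> + T * q) * (pb x - (\<beta> - T / 2))" by (simp add: algebra_simps)
  then have "fam_Q1 x = (r * \<alpha> + T * q) * (pb x - (\<beta> - T / 2)) / r" using r(1) by (simp add: eq_divide_eq mult.commute)
  then show ?thesis by simp
qed

context
  assumes b: "pb x = \<beta> - T / 2"
begin

text \<open>At the root of the first equation the radicand of \<open>fam_y3\<close> is a perfect
  square, and \<open>\<beta> < T\<close> gives the sign of its root.\<close>

lemma fam_limit_a3_y3:
  "fam_a3 x = (T\<^sup>2 - 2 * T * \<beta> - 1/4) / (2 * r)" "fam_y3 x = (T - \<beta>) / (2 * r)"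
  "(fam_re3 x)\<^sup>2 + (pb x)\<^sup>2 - (fam_a3 x)\<^sup>2 = ((T - \<beta>) / (2 * r))\<^sup>2"
proof -
  show a3: "fam_a3 x = (T\<^sup>2 - 2 * T * \<beta> - 1/4) / (2 * r)"
    unfolding fam_limit(11) b using r(1) by (simp add: field_simps power2_eq_square)
  have "4 * r\<^sup>2 * (1/16 + (\<beta> - T / 2)\<^sup>2) = (T\<^sup>2 - 2 * T * \<beta> - 1/4)\<^sup>2 + (T - \<beta>)\<^sup>2"
    unfolding r(2) by (simp add: power2_eq_square field_simps)
  then have "1/16 + (\<beta> - T / 2)\<^sup>2 = ((T\<^sup>2 - 2 * T * \<beta> - 1/4)\<^sup>2 + (T - \<beta>)\<^sup>2) / (4 * r\<^sup>2)"
    using r(1) by (simp add: field_simps)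
  then show y: "(fam_re3 x)\<^sup>2 + (pb x)\<^sup>2 - (fam_a3 x)\<^sup>2 = ((T - \<beta>) / (2 * r))\<^sup>2"
    unfolding fam_limit(9) b a3 by (simp add: power_divide power_mult_distrib add_divide_distrib)
  have "(T - \<beta>) / (2 * r) \<ge> 0" using beta_bounds r(1) by simp
  then show "fam_y3 x = (T - \<beta>) / (2 * r)" unfolding fam_y3_def y by (simp only: real_sqrt_abs abs_of_nonneg)
qed

lemma fam_a0_neg: "fam_a0 x < 0" using q_gt(2) by (simp add: fam_limit(10))
lemma fam_y3_pos: "fam_y3 x > 0" using beta_bounds r(1) by (simp add: fam_limit_a3_y3(2))

lemma fam_limit_v:
  "fam_a0 x * fam_v1 x = (- X + Y * pD x - pk x) / 2 + (1 - \<nu>\<^sup>2) / 4 + (\<nu> * q - \<alpha>) / 2 * pD x"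
  "fam_a3 x * fam_v1 x + fam_y3 x * fam_v2 x = 1/4 - pk x / 2 + (\<beta> - T / 2) * pD x"
proof -
  have nz: "fam_a0 x \<noteq> 0" "fam_y3 x \<noteq> 0" using fam_a0_neg fam_y3_pos by auto
  have "fam_a0 x * fam_v1 x = fam_R0 x" using nz by (simp add: fam_v1_def fam_det_def x)
  then show "fam_a0 x * fam_v1 x = (- X + Y * pD x - pk x) / 2 + (1 - \<nu>\<^sup>2) / 4 + (\<nu> * q - \<alpha>) / 2 * pD x"
    by (simp add: fam_R0_def fam_limit(5,6) x) (simp add: field_simps)
  have "fam_a3 x * fam_v1 x + fam_y3 x * fam_v2 x = fam_R3 x" using nz by (simp add: fam_v1_def fam_v2_def fam_det_def x field_simps)
  then show "fam_a3 x * fam_v1 x + fam_y3 x * fam_v2 x = 1/4 - pk x / 2 + (\<beta> - T / 2) * pD x"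
    by (simp add: fam_R3_def fam_limit(9) x b)
qed

lemma fam_Q23_limit:
  "fam_Q2 x = r * fam_v1 x - pk x + 1/2 + T * pD x" "fam_Q3 x = 1 + (pD x)\<^sup>2 - ((fam_v1 x)\<^sup>2 + (fam_v2 x)\<^sup>2)"
proof -
  have f: "fam_re1 x + (1 - X) / 2 = 1/4" "fam_im1 x - Y / 2 = - T / 2"
    unfolding fam_limit(1,2) X_eq Y_eq by (simp_all add: field_simps)
  show "fam_Q2 x = r * fam_v1 x - pk x + 1/2 + T * pD x"
    by (simp only: fam_Q2_def x fam_limit(4) f) (simp add: field_simps)
  show "fam_Q3 x = 1 + (pD x)\<^sup>2 - ((fam_v1 x)\<^sup>2 + (fam_v2 x)\<^sup>2)" by (simp add: fam_Q3_def x)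
qed

end

context
  assumes b: "pb x = \<beta> - T / 2" "pk x = 0" "pD x = D"
begin

text \<open>As a complex number, \<open>v1 + \<i> v2\<close> is the conjugate of
  \<open>(-1 + \<i> D) * (1 + 2 * \<i> * T) / (2 * r)\<close>. As \<open>2 * r\<close> is the
  modulus of the second factor, the short edge keeps its length, which is the third
  equation.\<close>

lemma fam_base_v: "fam_v1 x = - (1 + 2 * T * D) / (2 * r)" "fam_v2 x = (2 * T - D) / (2 * r)"
proof -
  have r4: "4 * r\<^sup>2 = 4 * T\<^sup>2 + 1" using r(2) by simp
  have "(q - \<nu> * \<alpha>) * (1 + 2 * T * D) = r * (1 - 2 * \<nu>\<^sup>2) + 2 * r * D * (T + 2 * \<nu> * q)"
  proof -
    have "(q - \<nu> * \<alpha>) * (1 + 2 * T * D) - (r * (1 - 2 * \<nu>\<^sup>2) + 2 * r * D * (T + 2 * \<nu> * q))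
        = 2 * \<nu> * ((\<nu> * r - \<alpha>) - D * (2 * (T * \<alpha> + r * q)))"
      unfolding r_eq by (simp add: power2_eq_square algebra_simps)
    then show ?thesis unfolding D by simp
  qed
  then have "fam_a0 x * (- (1 + 2 * T * D) / (2 * r)) = (1 - 2 * \<nu>\<^sup>2) / 4 + D * (T + 2 * \<nu> * q) / 2"
    unfolding fam_limit(10) using r(1) by (simp add: field_simps)
  also have "\<dots> = fam_a0 x * fam_v1 x"
    unfolding fam_limit_v(1)[OF b(1)] b X_eq Y_eq by (simp add: field_simps)
  finally have "fam_a0 x = 0 \<or> - (1 + 2 * T * D) / (2 * r) = fam_v1 x" by (simp only: mult_cancel_left)
  then show v1: "fam_v1 x = - (1 + 2 * T * D) / (2 * r)" using fam_a0_neg[OF b(1)] by (metis less_irrefl)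
  have "(T\<^sup>2 - 2 * T * \<beta> - 1/4) * - (1 + 2 * T * D) + (T - \<beta>) * (2 * T - D) = (4 * r\<^sup>2) * (1/4 + (\<beta> - T / 2) * D)"
    unfolding r4 by (simp add: power2_eq_square field_simps)
  then have "fam_a3 x * (- (1 + 2 * T * D) / (2 * r)) + fam_y3 x * ((2 * T - D) / (2 * r)) = 1/4 + (\<beta> - T / 2) * D"
    unfolding fam_limit_a3_y3(1,2)[OF b(1)] times_divide_times_eq add_divide_distrib[symmetric] using r(1) by (simp add: power2_eq_square divide_eq_eq)
  also have "\<dots> = fam_a3 x * fam_v1 x + fam_y3 x * fam_v2 x" using fam_limit_v(2)[OF b(1)] b by simp
  finally have "fam_y3 x * ((2 * T - D) / (2 * r)) = fam_y3 x * fam_v2 x" unfolding v1 by (simp only: add_left_cancel)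
  then have "fam_y3 x = 0 \<or> (2 * T - D) / (2 * r) = fam_v2 x" by (simp only: mult_cancel_left)
  then show "fam_v2 x = (2 * T - D) / (2 * r)" using fam_y3_pos[OF b(1)] by (metis less_irrefl)
qed

lemma fam_base_zero: "fam_Q x = 0"
proof -
  have "fam_Q1 x = 0" unfolding fam_Q1_limit b by simp
  moreover have "fam_Q2 x = 0" unfolding fam_Q23_limit(1)[OF b(1)] fam_base_v b using r(1) by (simp add: field_simps)
  moreover have "fam_Q3 x = 0"
  proof -
    have "(1 + 2 * T * D)\<^sup>2 + (2 * T - D)\<^sup>2 = (1 + D\<^sup>2) * (4 * r\<^sup>2)" unfolding r(2) by (simp add: power2_eq_square algebra_simps)
    moreover have "4 * r\<^sup>2 \<noteq> 0" using r(1) by simp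
    ultimately have "((1 + 2 * T * D)\<^sup>2 + (2 * T - D)\<^sup>2) / (4 * r\<^sup>2) = 1 + D\<^sup>2" by simp
    moreover have "(fam_v1 x)\<^sup>2 + (fam_v2 x)\<^sup>2 = ((1 + 2 * T * D)\<^sup>2 + (2 * T - D)\<^sup>2) / (4 * r\<^sup>2)"
      unfolding fam_base_v power_divide power2_minus by (simp add: add_divide_distrib power_mult_distrib)
    ultimately show ?thesis unfolding fam_Q23_limit(2)[OF b(1)] b by simp
  qed
  ultimately show ?thesis by (simp add: fam_Q_def zero_prod_def)
qed

lemma fam_base_regular: "regular x"
proof -
  have "fam_det x \<noteq> 0" using fam_a0_neg[OF b(1)] fam_y3_pos[OF b(1)] by (simp add: fam_det_def x)
  moreover have "fam_re1 x \<noteq> 0" using nu1(1) by (simp add: fam_limit(1))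
  moreover have "((T - \<beta>) / (2 * r))\<^sup>2 > 0" using beta_bounds r(1) by simp
  ultimately show ?thesis unfolding regular_def fam_limit_a3_y3(3)[OF b(1)]
    using Y X nu(1) by (simp add: x fam_limit(3))
qed

text \<open>The leading orientation terms that are not plain products. Their signs come down to
  \<open>D < 2 * T\<close>, \<open>D < 2 * \<beta>\<close> and \<open>\<beta> < T\<close>.\<close>

lemma fam_base_signs:
  "fam_v2 x > 0" "fam_y3 x * fam_v1 x - fam_a3 x * fam_v2 x + fam_r1 x * fam_v2 x > 0"
  "- (fam_y3 x * fam_v1 x) + fam_a3 x * fam_v2 x + fam_r1 x * fam_v2 x > 0"
proof -
  show "fam_v2 x > 0" unfolding fam_base_v using D_bounds(1) beta_bounds r(1) by simp
  have r2: "fam_r1 x = r\<^sup>2 / (2 * r)" unfolding fam_limit(4) using r(1) by (simp add: power2_eq_square)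
  have "fam_y3 x * fam_v1 x - fam_a3 x * fam_v2 x + fam_r1 x * fam_v2 x
      = ((T - \<beta>) * - (1 + 2 * T * D) - (T\<^sup>2 - 2 * T * \<beta> - 1/4) * (2 * T - D) + r\<^sup>2 * (2 * T - D)) / (2 * r * (2 * r))"
    unfolding fam_base_v fam_limit_a3_y3(1,2)[OF b(1)] r2 times_divide_times_eq add_divide_distrib[symmetric] diff_divide_distrib[symmetric] ..
  also have "\<dots> = (1 + 4 * T\<^sup>2) * (\<beta> - D / 2) / (2 * r * (2 * r))"
    unfolding r(2) by (simp add: power2_eq_square algebra_simps)
  also have "\<dots> > 0" using D_bounds(1) r(1) by (intro divide_pos_pos mult_pos_pos) (auto simp: add_pos_nonneg)
  finally show "fam_y3 x * fam_v1 x - fam_a3 x * fam_v2 x + fam_r1 x * fam_v2 x > 0" .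
  have "fam_a3 x * fam_v2 x + fam_r1 x * fam_v2 x - fam_y3 x * fam_v1 x
      = ((T\<^sup>2 - 2 * T * \<beta> - 1/4) * (2 * T - D) + r\<^sup>2 * (2 * T - D) - (T - \<beta>) * - (1 + 2 * T * D)) / (2 * r * (2 * r))"
    unfolding fam_base_v fam_limit_a3_y3(1,2)[OF b(1)] r2 times_divide_times_eq add_divide_distrib[symmetric] diff_divide_distrib[symmetric] ..
  also have "\<dots> = (1 + 4 * T\<^sup>2) * (T - \<beta>) / (2 * r * (2 * r))"
    unfolding r(2) by (simp add: power2_eq_square algebra_simps)
  also have "\<dots> > 0" using beta_bounds r(1) by (intro divide_pos_pos mult_pos_pos) (auto simp: add_pos_nonneg)
  finally show "- (fam_y3 x * fam_v1 x) + fam_a3 x * fam_v2 x + fam_r1 x * fam_v2 x > 0" by simp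
qed

end
end

text \<open>Along a line in the unknowns, with the period fixed and \<open>\<epsilon> = 0\<close>,
  the three equations are explicit functions of one variable. Their derivatives at 0 vanish if the
  direction lies in the kernel.\<close>

lemma fam_Q_kernel:
  defines "x0 \<equiv> ((\<beta> - T / 2, 0, D), (Complex X Y, 0)) :: family_point"
  assumes Q': "(fam_Q has_derivative Q') (at x0)" and ker: "Q' (u, 0) = 0"
  shows "u = 0"
proof -
  obtain p k d where u: "u = (p, k, d)" by (cases u) auto
  define L where "L h = ((\<beta> - T / 2 + h * p, h * k, D + h * d), (Complex X Y, 0 :: real))" for h
  have L: "pX (L h) = X" "pY (L h) = Y" "pe (L h) = 0" "pb (L h) = \<beta> - T / 2 + h * p" "pk (L h) = h * k" "pD (L h) = D + h * d" for h
    by (simp_all add: L_def pX_def pY_def pe_def pb_def pk_def pD_def)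
  have L_eq: "L h = x0 + h *\<^sub>R (u, 0)" for h by (simp add: L_def x0_def u zero_prod_def)
  have lin: "linear Q'" using Q' by (rule has_derivative_linear)
  have "(L has_derivative (\<lambda>h. h *\<^sub>R (u, 0))) (at 0)" unfolding L_eq by (auto intro!: derivative_eq_intros)
  moreover have "(fam_Q has_derivative Q') (at (L 0))"
  proof -
    have "L 0 = x0" by (simp add: L_def x0_def)
    then show ?thesis using Q' by simp
  qed
  ultimately have "((\<lambda>h. fam_Q (L h)) has_derivative (\<lambda>h. Q' (h *\<^sub>R (u, 0)))) (at 0)"
    by (rule has_derivative_compose)
  moreover have "Q' (h *\<^sub>R (u, 0)) = 0" for h using linear_scale[OF lin, of h "(u, 0)"] ker by simp
  ultimately have d: "((\<lambda>h. fam_Q (L h)) has_derivative (\<lambda>h. 0)) (at 0)" by simp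
  have zero: "(*) (0::real) = (\<lambda>_. 0)" by auto
  have d1: "((\<lambda>h. fam_Q1 (L h)) has_real_derivative 0) (at 0)"
    using has_derivative_fst[OF d] by (simp add: fam_Q_def has_field_derivative_def zero)
  have d2: "((\<lambda>h. fam_Q2 (L h)) has_real_derivative 0) (at 0)"
    using has_derivative_fst[OF has_derivative_snd[OF d]] by (simp add: fam_Q_def has_field_derivative_def zero)
  have d3: "((\<lambda>h. fam_Q3 (L h)) has_real_derivative 0) (at 0)"
    using has_derivative_snd[OF has_derivative_snd[OF d]] by (simp add: fam_Q_def has_field_derivative_def zero)
  define C where "C = (r * \<alpha> + T * q) / r"
  have C: "C \<noteq> 0" using PQ_pos(1) r(1) by (simp add: C_def)
  have "fam_Q1 (L h) = C * (h * p)" for h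
    unfolding C_def by (subst fam_Q1_limit) (simp_all add: L)
  then have eq1: "(\<lambda>h. fam_Q1 (L h)) = (\<lambda>h. C * (h * p))" by (rule ext)
  have "((\<lambda>h. C * (h * p)) has_real_derivative C * p) (at 0)" by (auto intro!: derivative_eq_intros)
  then have "C * p = 0" using d1 unfolding eq1 by (rule DERIV_unique)
  then have p: "p = 0" using C by simp
  have b: "pb (L h) = \<beta> - T / 2" for h by (simp add: L p)
  note Lh = L(1-3)
  define A Z W where "A = - (q - \<nu> * \<alpha>) / 2" and "Z = (T\<^sup>2 - 2 * T * \<beta> - 1/4) / (2 * r)" and "W = (T - \<beta>) / (2 * r)"
  have A: "A \<noteq> 0" "W \<noteq> 0" using q_gt(2) beta_bounds r(1) by (auto simp: A_def W_def)
  \<comment> \<open>With \<open>p = 0\<close> the functions \<open>fam_v1\<close> and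
    \<open>fam_v2\<close> are affine along the line; \<open>V1\<close> and \<open>V2\<close> are
    their slopes.\<close>
  define V1 where "V1 = (((T + 2 * \<nu> * q) * d - k) / 2) / A"
  define V2 where "V2 = (- k / 2 + (\<beta> - T / 2) * d - Z * V1) / W"
  define v1 v2 where "v1 = fam_v1 (L 0)" and "v2 = fam_v2 (L 0)"
  have vs: "A * fam_v1 (L h) = (- X + Y * (D + h * d) - h * k) / 2 + (1 - \<nu>\<^sup>2) / 4 + (\<nu> * q - \<alpha>) / 2 * (D + h * d)"
    "Z * fam_v1 (L h) + W * fam_v2 (L h) = 1/4 - h * k / 2 + (\<beta> - T / 2) * (D + h * d)" for h
  proof -
    show "A * fam_v1 (L h) = (- X + Y * (D + h * d) - h * k) / 2 + (1 - \<nu>\<^sup>2) / 4 + (\<nu> * q - \<alpha>) / 2 * (D + h * d)"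
      using fam_limit_v(1)[OF Lh b, of h] unfolding fam_limit(10)[OF Lh] L A_def .
    show "Z * fam_v1 (L h) + W * fam_v2 (L h) = 1/4 - h * k / 2 + (\<beta> - T / 2) * (D + h * d)"
      using fam_limit_v(2)[OF Lh b, of h] unfolding fam_limit_a3_y3(1,2)[OF Lh b] L Z_def W_def .
  qed
  have AV: "A * V1 = ((T + 2 * \<nu> * q) * d - k) / 2" using A(1) by (simp add: V1_def)
  have WV: "W * V2 = - k / 2 + (\<beta> - T / 2) * d - Z * V1" using A(2) by (simp add: V2_def)
  have v1h: "fam_v1 (L h) = v1 + h * V1" for h
  proof -
    have "A * fam_v1 (L h) = A * v1 + h * (A * V1)" unfolding v1_def vs(1) AV by (simp add: Y_eq field_simps)
    then have "A * fam_v1 (L h) = A * (v1 + h * V1)" by (simp add: algebra_simps)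
    then show ?thesis using A(1) by simp
  qed
  have v2h: "fam_v2 (L h) = v2 + h * V2" for h
  proof -
    have e: "W * fam_v2 (L h) = 1/4 - h * k / 2 + (\<beta> - T / 2) * (D + h * d) - Z * (v1 + h * V1)" for h
      using vs(2)[of h] unfolding v1h by linarith
    have "W * fam_v2 (L h) = W * fam_v2 (L 0) + h * (W * V2)" unfolding e WV by (simp add: field_simps)
    then have "W * fam_v2 (L h) = W * (v2 + h * V2)" by (simp add: v2_def algebra_simps)
    then show ?thesis using A(2) by simp
  qed
  have base: "pb (L 0) = \<beta> - T / 2" "pk (L 0) = 0" "pD (L 0) = D" by (simp_all add: L)
  have v: "v1 = - (1 + 2 * T * D) / (2 * r)" "v2 = (2 * T - D) / (2 * r)"
    unfolding v1_def v2_def using fam_base_v[OF Lh base] by simp_all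
  have "fam_Q2 (L h) = r * (v1 + h * V1) - h * k + 1/2 + T * (D + h * d)" for h
    using fam_Q23_limit(1)[OF Lh b, of h] unfolding v1h L .
  then have eq2: "(\<lambda>h. fam_Q2 (L h)) = (\<lambda>h. r * (v1 + h * V1) - h * k + 1/2 + T * (D + h * d))" by (rule ext)
  have "((\<lambda>h. r * (v1 + h * V1) - h * k + 1/2 + T * (D + h * d)) has_real_derivative r * V1 - k + T * d) (at 0)"
    by (auto intro!: derivative_eq_intros)
  then have k: "r * V1 - k + T * d = 0" using d2 unfolding eq2 by (rule DERIV_unique)
  have "fam_Q3 (L h) = 1 + (D + h * d)\<^sup>2 - ((v1 + h * V1)\<^sup>2 + (v2 + h * V2)\<^sup>2)" for h
    using fam_Q23_limit(2)[OF Lh b, of h] unfolding v1h v2h L .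
  then have eq3: "(\<lambda>h. fam_Q3 (L h)) = (\<lambda>h. 1 + (D + h * d)\<^sup>2 - ((v1 + h * V1)\<^sup>2 + (v2 + h * V2)\<^sup>2))" by (rule ext)
  have "((\<lambda>h. 1 + (D + h * d)\<^sup>2 - ((v1 + h * V1)\<^sup>2 + (v2 + h * V2)\<^sup>2)) has_real_derivative 2 * D * d - (2 * v1 * V1 + 2 * v2 * V2)) (at 0)"
    by (auto intro!: derivative_eq_intros)
  then have 3: "2 * D * d - (2 * v1 * V1 + 2 * v2 * V2) = 0" using d3 unfolding eq3 by (rule DERIV_unique)
  have k': "k = r * V1 + T * d" using k by simp
  have e1: "(A + r / 2) * V1 = \<nu> * q * d" using AV unfolding k' by (simp add: field_simps)
  have e2: "A + r / 2 = \<nu> * \<alpha>" unfolding A_def r_eq by (simp add: field_simps)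
  have "\<nu> * (\<alpha> * V1) = \<nu> * (q * d)" using e1 unfolding e2 by (simp only: mult.assoc)
  then have V1: "\<alpha> * V1 = q * d" using nu(1) by simp
  have "V2 = - (2 * r * d) - 2 * T * V1"
  proof -
    have "W * V2 = - k / 2 + (\<beta> - T / 2) * d - Z * V1" by (rule WV)
    also have "\<dots> = - ((T - \<beta>) * d) - (r / 2 + Z) * V1" unfolding k' by (simp add: field_simps)
    also have "r / 2 + Z = W * (2 * T)"
    proof -
      have "2 * r * (r / 2 + Z) = r\<^sup>2 + (T\<^sup>2 - 2 * T * \<beta> - 1/4)" using r(1) unfolding Z_def by (simp add: power2_eq_square field_simps)
      also have "\<dots> = 2 * r * (W * (2 * T))" using r(1) unfolding W_def r(2) by (simp add: power2_eq_square field_simps)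
      finally have "2 * r = 0 \<or> r / 2 + Z = W * (2 * T)" by (simp only: mult_cancel_left)
      then show ?thesis using r(1) by auto
    qed
    also have "- ((T - \<beta>) * d) = W * (- (2 * r * d))" using r(1) by (simp add: W_def field_simps)
    finally have "W * V2 = W * (- (2 * r * d) - 2 * T * V1)" by (simp add: algebra_simps)
    then show ?thesis using A(2) by simp
  qed
  note V2 = this
  have "D * d = v1 * V1 + v2 * V2" using 3 by simp
  then have "2 * r * (D * d) = (2 * r * v1) * V1 + (2 * r * v2) * V2" by (simp only:) (simp add: algebra_simps)
  also have "2 * r * v1 = - (1 + 2 * T * D)" using r(1) by (simp add: v)
  also have "2 * r * v2 = 2 * T - D" using r(1) by (simp add: v)
  finally have e3: "(4 * T\<^sup>2 + 1) * V1 = - (4 * r * T * d)" unfolding V2 by (simp add: power2_eq_square algebra_simps)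
  have e4: "4 * T\<^sup>2 + 1 = 4 * r * r" using r(2) by (simp add: power2_eq_square)
  have "4 * r * (r * V1) = 4 * r * (- (T * d))" using e3 unfolding e4 by (simp add: algebra_simps)
  then have "4 * r = 0 \<or> r * V1 = - (T * d)" by (simp only: mult_cancel_left)
  then have rV: "r * V1 = - (T * d)" using r(1) by auto
  \<comment> \<open>The second equation gave \<open>\<alpha> * V1 = q * d\<close>, the third
    \<open>r * V1 = - (T * d)\<close>. Comparing \<open>r * \<alpha> * V1\<close> leaves a positive
    multiple of \<open>d\<close> equal to 0.\<close>
  have "r * (\<alpha> * V1) = \<alpha> * (r * V1)" by simp
  then have "(T * \<alpha> + r * q) * d = 0" unfolding V1 rV by (simp add: algebra_simps)
  then have d: "d = 0" using PQ_pos(2) by simp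
  then have "V1 = 0" using rV r(1) by simp
  then have "k = 0" using k' d by simp
  then show ?thesis using p d by (simp add: u zero_prod_def)
qed

end

lemma exists_small_shift:
  fixes L :: "(real \<times> real) list"
  assumes "\<forall>(a, c) \<in> set L. 0 < a" shows "\<exists>\<delta>>0. \<forall>(a, c) \<in> set L. 0 < a + \<delta> * c"
proof -
  have "\<forall>\<^sub>F \<delta> in at_right 0. 0 < fst z + \<delta> * snd z" if "z \<in> set L" for z
  proof -
    have "((\<lambda>\<delta>. fst z + \<delta> * snd z) \<longlongrightarrow> fst z + 0 * snd z) (at_right 0)" by (intro tendsto_intros)
    moreover have "fst z + 0 * snd z > 0" using assms that by (auto simp: case_prod_unfold)
    ultimately show ?thesis by (rule order_tendstoD(1))
  qed
  then have "\<forall>\<^sub>F \<delta> in at_right 0. \<forall>z\<in>set L. 0 < fst z + \<delta> * snd z" by (intro eventually_ball_finite) auto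
  then have "\<forall>\<^sub>F \<delta> in at_right 0. 0 < \<delta> \<and> (\<forall>z\<in>set L. 0 < fst z + \<delta> * snd z)"
    using eventually_at_right_less by (intro eventually_conj)
  then obtain \<delta> where "0 < \<delta>" "\<forall>z\<in>set L. 0 < fst z + \<delta> * snd z" using eventually_happens' trivial_limit_at_right_real by blast
  then show ?thesis by (intro exI[of _ \<delta>]) (auto simp: case_prod_unfold)
qed

text \<open>In the limit some edge vectors become vertical or multiples of \<open>(h, m)\<close>.
  The natural functionals vanish on these and are tilted slightly to make the inequalities
  strict.\<close>

lemma (in tent_limit) flat_signs_limit:
  obtains n2 n3 where "flat_signs (Complex (- (1 - \<nu>\<^sup>2) / 4) ((\<nu> * q - \<alpha>) / 2)) (Complex (- (1 - \<nu>\<^sup>2) / 4) ((\<nu> * q + \<alpha>) / 2))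
     (Complex (1/4) (- T / 2)) (Complex (1/4) (\<beta> - T / 2)) (Complex X Y) (Complex (- 1) D) n2 n3"
proof -
  define k m h where "k = 1 - \<nu>\<^sup>2" and "m = \<nu> * q" and "h = \<nu>\<^sup>2 / 2"
  define z0 z1 z2 z3 t where "z0 = Complex (- (1 - \<nu>\<^sup>2) / 4) ((\<nu> * q - \<alpha>) / 2)" and "z1 = Complex (- (1 - \<nu>\<^sup>2) / 4) ((\<nu> * q + \<alpha>) / 2)"
    and "z2 = Complex (1/4) (- T / 2)" and "z3 = Complex (1/4) (\<beta> - T / 2)" and "t = Complex X Y"
  note zs = z0_def z1_def z2_def z3_def t_def
  have dirs: "z1 - z0 - 1/2 = Complex (- (1/2)) \<alpha>" "z3 - z2 - 1/2 = Complex (- (1/2)) \<beta>" "- 2 * z3 = Complex (- (1/2)) (T - 2 * \<beta>)"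
    "2 * z0 = Complex (- k / 2) (m - \<alpha>)"
    "z2 - z0 + t/2 = Complex (1/2) \<alpha>" "z3 - z1 + t/2 = Complex (1/2) \<beta>" "1/2 - z2 - z3 = Complex 0 (T - \<beta>)"
    "z0 + z1 + 1/2 = Complex h m"
    "z3 - z0 - 1/2 + t/2 = Complex 0 (\<alpha> + \<beta>)" "t/2 - z3 - z1 = Complex 0 (T - \<beta>)" "- 2 * z2 = Complex (- (1/2)) T"
    "z2 + z0 + t/2 = Complex h m" "2 * z1 = Complex (- k / 2) (m + \<alpha>)"
    unfolding zs X_eq k_def m_def h_def by (simp_all add: complex_eq_iff Y_eq field_simps)
  note pos = T_pos alpha_pos beta_bounds(1)
  have b: "T - \<beta> > 0" using beta_bounds by simp
  have m: "m > 0" "h > 0" "k > 0" using nu1(1) nu(1) q_pos by (simp_all add: m_def h_def k_def)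
  have P3: "m + h * D > 0"
  proof -
    have "\<nu> / 2 * (2 * q + \<nu> * D) > 0" using D_bounds(2) nu(1) by simp
    also have "\<nu> / 2 * (2 * q + \<nu> * D) = m + h * D" by (simp add: m_def h_def power2_eq_square algebra_simps)
    finally show ?thesis .
  qed
  have P4: "m / 2 - h * \<alpha> > 0"
  proof -
    have "\<nu> / 2 * (q - \<nu> * \<alpha>) > 0" using q_gt(2) nu(1) by simp
    also have "\<nu> / 2 * (q - \<nu> * \<alpha>) = m / 2 - h * \<alpha>" by (simp add: m_def h_def power2_eq_square field_simps)
    finally show ?thesis .
  qed
  have P2: "k * m / 2 + h * (m - \<alpha>) > 0"
  proof -
    have "k * m / 2 + h * (m - \<alpha>) = m / 2 - h * \<alpha>" by (simp add: k_def h_def field_simps)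
    then show ?thesis using P4 by simp
  qed
  have P1: "m / 2 + h * (T - 2 * \<beta>) > 0"
  proof -
    have "\<nu> / 2 * (q + \<nu> * T - 2 * \<nu> * \<beta>) > 0" using half_plane nu(1) by simp
    also have "\<nu> / 2 * (q + \<nu> * T - 2 * \<nu> * \<beta>) = m / 2 + h * (T - 2 * \<beta>)" by (simp add: m_def h_def power2_eq_square field_simps)
    finally show ?thesis .
  qed
  have P5: "m / 2 + \<alpha> / 2 - \<alpha> * k / 2 > 0"
  proof -
    have "m / 2 + \<alpha> / 2 - \<alpha> * k / 2 = m / 2 + \<alpha> * h" by (simp add: k_def h_def field_simps)
    moreover have "\<alpha> * h > 0" using m pos by simp
    ultimately show ?thesis using m by linarith
  qed
  \<comment> \<open>\<open>(-m, h)\<close> is orthogonal to the edge vectors \<open>(h, m)\<close>;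
    raising \<open>h\<close> to \<open>h + \<delta>\<close> makes it positive on them without
    spoiling the inequalities listed.\<close>
  have "\<exists>\<delta>>0. \<forall>(a, c) \<in> set [(m / 2 + h * (T - 2 * \<beta>), T - 2 * \<beta>), (k * m / 2 + h * (m - \<alpha>), m - \<alpha>), (m + h * D, D)]. 0 < a + \<delta> * c"
    by (rule exists_small_shift) (use P1 P2 P3 in simp)
  then obtain \<delta> where \<delta>: "\<delta> > 0" "0 < m / 2 + h * (T - 2 * \<beta>) + \<delta> * (T - 2 * \<beta>)"
     "0 < k * m / 2 + h * (m - \<alpha>) + \<delta> * (m - \<alpha>)" "0 < m + h * D + \<delta> * D" by auto
  \<comment> \<open>The leftward functional vanishes on the vertical edge vectors; the downward tilt
    \<open>c\<close> makes it negative there and keeps it positive on the vectors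
    \<open>e1\<close>.\<close>
  have "\<exists>c>0. \<forall>(a, c') \<in> set [(1/2, - \<alpha>), (1, - D), (1/2, - \<beta>), (1/2, - (T - 2 * \<beta>)), (k / 2, - (m - \<alpha>))]. 0 < a + c * c'"
    by (rule exists_small_shift) (use m in simp)
  then obtain c where c: "c > 0" "0 < 1/2 + c * - \<alpha>" "0 < 1 + c * - D" "0 < 1/2 + c * - \<beta>" "0 < 1/2 + c * - (T - 2 * \<beta>)" "0 < k / 2 + c * - (m - \<alpha>)" by auto
  define s where "s = h + \<delta>"
  have \<delta>': "0 < m / 2 + s * (T - 2 * \<beta>)" "0 < k * m / 2 + s * (m - \<alpha>)" "0 < m + s * D"
    using \<delta>(2-4) unfolding s_def by (simp_all only: distrib_right add.assoc)
  have s: "s > 0" "s * m - m * h > 0" using m \<delta>(1) by (simp_all add: s_def algebra_simps)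
  have pr: "s * (\<alpha> + \<beta>) > 0" "s * (T - \<beta>) > 0" "s * T > 0" "s * \<alpha> > 0" "s * \<beta> > 0" "s * m > 0" "c * (T - \<beta>) > 0"
      "c * \<alpha> > 0" "c * \<beta> > 0" "c * m > 0" "k * m > 0" "h * m > 0" "h * \<alpha> > 0"
    using s(1) pos b c(1) m by (simp_all add: add_pos_pos)
  have cr: "Im (Complex a b * cnj (Complex c d)) = b * c - a * d" "Complex a b \<bullet> Complex c d = a * c + b * d" "Im (Complex a b) = b" for a b c d
    by (simp_all add: inner_complex_def)
  note norm_form = algebra_simps mult_minus_left mult_minus_right times_divide_eq_left times_divide_eq_right minus_divide_left[symmetric]
    mult_1_left mult_1_right mult_zero_left mult_zero_right minus_minus
  note facts = pos b m P1 P2 P3 P4 P5 \<delta>' c pr s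
  note facts' = facts[simplified norm_form]
  have "flat_signs z0 z1 z2 z3 t (Complex (- 1) D) (Complex (- m) s) (Complex (- 1) (- c))"
    unfolding flat_signs_def dirs cr
    by (intro conjI; (simp only: norm_form)?; (insert facts', linarith)?; (insert pos b P5, simp add: field_simps)?; linarith?)
  then show ?thesis using that unfolding zs by blast
qed

section \<open>The parameter domain\<close>

definition limit_domain :: "complex set" where
  "limit_domain = {t. 0 < Im t \<and> 0 < Re t \<and> Re t < 1/2 \<and> 2 * Re t < (Re t)\<^sup>2 + (Im t)\<^sup>2}"

lemma open_limit_domain: "open limit_domain"
  unfolding limit_domain_def by (intro open_Collect_conj open_Collect_less continuous_intros)

text \<open>In the coordinates \<open>Re t\<close> and \<open>|t|^2 - 2 * Re t\<close> the domain is
  a product of two intervals.\<close>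

lemma connected_limit_domain: "connected limit_domain"
proof -
  let ?f = "\<lambda>z::real \<times> real. Complex (fst z) (sqrt (2 * fst z - (fst z)\<^sup>2 + snd z))"
  have eq: "limit_domain = ?f ` ({0<..<1/2} \<times> {0<..})"
  proof
    show "limit_domain \<subseteq> ?f ` ({0<..<1/2} \<times> {0<..})"
    proof
      fix t assume t: "t \<in> limit_domain"
      have "t = ?f (Re t, (Re t)\<^sup>2 + (Im t)\<^sup>2 - 2 * Re t)" using t by (simp add: limit_domain_def complex_eq_iff)
      moreover have "(Re t, (Re t)\<^sup>2 + (Im t)\<^sup>2 - 2 * Re t) \<in> {0<..<1/2} \<times> {0<..}" using t by (simp add: limit_domain_def)
      ultimately show "t \<in> ?f ` ({0<..<1/2} \<times> {0<..})" by (rule image_eqI)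
    qed
    show "?f ` ({0<..<1/2} \<times> {0<..}) \<subseteq> limit_domain"
    proof
      fix t assume "t \<in> ?f ` ({0<..<1/2} \<times> {0<..})"
      then obtain x u where t: "0 < x" "x < 1/2" "0 < u" "t = Complex x (sqrt (2 * x - x\<^sup>2 + u))" by auto
      have "x * x < x * 2" using t(1,2) by (intro mult_strict_left_mono) auto
      then have "2 * x - x\<^sup>2 + u > 0" using t(3) by (simp add: power2_eq_square)
      then show "t \<in> limit_domain" using t by (simp add: limit_domain_def)
    qed
  qed
  have cont: "continuous_on ({0<..<1/2} \<times> {0<..}) ?f"
    unfolding Complex_eq by (intro continuous_intros)
  have conn: "connected ({0<..<1/2::real} \<times> {0::real<..})" by (intro connected_Times convex_connected) auto
  show ?thesis unfolding eq by (rule connected_continuous_image[OF cont conn])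
qed

text \<open>An interior point can be moved a little to the left, to the right and down inside the
  closed domain. The downward move makes the circle inequality strict.\<close>

lemma interior_bicusped_domain: "interior bicusped_domain = limit_domain"
proof
  show "limit_domain \<subseteq> interior bicusped_domain"
    by (rule interior_maximal[OF _ open_limit_domain]) (auto simp: limit_domain_def bicusped_domain_def)
  show "interior bicusped_domain \<subseteq> limit_domain"
  proof
    fix z assume "z \<in> interior bicusped_domain"
    then obtain \<epsilon> where e: "\<epsilon> > 0" "ball z \<epsilon> \<subseteq> bicusped_domain" by (auto simp: mem_interior)
    define \<delta> where "\<delta> = \<epsilon> / 2"
    have \<delta>: "\<delta> > 0" "\<delta> < \<epsilon>" using e(1) by (simp_all add: \<delta>_def)
    have near: "w \<in> bicusped_domain" if "norm (z - w) = \<delta>" for w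
      using e(2) that \<delta>(2) by (auto simp: dist_norm)
    have z: "z \<in> bicusped_domain" using e by auto
    have l: "z - of_real \<delta> \<in> bicusped_domain" and r: "z + of_real \<delta> \<in> bicusped_domain" and d: "z - \<i> * of_real \<delta> \<in> bicusped_domain"
      by (rule near; use \<delta>(1) in \<open>simp add: norm_mult\<close>)+
    have 1: "Re z > 0" "Re z < 1/2" "Im z > 0" using l r z \<delta>(1) by (auto simp: bicusped_domain_def)
    have y: "0 < Im z - \<delta>" and q: "0 \<le> - 2 * Re z + (Re z)\<^sup>2 + (Im z - \<delta>)\<^sup>2"
      using d by (simp_all add: bicusped_domain_def)
    have "(Im z - \<delta>)\<^sup>2 < (Im z)\<^sup>2" using y \<delta>(1) by (intro power_strict_mono) auto
    then show "z \<in> limit_domain" using 1 q by (simp add: limit_domain_def)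
  qed
qed

definition limit_T :: "complex \<Rightarrow> real" where
  "limit_T = (\<lambda>t. ((Re t)\<^sup>2 + (Im t)\<^sup>2 - Re t) / (2 * Im t))"
definition limit_nu :: "complex \<Rightarrow> real" where "limit_nu = (\<lambda>t. sqrt (2 * Re t))"
definition limit_r :: "complex \<Rightarrow> real" where "limit_r = (\<lambda>t. sqrt ((limit_T t)\<^sup>2 + 1/4))"
definition limit_alpha :: "complex \<Rightarrow> real" where
  "limit_alpha = (\<lambda>t. (Im t - limit_T t - limit_nu t * limit_r t) / (1 - 2 * Re t))"
definition limit_q :: "complex \<Rightarrow> real" where "limit_q = (\<lambda>t. limit_r t - limit_nu t * limit_alpha t)"
definition limit_beta :: "complex \<Rightarrow> real" where
  "limit_beta = (\<lambda>t. limit_nu t * limit_alpha t / (4 * (limit_r t * limit_alpha t + limit_T t * limit_q t)))"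
definition limit_D :: "complex \<Rightarrow> real" where
  "limit_D = (\<lambda>t. (limit_nu t * limit_r t - limit_alpha t) / (2 * (limit_T t * limit_alpha t + limit_r t * limit_q t)))"
definition limit_point :: "complex \<Rightarrow> real \<times> real \<times> real" where
  "limit_point = (\<lambda>t. (limit_beta t - limit_T t / 2, 0, limit_D t))"

lemma tent_period_limit:
  assumes "t \<in> limit_domain"
  shows "tent_period (Re t) (Im t) (limit_T t) (limit_nu t) (limit_r t) (limit_alpha t) (limit_q t)"
proof
  show "0 < Re t" "Re t < 1/2" "0 < Im t" "2 * Re t < (Re t)\<^sup>2 + (Im t)\<^sup>2" using assms by (simp_all add: limit_domain_def)
  then show "2 * Im t * limit_T t = (Re t)\<^sup>2 + (Im t)\<^sup>2 - Re t" "0 < limit_nu t" "(limit_nu t)\<^sup>2 = 2 * Re t"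
    "(1 - (limit_nu t)\<^sup>2) * limit_alpha t = Im t - limit_T t - limit_nu t * limit_r t"
    by (simp_all add: limit_T_def limit_nu_def limit_alpha_def)
  have "0 \<le> (limit_T t)\<^sup>2" by simp
  then have "0 < (limit_T t)\<^sup>2 + 1/4" by linarith
  then show "0 < limit_r t" "(limit_r t)\<^sup>2 = (limit_T t)\<^sup>2 + 1/4" by (simp_all add: limit_r_def)
  show "limit_q t = limit_r t - limit_nu t * limit_alpha t" by (simp add: limit_q_def)
qed

lemma tent_limit_limit:
  assumes "t \<in> limit_domain"
  shows "tent_limit (Re t) (Im t) (limit_T t) (limit_nu t) (limit_r t) (limit_alpha t) (limit_q t) (limit_beta t) (limit_D t)"
proof -
  interpret tent_period "Re t" "Im t" "limit_T t" "limit_nu t" "limit_r t" "limit_alpha t" "limit_q t"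
    by (rule tent_period_limit[OF assms])
  show ?thesis by unfold_locales (use PQ_pos in \<open>simp_all add: limit_beta_def limit_D_def\<close>)
qed

lemma continuous_on_limit_point: "continuous_on limit_domain limit_point"
proof -
  note nz = tent_period.PQ_pos[OF tent_period_limit]
  have nz': "4 * (limit_r t * limit_alpha t + limit_T t * limit_q t) \<noteq> 0" "2 * (limit_T t * limit_alpha t + limit_r t * limit_q t) \<noteq> 0"
    "2 * Im t \<noteq> 0" "1 - 2 * Re t \<noteq> 0" if "t \<in> limit_domain" for t
    using nz[OF that] that by (auto simp: limit_domain_def)
  have T: "continuous_on limit_domain limit_T" unfolding limit_T_def by (intro continuous_intros ballI nz')
  have n: "continuous_on limit_domain limit_nu" unfolding limit_nu_def by (intro continuous_intros)
  have r: "continuous_on limit_domain limit_r" unfolding limit_r_def by (intro continuous_intros T)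
  have a: "continuous_on limit_domain limit_alpha" unfolding limit_alpha_def by (intro continuous_intros ballI nz' T n r)
  have q: "continuous_on limit_domain limit_q" unfolding limit_q_def by (intro continuous_intros n r a)
  have b: "continuous_on limit_domain limit_beta" unfolding limit_beta_def by (intro continuous_intros ballI nz' T n r a q)
  have D: "continuous_on limit_domain limit_D" unfolding limit_D_def by (intro continuous_intros ballI nz' T n r a q)
  show ?thesis unfolding limit_point_def by (intro continuous_intros T b D) simp
qed

section \<open>Pup tents near the limit\<close>

text \<open>The two equations on edge vectors record the periods, so that the modular point can be
  computed from the parameters.\<close>

definition tent_torus :: "family_point \<Rightarrow> bool" where
  "tent_torus x \<longleftrightarrow> fst (snd x) \<in> limit_domain \<and> pup_tent (fam_tent x) \<and> general_position (fam_tent x) \<and>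
     (\<exists>e1 e2 e3 n1 n2 n3. flat_data (fam_tent x) e1 e2 e3 n1 n2 n3 \<and>
        (\<Sum>v\<in>UNIV. e1 v) = fst (snd x) - 3 \<and> e2 0 - e1 0 - e1 1 = 1)"

lemma tent_symmetric: "tent a s r a' y v w e $ (7 - j) = \<rho> (tent a s r a' y v w e $ j)"
proof -
  have "\<forall>j. tent a s r a' y v w e $ (7 - j) = \<rho> (tent a s r a' y v w e $ j)"
    unfolding all_8 by (simp add: tent_nth \<rho>_def add.commute)
  then show ?thesis by blast
qed

lemma tent_torusI:
  assumes "fst (snd x) \<in> limit_domain" "regular x" "fam_Q x = 0" "pe x > 0"
    and S: "tent_signs (fam_a0 x) (fam_hs x) (fam_r1 x) (fam_a3 x) (fam_y3 x) (fam_v1 x) (fam_v2 x) (pe x)"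
    and F: "flat_signs (fam_z0 x) (fam_z1 x) (fam_z2 x) (fam_z3 x) (fst (snd x)) (fam_d x) n2 n3"
  shows "tent_torus x"
proof -
  have "pY x > 0" using assms(1) by (simp add: pY_def limit_domain_def)
  note fd = fam_flat_data[OF assms(2-4) this F]
  interpret c: pup_configuration "fam_tent x"
    by unfold_locales (simp only: fam_tent_def tent_chirotope[OF S assms(4)])
  have "paper_torus (fam_tent x)"
    unfolding paper_torus_def using c.inj_on_realization flat_data.cone_angle[OF fd(1)] by blast
  then have "pup_tent (fam_tent x)"
    unfolding pup_tent_def using c.hull_triangles tent_symmetric by (simp add: fam_tent_def)
  then show ?thesis unfolding tent_torus_def using assms(1) c.general_position fd by blast
qed

lemma continuous_on_vector_3:
  assumes "continuous_on A f" "continuous_on A g" "continuous_on A h"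
  shows "continuous_on A (\<lambda>z. vector [f z, g z, h z] :: real^3)"
proof -
  have "(vector [a, b, c] :: real^3) = (\<chi> i. if i = 1 then a else if i = 2 then b else c)" for a b c :: real
    by (simp add: vec_eq_iff forall_3)
  moreover have "continuous_on A (\<lambda>z. \<chi> i::3. if i = 1 then f z else if i = 2 then g z else h z)"
  proof (rule continuous_on_vec_lambda)
    fix i :: 3 show "continuous_on A (\<lambda>z. if i = 1 then f z else if i = 2 then g z else h z)"
      by (cases "i = 1"; cases "i = 2"; simp add: assms)
  qed
  ultimately show ?thesis by simp
qed

lemma continuous_on_tent:
  assumes "continuous_on A a" "continuous_on A s" "continuous_on A r" "continuous_on A a'" "continuous_on A y"
    "continuous_on A v" "continuous_on A w" "continuous_on A e"
  shows "continuous_on A (\<lambda>z. tent (a z) (s z) (r z) (a' z) (y z) (v z) (w z) (e z))"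
proof -
  define g :: "8 \<Rightarrow> 'a \<Rightarrow> real^3" where "g = (\<lambda>j z. if j = 0 then vector [a z, (e z)\<^sup>2, - s z] else if j = 1 then vector [r z, 0, - (e z)\<^sup>2]
     else if j = 2 then vector [r z + e z * v z, e z * w z, 2 * (e z)\<^sup>2] else if j = 3 then vector [a' z, y z, 0]
     else if j = 4 then vector [- a' z, - y z, 0] else if j = 5 then vector [- (r z + e z * v z), - (e z * w z), 2 * (e z)\<^sup>2]
     else if j = 6 then vector [- r z, 0, - (e z)\<^sup>2] else vector [- a z, - (e z)\<^sup>2, - s z])"
  have "\<forall>j. continuous_on A (g j)"
    unfolding all_8 g_def by (simp, intro conjI continuous_on_vector_3 continuous_intros assms)
  then have "continuous_on A (\<lambda>z. \<chi> j. g j z)" by (intro continuous_on_vec_lambda) blast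
  then show ?thesis by (simp add: tent_def g_def)
qed

lemma tendsto_nhds_of_strictly_differentiable:
  "strictly_differentiable f x \<Longrightarrow> (f \<longlongrightarrow> f x) (nhds x)"
  using strictly_differentiable_isCont unfolding isCont_def tendsto_at_iff_tendsto_nhds by blast

text \<open>The local hypothesis of \<open>path_connected_zero_set\<close> at one limit
  configuration. Membership of the domain, regularity and both lists of signs are open conditions
  that hold there; only \<open>\<epsilon> > 0\<close> and \<open>fam_Q = 0\<close> have to be
  added.\<close>

lemma limit_neighbourhood:
  assumes t: "t \<in> limit_domain"
  shows "\<exists>\<delta>>0. inj_on (\<lambda>x. (fam_Q x, snd x)) (ball (limit_point t, t, 0) \<delta>) \<and>
      continuous_on (ball (limit_point t, t, 0) \<delta>) fam_Q \<and> continuous_on (ball (limit_point t, t, 0) \<delta>) fam_tent \<and>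
      (\<forall>x\<in>ball (limit_point t, t, 0) \<delta>. snd (snd x) > 0 \<longrightarrow> fam_Q x = 0 \<longrightarrow> tent_torus x)"
proof -
  interpret tent_limit "Re t" "Im t" "limit_T t" "limit_nu t" "limit_r t" "limit_alpha t" "limit_q t" "limit_beta t" "limit_D t"
    by (rule tent_limit_limit[OF t])
  define x0 :: family_point where "x0 = (limit_point t, t, 0)"
  have x: "pX x0 = Re t" "pY x0 = Im t" "pe x0 = 0" and b: "pb x0 = limit_beta t - limit_T t / 2" "pk x0 = 0" "pD x0 = limit_D t"
    by (simp_all add: x0_def pX_def pY_def pe_def pb_def pk_def pD_def limit_point_def)
  have reg: "regular x0" by (rule fam_base_regular[OF x b])
  note sd = regular_strictly_differentiable[OF reg]
  obtain Q' where Q': "has_strict_derivative fam_Q Q' x0"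
    using sd(27) unfolding strictly_differentiable_def by blast
  have "has_strict_derivative (\<lambda>x. (fam_Q x, snd x)) (\<lambda>v. (Q' v, snd v)) x0"
    by (intro has_strict_derivative_Pair Q' has_strict_derivative_bounded_linear bounded_linear_snd)
  \<comment> \<open>A kernel vector has zero parameter part because of the second component, so the
    kernel is that of the derivative in the unknowns alone.\<close>
  moreover have "v = 0" if v: "(Q' v, snd v) = 0" for v
  proof -
    have Qv: "Q' v = 0" and "snd v = 0" using arg_cong[OF v, of fst] arg_cong[OF v, of snd] by (simp_all only: fst_conv snd_conv fst_zero snd_zero)
    then have v': "v = (fst v, 0)" by (metis prod.collapse)
    have Q0: "Q' (fst v, 0) = 0" by (subst v'[symmetric]) (rule Qv)
    have "x0 = ((limit_beta t - limit_T t / 2, 0, limit_D t), (Complex (Re t) (Im t), 0))" by (simp add: x0_def limit_point_def)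
    then have "fst v = 0" using fam_Q_kernel[of Q' "fst v"] has_strict_derivative_imp_has_derivative[OF Q'] Q0 by simp
    then show ?thesis using v' by (metis zero_prod_def)
  qed
  ultimately obtain r1 where r1: "r1 > 0" "inj_on (\<lambda>x. (fam_Q x, snd x)) (ball x0 r1)"
    by (rule has_strict_derivative_inj_on_ball)
  obtain r2 where r2: "r2 > 0" "continuous_on (ball x0 r2) fam_Q"
    by (rule strictly_differentiable_continuous_on_ball[OF sd(27)])
  let ?c = "\<lambda>x. (fam_a0 x, fam_hs x, fam_r1 x, fam_a3 x, fam_y3 x, fam_v1 x, fam_v2 x, pe x)"
  have "strictly_differentiable ?c x0" by (intro strictly_differentiable_Pair sd)
  then obtain r3 where r3: "r3 > 0" "continuous_on (ball x0 r3) ?c"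
    by (rule strictly_differentiable_continuous_on_ball)
  have cont: "continuous_on (ball x0 r3) fam_tent"
    unfolding fam_tent_def
    by (rule continuous_on_tent; use continuous_on_fst[OF r3(2)] continuous_on_snd[OF r3(2)]
        continuous_on_fst[OF continuous_on_snd[OF r3(2)]] continuous_on_snd[OF continuous_on_snd[OF r3(2)]]
        continuous_on_fst[OF continuous_on_snd[OF continuous_on_snd[OF r3(2)]]]
        continuous_on_fst[OF continuous_on_snd[OF continuous_on_snd[OF continuous_on_snd[OF r3(2)]]]]
        continuous_on_fst[OF continuous_on_snd[OF continuous_on_snd[OF continuous_on_snd[OF continuous_on_snd[OF r3(2)]]]]]
        continuous_on_fst[OF continuous_on_snd[OF continuous_on_snd[OF continuous_on_snd[OF continuous_on_snd[OF continuous_on_snd[OF r3(2)]]]]]]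
        continuous_on_fst[OF continuous_on_snd[OF continuous_on_snd[OF continuous_on_snd[OF continuous_on_snd[OF continuous_on_snd[OF continuous_on_snd[OF r3(2)]]]]]]]
        continuous_on_snd[OF continuous_on_snd[OF continuous_on_snd[OF continuous_on_snd[OF continuous_on_snd[OF continuous_on_snd[OF continuous_on_snd[OF r3(2)]]]]]]]
      in simp)
  note l = sd[THEN tendsto_nhds_of_strictly_differentiable]
  have lt: "((\<lambda>x. fst (snd x)) \<longlongrightarrow> t) (nhds x0)"
  proof -
    have "((\<lambda>x. fst (snd x)) \<longlongrightarrow> fst (snd x0)) (nhds x0)" by (intro tendsto_fst tendsto_snd filterlim_ident)
    then show ?thesis by (simp add: x0_def)
  qed
  have ev1: "\<forall>\<^sub>F x in nhds x0. fst (snd x) \<in> limit_domain"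
    using topological_tendstoD[OF lt open_limit_domain t] .
  have ev2: "\<forall>\<^sub>F x in nhds x0. regular x"
  proof -
    have c: "((\<lambda>x. pX x / 2 - pe x ^ 4 + pe x * (- pX x + pY x * pD x)) \<longlongrightarrow> pX x0 / 2 - pe x0 ^ 4 + pe x0 * (- pX x0 + pY x0 * pD x0)) (nhds x0)"
      "((\<lambda>x. fam_hs x - (pe x)^2) \<longlongrightarrow> fam_hs x0 - (pe x0)^2) (nhds x0)"
      "((\<lambda>x. (fam_re3 x)^2 + (pb x)^2 - (fam_a3 x)^2) \<longlongrightarrow> (fam_re3 x0)^2 + (pb x0)^2 - (fam_a3 x0)^2) (nhds x0)"
      by (intro tendsto_intros l; simp)+
    show ?thesis unfolding regular_def
      by (intro eventually_conj tendsto_imp_eventually_ne[OF l(5)] tendsto_imp_eventually_ne[OF l(7)] tendsto_imp_eventually_ne[OF c(2)]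
          tendsto_imp_eventually_ne[OF l(21)] order_tendstoD(1)[OF c(1)] order_tendstoD(1)[OF c(3)])
        (use reg in \<open>simp_all add: regular_def\<close>)
  qed
  have l0: "(pe \<longlongrightarrow> 0) (nhds x0)" using l(6) by (simp add: x)
  have ev3: "\<forall>\<^sub>F z in nhds x0. tent_signs (fam_a0 z) (fam_hs z) (fam_r1 z) (fam_a3 z) (fam_y3 z) (fam_v1 z) (fam_v2 z) (pe z)"
    by (rule eventually_tent_signs[OF l(16) l(9) l(13) l(17) l(18) l(22) l(23) l0])
      (use fam_a0_neg[OF x b(1)] fam_y3_pos[OF x b(1)] fam_base_signs[OF x b] regular_r1(3)[OF reg] nu(1) in \<open>simp_all add: fam_limit(3)[OF x]\<close>)
  obtain n2 n3 where F: "flat_signs (Complex (- (1 - (limit_nu t)\<^sup>2) / 4) ((limit_nu t * limit_q t - limit_alpha t) / 2))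
      (Complex (- (1 - (limit_nu t)\<^sup>2) / 4) ((limit_nu t * limit_q t + limit_alpha t) / 2))
     (Complex (1/4) (- limit_T t / 2)) (Complex (1/4) (limit_beta t - limit_T t / 2)) (Complex (Re t) (Im t)) (Complex (- 1) (limit_D t)) n2 n3"
    by (rule flat_signs_limit)
  have ev4: "\<forall>\<^sub>F x in nhds x0. flat_signs (fam_z0 x) (fam_z1 x) (fam_z2 x) (fam_z3 x) (fst (snd x)) (fam_d x) n2 n3"
  proof (rule eventually_flat_signs[OF _ _ _ _ _ _ F])
    note lim = l[unfolded fam_limit[OF x] b]
    show "(fam_z0 \<longlongrightarrow> Complex (- (1 - (limit_nu t)\<^sup>2) / 4) ((limit_nu t * limit_q t - limit_alpha t) / 2)) (nhds x0)"
      unfolding fam_z0_def by (intro tendsto_Complex lim)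
    show "(fam_z1 \<longlongrightarrow> Complex (- (1 - (limit_nu t)\<^sup>2) / 4) ((limit_nu t * limit_q t + limit_alpha t) / 2)) (nhds x0)"
      unfolding fam_z1_def by (intro tendsto_Complex lim)
    show "(fam_z2 \<longlongrightarrow> Complex (1/4) (- limit_T t / 2)) (nhds x0)" unfolding fam_z2_def by (intro tendsto_Complex lim)
    show "(fam_z3 \<longlongrightarrow> Complex (1/4) (limit_beta t - limit_T t / 2)) (nhds x0)" unfolding fam_z3_def by (intro tendsto_Complex lim)
    show "((\<lambda>x. fst (snd x)) \<longlongrightarrow> Complex (Re t) (Im t)) (nhds x0)" using lt by simp
    show "(fam_d \<longlongrightarrow> Complex (- 1) (limit_D t)) (nhds x0)" unfolding fam_d_def by (intro tendsto_Complex lim tendsto_const)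
  qed
  have "\<forall>\<^sub>F x in nhds x0. snd (snd x) > 0 \<longrightarrow> fam_Q x = 0 \<longrightarrow> tent_torus x"
    using ev1 ev2 ev3 ev4 by eventually_elim (auto intro!: tent_torusI simp: pe_def)
  then obtain r4 where r4: "r4 > 0" "\<And>x. dist x x0 < r4 \<Longrightarrow> snd (snd x) > 0 \<longrightarrow> fam_Q x = 0 \<longrightarrow> tent_torus x"
    unfolding eventually_nhds_metric by blast
  define \<delta> where "\<delta> = min (min r1 r2) (min r3 r4)"
  have \<delta>: "\<delta> > 0" "ball x0 \<delta> \<subseteq> ball x0 r1" "ball x0 \<delta> \<subseteq> ball x0 r2" "ball x0 \<delta> \<subseteq> ball x0 r3" "\<delta> \<le> r4"
    using r1(1) r2(1) r3(1) r4(1) by (auto simp: \<delta>_def)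
  have "tent_torus x" if "x \<in> ball x0 \<delta>" "snd (snd x) > 0" "fam_Q x = 0" for x
    using r4(2)[of x] that \<delta>(5) by (auto simp: dist_commute)
  then show ?thesis unfolding x0_def[symmetric]
    using \<delta>(1) inj_on_subset[OF r1(2) \<delta>(2)] continuous_on_subset[OF r2(2) \<delta>(3)] continuous_on_subset[OF cont \<delta>(4)] by blast
qed

section \<open>Similarity classes\<close>

text \<open>Only distances between vertices enter, so reflections of space are covered as well: the
  orientation of the torus comes from the labels.\<close>

lemma flat_data_similar:
  assumes fd: "flat_data p e1 e2 e3 n1 n2 n3" and c: "c > 0" and f: "\<And>x y. dist (f x) (f y) = c * dist x y"
    and q: "\<And>j. q $ j = f (p $ j)"
  shows "flat_data q (\<lambda>v. c *\<^sub>R e1 v) (\<lambda>v. c *\<^sub>R e2 v) (\<lambda>v. c *\<^sub>R e3 v) n1 n2 n3"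
proof -
  interpret flat_data p e1 e2 e3 n1 n2 n3 by (rule fd)
  have im: "Im ((c *\<^sub>R a) * cnj (c *\<^sub>R b)) = c\<^sup>2 * Im (a * cnj b)" for a b :: complex
    by (simp add: power2_eq_square algebra_simps)
  have c2: "c\<^sup>2 > 0" using c by simp
  have s: "c *\<^sub>R e2 0 - c *\<^sub>R e1 0 - c *\<^sub>R e1 1 = c *\<^sub>R (e2 0 - e1 0 - e1 1)" by (simp add: scaleR_diff_right)
  show ?thesis
  proof
    show "Im ((\<Sum>v\<in>UNIV. c *\<^sub>R e1 v) * cnj (c *\<^sub>R e2 0 - c *\<^sub>R e1 0 - c *\<^sub>R e1 1)) > 0"
      unfolding s scaleR_sum_right[symmetric] im using periods c2 by (rule mult_pos_pos[rotated])
    show "Im ((c *\<^sub>R e3 v) * cnj (c *\<^sub>R e2 v)) > 0" "Im ((c *\<^sub>R e1 v) * cnj (c *\<^sub>R e3 v)) > 0" for v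
      unfolding im using upper lower c2 by (simp_all only: mult_pos_pos)
    show "c *\<^sub>R e3 v = c *\<^sub>R e2 v + c *\<^sub>R e1 (v + 2)" "c *\<^sub>R e3 v = c *\<^sub>R e1 v + c *\<^sub>R e2 (v + 1)" for v
      using e3_upper e3_lower by (metis scaleR_add_right)+
    show "dist (q $ v) (q $ (v + 1)) = norm (c *\<^sub>R e1 v)" "dist (q $ v) (q $ (v + 2)) = norm (c *\<^sub>R e2 v)"
      "dist (q $ v) (q $ (v + 3)) = norm (c *\<^sub>R e3 v)" for v
      unfolding q f using dist1 dist2 dist3 c by simp_all
    show "n1 \<bullet> (c *\<^sub>R e2 v) > 0" "n1 \<bullet> (c *\<^sub>R e3 v) > 0" "n2 \<bullet> (c *\<^sub>R e3 v) > 0" "n2 \<bullet> (c *\<^sub>R e1 v) > 0" "n3 \<bullet> (c *\<^sub>R e1 v) > 0"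
        "n3 \<bullet> (c *\<^sub>R e2 v) < 0" for v
      using n1 n2 n3 c by (simp_all add: mult_pos_neg)
  qed
qed

lemma (in flat_data) flat_structure_periods:
  "flat_structure p = modular_orbit ((\<Sum>v\<in>UNIV. e1 v) / (e2 0 - e1 0 - e1 1))"
  using flat_structure unfolding period1_def period2_def .

lemma flat_structure_similar:
  assumes "flat_data p e1 e2 e3 n1 n2 n3" "similarity f" "\<And>j. q $ j = f (p $ j)"
  shows "flat_structure q = modular_orbit ((\<Sum>v\<in>UNIV. e1 v) / (e2 0 - e1 0 - e1 1))"
proof -
  obtain c where c: "c > 0" "\<And>x y. dist (f x) (f y) = c * dist x y" using assms(2) unfolding similarity_def by blast
  have "flat_structure q = modular_orbit ((\<Sum>v\<in>UNIV. c *\<^sub>R e1 v) / (c *\<^sub>R e2 0 - c *\<^sub>R e1 0 - c *\<^sub>R e1 1))"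
    by (rule flat_data.flat_structure_periods[OF flat_data_similar[OF assms(1) c assms(3)]])
  also have "(\<Sum>v\<in>UNIV. c *\<^sub>R e1 v) / (c *\<^sub>R e2 0 - c *\<^sub>R e1 0 - c *\<^sub>R e1 1) = (\<Sum>v\<in>UNIV. e1 v) / (e2 0 - e1 0 - e1 1)"
    unfolding scaleR_sum_right[symmetric] scaleR_diff_right[symmetric] using c(1) by (simp add: scaleR_conv_of_real)
  finally show ?thesis .
qed

text \<open>The inverse similarity is a translation after a scaled orthogonal map, hence carries
  coplanar sets back to coplanar sets.\<close>

lemma general_position_similar:
  assumes g: "general_position p" and f: "similarity f" and q: "\<And>j. q $ j = f (p $ j)"
  shows "general_position q"
proof -
  obtain g where g: "similarity g" "\<And>x. g (f x) = x" using similarity_inverse[OF f] by blast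
  then obtain c where c: "c > 0" "\<And>x y. dist (g x) (g y) = c * dist x y" unfolding similarity_def by blast
  define h where "h x = (1 / c) *\<^sub>R (g x - g 0)" for x
  have "dist (h x) (h y) = dist x y" for x y
  proof -
    have "h x - h y = (1 / c) *\<^sub>R (g x - g y)" by (simp add: h_def scaleR_diff_right)
    then have "dist (h x) (h y) = (1 / c) * dist (g x) (g y)" using c(1) by (simp add: dist_norm)
    then show ?thesis using c by simp
  qed
  then have "orthogonal_transformation h" by (simp add: orthogonal_transformation_isometry h_def)
  then have lin: "linear (\<lambda>x. c *\<^sub>R h x)" by (intro linear_compose_scale_right orthogonal_transformation_linear)
  have gh: "g x = g 0 + c *\<^sub>R h x" for x using c(1) by (simp add: h_def)
  have "coplanar ((\<lambda>i. p $ i) ` S)" if "coplanar ((\<lambda>i. q $ i) ` S)" for S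
  proof -
    have "coplanar ((\<lambda>x. g 0 + x) ` (\<lambda>x. c *\<^sub>R h x) ` (\<lambda>i. q $ i) ` S)"
      by (intro coplanar_translation_imp coplanar_linear_image that lin)
    also have "(\<lambda>x. g 0 + x) ` (\<lambda>x. c *\<^sub>R h x) ` (\<lambda>i. q $ i) ` S = (\<lambda>i. p $ i) ` S"
      unfolding image_image gh[symmetric] q g(2) ..
    finally show ?thesis .
  qed
  then show ?thesis using \<open>general_position p\<close> unfolding general_position_def by blast
qed

lemma tent_torus_class:
  assumes "tent_torus x" and c: "c = similar `` {fam_tent x}"
  shows "\<forall>q\<in>c. general_position q" "\<Phi> c = modular_orbit (fst (snd x))" "fst (snd x) \<in> limit_domain"
proof -
  obtain e1 e2 e3 n1 n2 n3 where x: "fst (snd x) \<in> limit_domain" "pup_tent (fam_tent x)" "general_position (fam_tent x)"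
    and fd: "flat_data (fam_tent x) e1 e2 e3 n1 n2 n3" "(\<Sum>v\<in>UNIV. e1 v) = fst (snd x) - 3" "e2 0 - e1 0 - e1 1 = 1"
    using assms(1) unfolding tent_torus_def by blast
  show "fst (snd x) \<in> limit_domain" by (rule x)
  show "\<forall>q\<in>c. general_position q"
    unfolding c similar_def using general_position_similar[OF x(3)] by blast
  have "flat_structure q = modular_orbit (fst (snd x) - 3)" if qc: "q \<in> c" for q
  proof -
    obtain f where "similarity f" "\<And>j. q $ j = f (fam_tent x $ j)" using qc unfolding c similar_def by blast
    from flat_structure_similar[OF fd(1) this] show ?thesis unfolding fd(2,3) by simp
  qed
  moreover have "fam_tent x \<in> c" unfolding c using equiv_class_self[OF equiv_similar] x(2) by simp
  ultimately have "flat_structure ` c = {modular_orbit (fst (snd x) - 3)}" by (auto intro: image_eqI[rotated])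
  \<comment> \<open>The integer translation by -3 belongs to the modular group.\<close>
  moreover have "modular_orbit (fst (snd x) - 3) = modular_orbit (fst (snd x))"
    by (rule modular_orbit_eq[where a = 1 and b = "- 3" and c = 0 and d = 1]) (use x(1) in \<open>simp_all add: limit_domain_def\<close>)
  ultimately show "\<Phi> c = modular_orbit (fst (snd x))" unfolding \<Phi>_def by simp
qed

theorem theorem1p1:
  shows "\<exists>U. U \<subseteq> pup_classes \<and> path_connectedin pup_topology U \<and>
    (\<forall>c\<in>U. \<forall>p\<in>c. general_position p) \<and> \<Phi> ` U = bicusped_interior"
proof -
  have base: "fam_Q (limit_point t, t, 0) = 0" if t: "t \<in> limit_domain" for t
    by (rule tent_limit.fam_base_zero[OF tent_limit_limit[OF t]])
      (simp_all add: pX_def pY_def pe_def pb_def pk_def pD_def limit_point_def)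
  obtain S where S: "path_connected (fam_tent ` S)"
    "\<And>x. x \<in> S \<Longrightarrow> fam_Q x = 0 \<and> snd (snd x) > 0 \<and> tent_torus x" "limit_domain \<subseteq> (\<lambda>x. fst (snd x)) ` S"
    by (rule path_connected_zero_set[OF connected_limit_domain continuous_on_limit_point base limit_neighbourhood]) auto
  let ?cl = "\<lambda>p. similar `` {p}"
  define U where "U = ?cl ` (fam_tent ` S)"
  have pup: "fam_tent ` S \<subseteq> {p. pup_tent p}" using S(2) by (auto simp: tent_torus_def)
  have "U \<subseteq> pup_classes" unfolding U_def pup_classes_def using pup by (auto intro!: quotientI)
  moreover have "path_connectedin pup_topology U"
    unfolding U_def pup_topology_def
  proof (rule path_connectedin_continuous_map_image)
    show "continuous_map (top_of_set {p. pup_tent p}) (quotient_topology (top_of_set {p. pup_tent p}) ?cl) ?cl"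
      by (rule quotient_imp_continuous_map[OF quotient_map_quotient_topology])
    show "path_connectedin (top_of_set {p. pup_tent p}) (fam_tent ` S)"
      using pup S(1) by (simp add: path_connectedin_subtopology)
  qed
  moreover have "\<forall>c\<in>U. \<forall>p\<in>c. general_position p"
    unfolding U_def using S(2) tent_torus_class(1)[OF _ refl] by blast
  moreover have "\<Phi> ` U = bicusped_interior"
  proof -
    have "\<Phi> ` U = (\<lambda>x. modular_orbit (fst (snd x))) ` S"
      unfolding U_def image_image by (rule image_cong[OF refl]) (use S(2) tent_torus_class(2)[OF _ refl] in blast)
    also have "\<dots> = modular_orbit ` (\<lambda>x. fst (snd x)) ` S" by (simp only: image_image)
    also have "(\<lambda>x. fst (snd x)) ` S = limit_domain"
      using S(2,3) by (auto simp: tent_torus_def)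
    finally show ?thesis unfolding bicusped_interior_def interior_bicusped_domain .
  qed
  ultimately show ?thesis by blast
qed

end
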